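(* Let $\{(\mathcal{M}_\kappa,T_\kappa,\Omega_\kappa)\}_{\kappa\in K}$ be a family of two-dimensional Borchers triples on Hilbert spaces $\{\mathcal{H}_\kappa\}_{\kappa\in K}$. Set $$(\mathcal{H},\Omega):=\bigstar_{\kappa\in K}(\mathcal{H}_\kappa,\Omega_\kappa),\quad (\mathcal{M},\omega):=\bigstar_{\kappa\in K}(\mathcal{M}_\kappa,\omega_\kappa),\quad T(a):=\bigstar_{\kappa\in K}T_\kappa(a).$$ Then $(\mathcal{M},T,\Omega)$ is again a two-dimensional Borchers triple. Furthermore, if $K$ is an infinite index set and all these Borchers triples are identical, then the relative commutant $(\mathrm{Ad}\,T(a)(\mathcal{M}))'\cap\mathcal{M}$ is trivial (equal to $\mathbb{C}\mathbf{1}$) for any $a\in W_{\mathrm R}$.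
   Context: $W_{\mathrm R}=\{(a_0,a_1)\in\mathbb{R}^2:a_1>|a_0|\}$ and $\overline V_+=\{(t_0,t_1)\in\mathbb{R}^2:t_0\ge|t_1|\}$. A two-dimensional Borchers triple $(\mathcal{M},T,\Omega)$ on a Hilbert space $\mathcal{H}$: a von Neumann algebra $\mathcal{M}$ on $\mathcal{H}$, a (strongly continuous) unitary representation $T$ of $\mathbb{R}^2$ on $\mathcal{H}$ with joint spectrum in $\overline V_+$ (Lorentz product convention $a\cdot b=a_0b_0-a_1b_1$, i.e. $T(a)=e^{ia\cdot P}$), and a unit vector $\Omega$ such that: $\Omega$ is the unique (up to scalar) vector invariant under all $T(a)$; $\mathrm{Ad}\,T(a)(\mathcal{M})\subset\mathcal{M}$ for $a\in W_{\mathrm R}$; $\Omega$ is cyclic and separating for $\mathcal{M}$. Free product of Hilbert spaces: with $\mathcal{H}_\kappa^\circ=\mathcal{H}_\kappa\ominus\mathbb{C}\Omega_\kappa$, $$\mathcal{H}=\mathbb{C}\Omega\oplus\bigoplus_{n\ge1}\ \bigoplus_{\kappa_j\ne\kappa_{j+1},\,1\le j\le n-1}\mathcal{H}^\circ_{\kappa_1}\bar\otimes\cdots\bar\otimes\mathcal{H}^\circ_{\kappa_n},\qquad \|\Omega\|=1.$$ Let $\mathcal{H}(\kappa)\subset\mathcal{H}$ be the closed span of $\Omega$ and the summands with $\kappa_1\neq\kappa$. Define $\lambda_\kappa:B(\mathcal{H}_\kappa)\to B(\mathcal{H})$ by $\lambda_\kappa(S)=V_\kappa(S\otimes\mathbf{1})V_\kappa^*$,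 where $V_\kappa:\mathcal{H}_\kappa\bar\otimes\mathcal{H}(\kappa)\to\mathcal{H}$ is the unitary with $\Omega_\kappa\otimes\Omega\mapsto\Omega$, $\xi\otimes\Omega\mapsto\xi$, $\Omega_\kappa\otimes\eta\mapsto\eta$, $\xi\otimes\eta\mapsto\xi\otimes\eta$ for $\xi\in\mathcal{H}_\kappa^\circ$, $\eta\in\mathcal{H}(\kappa)\ominus\mathbb{C}\Omega$. Free product of von Neumann algebras: $\mathcal{M}=\bigvee_{\kappa\in K}\lambda_\kappa(\mathcal{M}_\kappa)$ on $\mathcal{H}$, with $\omega_\kappa=\langle\Omega_\kappa,\cdot\,\Omega_\kappa\rangle$ and $\omega=\langle\Omega,\cdot\,\Omega\rangle$. Free product of unitaries $T_\kappa$ fixing $\Omega_\kappa$: $\bigstar_\kappa T_\kappa$ is the identity on $\mathbb{C}\Omega$ and acts as $T_{\kappa_1}|_{\mathcal{H}^\circ_{\kappa_1}}\otimes\cdots\otimes T_{\kappa_n}|_{\mathcal{H}^\circ_{\kappa_n}}$ on $\mathcal{H}^\circ_{\kappa_1}\bar\otimes\cdots\bar\otimes\mathcal{H}^\circ_{\kappa_n}$. *)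

theory Defs
  imports "HOL-Analysis.Analysis"
begin

section \<open>Complex Hilbert spaces\<close>

text \<open>
  A family of Hilbert spaces indexed by a set cannot be a family of types, so Hilbert spaces are
  records with an explicit carrier. The inner product is conjugate linear in its first argument.
  The operations are unconstrained off the carrier.
\<close>

record 'a hilb =
  hcarrier :: "'a set"
  hzero :: 'a
  hadd :: "'a \<Rightarrow> 'a \<Rightarrow> 'a"
  hscale :: "complex \<Rightarrow> 'a \<Rightarrow> 'a"
  hinner :: "'a \<Rightarrow> 'a \<Rightarrow> complex"

definition hnorm :: "'a hilb \<Rightarrow> 'a \<Rightarrow> real" where
  "hnorm H x = sqrt (Re (hinner H x x))"

text \<open>
  The distance is totalized by \<open>0\<close> because \<^locale>\<open>Metric_space\<close> demands symmetry and nonnegativity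
  off the carrier as well.
\<close>

definition hdist :: "'a hilb \<Rightarrow> 'a \<Rightarrow> 'a \<Rightarrow> real" where
  "hdist H x y = (if x \<in> hcarrier H \<and> y \<in> hcarrier H
     then hnorm H (hadd H x (hscale H (- 1) y)) else 0)"

abbreviation htop :: "'a hilb \<Rightarrow> 'a topology" where
  "htop H \<equiv> Metric_space.mtopology (hcarrier H) (hdist H)"

locale hilbert_space =
  fixes H :: "'a hilb"
  assumes zero_closed: "hzero H \<in> hcarrier H"
    and add_closed: "\<lbrakk>x \<in> hcarrier H; y \<in> hcarrier H\<rbrakk> \<Longrightarrow> hadd H x y \<in> hcarrier H"
    and scale_closed: "x \<in> hcarrier H \<Longrightarrow> hscale H c x \<in> hcarrier H"
    and add_assoc: "\<lbrakk>x \<in> hcarrier H; y \<in> hcarrier H; z \<in> hcarrier H\<rbrakk>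
      \<Longrightarrow> hadd H (hadd H x y) z = hadd H x (hadd H y z)"
    and add_commute: "\<lbrakk>x \<in> hcarrier H; y \<in> hcarrier H\<rbrakk> \<Longrightarrow> hadd H x y = hadd H y x"
    and add_zero: "x \<in> hcarrier H \<Longrightarrow> hadd H x (hzero H) = x"
    and scale_one: "x \<in> hcarrier H \<Longrightarrow> hscale H 1 x = x"
    and scale_zero: "x \<in> hcarrier H \<Longrightarrow> hscale H 0 x = hzero H"
    and scale_scale: "x \<in> hcarrier H \<Longrightarrow> hscale H c (hscale H d x) = hscale H (c * d) x"
    and scale_add_left: "x \<in> hcarrier H
      \<Longrightarrow> hscale H (c + d) x = hadd H (hscale H c x) (hscale H d x)"
    and scale_add_right: "\<lbrakk>x \<in> hcarrier H; y \<in> hcarrier H\<rbrakk>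
      \<Longrightarrow> hscale H c (hadd H x y) = hadd H (hscale H c x) (hscale H c y)"
    and inner_commute: "\<lbrakk>x \<in> hcarrier H; y \<in> hcarrier H\<rbrakk>
      \<Longrightarrow> hinner H y x = cnj (hinner H x y)"
    and inner_add_right: "\<lbrakk>x \<in> hcarrier H; y \<in> hcarrier H; z \<in> hcarrier H\<rbrakk>
      \<Longrightarrow> hinner H x (hadd H y z) = hinner H x y + hinner H x z"
    and inner_scale_right: "\<lbrakk>x \<in> hcarrier H; y \<in> hcarrier H\<rbrakk>
      \<Longrightarrow> hinner H x (hscale H c y) = c * hinner H x y"
    and inner_ge_zero: "x \<in> hcarrier H \<Longrightarrow> 0 \<le> Re (hinner H x x)"
    and inner_eq_zero: "\<lbrakk>x \<in> hcarrier H; hinner H x x = 0\<rbrakk> \<Longrightarrow> x = hzero H"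
    and complete: "Metric_space.mcomplete (hcarrier H) (hdist H)"

definition closed_subspace :: "'a hilb \<Rightarrow> 'a set \<Rightarrow> bool" where
  "closed_subspace H L \<longleftrightarrow> hzero H \<in> L
     \<and> (\<forall>x\<in>L. \<forall>y\<in>L. hadd H x y \<in> L)
     \<and> (\<forall>c. \<forall>x\<in>L. hscale H c x \<in> L)
     \<and> closedin (htop H) L"

definition closed_span :: "'a hilb \<Rightarrow> 'a set \<Rightarrow> 'a set" where
  "closed_span H S = \<Inter>{L. closed_subspace H L \<and> S \<subseteq> L}"

definition hsub :: "'a hilb \<Rightarrow> 'a set \<Rightarrow> 'a hilb" where
  "hsub H L = H\<lparr>hcarrier := L\<rparr>"

text \<open>The orthogonal complement of the line spanned by a vector.\<close>

definition hcompl :: "'a hilb \<Rightarrow> 'a \<Rightarrow> 'a hilb" where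
  "hcompl H v = hsub H {x \<in> hcarrier H. hinner H v x = 0}"

definition orthonormal_basis :: "'a hilb \<Rightarrow> 'a set \<Rightarrow> bool" where
  "orthonormal_basis H B \<longleftrightarrow> B \<subseteq> hcarrier H
     \<and> (\<forall>e\<in>B. \<forall>f\<in>B. hinner H e f = (if e = f then 1 else 0))
     \<and> closed_span H B = hcarrier H"

definition some_basis :: "'a hilb \<Rightarrow> 'a set" where
  "some_basis H = (SOME B. orthonormal_basis H B)"


section \<open>Bounded operators and von Neumann algebras\<close>

text \<open>
  Operators are extensional functions on the carrier, so that equality of operators is equality
  of functions.
\<close>

definition bop :: "'a hilb \<Rightarrow> 'b hilb \<Rightarrow> ('a \<Rightarrow> 'b) set" where
  "bop H G = {x \<in> hcarrier H \<rightarrow>\<^sub>E hcarrier G.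
     (\<forall>\<xi>\<in>hcarrier H. \<forall>\<eta>\<in>hcarrier H. x (hadd H \<xi> \<eta>) = hadd G (x \<xi>) (x \<eta>))
     \<and> (\<forall>c. \<forall>\<xi>\<in>hcarrier H. x (hscale H c \<xi>) = hscale G c (x \<xi>))
     \<and> (\<exists>C. \<forall>\<xi>\<in>hcarrier H. hnorm G (x \<xi>) \<le> C * hnorm H \<xi>)}"

abbreviation bops :: "'a hilb \<Rightarrow> ('a \<Rightarrow> 'a) set" where
  "bops H \<equiv> bop H H"

definition scalar_op :: "'a hilb \<Rightarrow> complex \<Rightarrow> 'a \<Rightarrow> 'a" where
  "scalar_op H c = (\<lambda>\<xi>\<in>hcarrier H. hscale H c \<xi>)"

definition hadj :: "'a hilb \<Rightarrow> 'b hilb \<Rightarrow> ('a \<Rightarrow> 'b) \<Rightarrow> 'b \<Rightarrow> 'a" where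
  "hadj H G x = (THE y. y \<in> bop G H \<and>
     (\<forall>\<xi>\<in>hcarrier H. \<forall>\<eta>\<in>hcarrier G. hinner G (x \<xi>) \<eta> = hinner H \<xi> (y \<eta>)))"

definition unitary_op :: "'a hilb \<Rightarrow> 'b hilb \<Rightarrow> ('a \<Rightarrow> 'b) \<Rightarrow> bool" where
  "unitary_op H G U \<longleftrightarrow> U \<in> bop H G
     \<and> (\<forall>\<xi>\<in>hcarrier H. \<forall>\<eta>\<in>hcarrier H. hinner G (U \<xi>) (U \<eta>) = hinner H \<xi> \<eta>)
     \<and> U ` hcarrier H = hcarrier G"

definition projection_op :: "'a hilb \<Rightarrow> ('a \<Rightarrow> 'a) \<Rightarrow> bool" where
  "projection_op H P \<longleftrightarrow> P \<in> bops H \<and> compose (hcarrier H) P P = P \<and> hadj H H P = P"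

definition Ad :: "'a hilb \<Rightarrow> ('a \<Rightarrow> 'a) \<Rightarrow> ('a \<Rightarrow> 'a) \<Rightarrow> 'a \<Rightarrow> 'a" where
  "Ad H U x = compose (hcarrier H) U (compose (hcarrier H) x (hadj H H U))"

definition commutant :: "'a hilb \<Rightarrow> ('a \<Rightarrow> 'a) set \<Rightarrow> ('a \<Rightarrow> 'a) set" where
  "commutant H S = {x \<in> bops H. \<forall>y\<in>S. compose (hcarrier H) x y = compose (hcarrier H) y x}"

definition von_neumann_algebra :: "'a hilb \<Rightarrow> ('a \<Rightarrow> 'a) set \<Rightarrow> bool" where
  "von_neumann_algebra H M \<longleftrightarrow> M \<subseteq> bops H
     \<and> (\<forall>x\<in>M. hadj H H x \<in> M)
     \<and> commutant H (commutant H M) = M"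

definition vN_join :: "'a hilb \<Rightarrow> 'k set \<Rightarrow> ('k \<Rightarrow> ('a \<Rightarrow> 'a) set) \<Rightarrow> ('a \<Rightarrow> 'a) set" where
  "vN_join H K M = commutant H (commutant H (\<Union>\<kappa>\<in>K. M \<kappa>))"

definition cyclic_vector :: "'a hilb \<Rightarrow> ('a \<Rightarrow> 'a) set \<Rightarrow> 'a \<Rightarrow> bool" where
  "cyclic_vector H M v \<longleftrightarrow> htop H closure_of {x v |x. x \<in> M} = hcarrier H"

definition separating_vector :: "'a hilb \<Rightarrow> ('a \<Rightarrow> 'a) set \<Rightarrow> 'a \<Rightarrow> bool" where
  "separating_vector H M v \<longleftrightarrow> (\<forall>x\<in>M. x v = hzero H \<longrightarrow> x = scalar_op H 0)"


section \<open>Unitary representations of the plane and their joint spectrum\<close>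

definition unitary_rep :: "'a hilb \<Rightarrow> (real \<times> real \<Rightarrow> 'a \<Rightarrow> 'a) \<Rightarrow> bool" where
  "unitary_rep H T \<longleftrightarrow> (\<forall>a. unitary_op H H (T a))
     \<and> (\<forall>a b. T (a + b) = compose (hcarrier H) (T a) (T b))
     \<and> (\<forall>\<xi>\<in>hcarrier H. continuous_map euclidean (htop H) (\<lambda>a. T a \<xi>))"

definition lorentz :: "real \<times> real \<Rightarrow> real \<times> real \<Rightarrow> real" where
  "lorentz a b = fst a * fst b - snd a * snd b"

definition right_wedge :: "(real \<times> real) set" where
  "right_wedge = {a. snd a > \<bar>fst a\<bar>}"

definition closed_forward_cone :: "(real \<times> real) set" where
  "closed_forward_cone = {t. fst t \<ge> \<bar>snd t\<bar>}"

text \<open>Projection-valued measures on the Borel sets of the plane; values off the Borel sets are junk.\<close>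

definition pvm :: "'a hilb \<Rightarrow> ((real \<times> real) set \<Rightarrow> 'a \<Rightarrow> 'a) \<Rightarrow> bool" where
  "pvm H E \<longleftrightarrow> (\<forall>B\<in>sets borel. projection_op H (E B))
     \<and> E UNIV = scalar_op H 1
     \<and> (\<forall>A\<in>sets borel. \<forall>B\<in>sets borel. E (A \<inter> B) = compose (hcarrier H) (E A) (E B))
     \<and> (\<forall>\<xi>\<in>hcarrier H. \<forall>B. range B \<subseteq> sets borel \<longrightarrow> disjoint_family B \<longrightarrow>
          (\<lambda>n::nat. hinner H \<xi> (E (B n) \<xi>)) sums hinner H \<xi> (E (\<Union>n. B n) \<xi>))"

definition pvm_scalar :: "'a hilb \<Rightarrow> ((real \<times> real) set \<Rightarrow> 'a \<Rightarrow> 'a) \<Rightarrow> 'a \<Rightarrow> (real \<times> real) measure"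
  where
  "pvm_scalar H E \<xi> = measure_of UNIV (sets borel) (\<lambda>B. ennreal (Re (hinner H \<xi> (E B \<xi>))))"

definition pvm_support :: "'a hilb \<Rightarrow> ((real \<times> real) set \<Rightarrow> 'a \<Rightarrow> 'a) \<Rightarrow> (real \<times> real) set" where
  "pvm_support H E = {p. \<forall>U. open U \<longrightarrow> p \<in> U \<longrightarrow> E U \<noteq> scalar_op H 0}"

text \<open>
  \<open>T(a) = exp (i a \<cdot> P)\<close> means that \<open>T(a)\<close> is the integral of \<open>exp (i a \<cdot> p)\<close> against the joint
  spectral measure \<open>E\<close> of the generators \<open>P = (P\<^sub>0, P\<^sub>1)\<close>; the integral is taken weakly, and by
  polarization its diagonal matrix elements determine \<open>T(a)\<close>. Such an \<open>E\<close> exists for every strongly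
  continuous unitary representation and is unique on Borel sets; its support is the joint spectrum.
\<close>

definition joint_spectral_measure ::
    "'a hilb \<Rightarrow> (real \<times> real \<Rightarrow> 'a \<Rightarrow> 'a) \<Rightarrow> ((real \<times> real) set \<Rightarrow> 'a \<Rightarrow> 'a) \<Rightarrow> bool" where
  "joint_spectral_measure H T E \<longleftrightarrow> pvm H E
     \<and> (\<forall>a. \<forall>\<xi>\<in>hcarrier H.
          hinner H \<xi> (T a \<xi>) = (LINT p|pvm_scalar H E \<xi>. exp (\<i> * complex_of_real (lorentz a p))))"

definition spectrum_condition :: "'a hilb \<Rightarrow> (real \<times> real \<Rightarrow> 'a \<Rightarrow> 'a) \<Rightarrow> bool" where
  "spectrum_condition H T \<longleftrightarrow>
     (\<exists>E. joint_spectral_measure H T E \<and> pvm_support H E \<subseteq> closed_forward_cone)"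


section \<open>Borchers triples\<close>

definition borchers_triple ::
    "'a hilb \<Rightarrow> ('a \<Rightarrow> 'a) set \<Rightarrow> (real \<times> real \<Rightarrow> 'a \<Rightarrow> 'a) \<Rightarrow> 'a \<Rightarrow> bool" where
  "borchers_triple H M T \<Omega> \<longleftrightarrow>
     hilbert_space H
     \<and> von_neumann_algebra H M
     \<and> unitary_rep H T
     \<and> spectrum_condition H T
     \<and> \<Omega> \<in> hcarrier H \<and> hnorm H \<Omega> = 1
     \<and> (\<forall>\<xi>\<in>hcarrier H. (\<forall>a. T a \<xi> = \<xi>) \<longleftrightarrow> (\<exists>c. \<xi> = hscale H c \<Omega>))
     \<and> (\<forall>a\<in>right_wedge. Ad H (T a) ` M \<subseteq> M)
     \<and> cyclic_vector H M \<Omega>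
     \<and> separating_vector H M \<Omega>"


section \<open>Direct sums and tensor products of Hilbert spaces\<close>

definition hsum :: "'i set \<Rightarrow> ('i \<Rightarrow> 'a hilb) \<Rightarrow> ('i \<Rightarrow> 'a) hilb" where
  "hsum I H = \<lparr>
     hcarrier = {v \<in> \<Pi>\<^sub>E i\<in>I. hcarrier (H i). (\<lambda>i. (hnorm (H i) (v i))\<^sup>2) summable_on I},
     hzero = (\<lambda>i\<in>I. hzero (H i)),
     hadd = (\<lambda>v w. \<lambda>i\<in>I. hadd (H i) (v i) (w i)),
     hscale = (\<lambda>c v. \<lambda>i\<in>I. hscale (H i) c (v i)),
     hinner = (\<lambda>v w. \<Sum>\<^sub>\<infinity>i\<in>I. hinner (H i) (v i) (w i))\<rparr>"

definition hsum_inj :: "'i set \<Rightarrow> ('i \<Rightarrow> 'a hilb) \<Rightarrow> 'i \<Rightarrow> 'a \<Rightarrow> 'i \<Rightarrow> 'a" where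
  "hsum_inj I H i x = (\<lambda>j\<in>I. if j = i then x else hzero (H j))"

definition hsum_op :: "'i set \<Rightarrow> ('i \<Rightarrow> 'a hilb) \<Rightarrow> ('i \<Rightarrow> 'a \<Rightarrow> 'a) \<Rightarrow> ('i \<Rightarrow> 'a) \<Rightarrow> 'i \<Rightarrow> 'a" where
  "hsum_op I H X = (\<lambda>v\<in>hcarrier (hsum I H). \<lambda>i\<in>I. X i (v i))"

text \<open>
  The Hilbert space tensor product is realized as the space of Hilbert-Schmidt functionals
  (Kadison and Ringrose, Fundamentals of the Theory of Operator Algebras I, Section 2.6): a vector
  \<open>\<psi>\<close> of the tensor product is the bounded conjugate-multilinear function
  \<open>(\<eta>\<^sub>1, \<dots>, \<eta>\<^sub>n) \<mapsto> \<langle>\<eta>\<^sub>1 \<otimes> \<dots> \<otimes> \<eta>\<^sub>n, \<psi>\<rangle>\<close>, which is square summable over the products of orthonormal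
  bases. The inner product does not depend on the bases. Both the product of two spaces with
  different element types and the product of a list of spaces are needed; the empty product is
  the field of complex numbers.
\<close>

definition functional_space ::
    "'x set \<Rightarrow> 'x set \<Rightarrow> ('x \<Rightarrow> complex) set \<Rightarrow> ('x \<Rightarrow> complex) hilb" where
  "functional_space X B F = \<lparr>
     hcarrier = {\<phi> \<in> F. (\<forall>x. x \<notin> X \<longrightarrow> \<phi> x = 0) \<and> (\<lambda>e. (cmod (\<phi> e))\<^sup>2) summable_on B},
     hzero = (\<lambda>x. 0),
     hadd = (\<lambda>\<phi> \<psi> x. \<phi> x + \<psi> x),
     hscale = (\<lambda>c \<phi> x. c * \<phi> x),
     hinner = (\<lambda>\<phi> \<psi>. \<Sum>\<^sub>\<infinity>e\<in>B. cnj (\<phi> e) * \<psi> e)\<rparr>"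

definition bounded_antibilinear :: "'a hilb \<Rightarrow> 'b hilb \<Rightarrow> ('a \<times> 'b \<Rightarrow> complex) set" where
  "bounded_antibilinear H G = {\<phi>.
     (\<forall>x\<in>hcarrier H. \<forall>x'\<in>hcarrier H. \<forall>y\<in>hcarrier G. \<forall>c.
        \<phi> (hadd H x (hscale H c x'), y) = \<phi> (x, y) + cnj c * \<phi> (x', y))
     \<and> (\<forall>x\<in>hcarrier H. \<forall>y\<in>hcarrier G. \<forall>y'\<in>hcarrier G. \<forall>c.
        \<phi> (x, hadd G y (hscale G c y')) = \<phi> (x, y) + cnj c * \<phi> (x, y'))
     \<and> (\<exists>C. \<forall>x\<in>hcarrier H. \<forall>y\<in>hcarrier G. cmod (\<phi> (x, y)) \<le> C * hnorm H x * hnorm G y)}"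

definition tensor :: "'a hilb \<Rightarrow> 'b hilb \<Rightarrow> ('a \<times> 'b \<Rightarrow> complex) hilb" where
  "tensor H G = functional_space (hcarrier H \<times> hcarrier G) (some_basis H \<times> some_basis G)
     (bounded_antibilinear H G)"

definition tensor_vec :: "'a hilb \<Rightarrow> 'b hilb \<Rightarrow> 'a \<Rightarrow> 'b \<Rightarrow> 'a \<times> 'b \<Rightarrow> complex" where
  "tensor_vec H G \<xi> \<eta> = (\<lambda>(x, y).
     if x \<in> hcarrier H \<and> y \<in> hcarrier G then hinner H x \<xi> * hinner G y \<eta> else 0)"

definition tensor_op ::
    "'a hilb \<Rightarrow> 'b hilb \<Rightarrow> ('a \<Rightarrow> 'a) \<Rightarrow> ('b \<Rightarrow> 'b) \<Rightarrow> ('a \<times> 'b \<Rightarrow> complex) \<Rightarrow> 'a \<times> 'b \<Rightarrow> complex"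
  where
  "tensor_op H G R S = (THE X. X \<in> bops (tensor H G) \<and>
     (\<forall>\<xi>\<in>hcarrier H. \<forall>\<eta>\<in>hcarrier G.
        X (tensor_vec H G \<xi> \<eta>) = tensor_vec H G (R \<xi>) (S \<eta>)))"

definition bounded_antimultilinear :: "'a hilb list \<Rightarrow> ('a list \<Rightarrow> complex) set" where
  "bounded_antimultilinear Hs = {\<phi>.
     (\<forall>xs\<in>listset (map hcarrier Hs). \<forall>i<length Hs.
        \<forall>x\<in>hcarrier (Hs ! i). \<forall>x'\<in>hcarrier (Hs ! i). \<forall>c.
        \<phi> (xs[i := hadd (Hs ! i) x (hscale (Hs ! i) c x')])
          = \<phi> (xs[i := x]) + cnj c * \<phi> (xs[i := x']))
     \<and> (\<exists>C. \<forall>xs\<in>listset (map hcarrier Hs).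
          cmod (\<phi> xs) \<le> C * (\<Prod>i<length Hs. hnorm (Hs ! i) (xs ! i)))}"

definition tensor_list :: "'a hilb list \<Rightarrow> ('a list \<Rightarrow> complex) hilb" where
  "tensor_list Hs = functional_space (listset (map hcarrier Hs)) (listset (map some_basis Hs))
     (bounded_antimultilinear Hs)"

definition tensor_list_vec :: "'a hilb list \<Rightarrow> 'a list \<Rightarrow> 'a list \<Rightarrow> complex" where
  "tensor_list_vec Hs \<xi>s = (\<lambda>xs.
     if xs \<in> listset (map hcarrier Hs)
     then \<Prod>i<length Hs. hinner (Hs ! i) (xs ! i) (\<xi>s ! i) else 0)"

definition tensor_list_op ::
    "'a hilb list \<Rightarrow> ('a \<Rightarrow> 'a) list \<Rightarrow> ('a list \<Rightarrow> complex) \<Rightarrow> 'a list \<Rightarrow> complex" where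
  "tensor_list_op Hs Rs = (THE X. X \<in> bops (tensor_list Hs) \<and>
     (\<forall>\<xi>s\<in>listset (map hcarrier Hs).
        X (tensor_list_vec Hs \<xi>s) = tensor_list_vec Hs (map2 (\<lambda>R \<xi>. R \<xi>) Rs \<xi>s)))"


section \<open>Free products\<close>

definition alternating_words :: "'k set \<Rightarrow> 'k list set" where
  "alternating_words K = {w. set w \<subseteq> K \<and> distinct_adj w}"

definition word_factors :: "('k \<Rightarrow> 'a hilb) \<Rightarrow> ('k \<Rightarrow> 'a) \<Rightarrow> 'k list \<Rightarrow> 'a hilb list" where
  "word_factors H \<Omega> w = map (\<lambda>\<kappa>. hcompl (H \<kappa>) (\<Omega> \<kappa>)) w"

definition word_space :: "('k \<Rightarrow> 'a hilb) \<Rightarrow> ('k \<Rightarrow> 'a) \<Rightarrow> 'k list \<Rightarrow> ('a list \<Rightarrow> complex) hilb" where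
  "word_space H \<Omega> w = tensor_list (word_factors H \<Omega> w)"

text \<open>The summand of the empty word is the empty tensor product, that is, the line of the vacuum.\<close>

definition free_hilb ::
    "'k set \<Rightarrow> ('k \<Rightarrow> 'a hilb) \<Rightarrow> ('k \<Rightarrow> 'a) \<Rightarrow> ('k list \<Rightarrow> 'a list \<Rightarrow> complex) hilb" where
  "free_hilb K H \<Omega> = hsum (alternating_words K) (word_space H \<Omega>)"

definition free_inj ::
    "'k set \<Rightarrow> ('k \<Rightarrow> 'a hilb) \<Rightarrow> ('k \<Rightarrow> 'a) \<Rightarrow> 'k list \<Rightarrow> ('a list \<Rightarrow> complex)
      \<Rightarrow> 'k list \<Rightarrow> 'a list \<Rightarrow> complex" where
  "free_inj K H \<Omega> = hsum_inj (alternating_words K) (word_space H \<Omega>)"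

definition free_vec ::
    "'k set \<Rightarrow> ('k \<Rightarrow> 'a hilb) \<Rightarrow> ('k \<Rightarrow> 'a) \<Rightarrow> 'k list \<Rightarrow> 'a list \<Rightarrow> 'k list \<Rightarrow> 'a list \<Rightarrow> complex"
  where
  "free_vec K H \<Omega> w \<xi>s = free_inj K H \<Omega> w (tensor_list_vec (word_factors H \<Omega> w) \<xi>s)"

definition free_vacuum ::
    "'k set \<Rightarrow> ('k \<Rightarrow> 'a hilb) \<Rightarrow> ('k \<Rightarrow> 'a) \<Rightarrow> 'k list \<Rightarrow> 'a list \<Rightarrow> complex" where
  "free_vacuum K H \<Omega> = free_vec K H \<Omega> [] []"

text \<open>The subspace \<open>\<H>(\<kappa>)\<close> as a Hilbert space.\<close>

definition free_sub ::
    "'k set \<Rightarrow> ('k \<Rightarrow> 'a hilb) \<Rightarrow> ('k \<Rightarrow> 'a) \<Rightarrow> 'k \<Rightarrow> ('k list \<Rightarrow> 'a list \<Rightarrow> complex) hilb" where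
  "free_sub K H \<Omega> \<kappa> = hsub (free_hilb K H \<Omega>) (closed_span (free_hilb K H \<Omega>)
     (insert (free_vacuum K H \<Omega>)
       (\<Union>w\<in>{w \<in> alternating_words K. w \<noteq> [] \<and> hd w \<noteq> \<kappa>}.
          free_inj K H \<Omega> w ` hcarrier (word_space H \<Omega> w))))"

text \<open>
  The last clause prescribes \<open>\<xi> \<otimes> \<eta> \<mapsto> \<xi> \<otimes> \<eta>\<close> for elementary tensors \<open>\<eta>\<close>, which are total in the
  orthogonal complement of the vacuum in \<open>\<H>(\<kappa>)\<close>.
\<close>

definition free_V ::
    "'k set \<Rightarrow> ('k \<Rightarrow> 'a hilb) \<Rightarrow> ('k \<Rightarrow> 'a) \<Rightarrow> 'k
      \<Rightarrow> ('a \<times> ('k list \<Rightarrow> 'a list \<Rightarrow> complex) \<Rightarrow> complex) \<Rightarrow> 'k list \<Rightarrow> 'a list \<Rightarrow> complex" where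
  "free_V K H \<Omega> \<kappa> = (THE V.
     let vac = free_vacuum K H \<Omega>;
         tens = tensor_vec (H \<kappa>) (free_sub K H \<Omega> \<kappa>);
         H0 = hcarrier (hcompl (H \<kappa>) (\<Omega> \<kappa>))
     in unitary_op (tensor (H \<kappa>) (free_sub K H \<Omega> \<kappa>)) (free_hilb K H \<Omega>) V
      \<and> V (tens (\<Omega> \<kappa>) vac) = vac
      \<and> (\<forall>\<xi>\<in>H0. V (tens \<xi> vac) = free_vec K H \<Omega> [\<kappa>] [\<xi>])
      \<and> (\<forall>\<eta>\<in>hcarrier (hcompl (free_sub K H \<Omega> \<kappa>) vac). V (tens (\<Omega> \<kappa>) \<eta>) = \<eta>)
      \<and> (\<forall>\<xi>\<in>H0. \<forall>w\<in>alternating_words K. w \<noteq> [] \<longrightarrow> hd w \<noteq> \<kappa> \<longrightarrow>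
           (\<forall>\<eta>s\<in>listset (map hcarrier (word_factors H \<Omega> w)).
              V (tens \<xi> (free_vec K H \<Omega> w \<eta>s)) = free_vec K H \<Omega> (\<kappa> # w) (\<xi> # \<eta>s))))"

definition free_lambda ::
    "'k set \<Rightarrow> ('k \<Rightarrow> 'a hilb) \<Rightarrow> ('k \<Rightarrow> 'a) \<Rightarrow> 'k \<Rightarrow> ('a \<Rightarrow> 'a)
      \<Rightarrow> ('k list \<Rightarrow> 'a list \<Rightarrow> complex) \<Rightarrow> 'k list \<Rightarrow> 'a list \<Rightarrow> complex" where
  "free_lambda K H \<Omega> \<kappa> S =
     (let G = free_sub K H \<Omega> \<kappa>; F = free_hilb K H \<Omega>; V = free_V K H \<Omega> \<kappa>
      in compose (hcarrier F) V
           (compose (hcarrier F) (tensor_op (H \<kappa>) G S (scalar_op G 1)) (hadj (tensor (H \<kappa>) G) F V)))"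

definition free_vN ::
    "'k set \<Rightarrow> ('k \<Rightarrow> 'a hilb) \<Rightarrow> ('k \<Rightarrow> 'a) \<Rightarrow> ('k \<Rightarrow> ('a \<Rightarrow> 'a) set)
      \<Rightarrow> (('k list \<Rightarrow> 'a list \<Rightarrow> complex) \<Rightarrow> 'k list \<Rightarrow> 'a list \<Rightarrow> complex) set" where
  "free_vN K H \<Omega> M = vN_join (free_hilb K H \<Omega>) K (\<lambda>\<kappa>. free_lambda K H \<Omega> \<kappa> ` M \<kappa>)"

definition free_unitary ::
    "'k set \<Rightarrow> ('k \<Rightarrow> 'a hilb) \<Rightarrow> ('k \<Rightarrow> 'a) \<Rightarrow> ('k \<Rightarrow> 'a \<Rightarrow> 'a)
      \<Rightarrow> ('k list \<Rightarrow> 'a list \<Rightarrow> complex) \<Rightarrow> 'k list \<Rightarrow> 'a list \<Rightarrow> complex" where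
  "free_unitary K H \<Omega> U = hsum_op (alternating_words K) (word_space H \<Omega>)
     (\<lambda>w. tensor_list_op (word_factors H \<Omega> w)
        (map (\<lambda>\<kappa>. restrict (U \<kappa>) (hcarrier (hcompl (H \<kappa>) (\<Omega> \<kappa>)))) w))"

end

(* The algebras lambda_k(M_k) commute with the right actions rho_k(M_k'), where rho_k is lambda_k
conjugated by the flip that reverses words. By induction on words the vacuum is cyclic for both
families, hence cyclic and separating for the free product.

On the summand of a word the joint spectral measure of T is the convolution of those of the letters:
vectors indexed by Borel subsets of (R^2)^n are obtained from their Gram matrix, and pushed forward
along addition. The forward cone is closed under addition and 0 is its only extreme point, so the
support stays in the cone and only the vacuum is invariant.

For the relative commutant let x commute with Ad T(a)(M) and put xi = x vac. Choose Y in Ad T(a)(M_0)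
and Y' in M_0' with Y Omega and Y' Omega close to e, the first letter of an elementary tensor z. For a
letter k not occurring in z the vectors lambda_k(Y) xi and rho_k(Y') xi are close; pairing both with
the vector e in the slot k followed by z gives |e|^2 <z, xi> up to inner products of xi with vectors
that are orthogonal for different k. By Bessel's inequality these are small for some k, so xi is
orthogonal to z. *)

theory Submission
  imports Defs
begin

section \<open>Elementary Hilbert space geometry\<close>

text \<open>The unitary V, the flip, the translations and the spectral measure are prescribed on
  elementary tensors, which are linearly dependent, so well-definedness is the obstacle. It is met
  once, in \<open>family_functional\<close>: a bounded prescription on a family of vectors is
  represented by a vector of the closed span. Equal Gram matrices then give isometries, and
  Cauchy-Schwarz for step functions gives vectors indexed by measurable sets. Uniqueness is dual:
  inner products with a total set determine a vector. No product of projection-valued measures is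
  formed. Only the vectors that E(B) should produce from elementary tensors are built, and E(B) is
  the projection onto the closed span of those belonging to subsets of B. In the relative commutant
  the leading term comes from an asymmetry: the adjoint of the left action can strip the new letter
  k from the front and leave z, which does not depend on k, while the adjoint of the right action
  keeps k in front, so that all its terms change with k.\<close>

abbreviation "hc \<equiv> hcarrier"

abbreviation hdiff :: "'a hilb \<Rightarrow> 'a \<Rightarrow> 'a \<Rightarrow> 'a" where
 "hdiff H x y \<equiv> hadd H x (hscale H (- 1) y)"

text \<open>The axioms of \<open>hilbert_space\<close> without completeness: direct sums and
  functional spaces need the geometry below before their completeness can be shown.\<close>

locale pre_hilbert_space =
 fixes H :: "'a hilb"
 assumes zero_closed: "hzero H \<in> hc H"
  and add_closed: "[|x \<in> hc H; y \<in> hc H|] ==> hadd H x y \<in> hc H"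
  and scale_closed: "x \<in> hc H ==> hscale H c x \<in> hc H"
  and add_assoc: "[|x \<in> hc H; y \<in> hc H; z \<in> hc H|]
   ==> hadd H (hadd H x y) z = hadd H x (hadd H y z)"
  and add_commute: "[|x \<in> hc H; y \<in> hc H|] ==> hadd H x y = hadd H y x"
  and add_zero: "x \<in> hc H ==> hadd H x (hzero H) = x"
  and scale_one: "x \<in> hc H ==> hscale H 1 x = x"
  and scale_zero: "x \<in> hc H ==> hscale H 0 x = hzero H"
  and scale_scale: "x \<in> hc H ==> hscale H c (hscale H d x) = hscale H (c * d) x"
  and scale_add_left: "x \<in> hc H
   ==> hscale H (c + d) x = hadd H (hscale H c x) (hscale H d x)"
  and scale_add_right: "[|x \<in> hc H; y \<in> hc H|]
   ==> hscale H c (hadd H x y) = hadd H (hscale H c x) (hscale H c y)"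
  and inner_commute: "[|x \<in> hc H; y \<in> hc H|]
   ==> hinner H y x = cnj (hinner H x y)"
  and inner_add_right: "[|x \<in> hc H; y \<in> hc H; z \<in> hc H|]
   ==> hinner H x (hadd H y z) = hinner H x y + hinner H x z"
  and inner_scale_right: "[|x \<in> hc H; y \<in> hc H|]
   ==> hinner H x (hscale H c y) = c * hinner H x y"
  and inner_ge_zero: "x \<in> hc H ==> 0 \<le> Re (hinner H x x)"
  and inner_eq_zero: "[|x \<in> hc H; hinner H x x = 0|] ==> x = hzero H"

lemma hilbert_space_iff:
 "hilbert_space H \<longleftrightarrow> pre_hilbert_space H \<and> Metric_space.mcomplete (hc H) (hdist H)"
 unfolding hilbert_space_def pre_hilbert_space_def by meson

lemma hilbert_pre [simp, dest]: "hilbert_space H ==> pre_hilbert_space H"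
 by (simp add: hilbert_space_iff)

declare pre_hilbert_space.zero_closed [simp] pre_hilbert_space.add_closed [simp]
 pre_hilbert_space.scale_closed [simp] pre_hilbert_space.inner_add_right [simp]
 pre_hilbert_space.inner_scale_right [simp] pre_hilbert_space.add_zero [simp]
 pre_hilbert_space.scale_one [simp] pre_hilbert_space.scale_zero [simp]

context pre_hilbert_space
begin

lemma pre [simp]: "pre_hilbert_space H" by (rule pre_hilbert_space_axioms)

lemma inner_add_left:
 assumes "x \<in> hc H" "y \<in> hc H" "z \<in> hc H"
 shows "hinner H (hadd H x y) z = hinner H x z + hinner H y z"
 using assms inner_commute[of z x] inner_commute[of z y] inner_commute[of z "hadd H x y"] by simp

lemma inner_scale_left:
 assumes "x \<in> hc H" "y \<in> hc H"
 shows "hinner H (hscale H c x) y = cnj c * hinner H x y"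
 using assms inner_commute[of y x] inner_commute[of y "hscale H c x"] by simp

lemma inner_zero_right: "x \<in> hc H ==> hinner H x (hzero H) = 0"
 using inner_scale_right[of x x 0] by simp

lemma inner_zero_left: "x \<in> hc H ==> hinner H (hzero H) x = 0"
 using inner_scale_left[of x x 0] by simp

lemma scale_zero_right: "hscale H c (hzero H) = hzero H"
 using scale_scale[of "hzero H" c 0] by simp

lemma zero_add: "x \<in> hc H ==> hadd H (hzero H) x = x"
 using add_commute[of "hzero H" x] by simp

lemma diff_self: "x \<in> hc H ==> hdiff H x x = hzero H"
 using scale_add_left[of x 1 "- 1"] by simp

lemma hnorm_nonneg: "x \<in> hc H ==> 0 \<le> hnorm H x"
 by (simp add: hnorm_def inner_ge_zero)

lemma hnorm_sq: "x \<in> hc H ==> (hnorm H x)\<^sup>2 = Re (hinner H x x)"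
 by (simp add: hnorm_def inner_ge_zero)

lemma inner_self:
 assumes "x \<in> hc H"
 shows "hinner H x x = complex_of_real ((hnorm H x)\<^sup>2)"
proof -
 have "Im (hinner H x x) = 0"
  using arg_cong[OF inner_commute[OF assms assms], of Im] by simp
 then show ?thesis using assms by (simp add: hnorm_sq complex_eq_iff)
qed

lemma hnorm_zero: "hnorm H (hzero H) = 0"
 by (simp add: hnorm_def inner_zero_left)

lemma hnorm_eq_zero:
 assumes "x \<in> hc H"
 shows "hnorm H x = 0 \<longleftrightarrow> x = hzero H"
 using inner_self[OF assms] inner_eq_zero[OF assms] by (auto simp: hnorm_zero)

lemma hnorm_scale:
 assumes "x \<in> hc H"
 shows "hnorm H (hscale H c x) = cmod c * hnorm H x"
proof -
 have "cnj c * (c * complex_of_real ((hnorm H x)\<^sup>2)) = complex_of_real ((cmod c * hnorm H x)\<^sup>2)"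
  by (simp add: power_mult_distrib complex_norm_square mult.assoc del: of_real_power)
 moreover have "hinner H (hscale H c x) (hscale H c x) = cnj c * (c * hinner H x x)"
  using assms scale_closed[OF assms] by (simp add: inner_scale_left)
 ultimately have "(hnorm H (hscale H c x))\<^sup>2 = (cmod c * hnorm H x)\<^sup>2"
  unfolding hnorm_sq[OF scale_closed[OF assms]] inner_self[OF assms] by (simp only: Re_complex_of_real)
 then show ?thesis
  using assms by (simp add: hnorm_nonneg)
qed

lemma cauchy_schwarz:
 assumes x: "x \<in> hc H" and y: "y \<in> hc H"
 shows "cmod (hinner H x y) \<le> hnorm H x * hnorm H y"
proof (cases "y = hzero H")
 case True
 then show ?thesis using x by (simp add: inner_zero_right hnorm_zero)
next
 case False
 define b where "b = (hnorm H y)\<^sup>2"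
 have b: "b > 0" using False hnorm_eq_zero[OF y] hnorm_nonneg[OF y] by (simp add: b_def)
 define a where "a = hinner H y x"
 define z where "z = hadd H x (hscale H (- (a / b)) y)"
 have xy: "hinner H x y = cnj a" by (simp add: a_def inner_commute[OF y x])
 have "hinner H z z = hinner H x x - cnj a * a / b"
  using b x y by (simp add: z_def inner_add_left inner_scale_left inner_self[OF y]
   flip: a_def b_def) (simp add: xy field_simps power2_eq_square)
 also have "cnj a * a / b = complex_of_real ((cmod a)\<^sup>2 / b)"
  by (simp add: complex_norm_square mult.commute del: of_real_power)
 finally have "Re (hinner H z z) = (hnorm H x)\<^sup>2 - (cmod a)\<^sup>2 / b"
  using x by (simp add: hnorm_sq)
 moreover have "0 \<le> Re (hinner H z z)" using x y by (intro inner_ge_zero) (simp add: z_def)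
 ultimately have "(cmod a)\<^sup>2 / b \<le> (hnorm H x)\<^sup>2" by simp
 then have "(cmod a)\<^sup>2 \<le> (hnorm H x)\<^sup>2 * b" using b by (simp add: pos_divide_le_eq)
 then have "(cmod a)\<^sup>2 \<le> (hnorm H x * hnorm H y)\<^sup>2" by (simp add: b_def power_mult_distrib)
 then have "cmod a \<le> hnorm H x * hnorm H y"
  by (rule power2_le_imp_le) (simp add: hnorm_nonneg x y)
 then show ?thesis by (simp add: xy)
qed

lemma hnorm_triangle:
 assumes x: "x \<in> hc H" and y: "y \<in> hc H"
 shows "hnorm H (hadd H x y) \<le> hnorm H x + hnorm H y"
proof (rule power2_le_imp_le)
 have "Re (hinner H x y) \<le> hnorm H x * hnorm H y"
  using cauchy_schwarz[OF x y] complex_Re_le_cmod order_trans by blast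
 moreover have "Re (hinner H y x) = Re (hinner H x y)" by (simp add: inner_commute[OF x y])
 ultimately show "(hnorm H (hadd H x y))\<^sup>2 \<le> (hnorm H x + hnorm H y)\<^sup>2"
  using x y by (simp add: hnorm_sq inner_add_left power2_sum)
qed (simp add: hnorm_nonneg x y)

text \<open>Paired with a test vector, an identity of vectors becomes one of complex numbers that
  the simplifier settles; most vector identities below are proved this way instead of with the group
  laws of the carrier.\<close>

lemma eqI:
 assumes "x \<in> hc H" "y \<in> hc H" "\<And>z. z \<in> hc H ==> hinner H z x = hinner H z y"
 shows "x = y"
proof -
 have "hinner H (hdiff H x y) (hdiff H x y) = 0"
  using assms by simp
 then have 0: "hdiff H x y = hzero H" using assms by (intro inner_eq_zero) simp_all
 have "hscale H 0 y = hadd H (hscale H (- 1) y) (hscale H 1 y)"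
  using scale_add_left[of y "- 1" 1] assms by simp
 then have "hadd H (hscale H (- 1) y) y = hzero H" using assms by simp
 then have "x = hadd H (hdiff H x y) y" using assms by (simp add: add_assoc)
 also have "\<dots> = y" using 0 assms by (simp add: add_commute)
 finally show ?thesis .
qed

lemma eqI':
 assumes "x \<in> hc H" "y \<in> hc H" "\<And>z. z \<in> hc H ==> hinner H x z = hinner H y z"
 shows "x = y"
 by (rule eqI) (use assms in \<open>simp_all add: inner_commute[of x] inner_commute[of y]\<close>)

lemma diff_zero_iff:
 assumes "x \<in> hc H" "y \<in> hc H"
 shows "hdiff H x y = hzero H \<longleftrightarrow> x = y"
proof
 assume "hdiff H x y = hzero H"
 then have "hinner H z x = hinner H z y" if "z \<in> hc H" for z
  using that assms by (metis (no_types, lifting) add.inverse_inverse eq_iff_diff_eq_0 inner_add_right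
    inner_scale_right inner_zero_right mult_minus1 pre pre_hilbert_space.scale_closed uminus_add_conv_diff add.commute)
 then show "x = y" using assms by (intro eqI)
qed (rule eqI, use assms in \<open>simp_all add: inner_zero_right\<close>)

lemma hnorm_diff_commute:
 assumes "x \<in> hc H" "y \<in> hc H"
 shows "hnorm H (hdiff H x y) = hnorm H (hdiff H y x)"
proof -
 have "hdiff H x y = hscale H (- 1) (hdiff H y x)"
  by (rule eqI) (use assms in simp_all)
 then show ?thesis using assms by (simp add: hnorm_scale)
qed

lemma hnorm_diff_triangle:
 assumes "x \<in> hc H" "y \<in> hc H" "z \<in> hc H"
 shows "hnorm H (hdiff H x z) \<le> hnorm H (hdiff H x y) + hnorm H (hdiff H y z)"
proof -
 have "hdiff H x z = hadd H (hdiff H x y) (hdiff H y z)"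
  by (rule eqI) (use assms in simp_all)
 then show ?thesis using assms hnorm_triangle[of "hdiff H x y" "hdiff H y z"] by simp
qed

lemma hnorm_diff_sq:
 assumes "x \<in> hc H" "y \<in> hc H"
 shows "(hnorm H (hdiff H x y))\<^sup>2 = (hnorm H x)\<^sup>2 - 2 * Re (hinner H x y) + (hnorm H y)\<^sup>2"
 using assms by (simp add: hnorm_sq inner_add_left inner_scale_left inner_commute[of x y])

lemma hnorm_add_sq:
 assumes "x \<in> hc H" "y \<in> hc H"
 shows "(hnorm H (hadd H x y))\<^sup>2 = (hnorm H x)\<^sup>2 + 2 * Re (hinner H x y) + (hnorm H y)\<^sup>2"
 using assms by (simp add: hnorm_sq inner_add_left inner_commute[of x y])

section \<open>The metric: sequential forms of completeness, closedness and totality\<close>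

lemma hdist_eq:
 "x \<in> hc H ==> y \<in> hc H ==> hdist H x y = hnorm H (hdiff H x y)"
 by (simp add: hdist_def)

lemma metric: "Metric_space (hc H) (hdist H)"
proof
 show "0 \<le> hdist H x y" for x y by (simp add: hdist_def hnorm_nonneg)
 show "hdist H x y = hdist H y x" for x y by (simp add: hdist_def hnorm_diff_commute)
 show "(hdist H x y = 0) = (x = y)" if "x \<in> hc H" "y \<in> hc H" for x y
  using that by (simp add: hdist_def hnorm_eq_zero diff_zero_iff)
 show "hdist H x z \<le> hdist H x y + hdist H y z"
  if "x \<in> hc H" "y \<in> hc H" "z \<in> hc H" for x y z
  using that by (simp add: hdist_def hnorm_diff_triangle)
qed

lemma inner_right_limit:
 assumes "\<And>n. X n \<in> hc H" "l \<in> hc H" "y \<in> hc H"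
  and "(\<lambda>n. hnorm H (hdiff H (X n) l)) \<longlonglongrightarrow> 0"
 shows "(\<lambda>n. hinner H y (X n)) \<longlonglongrightarrow> hinner H y l"
proof (rule LIM_zero_cancel, rule Lim_null_comparison)
 have "hinner H y (X n) - hinner H y l = hinner H y (hdiff H (X n) l)" for n
  using assms by simp
 then show "\<forall>\<^sub>F n in sequentially. cmod (hinner H y (X n) - hinner H y l)
   \<le> hnorm H y * hnorm H (hdiff H (X n) l)"
  using assms cauchy_schwarz[OF assms(3), of "hdiff H (X _) l"] by (intro always_eventually allI) (simp only: add_closed scale_closed)
 show "(\<lambda>n. hnorm H y * hnorm H (hdiff H (X n) l)) \<longlonglongrightarrow> 0"
  using tendsto_mult_right_zero[OF assms(4)] by simp
qed

lemma hnorm_limit: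
 assumes "\<And>n. X n \<in> hc H" "l \<in> hc H"
  and "(\<lambda>n. hnorm H (hdiff H (X n) l)) \<longlonglongrightarrow> 0"
 shows "(\<lambda>n. hnorm H (X n)) \<longlonglongrightarrow> hnorm H l"
proof (rule LIM_zero_cancel, rule Lim_null_comparison[OF _ assms(3)])
 have 1: "hnorm H x \<le> hnorm H (hdiff H x y) + hnorm H y" if "x \<in> hc H" "y \<in> hc H" for x y
 proof -
  have "x = hadd H (hdiff H x y) y" by (rule eqI) (use that in simp_all)
  then show ?thesis using hnorm_triangle[of "hdiff H x y" y] that by simp
 qed
 show "\<forall>\<^sub>F n in sequentially. norm (hnorm H (X n) - hnorm H l) \<le> hnorm H (hdiff H (X n) l)"
 proof (intro always_eventually allI)
  fix n
  show "norm (hnorm H (X n) - hnorm H l) \<le> hnorm H (hdiff H (X n) l)"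
   using 1[OF assms(1) assms(2), of n] 1[OF assms(2) assms(1), of n] hnorm_diff_commute[OF assms(2) assms(1), of n]
   by (simp add: abs_le_iff)
 qed
qed

lemma mcomplete_iff:
 "Metric_space.mcomplete (hc H) (hdist H) \<longleftrightarrow>
  (\<forall>X. (\<forall>n. X n \<in> hc H) \<longrightarrow>
   (\<forall>e>0. \<exists>N. \<forall>m\<ge>N. \<forall>n\<ge>N. hnorm H (hdiff H (X m) (X n)) < e) \<longrightarrow>
   (\<exists>l\<in>hc H. (\<lambda>n. hnorm H (hdiff H (X n) l)) \<longlonglongrightarrow> 0))"
proof -
 interpret M: Metric_space "hc H" "hdist H" by (rule metric)
 have lim: "limitin M.mtopology X l sequentially \<longleftrightarrow> (\<lambda>n. hnorm H (hdiff H (X n) l)) \<longlonglongrightarrow> 0"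
  if X: "\<forall>n. X n \<in> hc H" and l: "l \<in> hc H" for X l
  using X l by (simp add: M.limit_metric_sequentially LIMSEQ_def hdist_eq hnorm_nonneg)
 have cau: "M.MCauchy X \<longleftrightarrow> (\<forall>n. X n \<in> hc H) \<and>
   (\<forall>e>0. \<exists>N. \<forall>m\<ge>N. \<forall>n\<ge>N. hnorm H (hdiff H (X m) (X n)) < e)" for X
  by (auto simp: M.MCauchy_def hdist_eq image_subset_iff)
 have "(\<exists>l. limitin M.mtopology X l sequentially) \<longleftrightarrow> (\<exists>l\<in>hc H. (\<lambda>n. hnorm H (hdiff H (X n) l)) \<longlonglongrightarrow> 0)"
  if "\<forall>n. X n \<in> hc H" for X
  using lim[OF that] M.limitin_mspace by blast
 then show ?thesis unfolding M.mcomplete_def cau by (simp add: imp_conjL)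
qed

lemma closedin_iff:
 "closedin (htop H) L \<longleftrightarrow> L \<subseteq> hc H \<and>
  (\<forall>x\<in>hc H. (\<forall>e>0. \<exists>y\<in>L. hnorm H (hdiff H x y) < e) \<longrightarrow> x \<in> L)"
proof -
 interpret M: Metric_space "hc H" "hdist H" by (rule metric)
 have "disjnt L (M.mball x r) \<longleftrightarrow> (\<forall>y\<in>L. \<not> hnorm H (hdiff H x y) < r)"
  if "x \<in> hc H" "L \<subseteq> hc H" for x r
  using that by (auto simp: disjnt_iff M.in_mball hdist_eq subset_iff)
 then show ?thesis
  unfolding M.closedin_metric by (metis Diff_iff)
qed

lemma closure_of_iff:
 assumes "S \<subseteq> hc H"
 shows "x \<in> htop H closure_of S \<longleftrightarrow> x \<in> hc H \<and> (\<forall>e>0. \<exists>y\<in>S. hnorm H (hdiff H x y) < e)"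
proof -
 interpret M: Metric_space "hc H" "hdist H" by (rule metric)
 show ?thesis using assms
  by (auto simp: M.metric_closure_of M.in_mball hdist_eq subset_iff) (metis hdist_eq)+
qed

lemma closed_subspace_iff:
 "closed_subspace H L \<longleftrightarrow> L \<subseteq> hc H \<and> hzero H \<in> L
  \<and> (\<forall>x\<in>L. \<forall>y\<in>L. hadd H x y \<in> L) \<and> (\<forall>c. \<forall>x\<in>L. hscale H c x \<in> L)
  \<and> (\<forall>x\<in>hc H. (\<forall>e>0. \<exists>y\<in>L. hnorm H (hdiff H x y) < e) \<longrightarrow> x \<in> L)"
 unfolding closed_subspace_def closedin_iff by blast

lemma closed_subspaceI:
 assumes "L \<subseteq> hc H" "hzero H \<in> L" "\<And>x y. x \<in> L ==> y \<in> L ==> hadd H x y \<in> L"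
  "\<And>c x. x \<in> L ==> hscale H c x \<in> L"
  "\<And>x. x \<in> hc H ==> (\<And>e. e > 0 ==> \<exists>y\<in>L. hnorm H (hdiff H x y) < e) ==> x \<in> L"
 shows "closed_subspace H L"
 unfolding closed_subspace_iff using assms by blast

lemma closed_subspaceD:
 assumes "closed_subspace H L"
 shows "L \<subseteq> hc H" "hzero H \<in> L" "\<And>x y. x \<in> L ==> y \<in> L ==> hadd H x y \<in> L"
  "\<And>c x. x \<in> L ==> hscale H c x \<in> L"
  "\<And>x. x \<in> hc H ==> (\<And>e. e > 0 ==> \<exists>y\<in>L. hnorm H (hdiff H x y) < e) ==> x \<in> L"
  "\<And>x y. x \<in> L ==> y \<in> L ==> hdiff H x y \<in> L"
 using assms unfolding closed_subspace_iff by blast+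

lemma closed_subspace_carrier: "closed_subspace H (hc H)"
 by (rule closed_subspaceI) (auto simp:)

lemma approx_sequence:
 assumes "\<And>e. e > 0 ==> \<exists>y\<in>L. hnorm H (hdiff H x y) < e" "L \<subseteq> hc H" "x \<in> hc H"
 obtains X where "\<And>n. X n \<in> L" "(\<lambda>n. hnorm H (hdiff H (X n) x)) \<longlonglongrightarrow> 0"
proof -
 have "\<exists>y\<in>L. hnorm H (hdiff H x y) < 1 / Suc n" for n :: nat by (rule assms) simp
 then obtain X where X: "X n \<in> L" "hnorm H (hdiff H x (X n)) < 1 / Suc n" for n by metis
 have "(\<lambda>n. hnorm H (hdiff H (X n) x)) \<longlonglongrightarrow> 0"
 proof (rule Lim_null_comparison[OF _ LIMSEQ_inverse_real_of_nat])
  show "\<forall>\<^sub>F n in sequentially. norm (hnorm H (hdiff H (X n) x)) \<le> inverse (real (Suc n))"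
  proof (intro always_eventually allI)
   fix n
   have "X n \<in> hc H" using X assms by blast
   then show "norm (hnorm H (hdiff H (X n) x)) \<le> inverse (real (Suc n))"
    using X(2)[of n] assms(3) hnorm_diff_commute[of x "X n"]
    by (simp add: hnorm_nonneg pre inverse_eq_divide)
  qed
 qed
 with X(1) show ?thesis by (rule that)
qed

lemma limit_approx:
 assumes "\<And>n. X n \<in> L" "L \<subseteq> hc H" "x \<in> hc H"
  "(\<lambda>n. hnorm H (hdiff H (X n) x)) \<longlonglongrightarrow> 0" "e > 0"
 shows "\<exists>y\<in>L. hnorm H (hdiff H x y) < e"
proof -
 obtain n where "norm (hnorm H (hdiff H (X n) x)) < e"
  using LIMSEQ_D[OF assms(4,5)] by auto
 moreover have "X n \<in> hc H" using assms(1,2) by blast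
 ultimately show ?thesis using assms(1,3) hnorm_diff_commute[of x "X n"] by (intro bexI[of _ "X n"]) auto
qed

lemma closed_span_least: "closed_subspace H L ==> S \<subseteq> L ==> closed_span H S \<subseteq> L"
 unfolding closed_span_def by blast

lemma closed_span_superset: "S \<subseteq> closed_span H S"
 unfolding closed_span_def by blast

lemma closed_span_closed:
 assumes "S \<subseteq> hc H"
 shows "closed_subspace H (closed_span H S)"
proof (rule closed_subspaceI)
 show sub: "closed_span H S \<subseteq> hc H"
  by (rule closed_span_least[OF closed_subspace_carrier assms])
 show "x \<in> closed_span H S" if x: "x \<in> hc H"
  and a: "\<And>e. 0 < e ==> \<exists>y\<in>closed_span H S. hnorm H (hdiff H x y) < e" for x
 proof -
  have "x \<in> L" if L: "closed_subspace H L" "S \<subseteq> L" for L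
   using closed_subspaceD(5)[OF L(1) x] a closed_span_least[OF L] by blast
  then show ?thesis unfolding closed_span_def by blast
 qed
qed (auto simp: closed_span_def dest: closed_subspaceD)

text \<open>The form in which density is used: \<open>L\<close> is the set of vectors with the
  desired property, usually a preimage as in \<open>bop_vimage_closed\<close>.\<close>

lemma total_induct:
 assumes "closed_span H S = hc H" "closed_subspace H L" "S \<subseteq> L"
 shows "L = hc H"
 using closed_span_least[OF assms(2,3)] assms(1) closed_subspaceD(1)[OF assms(2)] by blast

lemma orthogonal_closed_subspace:
 assumes "S \<subseteq> hc H"
 shows "closed_subspace H {x \<in> hc H. \<forall>y\<in>S. hinner H y x = 0}"
proof (rule closed_subspaceI)
 fix x assume x: "x \<in> hc H"
  and a: "\<And>e. e > 0 ==> \<exists>y\<in>{x \<in> hc H. \<forall>y\<in>S. hinner H y x = 0}. hnorm H (hdiff H x y) < e"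
 have sub: "{x \<in> hc H. \<forall>y\<in>S. hinner H y x = 0} \<subseteq> hc H" by blast
 obtain X where X: "\<And>n. X n \<in> {x \<in> hc H. \<forall>y\<in>S. hinner H y x = 0}"
  "(\<lambda>n. hnorm H (hdiff H (X n) x)) \<longlonglongrightarrow> 0"
  using approx_sequence[OF a sub x] by blast
 have "hinner H y x = 0" if y: "y \<in> S" for y
 proof -
  have "(\<lambda>n. hinner H y (X n)) \<longlonglongrightarrow> hinner H y x"
   using X y assms x by (intro inner_right_limit) auto
  then show ?thesis using X(1) y by (simp add: LIMSEQ_const_iff)
 qed
 with x show "x \<in> {x \<in> hc H. \<forall>y\<in>S. hinner H y x = 0}" by blast
qed (use assms in \<open>auto simp: inner_zero_right subset_iff\<close>)

lemma total_eqI: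
 assumes "closed_span H S = hc H" "S \<subseteq> hc H" "x \<in> hc H" "y \<in> hc H"
  "\<And>z. z \<in> S ==> hinner H z x = hinner H z y"
 shows "x = y"
proof -
 define d where "d = hdiff H x y"
 have d: "d \<in> hc H" using assms by (simp add: d_def)
 have "S \<subseteq> {u \<in> hc H. \<forall>v\<in>{d}. hinner H v u = 0}"
 proof
  fix z assume z: "z \<in> S"
  then have zc: "z \<in> hc H" using assms by blast
  then have "hinner H z d = 0" using assms z by (simp add: d_def)
  then show "z \<in> {u \<in> hc H. \<forall>v\<in>{d}. hinner H v u = 0}"
   using zc d by (simp add: inner_commute[of z d])
 qed
 from total_induct[OF assms(1) orthogonal_closed_subspace this] d
 have "hinner H d d = 0" by blast
 then show ?thesis using inner_eq_zero[OF d] diff_zero_iff[OF assms(3,4)] by (simp add: d_def)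
qed

end

declare pre_hilbert_space.inner_add_left [simp] pre_hilbert_space.inner_scale_left [simp]
 pre_hilbert_space.inner_zero_left [simp] pre_hilbert_space.inner_zero_right [simp]
 pre_hilbert_space.scale_zero_right [simp] pre_hilbert_space.zero_add [simp]
 pre_hilbert_space.diff_self [simp] pre_hilbert_space.hnorm_nonneg [simp] pre_hilbert_space.hnorm_zero [simp]
 pre_hilbert_space.hnorm_scale [simp]

lemma hilbert_spaceI:
 fixes H :: "'a hilb"
 assumes "pre_hilbert_space H"
  "\<And>X :: nat \<Rightarrow> 'a. [|\<And>n. X n \<in> hc H; \<And>e. e > 0 ==> \<exists>N. \<forall>m\<ge>N. \<forall>n\<ge>N. hnorm H (hdiff H (X m) (X n)) < e|]
   ==> \<exists>l\<in>hc H. (\<lambda>n. hnorm H (hdiff H (X n) l)) \<longlonglongrightarrow> 0"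
 shows "hilbert_space H"
 unfolding hilbert_space_iff pre_hilbert_space.mcomplete_iff[OF assms(1)] using assms by blast

lemma hilbert_cauchy_limit:
 fixes X :: "nat \<Rightarrow> 'a" and H :: "'a hilb"
 assumes "hilbert_space H" "\<And>n. X n \<in> hc H"
  "\<And>e. e > 0 ==> \<exists>N. \<forall>m\<ge>N. \<forall>n\<ge>N. hnorm H (hdiff H (X m) (X n)) < e"
 obtains l where "l \<in> hc H" "(\<lambda>n. hnorm H (hdiff H (X n) l)) \<longlonglongrightarrow> 0"
 using assms(1)[unfolded hilbert_space_iff] pre_hilbert_space.mcomplete_iff[of H] assms(2,3) that by blast

lemma hsub_simps [simp]:
 "hc (hsub H L) = L" "hzero (hsub H L) = hzero H" "hadd (hsub H L) = hadd H"
 "hscale (hsub H L) = hscale H" "hinner (hsub H L) = hinner H" "hnorm (hsub H L) = hnorm H"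
 by (simp_all add: hsub_def hnorm_def[abs_def])

lemma hilbert_hsub:
 fixes H :: "'a hilb"
 assumes h: "hilbert_space H" and L: "closed_subspace H L"
 shows "hilbert_space (hsub H L)"
proof (rule hilbert_spaceI)
 interpret pre_hilbert_space H using h by (rule hilbert_pre)
 note L' = closed_subspaceD[OF L]
 show "pre_hilbert_space (hsub H L)"
  using L'(1) by (unfold_locales; unfold hsub_simps)
   (blast intro: L'(2-4) add_assoc add_commute add_zero scale_one scale_zero scale_scale
    scale_add_left scale_add_right inner_commute inner_add_right inner_scale_right
    inner_ge_zero inner_eq_zero)+
 fix X :: "nat \<Rightarrow> 'a" assume X: "\<And>n. X n \<in> hc (hsub H L)"
  "\<And>e. 0 < e ==> \<exists>N. \<forall>m\<ge>N. \<forall>n\<ge>N. hnorm (hsub H L) (hdiff (hsub H L) (X m) (X n)) < e"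
 have XC: "X n \<in> hc H" for n using X(1) L'(1) by auto
 obtain l where l: "l \<in> hc H" "(\<lambda>n. hnorm H (hdiff H (X n) l)) \<longlonglongrightarrow> 0"
  using hilbert_cauchy_limit[OF h, of X] XC X(2) by auto
 have "l \<in> L" using limit_approx[OF _ L'(1) l] X(1) l(1) by (intro L'(5)) auto
 with l show "\<exists>l\<in>hc (hsub H L). (\<lambda>n. hnorm (hsub H L) (hdiff (hsub H L) (X n) l)) \<longlonglongrightarrow> 0"
  by auto
qed

lemma hcompl_simps [simp]:
 "hc (hcompl H v) = {x \<in> hc H. hinner H v x = 0}" "hzero (hcompl H v) = hzero H"
 "hadd (hcompl H v) = hadd H" "hscale (hcompl H v) = hscale H" "hinner (hcompl H v) = hinner H"
 "hnorm (hcompl H v) = hnorm H"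
 by (simp_all add: hcompl_def)

lemma hilbert_hcompl:
 assumes "hilbert_space H" "v \<in> hc H"
 shows "hilbert_space (hcompl H v)"
 unfolding hcompl_def
 using pre_hilbert_space.orthogonal_closed_subspace[OF hilbert_pre[OF assms(1)], of "{v}"] assms
 by (intro hilbert_hsub) simp_all

section \<open>Projections, functionals and bounded operators\<close>

context pre_hilbert_space
begin

text \<open>Lists of coefficient-index pairs instead of finitely supported functions: concatenation
  is addition, an index may repeat, and the family may be linearly dependent.\<close>

primrec lc :: "('i \<Rightarrow> 'a) \<Rightarrow> (complex \<times> 'i) list \<Rightarrow> 'a" where
 "lc v [] = hzero H"
| "lc v (p # ps) = hadd H (hscale H (fst p) (v (snd p))) (lc v ps)"

lemma lc_closed [simp]:
 "(\<And>i. i \<in> snd ` set ps ==> v i \<in> hc H) ==> lc v ps \<in> hc H"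
 by (induction ps) auto

lemma inner_lc_right:
 assumes "\<And>i. i \<in> snd ` set ps ==> v i \<in> hc H" "y \<in> hc H"
 shows "hinner H y (lc v ps) = (\<Sum>p\<leftarrow>ps. fst p * hinner H y (v (snd p)))"
 using assms by (induction ps) auto

lemma inner_lc_left:
 assumes "\<And>i. i \<in> snd ` set ps ==> v i \<in> hc H" "y \<in> hc H"
 shows "hinner H (lc v ps) y = (\<Sum>p\<leftarrow>ps. cnj (fst p) * hinner H (v (snd p)) y)"
 using assms by (induction ps) auto

lemma lc_append:
 assumes "\<And>i. i \<in> snd ` set (ps @ qs) ==> v i \<in> hc H"
 shows "lc v (ps @ qs) = hadd H (lc v ps) (lc v qs)"
proof (rule eqI)
 have v: "v i \<in> hc H" if "i \<in> snd ` set ps \<or> i \<in> snd ` set qs" for i using assms[of i] that by auto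
 show "lc v (ps @ qs) \<in> hc H" by (rule lc_closed) (rule assms)
 show "hadd H (lc v ps) (lc v qs) \<in> hc H" by (intro add_closed lc_closed v) auto
 show "hinner H z (lc v (ps @ qs)) = hinner H z (hadd H (lc v ps) (lc v qs))" if z: "z \<in> hc H" for z
 proof -
  have "lc v ps \<in> hc H" "lc v qs \<in> hc H" by (intro lc_closed v; simp)+
  moreover have "hinner H z (lc v (ps @ qs)) = (\<Sum>p\<leftarrow>ps @ qs. fst p * hinner H z (v (snd p)))"
   by (intro inner_lc_right assms z)
  moreover have "hinner H z (lc v ps) = (\<Sum>p\<leftarrow>ps. fst p * hinner H z (v (snd p)))"
   "hinner H z (lc v qs) = (\<Sum>p\<leftarrow>qs. fst p * hinner H z (v (snd p)))"
   by (intro inner_lc_right v z; simp)+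
  ultimately show ?thesis using z by simp
 qed
qed

lemma lc_scale:
 assumes "\<And>i. i \<in> snd ` set ps ==> v i \<in> hc H"
 shows "lc v (map (\<lambda>p. (c * fst p, snd p)) ps) = hscale H c (lc v ps)"
proof (rule eqI)
 have l: "lc v ps \<in> hc H" by (rule lc_closed) (rule assms)
 have v: "v i \<in> hc H" if "i \<in> snd ` set (map (\<lambda>p. (c * fst p, snd p)) ps)" for i
  using that assms by (auto simp: image_image)
 show "lc v (map (\<lambda>p. (c * fst p, snd p)) ps) \<in> hc H" by (rule lc_closed) (rule v)
 show "hscale H c (lc v ps) \<in> hc H" using l by simp
 show "hinner H z (lc v (map (\<lambda>p. (c * fst p, snd p)) ps)) = hinner H z (hscale H c (lc v ps))"
  if z: "z \<in> hc H" for z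
 proof -
  have "hinner H z (lc v (map (\<lambda>p. (c * fst p, snd p)) ps))
    = (\<Sum>p\<leftarrow>map (\<lambda>p. (c * fst p, snd p)) ps. fst p * hinner H z (v (snd p)))"
   by (intro inner_lc_right v z)
  also have "\<dots> = c * (\<Sum>p\<leftarrow>ps. fst p * hinner H z (v (snd p)))"
   by (simp add: o_def sum_list_const_mult[symmetric] mult.assoc)
  also have "(\<Sum>p\<leftarrow>ps. fst p * hinner H z (v (snd p))) = hinner H z (lc v ps)"
   by (intro inner_lc_right[symmetric] assms z)
  finally show ?thesis using l z by simp
 qed
qed

lemma lc_in_subspace:
 assumes "closed_subspace H L" "\<And>i. i \<in> snd ` set ps ==> v i \<in> L"
 shows "lc v ps \<in> L"
 using assms(2) closed_subspaceD[OF assms(1)] by (induction ps) auto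

end

context hilbert_space
begin

sublocale pre_hilbert_space H using hilbert_space_axioms by (rule hilbert_pre)

lemma hil [simp]: "hilbert_space H" by (rule hilbert_space_axioms)

text \<open>A functional prescribed on a family of vectors extends to its closed span as soon as it is
 bounded on finite linear combinations: the representing vector minimizes \<open>\<parallel>\<xi>\<parallel>\<^sup>2 - 2 Re f(\<xi>)\<close>.\<close>

lemma family_functional_approx:
 fixes v :: "'i \<Rightarrow> 'a" and g :: "'i \<Rightarrow> complex"
 assumes v: "\<And>i. i \<in> I ==> v i \<in> hc H"
  and b: "\<And>ps. snd ` set ps \<subseteq> I ==> cmod (\<Sum>p\<leftarrow>ps. fst p * g (snd p)) \<le> B * hnorm H (lc v ps)"
 obtains z where "z \<in> closed_span H (v ` I)" "\<And>i. i \<in> I ==> hinner H z (v i) = g i"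
  "hnorm H z \<le> \<bar>B\<bar>" "\<And>e. e > 0 ==> \<exists>ps. snd ` set ps \<subseteq> I \<and> hnorm H (hdiff H z (lc v ps)) < e"
proof -
 define A where "A = {ps :: (complex \<times> 'i) list. snd ` set ps \<subseteq> I}"
 define f where "f ps = (\<Sum>p\<leftarrow>ps. fst p * g (snd p))" for ps
 define V where "V = lc v"
 define q where "q ps = (hnorm H (V ps))\<^sup>2 - 2 * Re (f ps)" for ps
 have V: "V ps \<in> hc H" if "ps \<in> A" for ps
  unfolding V_def by (rule lc_closed) (use that v in \<open>auto simp: A_def\<close>)
 have app: "ps @ qs \<in> A" "V (ps @ qs) = hadd H (V ps) (V qs)" "f (ps @ qs) = f ps + f qs" if "ps \<in> A" "qs \<in> A" for ps qs
 proof -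
  show "ps @ qs \<in> A" "f (ps @ qs) = f ps + f qs" using that by (auto simp: A_def f_def)
  show "V (ps @ qs) = hadd H (V ps) (V qs)"
   unfolding V_def by (rule lc_append, rule v) (use that in \<open>auto simp: A_def\<close>)
 qed
 have sc: "map (\<lambda>p. (c * fst p, snd p)) ps \<in> A" "V (map (\<lambda>p. (c * fst p, snd p)) ps) = hscale H c (V ps)"
  "f (map (\<lambda>p. (c * fst p, snd p)) ps) = c * f ps" if "ps \<in> A" for c ps
  unfolding V_def using that v
  by (auto simp: A_def f_def o_def sum_list_const_mult[symmetric] mult.assoc intro!: lc_scale)
 have sing: "[(c, i)] \<in> A" "V [(c, i)] = hscale H c (v i)" "f [(c, i)] = c * g i" if "i \<in> I" for c i
  using that v[OF that] by (simp_all add: A_def V_def f_def)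
 have fb: "cmod (f ps) \<le> B * hnorm H (V ps)" if "ps \<in> A" for ps using b that by (simp add: A_def f_def V_def)
 have low: "- B\<^sup>2 \<le> q ps" if "ps \<in> A" for ps
 proof -
  have "0 \<le> (hnorm H (V ps) - B)\<^sup>2" by simp
  then show ?thesis using fb[OF that] complex_Re_le_cmod[of "f ps"] by (simp add: q_def power2_diff algebra_simps)
 qed
 define m where "m = Inf (q ` A)"
 have m: "m \<le> q ps" if "ps \<in> A" for ps
  unfolding m_def by (rule cInf_lower) (use that low in \<open>auto intro!: bdd_belowI2\<close>)
 have "[] \<in> A" by (simp add: A_def)
 then have "\<exists>ps\<in>A. q ps < m + 1 / Suc n" for n :: nat
  using cInf_lessD[of "q ` A" "m + 1 / Suc n"] unfolding m_def[symmetric] by auto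
 then obtain X where X: "X n \<in> A" "q (X n) < m + 1 / Suc n" for n :: nat by metis
 note XC = V[OF X(1)]
 \<comment> \<open>The parallelogram law: the midpoint combination has \<open>q\<close> at least
   \<open>m\<close>, so two nearly minimal combinations are close to each other.\<close>
 have par: "(hnorm H (hdiff H (V (X k)) (V (X n))))\<^sup>2 \<le> 2 / Suc k + 2 / Suc n" for k n
 proof -
  note a = app[OF X(1) X(1), of k n]
  have "m \<le> q (map (\<lambda>p. (1 / 2 * fst p, snd p)) (X k @ X n))" by (rule m[OF sc(1)[OF a(1)]])
  moreover have "(hnorm H (hdiff H (V (X k)) (V (X n))))\<^sup>2 + 4 * q (map (\<lambda>p. (1 / 2 * fst p, snd p)) (X k @ X n))
    = 2 * q (X k) + 2 * q (X n)"
   unfolding q_def sc(2,3)[OF a(1)] a(2,3) using XC[of k] XC[of n]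
   by (simp add: power_divide hnorm_add_sq hnorm_diff_sq add_divide_distrib)
  moreover have "2 * (1 / real (Suc j)) = 2 / real (Suc j)" for j by simp
  ultimately show ?thesis using X(2)[of k] X(2)[of n] by linarith
 qed
 obtain z where z: "z \<in> hc H" "(\<lambda>n. hnorm H (hdiff H (V (X n)) z)) \<longlonglongrightarrow> 0"
 proof (rule hilbert_cauchy_limit[OF hil XC])
  fix e :: real assume e: "e > 0"
  obtain N :: nat where N: "4 / e\<^sup>2 < N" using reals_Archimedean2 by blast
  have "hnorm H (hdiff H (V (X k)) (V (X n))) < e" if "k \<ge> N" "n \<ge> N" for k n
  proof (rule power2_less_imp_less)
   have "2 / Suc j < e\<^sup>2 / 2" if "j \<ge> N" for j
   proof -
    have "4 / e\<^sup>2 < Suc j" using N that by linarith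
    then show ?thesis using e by (simp add: field_simps)
   qed
   from this[OF that(1)] this[OF that(2)] par[of k n]
   show "(hnorm H (hdiff H (V (X k)) (V (X n))))\<^sup>2 < e\<^sup>2" by linarith
  qed (use e in simp)
  then show "\<exists>N. \<forall>k\<ge>N. \<forall>n\<ge>N. hnorm H (hdiff H (V (X k)) (V (X n))) < e" by blast
 qed blast
 have cl: "closed_subspace H (closed_span H (v ` I))" by (rule closed_span_closed) (use v in blast)
 have "V ps \<in> closed_span H (v ` I)" if "ps \<in> A" for ps
  unfolding V_def by (rule lc_in_subspace[OF cl]) (use that closed_span_superset[of "v ` I"] in \<open>auto simp: A_def\<close>)
 then have zL: "z \<in> closed_span H (v ` I)"
  using limit_approx[OF _ closed_subspaceD(1)[OF cl] z] X(1) z(1) by (intro closed_subspaceD(5)[OF cl]) auto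
 have zi: "(\<lambda>n. hinner H y (V (X n))) \<longlonglongrightarrow> hinner H y z" if "y \<in> hc H" for y
  by (rule inner_right_limit[OF XC z(1) that z(2)])
 have rep: "hinner H z (v i) = g i" if i: "i \<in> I" for i
 proof (rule ccontr)
  assume "hinner H z (v i) \<noteq> g i"
  define d where "d = hinner H z (v i) - g i"
  define s where "s = (hnorm H (v i))\<^sup>2"
  \<comment> \<open>The minimizing sequence is perturbed along \<open>v i\<close> by the coefficient
    \<open>c\<close>. This \<open>r\<close> makes \<open>r * s < 1\<close>, so the first order gain
    \<open>2 * r * |d|^2\<close> outweighs the second order loss \<open>r * s * r * |d|^2\<close>,
    against minimality.\<close>
  define r where "r = 1 / (s + 1)"
  define c where "c = - complex_of_real r * cnj d"
  have d: "(cmod d)\<^sup>2 > 0" using \<open>_ \<noteq> g i\<close> by (simp add: d_def)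
  have s: "s \<ge> 0" "r > 0" "r * s < 1" by (simp_all add: s_def r_def add_nonneg_pos)
  have "m - 1 / Suc n - m \<le> 2 * Re (c * (cnj (hinner H (v i) (V (X n))) - g i)) + (cmod c)\<^sup>2 * s" for n
  proof -
   have e: "hinner H (V (X n)) (hscale H c (v i)) = c * cnj (hinner H (v i) (V (X n)))"
    using XC[of n] v[OF i] inner_commute[OF v[OF i] XC[of n]] by simp
   have "m \<le> q (X n @ [(c, i)])" by (rule m[OF app(1)[OF X(1) sing(1)[OF i]]])
   also have "\<dots> = q (X n) + 2 * Re (c * (cnj (hinner H (v i) (V (X n))) - g i)) + (cmod c)\<^sup>2 * s"
    unfolding q_def app(2,3)[OF X(1) sing(1)[OF i]] sing(2,3)[OF i] hnorm_add_sq[OF XC scale_closed[OF v[OF i]]] e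
    using v[OF i] by (simp add: s_def power_mult_distrib algebra_simps)
   finally show ?thesis using X(2)[of n] by linarith
  qed
  moreover have "(\<lambda>n. m - 1 / Suc n - m) \<longlonglongrightarrow> m - 0 - m"
   by (intro tendsto_intros) (use LIMSEQ_inverse_real_of_nat in \<open>simp add: inverse_eq_divide\<close>)
  moreover have "(\<lambda>n. 2 * Re (c * (cnj (hinner H (v i) (V (X n))) - g i)) + (cmod c)\<^sup>2 * s)
    \<longlonglongrightarrow> 2 * Re (c * (cnj (hinner H (v i) z) - g i)) + (cmod c)\<^sup>2 * s"
   by (intro tendsto_intros zi v i)
  ultimately have "m - 0 - m \<le> 2 * Re (c * (cnj (hinner H (v i) z) - g i)) + (cmod c)\<^sup>2 * s"
   by (intro LIMSEQ_le[rotated 1]) auto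
  moreover have "cnj (hinner H (v i) z) = hinner H z (v i)" by (rule inner_commute[OF v[OF i] z(1), symmetric])
  moreover have "Re (c * d) = - r * (cmod d)\<^sup>2"
  proof -
   have "c * d = complex_of_real (- r * (cmod d)\<^sup>2)" by (simp add: c_def complex_norm_square mult.commute del: of_real_power)
   then show ?thesis by simp
  qed
  moreover have "(cmod c)\<^sup>2 * s = (r * s) * (r * (cmod d)\<^sup>2)" using s by (simp add: c_def norm_mult power2_eq_square)
  ultimately have "2 * (r * (cmod d)\<^sup>2) \<le> (r * s) * (r * (cmod d)\<^sup>2)" by (simp add: d_def)
  moreover have "0 < r * (cmod d)\<^sup>2" using s d by simp
  moreover have "(r * s) * (r * (cmod d)\<^sup>2) < 1 * (r * (cmod d)\<^sup>2)" by (rule mult_strict_right_mono[OF s(3)]) fact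
  ultimately show False by linarith
 qed
 have "cmod (hinner H z (V ps)) \<le> \<bar>B\<bar> * hnorm H (V ps)" if ps: "ps \<in> A" for ps
 proof -
  have "hinner H z (V ps) = f ps"
   unfolding V_def f_def using ps v z(1) rep
   by (subst inner_lc_right) (auto simp: A_def intro!: arg_cong[of _ _ sum_list] map_cong)
  also have "cmod (f ps) \<le> \<bar>B\<bar> * hnorm H (V ps)"
   using fb[OF ps] mult_right_mono[OF abs_ge_self[of B], of "hnorm H (V ps)"] V[OF ps] by simp
  finally show ?thesis .
 qed
 then have "cmod (hinner H z z) \<le> \<bar>B\<bar> * hnorm H z"
  by (intro LIMSEQ_le[OF tendsto_norm[OF zi[OF z(1)]] tendsto_mult[OF tendsto_const hnorm_limit[OF XC z]]]) (use X(1) in auto)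
 then have "hnorm H z * hnorm H z \<le> \<bar>B\<bar> * hnorm H z"
  unfolding inner_self[OF z(1)] norm_of_real by (simp add: power2_eq_square)
 then have "hnorm H z \<le> \<bar>B\<bar>" using z(1) by (cases "hnorm H z = 0") (auto simp: order_less_le)
 moreover have "\<exists>ps. snd ` set ps \<subseteq> I \<and> hnorm H (hdiff H z (lc v ps)) < e" if "e > 0" for e
 proof -
  have "V ` A \<subseteq> hc H" using V by blast
  from limit_approx[of "\<lambda>n. V (X n)" "V ` A", OF _ this z that] X(1) show ?thesis by (auto simp: A_def V_def)
 qed
 ultimately show ?thesis using that[OF zL rep] by blast
qed

lemma family_functional:
 fixes v :: "'i \<Rightarrow> 'a" and g :: "'i \<Rightarrow> complex"
 assumes "\<And>i. i \<in> I ==> v i \<in> hc H"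
  and "\<And>ps. snd ` set ps \<subseteq> I ==> cmod (\<Sum>p\<leftarrow>ps. fst p * g (snd p)) \<le> B * hnorm H (lc v ps)"
 obtains z where "z \<in> closed_span H (v ` I)" "\<And>i. i \<in> I ==> hinner H z (v i) = g i"
  "hnorm H z \<le> \<bar>B\<bar>"
 using family_functional_approx[of I v g B] assms that by force

text \<open>\<open>closed_span\<close> is an intersection and by itself says nothing about
  approximation. But the vector that \<open>family_functional_approx\<close> finds for the
  functional \<open>hinner H x\<close> is approximable by construction, and it equals
  \<open>x\<close>: the difference lies in the span and is orthogonal to it.\<close>

lemma closed_span_approx:
 fixes v :: "'i \<Rightarrow> 'a"
 assumes v: "\<And>i. i \<in> I ==> v i \<in> hc H" and x: "x \<in> closed_span H (v ` I)" and e: "e > 0"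
 obtains ps where "snd ` set ps \<subseteq> I" "hnorm H (hdiff H x (lc v ps)) < e"
proof -
 have cl: "closed_subspace H (closed_span H (v ` I))" by (rule closed_span_closed) (use v in blast)
 have xc: "x \<in> hc H" using x closed_subspaceD(1)[OF cl] by blast
 obtain z where z: "z \<in> closed_span H (v ` I)" "\<And>i. i \<in> I ==> hinner H z (v i) = hinner H x (v i)"
  "\<And>e. e > 0 ==> \<exists>ps. snd ` set ps \<subseteq> I \<and> hnorm H (hdiff H z (lc v ps)) < e"
 proof (rule family_functional_approx[of I v "\<lambda>i. hinner H x (v i)" "hnorm H x"])
  fix ps :: "(complex \<times> 'i) list" assume ps: "snd ` set ps \<subseteq> I"
  then have "lc v ps \<in> hc H" "hinner H x (lc v ps) = (\<Sum>p\<leftarrow>ps. fst p * hinner H x (v (snd p)))"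
   using v xc by (auto intro!: lc_closed inner_lc_right)
  then show "cmod (\<Sum>p\<leftarrow>ps. fst p * hinner H x (v (snd p))) \<le> hnorm H x * hnorm H (lc v ps)"
   using cauchy_schwarz[OF xc] by metis
 qed (use v in blast)+
 have zc: "z \<in> hc H" using z(1) closed_subspaceD(1)[OF cl] by blast
 let ?d = "hdiff H z x"
 have d: "?d \<in> closed_span H (v ` I)" "?d \<in> hc H" using closed_subspaceD(1,6)[OF cl] z(1) x by auto
 have "closed_span H (v ` I) \<subseteq> {y \<in> hc H. \<forall>u\<in>{?d}. hinner H u y = 0}"
  by (rule closed_span_least[OF orthogonal_closed_subspace]) (use d(2) z(2) v zc xc in auto)
 then have "hinner H ?d ?d = 0" using d(1) by blast
 then have "z = x" using inner_eq_zero[OF d(2)] diff_zero_iff[OF zc xc] by simp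
 then show ?thesis using z(3)[OF e] that by blast
qed

text \<open>The case of \<open>family_functional\<close> in which the family consists of all
  vectors.\<close>

lemma riesz:
 assumes add: "\<And>x y. x \<in> hc H ==> y \<in> hc H ==> f (hadd H x y) = f x + f y"
  and scale: "\<And>c x. x \<in> hc H ==> f (hscale H c x) = c * f x"
  and bound: "\<And>x. x \<in> hc H ==> cmod (f x) \<le> B * hnorm H x"
 obtains z where "z \<in> hc H" "\<And>x. x \<in> hc H ==> f x = hinner H z x"
proof (rule family_functional[of "hc H" "\<lambda>x. x" f B])
 have f0: "f (hzero H) = 0" using scale[of "hzero H" 0] by (simp add: zero_closed)
 fix ps :: "(complex \<times> 'a) list" assume ps: "snd ` set ps \<subseteq> hc H"
 then have "(\<Sum>p\<leftarrow>ps. fst p * f (snd p)) = f (lc (\<lambda>x. x) ps)" and "lc (\<lambda>x. x) ps \<in> hc H"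
  by (induction ps) (auto simp: f0 add scale)
 then show "cmod (\<Sum>p\<leftarrow>ps. fst p * f (snd p)) \<le> B * hnorm H (lc (\<lambda>x. x) ps)" using bound by simp
next
 fix z assume "z \<in> closed_span H ((\<lambda>x. x) ` hc H)" "\<And>x. x \<in> hc H ==> hinner H z x = f x"
 then show thesis using that[of z] closed_span_least[OF closed_subspace_carrier, of "hc H"] by auto
qed

text \<open>The projection represents \<open>hinner H x\<close> on \<open>L\<close>, so it comes
  from \<open>family_functional\<close> rather than from a second minimization.\<close>

lemma projection_exists:
 assumes L: "closed_subspace H L" and x: "x \<in> hc H"
 shows "\<exists>p\<in>L. \<forall>y\<in>L. hinner H y (hdiff H x p) = 0"
proof -
 note L' = closed_subspaceD(1)[OF L]
 obtain p where p: "p \<in> closed_span H ((\<lambda>y. y) ` L)" "\<And>y. y \<in> L ==> hinner H p y = hinner H x y"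
 proof (rule family_functional[of L "\<lambda>y. y" "hinner H x" "hnorm H x"])
  fix ps :: "(complex \<times> 'a) list" assume ps: "snd ` set ps \<subseteq> L"
  then have "lc (\<lambda>y. y) ps \<in> hc H" "hinner H x (lc (\<lambda>y. y) ps) = (\<Sum>p\<leftarrow>ps. fst p * hinner H x (snd p))"
   using L' x by (auto intro!: lc_closed inner_lc_right)
  then show "cmod (\<Sum>p\<leftarrow>ps. fst p * hinner H x (snd p)) \<le> hnorm H x * hnorm H (lc (\<lambda>y. y) ps)"
   using cauchy_schwarz[OF x] by metis
 qed (use L' in blast)+
 have pL: "p \<in> L" using p(1) closed_span_least[OF L, of L] by auto
 have "hinner H y (hdiff H x p) = 0" if y: "y \<in> L" for y
  using p(2)[OF y] y pL L' x inner_commute[of p y] inner_commute[of x y] by (simp add: subset_iff)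
 then show ?thesis using pL by blast
qed

definition hproj :: "'a set \<Rightarrow> 'a \<Rightarrow> 'a" where
 "hproj L = (\<lambda>x\<in>hc H. SOME p. p \<in> L \<and> (\<forall>y\<in>L. hinner H y (hdiff H x p) = 0))"

lemma hproj_props:
 assumes "closed_subspace H L" "x \<in> hc H"
 shows "hproj L x \<in> L" "\<And>y. y \<in> L ==> hinner H y (hdiff H x (hproj L x)) = 0"
proof -
 have "hproj L x \<in> L \<and> (\<forall>y\<in>L. hinner H y (hdiff H x (hproj L x)) = 0)"
  unfolding hproj_def using projection_exists[OF assms] assms(2) by (simp add: Bex_def) (rule someI_ex)
 then show "hproj L x \<in> L" "\<And>y. y \<in> L ==> hinner H y (hdiff H x (hproj L x)) = 0" by auto
qed

lemma hproj_closed [simp]: "closed_subspace H L ==> x \<in> hc H ==> hproj L x \<in> hc H"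
 using hproj_props(1) closed_subspaceD(1) by blast

lemma inner_hproj:
 assumes "closed_subspace H L" "x \<in> hc H" "y \<in> L"
 shows "hinner H y (hproj L x) = hinner H y x"
proof -
 have "y \<in> hc H" using closed_subspaceD(1)[OF assms(1)] assms(3) by blast
 then show ?thesis using hproj_props(2)[OF assms] assms by simp
qed

lemma hproj_unique:
 assumes L: "closed_subspace H L" and x: "x \<in> hc H" and p: "p \<in> L"
  and o: "\<And>y. y \<in> L ==> hinner H y p = hinner H y x"
 shows "hproj L x = p"
proof -
 have c: "p \<in> hc H" "hproj L x \<in> hc H" using closed_subspaceD(1)[OF L] p x L by auto
 have "hdiff H (hproj L x) p \<in> L" using closed_subspaceD(6)[OF L] hproj_props(1)[OF L x] p by blast
 from o[OF this] inner_hproj[OF L x this]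
 have "hinner H (hdiff H (hproj L x) p) (hdiff H (hproj L x) p) = 0"
  using c x by fastforce
 then show ?thesis using c inner_eq_zero[of "hdiff H (hproj L x) p"] diff_zero_iff by simp
qed

lemma hproj_ident: "closed_subspace H L ==> x \<in> L ==> hproj L x = x"
 using closed_subspaceD(1) by (intro hproj_unique) auto

lemma totalI:
 assumes S: "S \<subseteq> hc H" and o: "\<And>x. x \<in> hc H ==> (\<And>s. s \<in> S ==> hinner H s x = 0) ==> x = hzero H"
 shows "closed_span H S = hc H"
proof -
 let ?L = "closed_span H S"
 have L: "closed_subspace H ?L" by (rule closed_span_closed[OF S])
 have "x \<in> ?L" if x: "x \<in> hc H" for x
 proof -
  have "hdiff H x (hproj ?L x) = hzero H"
   using closed_span_superset x L hproj_props(2)[OF L x] by (intro o) (auto simp: subset_iff)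
  then show ?thesis using hproj_props(1)[OF L x] diff_zero_iff[of x "hproj ?L x"] x L by simp
 qed
 then show ?thesis using closed_subspaceD(1)[OF L] by blast
qed

end

section \<open>Bounded operators, adjoints and isometric extension\<close>

lemma bopI:
 assumes "x \<in> hc H \<rightarrow>\<^sub>E hc G"
  "\<And>\<xi> \<eta>. \<xi> \<in> hc H ==> \<eta> \<in> hc H ==> x (hadd H \<xi> \<eta>) = hadd G (x \<xi>) (x \<eta>)"
  "\<And>c \<xi>. \<xi> \<in> hc H ==> x (hscale H c \<xi>) = hscale G c (x \<xi>)"
  "\<And>\<xi>. \<xi> \<in> hc H ==> hnorm G (x \<xi>) \<le> C * hnorm H \<xi>"
 shows "x \<in> bop H G"
 using assms unfolding bop_def by blast

lemma bopD:
 assumes "x \<in> bop H G"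
 shows "\<And>\<xi>. \<xi> \<in> hc H ==> x \<xi> \<in> hc G"
  "\<And>\<xi> \<eta>. \<xi> \<in> hc H ==> \<eta> \<in> hc H ==> x (hadd H \<xi> \<eta>) = hadd G (x \<xi>) (x \<eta>)"
  "\<And>c \<xi>. \<xi> \<in> hc H ==> x (hscale H c \<xi>) = hscale G c (x \<xi>)"
  "\<And>\<xi>. \<xi> \<notin> hc H ==> x \<xi> = undefined"
  "x \<in> extensional (hc H)"
 using assms unfolding bop_def by (auto simp: PiE_iff extensional_def)

lemma bop_bound:
 assumes "x \<in> bop H G" "pre_hilbert_space H"
 obtains C where "C > 0" "\<And>\<xi>. \<xi> \<in> hc H ==> hnorm G (x \<xi>) \<le> C * hnorm H \<xi>"
proof -
 obtain C where C: "\<And>\<xi>. \<xi> \<in> hc H ==> hnorm G (x \<xi>) \<le> C * hnorm H \<xi>"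
  using assms(1) unfolding bop_def by blast
 have "hnorm G (x \<xi>) \<le> (\<bar>C\<bar> + 1) * hnorm H \<xi>" if "\<xi> \<in> hc H" for \<xi>
  using C[OF that] mult_right_mono[of C "\<bar>C\<bar> + 1" "hnorm H \<xi>"] that assms(2) by fastforce
 then show ?thesis using that[of "\<bar>C\<bar> + 1"] by simp
qed

lemma bop_zero:
 assumes "x \<in> bop H G" "pre_hilbert_space H" "pre_hilbert_space G"
 shows "x (hzero H) = hzero G"
 using bopD(3)[OF assms(1), of "hzero H" 0] bopD(1)[OF assms(1), of "hzero H"] assms(2,3) by simp

lemma bop_diff:
 assumes "x \<in> bop H G" "pre_hilbert_space H" "\<xi> \<in> hc H" "\<eta> \<in> hc H"
 shows "x (hdiff H \<xi> \<eta>) = hdiff G (x \<xi>) (x \<eta>)"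
 using assms by (simp add: bopD(2,3))

lemma bop_eqI:
 assumes "x \<in> bop H G" "y \<in> bop H G" "\<And>\<xi>. \<xi> \<in> hc H ==> x \<xi> = y \<xi>"
 shows "x = y"
 using bopD(5)[OF assms(1)] bopD(5)[OF assms(2)] assms(3) by (rule extensionalityI)

lemma bop_compose:
 assumes x: "x \<in> bop H G" and y: "y \<in> bop G K" and h: "pre_hilbert_space H" "pre_hilbert_space G"
 shows "compose (hc H) y x \<in> bop H K"
proof -
 obtain C where C: "C > 0" "\<And>\<xi>. \<xi> \<in> hc H ==> hnorm G (x \<xi>) \<le> C * hnorm H \<xi>"
  using bop_bound[OF x h(1)] by blast
 obtain D where D: "D > 0" "\<And>\<xi>. \<xi> \<in> hc G ==> hnorm K (y \<xi>) \<le> D * hnorm G \<xi>"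
  using bop_bound[OF y h(2)] by blast
 show ?thesis
 proof (rule bopI[where C = "D * C"])
  fix \<xi> assume "\<xi> \<in> hc H"
  then show "hnorm K (compose (hc H) y x \<xi>) \<le> D * C * hnorm H \<xi>"
   using order.trans[OF D(2)[of "x \<xi>"] mult_left_mono[OF C(2), of \<xi> D]] D(1) bopD(1)[OF x, of \<xi>]
   by (simp add: compose_def mult.assoc)
 qed (use h in \<open>auto simp: compose_def bopD[OF x] bopD[OF y]\<close>)
qed

lemma scalar_op_apply [simp]: "\<xi> \<in> hc H ==> scalar_op H c \<xi> = hscale H c \<xi>"
 by (simp add: scalar_op_def)

lemma scalar_op_bop:
 assumes "pre_hilbert_space H"
 shows "scalar_op H c \<in> bops H"
 by (rule bopI[where C = "cmod c"])
  (use assms in \<open>auto simp: scalar_op_def pre_hilbert_space.scale_add_right pre_hilbert_space.scale_scale mult.commute\<close>)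

lemma bop_vimage_closed:
 assumes x: "x \<in> bop H G" and h: "pre_hilbert_space H" "pre_hilbert_space G" and L: "closed_subspace G L"
 shows "closed_subspace H {\<xi> \<in> hc H. x \<xi> \<in> L}"
proof (rule pre_hilbert_space.closed_subspaceI[OF h(1)])
 note L' = pre_hilbert_space.closed_subspaceD[OF h(2) L]
 obtain C where C: "C > 0" "\<And>\<xi>. \<xi> \<in> hc H ==> hnorm G (x \<xi>) \<le> C * hnorm H \<xi>"
  using bop_bound[OF x h(1)] by blast
 fix \<xi> assume xi: "\<xi> \<in> hc H"
  and a: "\<And>e. e > 0 ==> \<exists>\<eta>\<in>{\<xi> \<in> hc H. x \<xi> \<in> L}. hnorm H (hdiff H \<xi> \<eta>) < e"
 have "\<exists>\<eta>\<in>L. hnorm G (hdiff G (x \<xi>) \<eta>) < e" if e: "e > 0" for e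
 proof -
  obtain \<eta> where \<eta>: "\<eta> \<in> hc H" "x \<eta> \<in> L" "hnorm H (hdiff H \<xi> \<eta>) < e / C"
   using a[of "e / C"] e C by auto
  have "hnorm G (hdiff G (x \<xi>) (x \<eta>)) \<le> C * hnorm H (hdiff H \<xi> \<eta>)"
   using C(2)[of "hdiff H \<xi> \<eta>"] xi \<eta> h bop_diff[OF x h(1) xi \<eta>(1)] by simp
  also have "\<dots> < e" using \<eta>(3) C(1) by (simp add: pos_less_divide_eq mult.commute)
  finally show ?thesis using \<eta>(2) by blast
 qed
 then show "\<xi> \<in> {\<xi> \<in> hc H. x \<xi> \<in> L}" using xi bopD(1)[OF x xi] L'(5) by blast
qed (use pre_hilbert_space.closed_subspaceD[OF h(2) L] h in \<open>auto simp: bopD[OF x] bop_zero[OF x]\<close>)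

lemma adjoint_exists:
 assumes H: "hilbert_space H" and G: "hilbert_space G" and x: "x \<in> bop H G"
 obtains y where "y \<in> bop G H" "\<And>\<xi> \<eta>. \<xi> \<in> hc H ==> \<eta> \<in> hc G ==> hinner G (x \<xi>) \<eta> = hinner H \<xi> (y \<eta>)"
proof -
 interpret H: hilbert_space H by (rule H)
 interpret G: hilbert_space G by (rule G)
 note x' = bopD[OF x]
 obtain C where C: "C > 0" "\<And>\<xi>. \<xi> \<in> hc H ==> hnorm G (x \<xi>) \<le> C * hnorm H \<xi>"
  using bop_bound[OF x] by auto
 have b: "cmod (hinner G \<eta> (x \<xi>)) \<le> (C * hnorm G \<eta>) * hnorm H \<xi>"
  if "\<xi> \<in> hc H" "\<eta> \<in> hc G" for \<xi> \<eta>
  using G.cauchy_schwarz[of \<eta> "x \<xi>"] that x' mult_left_mono[OF C(2), of \<xi> "hnorm G \<eta>"]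
  by (simp add: algebra_simps)
 have "\<exists>z\<in>hc H. \<forall>\<xi>\<in>hc H. hinner G \<eta> (x \<xi>) = hinner H z \<xi>" if \<eta>: "\<eta> \<in> hc G" for \<eta>
 proof -
  obtain z where "z \<in> hc H" "\<And>\<xi>. \<xi> \<in> hc H ==> hinner G \<eta> (x \<xi>) = hinner H z \<xi>"
   by (rule H.riesz[of "\<lambda>\<xi>. hinner G \<eta> (x \<xi>)" "C * hnorm G \<eta>"]) (use b \<eta> x' in auto)
  then show ?thesis by blast
 qed
 then obtain y where y: "\<And>\<eta>. \<eta> \<in> hc G ==> y \<eta> \<in> hc H"
  "\<And>\<eta> \<xi>. \<eta> \<in> hc G ==> \<xi> \<in> hc H ==> hinner G \<eta> (x \<xi>) = hinner H (y \<eta>) \<xi>" by metis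
 have n: "hnorm H (y \<eta>) \<le> C * hnorm G \<eta>" if \<eta>: "\<eta> \<in> hc G" for \<eta>
 proof -
  have "(hnorm H (y \<eta>))\<^sup>2 = cmod (hinner H (y \<eta>) (y \<eta>))" using y(1)[OF \<eta>] by (simp add: H.inner_self del: of_real_power)
  also have "\<dots> \<le> (C * hnorm G \<eta>) * hnorm H (y \<eta>)" using b[OF y(1)[OF \<eta>] \<eta>] y(1)[OF \<eta>] y(2)[OF \<eta>] by simp
  finally show ?thesis using y(1)[OF \<eta>] C(1) \<eta>
   by (cases "hnorm H (y \<eta>) = 0") (auto simp: power2_eq_square order_less_le)
 qed
 define w where "w = restrict y (hc G)"
 have "w \<in> bop G H"
 proof (rule bopI[where C = C])
  fix \<xi> \<eta> assume "\<xi> \<in> hc G" "\<eta> \<in> hc G"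
  then show "w (hadd G \<xi> \<eta>) = hadd H (w \<xi>) (w \<eta>)"
   by (intro H.eqI') (simp_all add: w_def y x' flip: y(2))
 next
  fix c \<xi> assume "\<xi> \<in> hc G"
  then show "w (hscale G c \<xi>) = hscale H c (w \<xi>)"
   by (intro H.eqI') (simp_all add: w_def y x' flip: y(2))
 qed (auto simp: w_def y n)
 moreover have "hinner G (x \<xi>) \<eta> = hinner H \<xi> (w \<eta>)" if "\<xi> \<in> hc H" "\<eta> \<in> hc G" for \<xi> \<eta>
  using that y(1)[of \<eta>] y(2)[of \<eta> \<xi>] x' G.inner_commute[of \<eta> "x \<xi>"] H.inner_commute[of "w \<eta>" \<xi>] by (simp add: w_def)
 ultimately show ?thesis using that by blast
qed

lemma adjoint_unique:
 assumes H: "pre_hilbert_space H" and y: "y \<in> bop G H" and z: "z \<in> bop G H"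
  and e: "\<And>\<xi> \<eta>. \<xi> \<in> hc H ==> \<eta> \<in> hc G ==> hinner H \<xi> (y \<eta>) = hinner H \<xi> (z \<eta>)"
 shows "y = z"
 by (rule bop_eqI[OF y z], rule pre_hilbert_space.eqI[OF H]) (auto simp: bopD[OF y] bopD[OF z] e)

lemma hadj_eq:
 assumes H: "pre_hilbert_space H" and y: "y \<in> bop G H"
  and e: "\<And>\<xi> \<eta>. \<xi> \<in> hc H ==> \<eta> \<in> hc G ==> hinner G (x \<xi>) \<eta> = hinner H \<xi> (y \<eta>)"
 shows "hadj H G x = y"
 unfolding hadj_def
proof (rule the_equality)
 show "z = y" if "z \<in> bop G H \<and> (\<forall>\<xi>\<in>hc H. \<forall>\<eta>\<in>hc G. hinner G (x \<xi>) \<eta> = hinner H \<xi> (z \<eta>))" for z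
  using that e by (intro adjoint_unique[OF H _ y]) auto
qed (use y e in blast)

lemma hadj_props:
 assumes "hilbert_space H" "hilbert_space G" "x \<in> bop H G"
 shows "hadj H G x \<in> bop G H"
  "\<And>\<xi> \<eta>. \<xi> \<in> hc H ==> \<eta> \<in> hc G ==> hinner H \<xi> (hadj H G x \<eta>) = hinner G (x \<xi>) \<eta>"
  "\<And>\<xi> \<eta>. \<xi> \<in> hc H ==> \<eta> \<in> hc G ==> hinner H (hadj H G x \<eta>) \<xi> = hinner G \<eta> (x \<xi>)"
proof -
 obtain y where y: "y \<in> bop G H" "\<And>\<xi> \<eta>. \<xi> \<in> hc H ==> \<eta> \<in> hc G ==> hinner G (x \<xi>) \<eta> = hinner H \<xi> (y \<eta>)"
  using adjoint_exists[OF assms] by blast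
 have "hadj H G x = y" using assms y by (intro hadj_eq) auto
 then show 1: "hadj H G x \<in> bop G H"
  "\<And>\<xi> \<eta>. \<xi> \<in> hc H ==> \<eta> \<in> hc G ==> hinner H \<xi> (hadj H G x \<eta>) = hinner G (x \<xi>) \<eta>"
  using y by auto
 show "hinner H (hadj H G x \<eta>) \<xi> = hinner G \<eta> (x \<xi>)" if "\<xi> \<in> hc H" "\<eta> \<in> hc G" for \<xi> \<eta>
  using 1(2)[OF that] that bopD(1)[OF 1(1) that(2)] bopD(1)[OF assms(3) that(1)]
   pre_hilbert_space.inner_commute[OF hilbert_pre[OF assms(1)], of \<xi> "hadj H G x \<eta>"]
   pre_hilbert_space.inner_commute[OF hilbert_pre[OF assms(2)], of "x \<xi>" \<eta>] by simp
qed

lemma hadj_hadj: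
 assumes "hilbert_space H" "hilbert_space G" "x \<in> bop H G"
 shows "hadj G H (hadj H G x) = x"
 using assms hadj_props[OF assms] by (intro hadj_eq) auto

lemma hadj_compose:
 assumes "hilbert_space H" "hilbert_space G" "hilbert_space K" "x \<in> bop H G" "y \<in> bop G K"
 shows "hadj H K (compose (hc H) y x) = compose (hc K) (hadj H G x) (hadj G K y)"
proof (rule hadj_eq)
 note a = hadj_props[OF assms(1,2,4)] and b = hadj_props[OF assms(2,3,5)]
 show "compose (hc K) (hadj H G x) (hadj G K y) \<in> bop K H"
  using assms a b by (intro bop_compose[where G = G]) auto
 show "hinner K (compose (hc H) y x \<xi>) \<eta> = hinner H \<xi> (compose (hc K) (hadj H G x) (hadj G K y) \<eta>)"
  if "\<xi> \<in> hc H" "\<eta> \<in> hc K" for \<xi> \<eta>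
  using that a b by (simp add: compose_def bopD[OF b(1)] bopD[OF assms(4)])
qed (use assms in auto)

text \<open>Both adjoints, applied to one vector, have the same inner products with the total set
  and hence agree; passing to adjoints replaces an approximation argument.\<close>

lemma bop_eq_total:
 assumes H: "hilbert_space H" and G: "hilbert_space G" and x: "x \<in> bop H G" and y: "y \<in> bop H G"
  and S: "closed_span H S = hc H" "S \<subseteq> hc H" and e: "\<And>s. s \<in> S ==> x s = y s"
 shows "x = y"
proof (rule bop_eqI[OF x y], rule pre_hilbert_space.eqI[OF hilbert_pre[OF G]])
 note a = hadj_props[OF H G x] and b = hadj_props[OF H G y]
 fix \<xi> \<eta> assume xi: "\<xi> \<in> hc H" and eta: "\<eta> \<in> hc G"
 have "hadj H G x \<eta> = hadj H G y \<eta>"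
 proof (rule pre_hilbert_space.total_eqI[OF hilbert_pre[OF H] S])
  show "hinner H z (hadj H G x \<eta>) = hinner H z (hadj H G y \<eta>)" if "z \<in> S" for z
   using that S(2) eta e by (simp add: a(2) b(2) subset_iff)
 qed (use eta bopD(1)[OF a(1)] bopD(1)[OF b(1)] in auto)
 then show "hinner G \<eta> (x \<xi>) = hinner G \<eta> (y \<xi>)" using a(3)[OF xi eta] b(3)[OF xi eta] by simp
qed (use bopD(1)[OF x] bopD(1)[OF y] in auto)

text \<open>Defining \<open>U\<close> on combinations of the \<open>v i\<close> would raise the
  question of well-definedness. Instead the adjoint comes first: \<open>w \<eta>\<close> represents
  the functional that sends \<open>v i\<close> to \<open>hinner G \<eta> (u i)\<close>, which is
  bounded because equal Gram matrices give combinations equal norms. Then \<open>U\<close> is the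
  adjoint of \<open>w\<close>.\<close>

lemma isometric_extension:
 fixes v :: "'i \<Rightarrow> 'a" and u :: "'i \<Rightarrow> 'b"
 assumes H: "hilbert_space H" and G: "hilbert_space G"
  and v: "\<And>i. i \<in> I ==> v i \<in> hc H" and u: "\<And>i. i \<in> I ==> u i \<in> hc G"
  and tv: "closed_span H (v ` I) = hc H"
  and gram: "\<And>i j. i \<in> I ==> j \<in> I ==> hinner G (u i) (u j) = hinner H (v i) (v j)"
 obtains U where "U \<in> bop H G" "\<And>i. i \<in> I ==> U (v i) = u i"
  "\<And>\<xi> \<eta>. \<xi> \<in> hc H ==> \<eta> \<in> hc H ==> hinner G (U \<xi>) (U \<eta>) = hinner H \<xi> \<eta>"
proof -
 interpret H: hilbert_space H by (rule H)
 interpret G: hilbert_space G by (rule G)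
 have vI: "v ` I \<subseteq> hc H" using v by blast
 have lc_norm: "hnorm G (G.lc u ps) = hnorm H (H.lc v ps)" if "snd ` set ps \<subseteq> I" for ps
 proof -
  have uu: "\<And>i. i \<in> snd ` set ps ==> u i \<in> hc G" and vv: "\<And>i. i \<in> snd ` set ps ==> v i \<in> hc H"
   using that u v by auto
  have 1: "hinner G (u i) (G.lc u ps) = hinner H (v i) (H.lc v ps)" if "i \<in> I" for i
  proof -
   have "hinner G (u i) (G.lc u ps) = (\<Sum>p\<leftarrow>ps. fst p * hinner G (u i) (u (snd p)))"
    using uu u that by (intro G.inner_lc_right) auto
   also have "\<dots> = (\<Sum>p\<leftarrow>ps. fst p * hinner H (v i) (v (snd p)))"
    using that \<open>snd ` set ps \<subseteq> I\<close> gram by (intro arg_cong[of _ _ sum_list] map_cong) (auto simp: image_subset_iff)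
   also have "\<dots> = hinner H (v i) (H.lc v ps)"
    using vv v that by (intro H.inner_lc_right[symmetric]) auto
   finally show ?thesis .
  qed
  have "hinner G (G.lc u ps) (G.lc u ps) = (\<Sum>p\<leftarrow>ps. cnj (fst p) * hinner G (u (snd p)) (G.lc u ps))"
   using uu by (intro G.inner_lc_left) auto
  also have "\<dots> = (\<Sum>p\<leftarrow>ps. cnj (fst p) * hinner H (v (snd p)) (H.lc v ps))"
   using that 1 by (intro arg_cong[of _ _ sum_list] map_cong) (auto simp: image_subset_iff)
  also have "\<dots> = hinner H (H.lc v ps) (H.lc v ps)"
   using vv by (intro H.inner_lc_left[symmetric]) auto
  finally show ?thesis by (simp add: hnorm_def)
 qed
 have "\<exists>z\<in>hc H. (\<forall>i\<in>I. hinner H z (v i) = hinner G \<eta> (u i)) \<and> hnorm H z \<le> hnorm G \<eta>"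
  if \<eta>: "\<eta> \<in> hc G" for \<eta>
 proof -
  have "cmod (\<Sum>p\<leftarrow>ps. fst p * hinner G \<eta> (u (snd p))) \<le> hnorm G \<eta> * hnorm H (H.lc v ps)"
   if ps: "snd ` set ps \<subseteq> I" for ps
  proof -
   have uu: "\<And>i. i \<in> snd ` set ps ==> u i \<in> hc G" using ps u by auto
   then have c: "G.lc u ps \<in> hc G" by simp
   have "(\<Sum>p\<leftarrow>ps. fst p * hinner G \<eta> (u (snd p))) = hinner G \<eta> (G.lc u ps)"
    using uu \<eta> by (intro G.inner_lc_right[symmetric]) auto
   then show ?thesis using G.cauchy_schwarz[OF \<eta> c] lc_norm[OF ps] by simp
  qed
  from H.family_functional[OF v this] obtain z where
   "z \<in> closed_span H (v ` I)" "\<And>i. i \<in> I ==> hinner H z (v i) = hinner G \<eta> (u i)" "hnorm H z \<le> \<bar>hnorm G \<eta>\<bar>"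
   by blast
  then show ?thesis using tv \<eta> by auto
 qed
 then obtain y where y: "\<And>\<eta>. \<eta> \<in> hc G ==> y \<eta> \<in> hc H"
  "\<And>\<eta> i. \<eta> \<in> hc G ==> i \<in> I ==> hinner H (y \<eta>) (v i) = hinner G \<eta> (u i)"
  "\<And>\<eta>. \<eta> \<in> hc G ==> hnorm H (y \<eta>) \<le> hnorm G \<eta>" by metis
 have y2: "hinner H (v i) (y \<eta>) = hinner G (u i) \<eta>" if "\<eta> \<in> hc G" "i \<in> I" for i \<eta>
  using y(1)[OF that(1)] y(2)[OF that] that u v H.inner_commute[of "y \<eta>" "v i"] G.inner_commute[of \<eta> "u i"] by simp
 define w where "w = restrict y (hc G)"
 have w: "w \<in> bop G H"
 proof (rule bopI[where C = 1])
  fix \<xi> \<eta> assume "\<xi> \<in> hc G" "\<eta> \<in> hc G"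
  then show "w (hadd G \<xi> \<eta>) = hadd H (w \<xi>) (w \<eta>)"
   by (intro H.total_eqI[OF tv vI]) (auto simp: w_def y y2 v u)
 next
  fix c \<xi> assume "\<xi> \<in> hc G"
  then show "w (hscale G c \<xi>) = hscale H c (w \<xi>)"
   by (intro H.total_eqI[OF tv vI]) (auto simp: w_def y y2 v u)
 qed (auto simp: w_def y)
 define U where "U = hadj G H w"
 note a = hadj_props[OF G H w, folded U_def]
 have Uv: "U (v i) = u i" if i: "i \<in> I" for i
 proof (rule G.eqI)
  show "hinner G z (U (v i)) = hinner G z (u i)" if z: "z \<in> hc G" for z
   using a(2)[OF z v[OF i]] y(2)[OF z i] z by (simp add: w_def)
 qed (use i u v bopD(1)[OF a(1)] in auto)
 \<comment> \<open>\<open>w\<close> undoes \<open>U\<close> on the generators; as \<open>U\<close>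
   is the adjoint of \<open>w\<close>, this is the isometry property.\<close>
 have wU: "compose (hc H) w U = scalar_op H 1"
 proof (rule bop_eq_total[OF H H _ _ tv vI])
  show "compose (hc H) w U \<in> bops H" using a(1) w by (intro bop_compose[where G = G]) auto
  show "scalar_op H 1 \<in> bops H" by (rule scalar_op_bop) simp
  fix s assume "s \<in> v ` I"
  then obtain i where i: "i \<in> I" "s = v i" by blast
  have "w (u i) = v i"
   by (rule H.total_eqI[OF tv vI]) (use i u v y2 gram y(1) in \<open>auto simp: w_def\<close>)
  then show "compose (hc H) w U s = scalar_op H 1 s" using i v Uv by (simp add: compose_def)
 qed
 have "hinner G (U \<xi>) (U \<eta>) = hinner H \<xi> \<eta>" if "\<xi> \<in> hc H" "\<eta> \<in> hc H" for \<xi> \<eta>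
 proof -
  have "w (U \<xi>) = \<xi>" using fun_cong[OF wU, of \<xi>] that by (simp add: compose_def)
  then show ?thesis using a(2)[of "U \<xi>" \<eta>] that bopD(1)[OF a(1)] by simp
 qed
 with a(1) Uv show ?thesis using that by blast
qed

lemma unitary_opD:
 assumes "unitary_op H G U"
 shows "U \<in> bop H G" "\<And>\<xi> \<eta>. \<xi> \<in> hc H ==> \<eta> \<in> hc H ==> hinner G (U \<xi>) (U \<eta>) = hinner H \<xi> \<eta>"
  "U ` hc H = hc G" "\<And>\<xi>. \<xi> \<in> hc H ==> hnorm G (U \<xi>) = hnorm H \<xi>"
 using assms by (auto simp: unitary_op_def hnorm_def)

lemma hadj_unitary_left:
 assumes "hilbert_space H" "hilbert_space G" "unitary_op H G U" "\<xi> \<in> hc H"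
 shows "hadj H G U (U \<xi>) = \<xi>"
proof (rule pre_hilbert_space.eqI[OF hilbert_pre[OF assms(1)]])
 note U = unitary_opD[OF assms(3)]
 note a = hadj_props[OF assms(1,2) U(1)]
 show "hadj H G U (U \<xi>) \<in> hc H" using assms(4) bopD(1)[OF a(1)] bopD(1)[OF U(1)] by auto
 show "hinner H z (hadj H G U (U \<xi>)) = hinner H z \<xi>" if "z \<in> hc H" for z
  using a(2)[OF that, of "U \<xi>"] assms(4) bopD(1)[OF U(1)] U(2)[OF that] by simp
qed (use assms in auto)

lemma hadj_unitary_right:
 assumes "hilbert_space H" "hilbert_space G" "unitary_op H G U" "\<eta> \<in> hc G"
 shows "U (hadj H G U \<eta>) = \<eta>"
 using hadj_unitary_left[OF assms(1,2,3)] unitary_opD(3)[OF assms(3)] assms(4) by (metis image_iff)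

text \<open>The range of an isometry is closed, so it is everything once it contains a total family.\<close>

lemma unitary_extension:
 fixes v :: "'i \<Rightarrow> 'a" and u :: "'i \<Rightarrow> 'b"
 assumes H: "hilbert_space H" and G: "hilbert_space G"
  and v: "\<And>i. i \<in> I ==> v i \<in> hc H" and u: "\<And>i. i \<in> I ==> u i \<in> hc G"
  and tv: "closed_span H (v ` I) = hc H" and tu: "closed_span G (u ` I) = hc G"
  and gram: "\<And>i j. i \<in> I ==> j \<in> I ==> hinner G (u i) (u j) = hinner H (v i) (v j)"
 obtains U where "unitary_op H G U" "\<And>i. i \<in> I ==> U (v i) = u i"
proof -
 obtain U where U: "U \<in> bop H G" "\<And>i. i \<in> I ==> U (v i) = u i"
  "\<And>\<xi> \<eta>. \<xi> \<in> hc H ==> \<eta> \<in> hc H ==> hinner G (U \<xi>) (U \<eta>) = hinner H \<xi> \<eta>"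
  using isometric_extension[OF H G v u tv gram] by metis
 obtain W where W: "W \<in> bop G H" "\<And>i. i \<in> I ==> W (u i) = v i"
  using isometric_extension[OF G H u v tu gram[symmetric]] by metis
 have c: "compose (hc G) U W = scalar_op G 1"
 proof (rule bop_eq_total[OF G G _ _ tu])
  show "compose (hc G) U W \<in> bops G" using U(1) W(1) H G by (intro bop_compose[where G = H]) auto
  show "scalar_op G 1 \<in> bops G" using G by (intro scalar_op_bop) simp
 qed (use U W u v G in \<open>auto simp: compose_def\<close>)
 have "U (W \<eta>) = \<eta>" if "\<eta> \<in> hc G" for \<eta>
  using fun_cong[OF c, of \<eta>] that G by (simp add: compose_def)
 then have "U ` hc H = hc G" using bopD(1)[OF U(1)] bopD(1)[OF W(1)] by (metis image_eqI image_subsetI subsetI subset_antisym)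
 then show ?thesis using that U unfolding unitary_op_def by blast
qed

subsection \<open>Orthonormal bases\<close>

lemma orthonormal_basis_exists:
 assumes "hilbert_space H"
 shows "\<exists>B. orthonormal_basis H B"
proof -
 interpret hilbert_space H by (rule assms)
 define A where "A = {B. B \<subseteq> hc H \<and> (\<forall>e\<in>B. \<forall>f\<in>B. hinner H e f = (if e = f then 1 else 0))}"
 have "\<exists>U\<in>A. \<forall>X\<in>\<C>. X \<subseteq> U" if C: "subset.chain A \<C>" for \<C>
 proof (intro bexI[of _ "\<Union>\<C>"] ballI)
  show "\<Union>\<C> \<in> A" unfolding A_def
  proof (intro CollectI conjI ballI)
   show "\<Union>\<C> \<subseteq> hc H" using C by (auto simp: subset.chain_def A_def)
   fix e f assume "e \<in> \<Union>\<C>" "f \<in> \<Union>\<C>"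
   then obtain X where "X \<in> \<C>" "e \<in> X" "f \<in> X"
    using C unfolding subset.chain_def by fast
   moreover have "X \<in> A" using \<open>X \<in> \<C>\<close> C by (auto simp: subset.chain_def)
   ultimately show "hinner H e f = (if e = f then 1 else 0)" by (simp add: A_def)
  qed
 qed blast
 then obtain B where B: "B \<in> A" "\<And>X. X \<in> A ==> B \<subseteq> X ==> X = B"
  using subset_Zorn[of A] by force
 have BC: "B \<subseteq> hc H" using B(1) by (simp add: A_def)
 have "closed_span H B = hc H"
 proof (rule totalI[OF BC])
  fix x assume x: "x \<in> hc H" and o: "\<And>s. s \<in> B ==> hinner H s x = 0"
  show "x = hzero H"
  proof (rule ccontr)
   assume "x \<noteq> hzero H"
   then have n: "hnorm H x > 0" using hnorm_eq_zero[OF x] hnorm_nonneg[OF x] by linarith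
   define e where "e = hscale H (complex_of_real (1 / hnorm H x)) x"
   have e: "e \<in> hc H" using x by (simp add: e_def)
   have ee: "hinner H e e = 1" using x n by (simp add: e_def inner_self power2_eq_square)
   have o2: "hinner H s e = 0" "hinner H e s = 0" if "s \<in> B" for s
   proof -
    have s: "s \<in> hc H" using that BC by blast
    show "hinner H s e = 0" using that o x s by (simp add: e_def)
    then show "hinner H e s = 0" using inner_commute[OF s e] by simp
   qed
   have "insert e B \<in> A" using B(1) ee o2 e by (auto simp: A_def)
   from B(2)[OF this] have "e \<in> B" by blast
   with o2 ee show False by force
  qed
 qed
 then show ?thesis using B(1) unfolding orthonormal_basis_def A_def by blast
qed

lemma some_basis_orthonormal: "hilbert_space H ==> orthonormal_basis H (some_basis H)"
 unfolding some_basis_def by (rule someI_ex) (rule orthonormal_basis_exists)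

lemma some_basis_subset: "hilbert_space H ==> some_basis H \<subseteq> hc H"
 using some_basis_orthonormal[of H] by (simp add: orthonormal_basis_def)

lemma parseval:
 assumes H: "hilbert_space H" and x: "x \<in> hc H" and y: "y \<in> hc H"
 shows "((\<lambda>e. hinner H x e * hinner H e y) has_sum hinner H x y) (some_basis H)"
proof -
 interpret hilbert_space H by (rule H)
 define B where "B = some_basis H"
 have B: "B \<subseteq> hc H" "closed_span H B = hc H"
  and on: "\<And>e f. e \<in> B ==> f \<in> B ==> hinner H e f = (if e = f then 1 else 0)"
  using some_basis_orthonormal[OF H] by (auto simp: orthonormal_basis_def B_def)
 have "\<exists>F0. finite F0 \<and> F0 \<subseteq> B \<and> (\<forall>F. finite F \<and> F0 \<subseteq> F \<and> F \<subseteq> B \<longrightarrow>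
   dist (\<Sum>e\<in>F. hinner H x e * hinner H e y) (hinner H x y) < e0)" if e0: "e0 > 0" for e0
 proof -
  have "x \<in> closed_span H ((\<lambda>e. e) ` B)" using B x by simp
  \<comment> \<open>The \<open>+ 1\<close> in the denominator covers a vector \<open>y\<close> of
    norm zero.\<close>
  then obtain ps where ps: "snd ` set ps \<subseteq> B" "hnorm H (hdiff H x (lc (\<lambda>e. e) ps)) < e0 / (hnorm H y + 1)"
   by (rule closed_span_approx[of B "\<lambda>e. e" x "e0 / (hnorm H y + 1)", rotated])
    (use B e0 y in \<open>auto simp: add_nonneg_pos\<close>)
  have "dist (\<Sum>e\<in>F. hinner H x e * hinner H e y) (hinner H x y) < e0"
   if F: "finite F" "snd ` set ps \<subseteq> F" "F \<subseteq> B" for F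
  proof -
   have FC: "F \<subseteq> hc H" using F B by blast
   obtain l where l: "set l = F" "distinct l" using finite_distinct_list[OF F(1)] by blast
   \<comment> \<open>\<open>p\<close> is the orthogonal projection of \<open>x\<close> onto the span
     of the finite set \<open>F\<close>. The approximating combination lies in that span too, so
     \<open>p\<close> is at least as close to \<open>x\<close>.\<close>
   define p where "p = lc (\<lambda>e. e) (map (\<lambda>e. (hinner H e x, e)) l)"
   have lF: "\<And>i. i \<in> snd ` set (map (\<lambda>e. (hinner H e x, e)) l) ==> i \<in> hc H" using l FC by auto
   have pc: "p \<in> hc H" unfolding p_def by (rule lc_closed) (rule lF)
   have pin: "hinner H p z = (\<Sum>e\<in>F. hinner H x e * hinner H e z)" if z: "z \<in> hc H" for z
   proof -
    have "hinner H p z = (\<Sum>e\<leftarrow>l. cnj (hinner H e x) * hinner H e z)"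
     unfolding p_def using lF z by (subst inner_lc_left) (auto simp: o_def)
    also have "\<dots> = (\<Sum>e\<in>F. cnj (hinner H e x) * hinner H e z)"
     using l by (simp add: sum_list_distinct_conv_sum_set)
    also have "\<dots> = (\<Sum>e\<in>F. hinner H x e * hinner H e z)"
     using FC x by (intro sum.cong) (auto simp: inner_commute[of x] subset_iff)
    finally show ?thesis .
   qed
   have L: "closed_subspace H (closed_span H F)" by (rule closed_span_closed[OF FC])
   have "F \<subseteq> {z \<in> hc H. \<forall>u\<in>{hdiff H x p}. hinner H u z = 0}"
   proof
    fix e assume e: "e \<in> F"
    then have ec: "e \<in> hc H" using FC by blast
    have "hinner H p e = (\<Sum>f\<in>F. if f = e then hinner H x e else 0)"
     unfolding pin[OF ec] by (rule sum.cong) (use e F(3) on in \<open>auto simp: subset_iff\<close>)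
    then have "hinner H p e = hinner H x e" using F(1) e by simp
    then show "e \<in> {z \<in> hc H. \<forall>u\<in>{hdiff H x p}. hinner H u z = 0}" using ec x pc by simp
   qed
   then have orth: "hinner H (hdiff H x p) z = 0" if "z \<in> closed_span H F" for z
    using closed_span_least[OF orthogonal_closed_subspace, of "{hdiff H x p}" F] that x pc by auto
   have psF: "lc (\<lambda>e. e) ps \<in> closed_span H F" "p \<in> closed_span H F"
    unfolding p_def using F(2) closed_span_superset[of F] l by (intro lc_in_subspace[OF L]; auto simp: subset_iff)+
   define d where "d = hdiff H p (lc (\<lambda>e. e) ps)"
   have d: "d \<in> closed_span H F" unfolding d_def using closed_subspaceD(6)[OF L psF(2,1)] .
   have dc: "d \<in> hc H" "lc (\<lambda>e. e) ps \<in> hc H" using d psF closed_subspaceD(1)[OF L] by auto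
   have "hdiff H x (lc (\<lambda>e. e) ps) = hadd H (hdiff H x p) d"
    unfolding d_def by (rule eqI) (use x pc dc in simp_all)
   then have "(hnorm H (hdiff H x (lc (\<lambda>e. e) ps)))\<^sup>2 = (hnorm H (hdiff H x p))\<^sup>2 + (hnorm H d)\<^sup>2"
    using orth[OF d] x pc dc(1) by (simp only: hnorm_add_sq add_closed scale_closed) simp
   then have le: "(hnorm H (hdiff H x p))\<^sup>2 \<le> (hnorm H (hdiff H x (lc (\<lambda>e. e) ps)))\<^sup>2" by simp
   have "hnorm H (hdiff H x p) \<le> hnorm H (hdiff H x (lc (\<lambda>e. e) ps))"
    by (rule power2_le_imp_le[OF le]) (simp add: x dc)
   then have small: "hnorm H (hdiff H x p) < e0 / (hnorm H y + 1)" using ps(2) by linarith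
   have "dist (\<Sum>e\<in>F. hinner H x e * hinner H e y) (hinner H x y) = cmod (hinner H (hdiff H x p) y)"
    using x pc y pin[OF y] by (simp add: dist_norm norm_minus_commute)
   also have "\<dots> \<le> hnorm H (hdiff H x p) * hnorm H y" using x pc y by (intro cauchy_schwarz) simp_all
   also have "\<dots> \<le> hnorm H (hdiff H x p) * (hnorm H y + 1)" using x pc by (intro mult_left_mono) simp_all
   also have "\<dots> < e0" using small y by (simp add: pos_less_divide_eq add_nonneg_pos)
   finally show ?thesis .
  qed
  then show ?thesis using ps(1) by (intro exI[of _ "snd ` set ps"]) auto
 qed
 then show ?thesis unfolding has_sum_def tendsto_iff eventually_finite_subsets_at_top B_def[symmetric] by blast
qed

lemma parseval_norm:
 assumes H: "hilbert_space H" and x: "x \<in> hc H"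
 shows "((\<lambda>e. (cmod (hinner H e x))\<^sup>2) has_sum (hnorm H x)\<^sup>2) (some_basis H)"
proof -
 interpret hilbert_space H by (rule H)
 have 1: "((\<lambda>e. Re (hinner H x e * hinner H e x)) has_sum Re (hinner H x x)) (some_basis H)"
  by (rule has_sum_Re[OF parseval[OF H x x]])
 have 2: "Re (hinner H x e * hinner H e x) = (cmod (hinner H e x))\<^sup>2" if "e \<in> some_basis H" for e
 proof -
  have "hinner H x e = cnj (hinner H e x)"
   using that some_basis_subset[OF H] x by (intro inner_commute) auto
  moreover have "Re (cnj z * z) = (cmod z)\<^sup>2" for z by (simp add: cmod_def power2_eq_square)
  ultimately show ?thesis by simp
 qed
 have "((\<lambda>e. (cmod (hinner H e x))\<^sup>2) has_sum Re (hinner H x x)) (some_basis H)"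
  by (rule has_sum_cong[THEN iffD1, OF 2 1])
 then show ?thesis using x by (simp add: hnorm_sq)
qed

section \<open>Direct sums and spaces of square summable functionals\<close>

lemma square_summable_mult:
 fixes f g :: "'i \<Rightarrow> complex"
 assumes "(\<lambda>i. (cmod (f i))\<^sup>2) summable_on A" "(\<lambda>i. (cmod (g i))\<^sup>2) summable_on A"
 shows "(\<lambda>i. cmod (f i * g i)) summable_on A"
 by (rule abs_summable_product) (use assms in \<open>simp_all add: norm_mult power2_eq_square\<close>)

lemma square_summable_bound:
 fixes a :: "'i \<Rightarrow> real"
 assumes "\<And>F. finite F ==> F \<subseteq> A ==> (\<Sum>i\<in>F. (a i)\<^sup>2) \<le> c"
 shows "(\<lambda>i. (a i)\<^sup>2) summable_on A" "infsum (\<lambda>i. (a i)\<^sup>2) A \<le> c"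
proof -
 show s: "(\<lambda>i. (a i)\<^sup>2) summable_on A"
  by (rule nonneg_bdd_above_summable_on) (use assms in \<open>auto intro!: bdd_aboveI2[where M = c]\<close>)
 show "infsum (\<lambda>i. (a i)\<^sup>2) A \<le> c" by (rule infsum_le_finite_sums[OF s assms])
qed

text \<open>Fatou's lemma for square sums, read off from finite partial sums. Both completeness
  proofs below rest on it.\<close>

lemma square_summable_limit:
 fixes a :: "nat \<Rightarrow> 'i \<Rightarrow> real"
 assumes lim: "\<And>i. i \<in> A ==> (\<lambda>m. a m i) \<longlonglongrightarrow> b i"
  and bound: "\<And>m F. m \<ge> N ==> finite F ==> F \<subseteq> A ==> (\<Sum>i\<in>F. (a m i)\<^sup>2) \<le> c"
 shows "(\<lambda>i. (b i)\<^sup>2) summable_on A" "infsum (\<lambda>i. (b i)\<^sup>2) A \<le> c"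
proof -
 have "(\<Sum>i\<in>F. (b i)\<^sup>2) \<le> c" if F: "finite F" "F \<subseteq> A" for F
 proof (rule LIMSEQ_le_const2)
  show "(\<lambda>m. \<Sum>i\<in>F. (a m i)\<^sup>2) \<longlonglongrightarrow> (\<Sum>i\<in>F. (b i)\<^sup>2)"
   using F lim by (intro tendsto_sum tendsto_power) auto
  show "\<exists>M. \<forall>n\<ge>M. (\<Sum>i\<in>F. (a n i)\<^sup>2) \<le> c" using bound F by blast
 qed
 from square_summable_bound[OF this] show "(\<lambda>i. (b i)\<^sup>2) summable_on A" "infsum (\<lambda>i. (b i)\<^sup>2) A \<le> c"
  by auto
qed

lemma hsum_simps [simp]:
 "hzero (hsum I H) = (\<lambda>i\<in>I. hzero (H i))"
 "hadd (hsum I H) = (\<lambda>v w. \<lambda>i\<in>I. hadd (H i) (v i) (w i))"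
 "hscale (hsum I H) = (\<lambda>c v. \<lambda>i\<in>I. hscale (H i) c (v i))"
 "hinner (hsum I H) = (\<lambda>v w. \<Sum>\<^sub>\<infinity>i\<in>I. hinner (H i) (v i) (w i))"
 by (simp_all add: hsum_def)

lemma hsum_carrier:
 "v \<in> hc (hsum I H) \<longleftrightarrow>
  v \<in> (\<Pi>\<^sub>E i\<in>I. hc (H i)) \<and> (\<lambda>i. (hnorm (H i) (v i))\<^sup>2) summable_on I"
 by (simp add: hsum_def)

locale hilbert_family =
 fixes I :: "'i set" and H :: "'i \<Rightarrow> 'a hilb"
 assumes hilb: "\<And>i. i \<in> I ==> hilbert_space (H i)"
begin

abbreviation "HS \<equiv> hsum I H"

lemma pre_hilb: "i \<in> I ==> pre_hilbert_space (H i)"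
 using hilb by (rule hilbert_pre)

lemma hsum_comp: "v \<in> hc HS ==> i \<in> I ==> v i \<in> hc (H i)"
 by (auto simp: hsum_carrier)

lemma hsum_inner_summable:
 assumes v: "v \<in> hc HS" and w: "w \<in> hc HS"
 shows "(\<lambda>i. hinner (H i) (v i) (w i)) summable_on I"
proof (rule abs_summable_summable, rule Infinite_Sum.abs_summable_on_comparison_test)
 show "(\<lambda>i. cmod (complex_of_real (hnorm (H i) (v i)) * complex_of_real (hnorm (H i) (w i)))) summable_on I"
  using v w by (intro square_summable_mult) (simp_all add: hsum_carrier)
 show "cmod (hinner (H i) (v i) (w i)) \<le> cmod (complex_of_real (hnorm (H i) (v i)) * complex_of_real (hnorm (H i) (w i)))"
  if i: "i \<in> I" for i
  using pre_hilbert_space.cauchy_schwarz[OF pre_hilb[OF i] hsum_comp[OF v i] hsum_comp[OF w i]]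
   pre_hilbert_space.hnorm_nonneg[OF pre_hilb[OF i]] hsum_comp[OF v i] hsum_comp[OF w i]
  by (simp add: norm_mult)
qed

lemma hsum_norm_sq:
 assumes v: "v \<in> hc HS"
 shows "hinner HS v v = complex_of_real (\<Sum>\<^sub>\<infinity>i\<in>I. (hnorm (H i) (v i))\<^sup>2)"
  "(hnorm HS v)\<^sup>2 = (\<Sum>\<^sub>\<infinity>i\<in>I. (hnorm (H i) (v i))\<^sup>2)"
proof -
 have "hinner HS v v = (\<Sum>\<^sub>\<infinity>i\<in>I. complex_of_real ((hnorm (H i) (v i))\<^sup>2))"
  unfolding hsum_simps
  by (rule infsum_cong) (use v pre_hilb hsum_comp in \<open>simp add: pre_hilbert_space.inner_self\<close>)
 also have "\<dots> = complex_of_real (\<Sum>\<^sub>\<infinity>i\<in>I. (hnorm (H i) (v i))\<^sup>2)"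
  using v by (intro infsumI has_sum_of_real has_sum_infsum) (simp add: hsum_carrier)
 finally show 1: "hinner HS v v = complex_of_real (\<Sum>\<^sub>\<infinity>i\<in>I. (hnorm (H i) (v i))\<^sup>2)" .
 show "(hnorm HS v)\<^sup>2 = (\<Sum>\<^sub>\<infinity>i\<in>I. (hnorm (H i) (v i))\<^sup>2)"
  unfolding hnorm_def[of HS] 1 by (simp add: infsum_nonneg)
qed

lemma hsum_add_closed:
 assumes v: "v \<in> hc HS" and w: "w \<in> hc HS"
 shows "hadd HS v w \<in> hc HS"
proof -
 have "(\<lambda>i. (hnorm (H i) (hadd HS v w i))\<^sup>2) summable_on I"
 proof (rule summable_on_comparison_test)
  show "(\<lambda>i. 2 * (hnorm (H i) (v i))\<^sup>2 + 2 * (hnorm (H i) (w i))\<^sup>2) summable_on I"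
   using v w by (intro summable_on_add summable_on_cmult_right) (simp_all add: hsum_carrier)
  show "(hnorm (H i) (hadd HS v w i))\<^sup>2 \<le> 2 * (hnorm (H i) (v i))\<^sup>2 + 2 * (hnorm (H i) (w i))\<^sup>2"
   if i: "i \<in> I" for i
  proof -
   note c = hsum_comp[OF v i] hsum_comp[OF w i]
   have "hnorm (H i) (hadd (H i) (v i) (w i)) \<le> hnorm (H i) (v i) + hnorm (H i) (w i)"
    by (rule pre_hilbert_space.hnorm_triangle[OF pre_hilb[OF i] c])
   then have "(hnorm (H i) (hadd (H i) (v i) (w i)))\<^sup>2 \<le> (hnorm (H i) (v i) + hnorm (H i) (w i))\<^sup>2"
    using c pre_hilb[OF i] by (intro power_mono) simp_all
   also have "\<dots> \<le> 2 * (hnorm (H i) (v i))\<^sup>2 + 2 * (hnorm (H i) (w i))\<^sup>2"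
    using sum_squares_bound[of "hnorm (H i) (v i)" "hnorm (H i) (w i)"] by (simp add: power2_sum)
   finally show ?thesis using i by simp
  qed
 qed simp
 then show ?thesis using hsum_comp[OF v] hsum_comp[OF w] pre_hilb by (simp add: hsum_carrier)
qed

lemma hsum_scale_closed:
 assumes v: "v \<in> hc HS"
 shows "hscale HS c v \<in> hc HS"
proof -
 have "(\<lambda>i. (cmod c)\<^sup>2 * (hnorm (H i) (v i))\<^sup>2) summable_on I"
  using v by (intro summable_on_cmult_right) (simp add: hsum_carrier)
 also have "?this \<longleftrightarrow> (\<lambda>i. (hnorm (H i) (hscale HS c v i))\<^sup>2) summable_on I"
  by (rule summable_on_cong) (use hsum_comp[OF v] pre_hilb in \<open>simp add: power_mult_distrib\<close>)
 finally show ?thesis using hsum_comp[OF v] pre_hilb by (simp add: hsum_carrier)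
qed

lemma hsum_pre: "pre_hilbert_space HS"
proof
 note c = hsum_comp and p = pre_hilb
 show "hzero HS \<in> hc HS"
  using p by (auto simp: hsum_carrier intro!: summable_on_0)
 show "hadd HS x y \<in> hc HS"
  if "x \<in> hc HS" "y \<in> hc HS" for x y using that by (rule hsum_add_closed)
 show "hscale HS a x \<in> hc HS"
  if "x \<in> hc HS" for a x using that by (rule hsum_scale_closed)
 show "hadd HS (hadd HS x y) z = hadd HS x (hadd HS y z)"
  if "x \<in> hc HS" "y \<in> hc HS" "z \<in> hc HS" for x y z
  using that c p by (auto intro!: restrict_ext pre_hilbert_space.add_assoc)
 show "hadd HS x y = hadd HS y x"
  if "x \<in> hc HS" "y \<in> hc HS" for x y
  using that c p by (auto intro!: restrict_ext pre_hilbert_space.add_commute)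
 have ext: "restrict x I = x" if "x \<in> hc HS" for x
  using that by (simp add: hsum_carrier PiE_iff extensional_restrict)
 show "hadd HS x (hzero HS) = x" if "x \<in> hc HS" for x
  using that c p by (subst (2) ext[OF that, symmetric]) (auto intro!: restrict_ext)
 show "hscale HS 1 x = x" if "x \<in> hc HS" for x
  using that c p by (subst (2) ext[OF that, symmetric]) (auto intro!: restrict_ext)
 show "hscale HS 0 x = hzero HS" if "x \<in> hc HS" for x
  using that c p by (auto intro!: restrict_ext)
 show "hscale HS a (hscale HS b x) = hscale HS (a * b) x"
  if "x \<in> hc HS" for a b x
  using that c p by (auto intro!: restrict_ext pre_hilbert_space.scale_scale)
 show "hscale HS (a + b) x = hadd HS (hscale HS a x) (hscale HS b x)"
  if "x \<in> hc HS" for a b x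
  using that c p by (auto intro!: restrict_ext pre_hilbert_space.scale_add_left)
 show "hscale HS a (hadd HS x y) = hadd HS (hscale HS a x) (hscale HS a y)"
  if "x \<in> hc HS" "y \<in> hc HS" for a x y
  using that c p by (auto intro!: restrict_ext pre_hilbert_space.scale_add_right)
 show "hinner HS y x = cnj (hinner HS x y)"
  if "x \<in> hc HS" "y \<in> hc HS" for x y
 proof -
  have "(\<Sum>\<^sub>\<infinity>i\<in>I. hinner (H i) (y i) (x i)) = (\<Sum>\<^sub>\<infinity>i\<in>I. cnj (hinner (H i) (x i) (y i)))"
   by (rule infsum_cong) (use that c p in \<open>blast intro: pre_hilbert_space.inner_commute\<close>)
  then show ?thesis by (simp add: infsum_cnj)
 qed
 show "hinner HS x (hadd HS y z) = hinner HS x y + hinner HS x z"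
  if "x \<in> hc HS" "y \<in> hc HS" "z \<in> hc HS" for x y z
 proof -
  have "(\<Sum>\<^sub>\<infinity>i\<in>I. hinner (H i) (x i) (hadd HS y z i))
    = (\<Sum>\<^sub>\<infinity>i\<in>I. hinner (H i) (x i) (y i) + hinner (H i) (x i) (z i))"
   by (rule infsum_cong) (use that c p in simp)
  also have "\<dots> = (\<Sum>\<^sub>\<infinity>i\<in>I. hinner (H i) (x i) (y i)) + (\<Sum>\<^sub>\<infinity>i\<in>I. hinner (H i) (x i) (z i))"
   using that by (intro infsum_add hsum_inner_summable)
  finally show ?thesis by simp
 qed
 show "hinner HS x (hscale HS a y) = a * hinner HS x y"
  if "x \<in> hc HS" "y \<in> hc HS" for a x y
 proof -
  have "(\<Sum>\<^sub>\<infinity>i\<in>I. hinner (H i) (x i) (hscale HS a y i)) = (\<Sum>\<^sub>\<infinity>i\<in>I. a * hinner (H i) (x i) (y i))"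
   by (rule infsum_cong) (use that c p in simp)
  then show ?thesis by (simp add: infsum_cmult_right')
 qed
 show "0 \<le> Re (hinner HS x x)" if "x \<in> hc HS" for x
  unfolding hsum_norm_sq(1)[OF that] by (simp add: infsum_nonneg)
 show "x = hzero HS" if "x \<in> hc HS" "hinner HS x x = 0" for x
 proof -
  have 0: "(\<Sum>\<^sub>\<infinity>i\<in>I. (hnorm (H i) (x i))\<^sup>2) = 0"
   using that(2) unfolding hsum_norm_sq(1)[OF that(1)] of_real_eq_0_iff .
  have "(hnorm (H i) (x i))\<^sup>2 = 0" if i: "i \<in> I" for i
   using nonneg_infsum_le_0D[OF eq_refl[OF 0] _ _ i] \<open>x \<in> hc HS\<close> by (simp add: hsum_carrier)
  then have "x i = hzero (H i)" if i: "i \<in> I" for i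
   using pre_hilbert_space.hnorm_eq_zero[OF p[OF i] c[OF \<open>x \<in> hc HS\<close> i]] i by simp
  then show ?thesis by (subst ext[OF that(1), symmetric]) (auto intro!: restrict_ext)
 qed
qed

lemma hsum_norm_comp:
 assumes v: "v \<in> hc HS" and F: "finite F" "F \<subseteq> I"
 shows "(\<Sum>i\<in>F. (hnorm (H i) (v i))\<^sup>2) \<le> (hnorm HS v)\<^sup>2"
 unfolding hsum_norm_sq(2)[OF v] using v F by (intro finite_sum_le_infsum) (auto simp: hsum_carrier)

text \<open>The components of a Cauchy sequence converge. Letting one index run to infinity in the
  square sums of \<open>X n - X m\<close> bounds the distance to the componentwise limit, and this
  bound (\<open>key\<close>) yields membership as well as convergence.\<close>

lemma hilbert_hsum: "hilbert_space HS"
proof (rule hilbert_spaceI[OF hsum_pre])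
 fix X :: "nat \<Rightarrow> 'i \<Rightarrow> 'a" assume X: "\<And>n. X n \<in> hc HS"
  and C: "\<And>e. 0 < e ==> \<exists>N. \<forall>m\<ge>N. \<forall>n\<ge>N. hnorm HS (hdiff HS (X m) (X n)) < e"
 have d: "hdiff HS (X m) (X n) \<in> hc HS" for m n
  using X hsum_pre by (intro hsum_add_closed hsum_scale_closed)
 have di: "hdiff HS (X m) (X n) i = hdiff (H i) (X m i) (X n i)" if "i \<in> I" for m n i
  using that by simp
 have part: "(\<Sum>i\<in>F. (hnorm (H i) (hdiff (H i) (X m i) (X n i)))\<^sup>2) \<le> (hnorm HS (hdiff HS (X m) (X n)))\<^sup>2"
  if "finite F" "F \<subseteq> I" for F m n
 proof -
  have "(\<Sum>i\<in>F. (hnorm (H i) (hdiff (H i) (X m i) (X n i)))\<^sup>2)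
    = (\<Sum>i\<in>F. (hnorm (H i) (hdiff HS (X m) (X n) i))\<^sup>2)"
   using that by (intro sum.cong) auto
  then show ?thesis using hsum_norm_comp[OF d that] by simp
 qed
 have nn: "hnorm HS (hdiff HS (X m) (X n)) \<ge> 0" for m n
  using d hsum_pre by (rule pre_hilbert_space.hnorm_nonneg[rotated])
 have "\<exists>l\<in>hc (H i). (\<lambda>n. hnorm (H i) (hdiff (H i) (X n i) l)) \<longlonglongrightarrow> 0" if i: "i \<in> I" for i
 proof -
  have "hnorm (H i) (hdiff (H i) (X m i) (X n i)) \<le> hnorm HS (hdiff HS (X m) (X n))" for m n
   by (rule power2_le_imp_le[OF _ nn]) (use part[of "{i}" m n] i in simp)
  then have "\<exists>N. \<forall>m\<ge>N. \<forall>n\<ge>N. hnorm (H i) (hdiff (H i) (X m i) (X n i)) < e" if "e > 0" for e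
   using C[OF that] order.strict_trans1 by blast
  from hilbert_cauchy_limit[OF hilb[OF i] hsum_comp[OF X i] this] show ?thesis by blast
 qed
 then obtain l0 where l0: "\<And>i. i \<in> I ==> l0 i \<in> hc (H i)"
  "\<And>i. i \<in> I ==> (\<lambda>n. hnorm (H i) (hdiff (H i) (X n i) (l0 i))) \<longlonglongrightarrow> 0" by metis
 define l where "l = restrict l0 I"
 have key: "(\<lambda>i. (hnorm (H i) (hdiff (H i) (X n i) (l0 i)))\<^sup>2) summable_on I
   \<and> infsum (\<lambda>i. (hnorm (H i) (hdiff (H i) (X n i) (l0 i)))\<^sup>2) I \<le> e\<^sup>2"
  if N: "\<And>m n. m \<ge> N ==> n \<ge> N ==> hnorm HS (hdiff HS (X m) (X n)) < e" and n: "n \<ge> N" for N n e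
 proof -
  have lim: "(\<lambda>m. hnorm (H i) (hdiff (H i) (X n i) (X m i))) \<longlonglongrightarrow> hnorm (H i) (hdiff (H i) (X n i) (l0 i))"
   if i: "i \<in> I" for i
  proof (rule pre_hilbert_space.hnorm_limit[OF pre_hilb[OF i]])
   note c = hsum_comp[OF X i] l0(1)[OF i] pre_hilb[OF i]
   have "hdiff (H i) (hdiff (H i) (X n i) (X m i)) (hdiff (H i) (X n i) (l0 i)) = hdiff (H i) (l0 i) (X m i)" for m
    using c by (intro pre_hilbert_space.eqI[OF c(3)]) simp_all
   then show "(\<lambda>m. hnorm (H i) (hdiff (H i) (hdiff (H i) (X n i) (X m i)) (hdiff (H i) (X n i) (l0 i)))) \<longlonglongrightarrow> 0"
    using l0(2)[OF i] pre_hilbert_space.hnorm_diff_commute[OF c(3) c(2) c(1)] by simp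
  qed (use hsum_comp[OF X i] l0(1)[OF i] pre_hilb[OF i] in auto)
  have bd: "(\<Sum>i\<in>F. (hnorm (H i) (hdiff (H i) (X n i) (X m i)))\<^sup>2) \<le> e\<^sup>2" if "m \<ge> N" "finite F" "F \<subseteq> I" for m F
   using part[OF that(2,3), of n m] power_mono[OF less_imp_le[OF N[OF n that(1)]] nn, of 2] by linarith
  show ?thesis
   using square_summable_limit[where a = "\<lambda>m i. hnorm (H i) (hdiff (H i) (X n i) (X m i))" and A = I and N = N and c = "e\<^sup>2", OF lim bd]
   by blast
 qed
 obtain N where N: "\<And>m n. m \<ge> N ==> n \<ge> N ==> hnorm HS (hdiff HS (X m) (X n)) < 1"
  using C[of 1] by auto
 have dl: "restrict (\<lambda>i. hdiff (H i) (X n i) (l0 i)) I \<in> hc HS"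
  if "(\<lambda>i. (hnorm (H i) (hdiff (H i) (X n i) (l0 i)))\<^sup>2) summable_on I" for n
  using that hsum_comp[OF X] l0(1) pre_hilb by (auto simp: hsum_carrier cong: summable_on_cong)
 have lC: "l \<in> hc HS"
 proof -
  \<comment> \<open>The limit lies in the sum because it is the difference of \<open>X N\<close> and
    \<open>X N - l\<close>, both square summable.\<close>
  have "hdiff HS (X N) (restrict (\<lambda>i. hdiff (H i) (X N i) (l0 i)) I) \<in> hc HS"
   using X dl key[of N 1 N] N by (intro hsum_add_closed hsum_scale_closed) auto
  also have "hdiff HS (X N) (restrict (\<lambda>i. hdiff (H i) (X N i) (l0 i)) I) = l"
   unfolding l_def hsum_simps
  proof (rule restrict_ext)
   fix i assume i: "i \<in> I"
   note c = hsum_comp[OF X i] l0(1)[OF i] pre_hilb[OF i]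
   show "hadd (H i) (X N i) ((\<lambda>i\<in>I. hscale (H i) (- 1) ((\<lambda>i\<in>I. hdiff (H i) (X N i) (l0 i)) i)) i) = l0 i"
    using c i by (intro pre_hilbert_space.eqI[OF c(3)]) simp_all
  qed
  finally show ?thesis .
 qed
 have "(\<lambda>n. hnorm HS (hdiff HS (X n) l)) \<longlonglongrightarrow> 0"
 proof (rule LIMSEQ_I)
  fix r :: real assume r: "r > 0"
  obtain N where N: "\<And>m n. m \<ge> N ==> n \<ge> N ==> hnorm HS (hdiff HS (X m) (X n)) < r / 2"
   using C[of "r / 2"] r by auto
  have "hnorm HS (hdiff HS (X n) l) < r" if "n \<ge> N" for n
  proof -
   have dc: "hdiff HS (X n) l \<in> hc HS"
    using X lC by (intro hsum_add_closed hsum_scale_closed)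
   have "(hnorm HS (hdiff HS (X n) l))\<^sup>2 = infsum (\<lambda>i. (hnorm (H i) (hdiff (H i) (X n i) (l0 i)))\<^sup>2) I"
    unfolding hsum_norm_sq(2)[OF dc] by (rule infsum_cong) (simp add: l_def)
   also have "\<dots> \<le> (r / 2)\<^sup>2" using key[OF N that] by simp
   finally have "hnorm HS (hdiff HS (X n) l) \<le> r / 2"
    by (rule power2_le_imp_le) (use r in simp)
   then show ?thesis using r by simp
  qed
  moreover have "hnorm HS (hdiff HS (X n) l) \<ge> 0" for n
   using X lC hsum_pre by (intro pre_hilbert_space.hnorm_nonneg hsum_add_closed hsum_scale_closed)
  ultimately show "\<exists>no. \<forall>n\<ge>no. norm (hnorm HS (hdiff HS (X n) l) - 0) < r" by auto
 qed
 with lC show "\<exists>l\<in>hc HS. (\<lambda>n. hnorm HS (hdiff HS (X n) l)) \<longlonglongrightarrow> 0" by blast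
qed

lemma hsum_inj_closed:
 assumes i: "i \<in> I" and x: "x \<in> hc (H i)"
 shows "hsum_inj I H i x \<in> hc HS"
proof -
 have "(\<lambda>j. (hnorm (H j) (hsum_inj I H i x j))\<^sup>2) summable_on I \<longleftrightarrow>
   (\<lambda>j. (hnorm (H j) (hsum_inj I H i x j))\<^sup>2) summable_on {i}"
  by (rule summable_on_cong_neutral) (use i pre_hilb in \<open>auto simp: hsum_inj_def\<close>)
 then show ?thesis using assms pre_hilb by (auto simp: hsum_carrier hsum_inj_def)
qed

lemma inner_hsum_inj:
 assumes i: "i \<in> I" and x: "x \<in> hc (H i)" and v: "v \<in> hc HS"
 shows "hinner HS (hsum_inj I H i x) v = hinner (H i) x (v i)"
proof -
 have "(\<Sum>\<^sub>\<infinity>j\<in>I. hinner (H j) (hsum_inj I H i x j) (v j)) = (\<Sum>\<^sub>\<infinity>j\<in>{i}. hinner (H j) (hsum_inj I H i x j) (v j))"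
  by (rule infsum_cong_neutral) (use i pre_hilb hsum_comp[OF v] in \<open>auto simp: hsum_inj_def\<close>)
 then show ?thesis using i by (simp add: hsum_inj_def)
qed

lemma inner_hsum_inj_inj:
 assumes "i \<in> I" "x \<in> hc (H i)" "j \<in> I" "y \<in> hc (H j)"
 shows "hinner HS (hsum_inj I H i x) (hsum_inj I H j y) = (if i = j then hinner (H i) x y else 0)"
 unfolding inner_hsum_inj[OF assms(1,2) hsum_inj_closed[OF assms(3,4)]]
 using assms pre_hilb[OF assms(1)] by (simp add: hsum_inj_def)

lemma hsum_inj_total:
 assumes S: "\<And>i. i \<in> I ==> S i \<subseteq> hc (H i)" "\<And>i. i \<in> I ==> closed_span (H i) (S i) = hc (H i)"
 shows "closed_span HS (\<Union>i\<in>I. hsum_inj I H i ` S i) = hc HS"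
proof (rule hilbert_space.totalI[OF hilbert_hsum])
 show "(\<Union>i\<in>I. hsum_inj I H i ` S i) \<subseteq> hc HS" using S hsum_inj_closed by blast
 fix x assume x: "x \<in> hc HS"
  and o: "\<And>s. s \<in> (\<Union>i\<in>I. hsum_inj I H i ` S i) ==> hinner HS s x = 0"
 have "x i = hzero (H i)" if i: "i \<in> I" for i
 proof (rule pre_hilbert_space.total_eqI[OF pre_hilb[OF i] S(2,1)[OF i]])
  show "hinner (H i) z (x i) = hinner (H i) z (hzero (H i))" if z: "z \<in> S i" for z
  proof -
   have zc: "z \<in> hc (H i)" using S(1)[OF i] z by blast
   have "hinner HS (hsum_inj I H i z) x = 0" by (rule o) (use i z in blast)
   then show ?thesis using zc pre_hilb[OF i] unfolding inner_hsum_inj[OF i zc x] by simp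
  qed
 qed (use hsum_comp[OF x i] pre_hilb[OF i] in auto)
 then show "x = hzero HS"
  using x by (intro extensionalityI[of _ I]) (auto simp: hsum_carrier PiE_iff)
qed

end

declare hsum_simps [simp del]

section \<open>Square summable functionals with a reproducing kernel\<close>

lemma functional_space_simps [simp]:
 "hzero (functional_space X B F) = (\<lambda>x. 0)"
 "hadd (functional_space X B F) = (\<lambda>\<phi> \<psi> x. \<phi> x + \<psi> x)"
 "hscale (functional_space X B F) = (\<lambda>c \<phi> x. c * \<phi> x)"
 "hinner (functional_space X B F) = (\<lambda>\<phi> \<psi>. \<Sum>\<^sub>\<infinity>e\<in>B. cnj (\<phi> e) * \<psi> e)"
 by (simp_all add: functional_space_def)

lemma functional_space_carrier:
 "\<phi> \<in> hc (functional_space X B F) \<longleftrightarrow>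
  \<phi> \<in> F \<and> (\<forall>x. x \<notin> X \<longrightarrow> \<phi> x = 0) \<and> (\<lambda>e. (cmod (\<phi> e))\<^sup>2) summable_on B"
 by (simp add: functional_space_def)

text \<open>A functional space with a reproducing kernel: \<open>tv x\<close> represents evaluation at \<open>x\<close>. Point
 evaluations are then continuous, which gives completeness, and the kernel vectors are total.\<close>

locale reproducing_kernel =
 fixes X :: "'x set" and B :: "'x set" and F :: "('x \<Rightarrow> complex) set" and tv :: "'x \<Rightarrow> 'x \<Rightarrow> complex"
 assumes B_sub: "B \<subseteq> X"
  and F_zero: "(\<lambda>x. 0) \<in> F"
  and F_add: "\<And>\<phi> \<psi>. \<phi> \<in> F ==> \<psi> \<in> F ==> (\<lambda>x. \<phi> x + \<psi> x) \<in> F"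
  and F_scale: "\<And>c \<phi>. \<phi> \<in> F ==> (\<lambda>x. c * \<phi> x) \<in> F"
  and tv: "\<And>x. x \<in> X ==> tv x \<in> hc (functional_space X B F)"
  and reproducing: "\<And>\<phi> x. \<phi> \<in> hc (functional_space X B F) ==> x \<in> X ==>
   ((\<lambda>e. cnj (tv x e) * \<phi> e) has_sum \<phi> x) B"
  and F_limit: "\<And>(\<Phi> :: nat \<Rightarrow> 'x \<Rightarrow> complex) \<phi> C. (\<And>n. \<Phi> n \<in> hc (functional_space X B F)) ==>
   (\<And>x. (\<lambda>n. \<Phi> n x) \<longlonglongrightarrow> \<phi> x) ==>
   (\<And>x n. x \<in> X ==> cmod (\<Phi> n x) \<le> C * sqrt (Re (tv x x))) ==> \<phi> \<in> F"
begin

abbreviation "S \<equiv> functional_space X B F"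

lemma inner_summable:
 assumes "\<phi> \<in> hc S" "\<psi> \<in> hc S"
 shows "(\<lambda>e. cnj (\<phi> e) * \<psi> e) summable_on B"
 by (rule abs_summable_summable, rule square_summable_mult)
  (use assms in \<open>simp_all add: functional_space_carrier\<close>)

lemma norm_sq:
 assumes "\<phi> \<in> hc S"
 shows "hinner S \<phi> \<phi> = complex_of_real (\<Sum>\<^sub>\<infinity>e\<in>B. (cmod (\<phi> e))\<^sup>2)"
  "(hnorm S \<phi>)\<^sup>2 = (\<Sum>\<^sub>\<infinity>e\<in>B. (cmod (\<phi> e))\<^sup>2)"
proof -
 have "hinner S \<phi> \<phi> = (\<Sum>\<^sub>\<infinity>e\<in>B. complex_of_real ((cmod (\<phi> e))\<^sup>2))"
  unfolding functional_space_simps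
  by (rule infsum_cong) (simp add: complex_norm_square mult.commute del: of_real_power)
 also have "\<dots> = complex_of_real (\<Sum>\<^sub>\<infinity>e\<in>B. (cmod (\<phi> e))\<^sup>2)"
  using assms by (intro infsumI has_sum_of_real has_sum_infsum) (simp add: functional_space_carrier)
 finally show 1: "hinner S \<phi> \<phi> = complex_of_real (\<Sum>\<^sub>\<infinity>e\<in>B. (cmod (\<phi> e))\<^sup>2)" .
 show "(hnorm S \<phi>)\<^sup>2 = (\<Sum>\<^sub>\<infinity>e\<in>B. (cmod (\<phi> e))\<^sup>2)"
  unfolding hnorm_def[of S] 1 by (simp add: infsum_nonneg)
qed

lemma add_closed':
 assumes "\<phi> \<in> hc S" "\<psi> \<in> hc S"
 shows "(\<lambda>x. \<phi> x + \<psi> x) \<in> hc S"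
proof -
 have "(\<lambda>e. (cmod (\<phi> e + \<psi> e))\<^sup>2) summable_on B"
 proof (rule summable_on_comparison_test)
  show "(\<lambda>e. 2 * (cmod (\<phi> e))\<^sup>2 + 2 * (cmod (\<psi> e))\<^sup>2) summable_on B"
   using assms by (intro summable_on_add summable_on_cmult_right) (simp_all add: functional_space_carrier)
  show "(cmod (\<phi> e + \<psi> e))\<^sup>2 \<le> 2 * (cmod (\<phi> e))\<^sup>2 + 2 * (cmod (\<psi> e))\<^sup>2" for e
  proof -
   have "(cmod (\<phi> e + \<psi> e))\<^sup>2 \<le> (cmod (\<phi> e) + cmod (\<psi> e))\<^sup>2"
    by (intro power_mono norm_triangle_ineq) simp
   also have "\<dots> \<le> 2 * (cmod (\<phi> e))\<^sup>2 + 2 * (cmod (\<psi> e))\<^sup>2"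
    using sum_squares_bound[of "cmod (\<phi> e)" "cmod (\<psi> e)"] by (simp add: power2_sum)
   finally show ?thesis .
  qed
 qed simp
 then show ?thesis using assms by (simp add: functional_space_carrier F_add)
qed

lemma scale_closed':
 assumes "\<phi> \<in> hc S"
 shows "(\<lambda>x. c * \<phi> x) \<in> hc S"
proof -
 have "(\<lambda>e. (cmod c)\<^sup>2 * (cmod (\<phi> e))\<^sup>2) summable_on B"
  using assms by (intro summable_on_cmult_right) (simp add: functional_space_carrier)
 then show ?thesis using assms by (simp add: functional_space_carrier F_scale norm_mult power_mult_distrib)
qed

lemma pre_S: "pre_hilbert_space S"
proof
 show "hzero S \<in> hc S" by (simp add: functional_space_carrier F_zero)
 show "hadd S x y \<in> hc S" if "x \<in> hc S" "y \<in> hc S" for x y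
  using add_closed'[OF that] by simp
 show "hscale S c x \<in> hc S" if "x \<in> hc S" for c x
  using scale_closed'[OF that] by simp
 show "hinner S y x = cnj (hinner S x y)" for x y
  by (simp add: infsum_cnj[symmetric] mult.commute)
 show "hinner S x (hadd S y z) = hinner S x y + hinner S x z"
  if "x \<in> hc S" "y \<in> hc S" "z \<in> hc S" for x y z
  using infsum_add[OF inner_summable[OF that(1,2)] inner_summable[OF that(1,3)]]
  by (simp add: algebra_simps)
 show "hinner S x (hscale S c y) = c * hinner S x y" for c x y
  by (simp add: infsum_cmult_right'[symmetric] algebra_simps)
 show "0 \<le> Re (hinner S x x)" if "x \<in> hc S" for x
  unfolding norm_sq(1)[OF that] by (simp add: infsum_nonneg)
 show "x = hzero S" if x: "x \<in> hc S" and 0: "hinner S x x = 0" for x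
 proof -
  have i0: "(\<Sum>\<^sub>\<infinity>e\<in>B. (cmod (x e))\<^sup>2) = 0" using 0 unfolding norm_sq(1)[OF x] of_real_eq_0_iff .
  have e0: "x e = 0" if e: "e \<in> B" for e
   using nonneg_infsum_le_0D[OF eq_refl[OF i0] _ _ e] x by (simp add: functional_space_carrier)
  have "x y = 0" for y
  proof (cases "y \<in> X")
   case True
   have "((\<lambda>e. cnj (tv y e) * x e) has_sum 0) B" by (rule has_sum_0) (simp add: e0)
   with reproducing[OF x True] show ?thesis by (rule has_sum_unique)
  qed (use x in \<open>simp add: functional_space_carrier\<close>)
  then show ?thesis by auto
 qed
qed (auto simp: algebra_simps)

lemma inner_tv:
 assumes "x \<in> X" "\<phi> \<in> hc S"
 shows "hinner S (tv x) \<phi> = \<phi> x"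
 using infsumI[OF reproducing[OF assms(2,1)]] by simp

lemma norm_tv: "x \<in> X ==> hnorm S (tv x) = sqrt (Re (tv x x))"
 unfolding hnorm_def by (subst inner_tv) (auto intro: tv)

lemma eval_bound:
 assumes "x \<in> X" "\<phi> \<in> hc S"
 shows "cmod (\<phi> x) \<le> hnorm S \<phi> * sqrt (Re (tv x x))"
 using pre_hilbert_space.cauchy_schwarz[OF pre_S tv[OF assms(1)] assms(2)] inner_tv[OF assms] norm_tv[OF assms(1)]
 by (simp add: mult.commute del: functional_space_simps)

text \<open>The argument of \<open>hilbert_hsum\<close> with point evaluations as components:
  \<open>eval_bound\<close> makes them converge, and \<open>F_limit\<close> keeps the limit in the
  class of functionals.\<close>

lemma hilbert_S: "hilbert_space S"
proof (rule hilbert_spaceI[OF pre_S])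
 fix \<Phi> :: "nat \<Rightarrow> 'x \<Rightarrow> complex" assume P: "\<And>n. \<Phi> n \<in> hc S"
  and C: "\<And>e. 0 < e ==> \<exists>N. \<forall>m\<ge>N. \<forall>n\<ge>N. hnorm S (hdiff S (\<Phi> m) (\<Phi> n)) < e"
 interpret S: pre_hilbert_space S by (rule pre_S)
 have d: "hdiff S (\<Phi> m) (\<Phi> n) \<in> hc S" for m n
  using P pre_S by (intro S.add_closed S.scale_closed)
 have dx: "hdiff S (\<Phi> m) (\<Phi> n) x = \<Phi> m x - \<Phi> n x" for m n x by simp
 have "\<exists>a. (\<lambda>n. \<Phi> n x) \<longlonglongrightarrow> a" for x
 proof (cases "x \<in> X")
  case True
  define k where "k = sqrt (Re (tv x x)) + 1"
  have t0: "sqrt (Re (tv x x)) \<ge> 0"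
   using norm_tv[OF True] S.hnorm_nonneg[OF tv[OF True]] by simp
  have k: "k > 0" unfolding k_def using t0 by linarith
  have "Cauchy (\<lambda>n. \<Phi> n x)"
  proof (rule CauchyI)
   fix e :: real assume e: "e > 0"
   obtain N where N: "\<And>m n. m \<ge> N ==> n \<ge> N ==> hnorm S (hdiff S (\<Phi> m) (\<Phi> n)) < e / k"
    using C[of "e / k"] e k by auto
   have "cmod (\<Phi> m x - \<Phi> n x) < e" if "m \<ge> N" "n \<ge> N" for m n
   proof -
    have "cmod (\<Phi> m x - \<Phi> n x) \<le> hnorm S (hdiff S (\<Phi> m) (\<Phi> n)) * sqrt (Re (tv x x))"
     using eval_bound[OF True d, of m n] unfolding dx .
    also have "\<dots> \<le> hnorm S (hdiff S (\<Phi> m) (\<Phi> n)) * k"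
     using S.hnorm_nonneg[OF d] by (intro mult_left_mono) (simp_all add: k_def del: functional_space_simps)
    also have "\<dots> < e" using N[OF that] k by (simp add: pos_less_divide_eq del: functional_space_simps)
    finally show ?thesis .
   qed
   then show "\<exists>M. \<forall>m\<ge>M. \<forall>n\<ge>M. norm (\<Phi> m x - \<Phi> n x) < e" by blast
  qed
  then show ?thesis using Cauchy_convergent_iff convergent_def by blast
 next
  case False
  then have "\<Phi> n x = 0" for n using P[of n] by (simp add: functional_space_carrier)
  then show ?thesis by auto
 qed
 then obtain \<phi> where \<phi>: "\<And>x. (\<lambda>n. \<Phi> n x) \<longlonglongrightarrow> \<phi> x" by metis
 have key: "(\<lambda>e. (cmod (\<Phi> n e - \<phi> e))\<^sup>2) summable_on B \<and> infsum (\<lambda>e. (cmod (\<Phi> n e - \<phi> e))\<^sup>2) B \<le> r\<^sup>2"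
  if N: "\<And>m n. m \<ge> N ==> n \<ge> N ==> hnorm S (hdiff S (\<Phi> m) (\<Phi> n)) < r" and n: "n \<ge> N" for N n r
 proof -
  have lim: "(\<lambda>m. cmod (\<Phi> n e - \<Phi> m e)) \<longlonglongrightarrow> cmod (\<Phi> n e - \<phi> e)" for e
   by (intro tendsto_intros \<phi>)
  have bd: "(\<Sum>e\<in>A. (cmod (\<Phi> n e - \<Phi> m e))\<^sup>2) \<le> r\<^sup>2" if "m \<ge> N" "finite A" "A \<subseteq> B" for m A
  proof -
   have "(\<Sum>e\<in>A. (cmod (hdiff S (\<Phi> n) (\<Phi> m) e))\<^sup>2) \<le> (hnorm S (hdiff S (\<Phi> n) (\<Phi> m)))\<^sup>2"
    unfolding norm_sq(2)[OF d] using that d[of n m] unfolding functional_space_carrier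
    by (intro finite_sum_le_infsum) auto
   also have "\<dots> \<le> r\<^sup>2"
    using power_mono[OF less_imp_le[OF N[OF n that(1)]] S.hnorm_nonneg[OF d], of 2] by simp
   finally show ?thesis by simp
  qed
  show ?thesis
   using square_summable_limit[where a = "\<lambda>m e. cmod (\<Phi> n e - \<Phi> m e)" and A = B and N = N and c = "r\<^sup>2", OF lim bd]
   by blast
 qed
 obtain N where N: "\<And>m n. m \<ge> N ==> n \<ge> N ==> hnorm S (hdiff S (\<Phi> m) (\<Phi> n)) < 1"
  using C[of 1] by auto
 have "\<phi> \<in> F"
 proof (rule F_limit[of "\<lambda>n. \<Phi> (n + N)" _ "hnorm S (\<Phi> N) + 1"])
  show "\<Phi> (n + N) \<in> hc S" for n by (rule P)
  show "(\<lambda>n. \<Phi> (n + N) x) \<longlonglongrightarrow> \<phi> x" for x by (rule LIMSEQ_ignore_initial_segment[OF \<phi>])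
  show "cmod (\<Phi> (n + N) x) \<le> (hnorm S (\<Phi> N) + 1) * sqrt (Re (tv x x))" if x: "x \<in> X" for x n
  proof -
   have "hadd S (hdiff S (\<Phi> (n + N)) (\<Phi> N)) (\<Phi> N) = \<Phi> (n + N)" by simp
   then have "hnorm S (\<Phi> (n + N)) \<le> hnorm S (hdiff S (\<Phi> (n + N)) (\<Phi> N)) + hnorm S (\<Phi> N)"
    using S.hnorm_triangle[OF d P, of "n + N" N N] by metis
   also have "\<dots> \<le> hnorm S (\<Phi> N) + 1" using N[of "n + N" N] by linarith
   finally have "hnorm S (\<Phi> (n + N)) \<le> hnorm S (\<Phi> N) + 1" .
   moreover have "sqrt (Re (tv x x)) \<ge> 0"
    using norm_tv[OF x] S.hnorm_nonneg[OF tv[OF x]] by simp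
   ultimately show ?thesis
    using order.trans[OF eval_bound[OF x P] mult_right_mono] by blast
  qed
 qed
 moreover have "\<phi> x = 0" if "x \<notin> X" for x
 proof -
  have "\<Phi> n x = 0" for n using P[of n] that by (simp add: functional_space_carrier)
  then show ?thesis using \<phi>[of x] by (simp add: LIMSEQ_const_iff)
 qed
 moreover have "(\<lambda>e. (cmod (\<phi> e))\<^sup>2) summable_on B"
 proof (rule summable_on_comparison_test)
  show "(\<lambda>e. 2 * (cmod (\<Phi> N e))\<^sup>2 + 2 * (cmod (\<Phi> N e - \<phi> e))\<^sup>2) summable_on B"
   using P[of N] key[OF N order_refl]
   by (intro summable_on_add summable_on_cmult_right) (simp_all add: functional_space_carrier)
  show "(cmod (\<phi> e))\<^sup>2 \<le> 2 * (cmod (\<Phi> N e))\<^sup>2 + 2 * (cmod (\<Phi> N e - \<phi> e))\<^sup>2" for e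
  proof -
   have "cmod (\<phi> e) \<le> cmod (\<Phi> N e) + cmod (\<Phi> N e - \<phi> e)"
    using norm_triangle_ineq4[of "\<Phi> N e" "\<Phi> N e - \<phi> e"] by simp
   then have "(cmod (\<phi> e))\<^sup>2 \<le> (cmod (\<Phi> N e) + cmod (\<Phi> N e - \<phi> e))\<^sup>2" by (intro power_mono) simp_all
   also have "\<dots> \<le> 2 * (cmod (\<Phi> N e))\<^sup>2 + 2 * (cmod (\<Phi> N e - \<phi> e))\<^sup>2"
    using sum_squares_bound[of "cmod (\<Phi> N e)" "cmod (\<Phi> N e - \<phi> e)"] by (simp add: power2_sum)
   finally show ?thesis .
  qed
 qed simp
 ultimately have pC: "\<phi> \<in> hc S" by (simp add: functional_space_carrier)
 have "(\<lambda>n. hnorm S (hdiff S (\<Phi> n) \<phi>)) \<longlonglongrightarrow> 0"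
 proof (rule LIMSEQ_I)
  fix r :: real assume r: "r > 0"
  obtain N where N: "\<And>m n. m \<ge> N ==> n \<ge> N ==> hnorm S (hdiff S (\<Phi> m) (\<Phi> n)) < r / 2"
   using C[of "r / 2"] r by auto
  have dc: "hdiff S (\<Phi> n) \<phi> \<in> hc S" for n
   using P pC by (intro S.add_closed S.scale_closed)
  have "hnorm S (hdiff S (\<Phi> n) \<phi>) < r" if "n \<ge> N" for n
  proof -
   have "(hnorm S (hdiff S (\<Phi> n) \<phi>))\<^sup>2 \<le> (r / 2)\<^sup>2"
    unfolding norm_sq(2)[OF dc] using key[OF N that] by simp
   then have "hnorm S (hdiff S (\<Phi> n) \<phi>) \<le> r / 2" by (rule power2_le_imp_le) (use r in simp)
   then show ?thesis using r by linarith
  qed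
  then show "\<exists>no. \<forall>n\<ge>no. norm (hnorm S (hdiff S (\<Phi> n) \<phi>) - 0) < r"
   using S.hnorm_nonneg[OF dc] by (metis abs_of_nonneg diff_zero real_norm_def)
 qed
 with pC show "\<exists>l\<in>hc S. (\<lambda>n. hnorm S (hdiff S (\<Phi> n) l)) \<longlonglongrightarrow> 0" by blast
qed

lemma tv_total: "closed_span S (tv ` X) = hc S"
proof (rule hilbert_space.totalI[OF hilbert_S])
 fix \<phi> assume p: "\<phi> \<in> hc S" and o: "\<And>s. s \<in> tv ` X ==> hinner S s \<phi> = 0"
 have "\<phi> x = 0" for x
  using inner_tv[OF _ p, of x] o p by (cases "x \<in> X") (auto simp: functional_space_carrier)
 then show "\<phi> = hzero S" by auto
qed (use tv in blast)

end

section \<open>Tensor products\<close>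

text \<open>A functional of several variables is expanded one slot at a time: Riesz turns the slot
  into pairing with a vector \<open>z\<close>, and Parseval expands that pairing.\<close>

lemma antilinear_expansion:
 assumes H: "hilbert_space H"
  and lin: "\<And>x x' c. x \<in> hc H ==> x' \<in> hc H ==> f (hadd H x (hscale H c x')) = f x + cnj c * f x'"
  and bound: "\<And>x. x \<in> hc H ==> cmod (f x) \<le> C * hnorm H x"
 obtains z where "z \<in> hc H" "\<And>x. x \<in> hc H ==> f x = hinner H x z"
  "\<And>x. x \<in> hc H ==> ((\<lambda>e. hinner H x e * f e) has_sum f x) (some_basis H)"
proof -
 interpret hilbert_space H by (rule H)
 have f0: "f (hzero H) = 0" using lin[of "hzero H" "hzero H" 1] by simp
 have fs: "f (hscale H c x) = cnj c * f x" if "x \<in> hc H" for c x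
  using lin[of "hzero H" x c] that f0 by simp
 have fa: "f (hadd H x y) = f x + f y" if "x \<in> hc H" "y \<in> hc H" for x y
  using lin[of x y 1] that by simp
 obtain z where z: "z \<in> hc H" "\<And>x. x \<in> hc H ==> cnj (f x) = hinner H z x"
  using riesz[of "\<lambda>x. cnj (f x)" C] fa fs bound by auto
 have fz: "f x = hinner H x z" if "x \<in> hc H" for x
  using z(2)[OF that] inner_commute[OF z(1) that] by (metis complex_cnj_cnj)
 have "((\<lambda>e. hinner H x e * f e) has_sum f x) (some_basis H)" if x: "x \<in> hc H" for x
  unfolding fz[OF x]
  by (rule has_sum_cong[THEN iffD1, OF _ parseval[OF H x z(1)]]) (use some_basis_subset[OF H] fz in auto)
 with z(1) fz show ?thesis using that by blast
qed

lemma product_square_summable: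
 fixes a :: "'e \<Rightarrow> complex" and t :: "'f \<Rightarrow> complex"
 assumes a: "(\<lambda>e. (cmod (a e))\<^sup>2) summable_on A" and t: "(\<lambda>f. (cmod (t f))\<^sup>2) summable_on B"
 shows "(\<lambda>(e, f). (cmod (a e * t f))\<^sup>2) summable_on A \<times> B"
proof (rule summable_on_SigmaI)
 show "((\<lambda>f. (\<lambda>(e, f). (cmod (a e * t f))\<^sup>2) (e, f)) has_sum (cmod (a e))\<^sup>2 * infsum (\<lambda>f. (cmod (t f))\<^sup>2) B) B" for e
  using has_sum_cmult_right[OF has_sum_infsum[OF t], of "(cmod (a e))\<^sup>2"] by (simp add: norm_mult power_mult_distrib)
 show "(\<lambda>e. (cmod (a e))\<^sup>2 * infsum (\<lambda>f. (cmod (t f))\<^sup>2) B) summable_on A"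
  by (rule summable_on_cmult_left[OF a])
qed auto

text \<open>Cauchy-Schwarz makes the double series absolutely summable, so it may be summed in
  iterated order, one slot after the other.\<close>

lemma has_sum_product_square:
 fixes a :: "'e \<Rightarrow> complex" and t :: "'f \<Rightarrow> complex" and \<phi> :: "'e \<times> 'f \<Rightarrow> complex"
 assumes a: "(\<lambda>e. (cmod (a e))\<^sup>2) summable_on A" and t: "(\<lambda>f. (cmod (t f))\<^sup>2) summable_on B"
  and p: "(\<lambda>p. (cmod (\<phi> p))\<^sup>2) summable_on A \<times> B"
  and 1: "\<And>e. e \<in> A ==> ((\<lambda>f. t f * \<phi> (e, f)) has_sum \<psi> e) B"
  and 2: "((\<lambda>e. a e * \<psi> e) has_sum s) A"
 shows "((\<lambda>(e, f). a e * t f * \<phi> (e, f)) has_sum s) (A \<times> B)"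
proof (rule has_sum_SigmaI)
 show "((\<lambda>f. (\<lambda>(e, f). a e * t f * \<phi> (e, f)) (e, f)) has_sum a e * \<psi> e) B" if "e \<in> A" for e
  using has_sum_cmult_right[OF 1[OF that], of "a e"] by (simp add: mult.assoc)
 show "(\<lambda>(e, f). a e * t f * \<phi> (e, f)) summable_on A \<times> B"
  using abs_summable_summable[OF square_summable_mult[OF _ p, of "\<lambda>(e, f). a e * t f"]]
   product_square_summable[OF a t] by (simp add: case_prod_unfold)
qed (rule 2)

section \<open>Tensor products of two spaces\<close>

lemma bounded_antibilinearI:
 assumes "\<And>x x' y c. x \<in> hc H ==> x' \<in> hc H ==> y \<in> hc G ==>
   \<phi> (hadd H x (hscale H c x'), y) = \<phi> (x, y) + cnj c * \<phi> (x', y)"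
  "\<And>x y y' c. x \<in> hc H ==> y \<in> hc G ==> y' \<in> hc G ==>
   \<phi> (x, hadd G y (hscale G c y')) = \<phi> (x, y) + cnj c * \<phi> (x, y')"
  "\<And>x y. x \<in> hc H ==> y \<in> hc G ==> cmod (\<phi> (x, y)) \<le> C * hnorm H x * hnorm G y"
 shows "\<phi> \<in> bounded_antibilinear H G"
 using assms unfolding bounded_antibilinear_def by blast

lemma bounded_antibilinearD:
 assumes "\<phi> \<in> bounded_antibilinear H G"
 shows "\<And>x x' y c. x \<in> hc H ==> x' \<in> hc H ==> y \<in> hc G ==>
   \<phi> (hadd H x (hscale H c x'), y) = \<phi> (x, y) + cnj c * \<phi> (x', y)"
  "\<And>x y y' c. x \<in> hc H ==> y \<in> hc G ==> y' \<in> hc G ==>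
   \<phi> (x, hadd G y (hscale G c y')) = \<phi> (x, y) + cnj c * \<phi> (x, y')"
  "\<exists>C. \<forall>x y. x \<in> hc H \<longrightarrow> y \<in> hc G \<longrightarrow> cmod (\<phi> (x, y)) \<le> C * hnorm H x * hnorm G y"
 using assms unfolding bounded_antibilinear_def by blast+

text \<open>The elementary tensor of x and y is the functional (x', y') -> <x', x> <y', y>.
  Expanding an arbitrary functional in both slots by Parseval shows that pairing with this tensor is
  evaluation at (x, y).\<close>

lemma tensor_kernel:
 assumes H: "hilbert_space H" and G: "hilbert_space G"
 shows "reproducing_kernel (hc H \<times> hc G) (some_basis H \<times> some_basis G)
  (bounded_antibilinear H G) (\<lambda>(x, y). tensor_vec H G x y)"
proof
 interpret H: hilbert_space H by (rule H)
 interpret G: hilbert_space G by (rule G)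
 let ?X = "hc H \<times> hc G" and ?B = "some_basis H \<times> some_basis G" and ?F = "bounded_antibilinear H G"
 let ?S = "functional_space ?X ?B ?F" and ?t = "\<lambda>(x, y). tensor_vec H G x y"
 note bH = some_basis_subset[OF H] and bG = some_basis_subset[OF G]
 show "?B \<subseteq> ?X" using bH bG by blast
 show "(\<lambda>x. 0) \<in> ?F" by (auto simp: bounded_antibilinear_def intro!: exI[of _ 0])
 show "(\<lambda>x. \<phi> x + \<psi> x) \<in> ?F" if FF: "\<phi> \<in> ?F" "\<psi> \<in> ?F" for \<phi> \<psi>
 proof -
  obtain C where C: "\<And>x y. x \<in> hc H ==> y \<in> hc G ==> cmod (\<phi> (x, y)) \<le> C * hnorm H x * hnorm G y"
   using bounded_antibilinearD(3)[OF FF(1)] by blast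
  obtain D where D: "\<And>x y. x \<in> hc H ==> y \<in> hc G ==> cmod (\<psi> (x, y)) \<le> D * hnorm H x * hnorm G y"
   using bounded_antibilinearD(3)[OF FF(2)] by blast
  show ?thesis
  proof (rule bounded_antibilinearI[where C = "C + D"])
   show "cmod (\<phi> (x, y) + \<psi> (x, y)) \<le> (C + D) * hnorm H x * hnorm G y"
    if "x \<in> hc H" "y \<in> hc G" for x y
    using C[OF that] D[OF that] norm_triangle_ineq[of "\<phi> (x, y)" "\<psi> (x, y)"] by (simp add: algebra_simps)
  qed (simp_all add: bounded_antibilinearD(1,2)[OF FF(1)] bounded_antibilinearD(1,2)[OF FF(2)] algebra_simps)
 qed
 show "(\<lambda>x. c * \<phi> x) \<in> ?F" if FF: "\<phi> \<in> ?F" for c \<phi>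
 proof -
  obtain C where C: "\<And>x y. x \<in> hc H ==> y \<in> hc G ==> cmod (\<phi> (x, y)) \<le> C * hnorm H x * hnorm G y"
   using bounded_antibilinearD(3)[OF FF] by blast
  show ?thesis
  proof (rule bounded_antibilinearI[where C = "cmod c * C"])
   show "cmod (c * \<phi> (x, y)) \<le> cmod c * C * hnorm H x * hnorm G y"
    if "x \<in> hc H" "y \<in> hc G" for x y
    using mult_left_mono[OF C[OF that], of "cmod c"] by (simp add: norm_mult mult.assoc)
  qed (simp_all add: bounded_antibilinearD(1,2)[OF FF] algebra_simps)
 qed
 have sqH: "(\<lambda>e. (cmod (hinner H e x))\<^sup>2) summable_on some_basis H" if "x \<in> hc H" for x
  using parseval_norm[OF H that] by (auto simp: summable_on_def)
 have sqG: "(\<lambda>e. (cmod (hinner G e x))\<^sup>2) summable_on some_basis G" if "x \<in> hc G" for x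
  using parseval_norm[OF G that] by (auto simp: summable_on_def)
 have sq: "(\<lambda>p. (cmod (tensor_vec H G x y p))\<^sup>2) summable_on ?B" if "x \<in> hc H" "y \<in> hc G" for x y
 proof -
  have "(\<lambda>p. (cmod (tensor_vec H G x y p))\<^sup>2) summable_on ?B
    \<longleftrightarrow> (\<lambda>(e, f). (cmod (hinner H e x * hinner G f y))\<^sup>2) summable_on ?B"
   by (rule summable_on_cong) (use bH bG in \<open>auto simp: tensor_vec_def subset_iff\<close>)
  with product_square_summable[OF sqH sqG] that show ?thesis by simp
 qed
 show "?t z \<in> hc ?S" if zX: "z \<in> ?X" for z
 proof -
  obtain x y where z: "z = (x, y)" "x \<in> hc H" "y \<in> hc G" using zX by (cases z) auto
  have "\<forall>x'\<in>hc H. \<forall>y'\<in>hc G. cmod (hinner H x' x * hinner G y' y) \<le> (hnorm H x * hnorm G y) * hnorm H x' * hnorm G y'"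
  proof (intro ballI)
   fix x' y' assume "x' \<in> hc H" "y' \<in> hc G"
   then have "cmod (hinner H x' x) * cmod (hinner G y' y) \<le> (hnorm H x' * hnorm H x) * (hnorm G y' * hnorm G y)"
    using z by (intro mult_mono H.cauchy_schwarz G.cauchy_schwarz) simp_all
   then show "cmod (hinner H x' x * hinner G y' y) \<le> (hnorm H x * hnorm G y) * hnorm H x' * hnorm G y'"
    by (simp add: norm_mult algebra_simps)
  qed
  then have "tensor_vec H G x y \<in> ?F"
   by (intro bounded_antibilinearI[where C = "hnorm H x * hnorm G y"])
    (use z in \<open>auto simp: tensor_vec_def algebra_simps\<close>)
  then show ?thesis using sq z by (auto simp: functional_space_carrier tensor_vec_def)
 qed
 show "((\<lambda>e. cnj (?t z e) * \<phi> e) has_sum \<phi> z) ?B" if p: "\<phi> \<in> hc ?S" and zX: "z \<in> ?X" for \<phi> z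
 proof -
  obtain x y where z: "z = (x, y)" "x \<in> hc H" "y \<in> hc G" using zX by (cases z) auto
  have pF: "\<phi> \<in> ?F" using p by (simp add: functional_space_carrier)
  obtain C where C: "\<And>x y. x\<in>hc H ==> y\<in>hc G ==> cmod (\<phi> (x, y)) \<le> C * hnorm H x * hnorm G y"
   using bounded_antibilinearD(3)[OF pF] by blast
  have linH: "\<phi> (hadd H x (hscale H c x'), y) = \<phi> (x, y) + cnj c * \<phi> (x', y)"
   if "x \<in> hc H" "x' \<in> hc H" "y \<in> hc G" for x x' y c
   using p that by (simp add: bounded_antibilinear_def functional_space_carrier)
  have linG: "\<phi> (x, hadd G y (hscale G c y')) = \<phi> (x, y) + cnj c * \<phi> (x, y')"
   if "x \<in> hc H" "y \<in> hc G" "y' \<in> hc G" for x y y' c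
   using p that by (simp add: bounded_antibilinear_def functional_space_carrier)
  have 1: "((\<lambda>f. hinner G y f * \<phi> (e, f)) has_sum \<phi> (e, y)) (some_basis G)" if e: "e \<in> some_basis H" for e
   by (rule antilinear_expansion[OF G, of "\<lambda>y. \<phi> (e, y)" "C * hnorm H e"])
    (use e bH linG C z in \<open>auto simp: subset_iff\<close>)
  have 2: "((\<lambda>e. hinner H x e * \<phi> (e, y)) has_sum \<phi> (x, y)) (some_basis H)"
   by (rule antilinear_expansion[OF H, of "\<lambda>x. \<phi> (x, y)" "C * hnorm G y"])
    (use linH C z in \<open>auto simp: mult.assoc mult.commute[of "hnorm G y"]\<close>)
  have sx: "(\<lambda>e. (cmod (hinner H x e))\<^sup>2) summable_on some_basis H"
   using sqH[OF z(2)] z(2) bH H.inner_commute[of x] by (simp add: subset_iff cong: summable_on_cong)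
  have sy: "(\<lambda>e. (cmod (hinner G y e))\<^sup>2) summable_on some_basis G"
   using sqG[OF z(3)] z(3) bG G.inner_commute[of y] by (simp add: subset_iff cong: summable_on_cong)
  have "((\<lambda>(e, f). hinner H x e * hinner G y f * \<phi> (e, f)) has_sum \<phi> (x, y)) ?B"
   by (rule has_sum_product_square[OF sx sy _ 1 2]) (use p in \<open>simp_all add: functional_space_carrier\<close>)
  also have "?this \<longleftrightarrow> ((\<lambda>e. cnj (?t z e) * \<phi> e) has_sum \<phi> (x, y)) ?B"
   by (rule has_sum_cong) (use z bH bG H.inner_commute[of _ x] G.inner_commute[of _ y] in
    \<open>auto simp: tensor_vec_def subset_iff\<close>)
  finally show ?thesis using z by simp
 qed
 show "\<phi> \<in> ?F" if P: "\<And>n. \<Phi> n \<in> hc ?S" and lim: "\<And>x. (\<lambda>n. \<Phi> n x) \<longlonglongrightarrow> \<phi> x"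
  and b: "\<And>x n. x \<in> ?X ==> cmod (\<Phi> n x) \<le> C * sqrt (Re (?t x x))" for \<Phi> :: "nat \<Rightarrow> _" and \<phi> C
 proof -
  have P': "\<Phi> n \<in> ?F" for n using P by (simp add: functional_space_carrier)
  have "\<phi> (hadd H x (hscale H c x'), y) = \<phi> (x, y) + cnj c * \<phi> (x', y)"
   if "x \<in> hc H" "x' \<in> hc H" "y \<in> hc G" for x x' y c
  proof (rule LIMSEQ_unique[OF lim])
   have "(\<lambda>n. \<Phi> n (x, y) + cnj c * \<Phi> n (x', y)) \<longlonglongrightarrow> \<phi> (x, y) + cnj c * \<phi> (x', y)"
    by (intro tendsto_intros lim)
   then show "(\<lambda>n. \<Phi> n (hadd H x (hscale H c x'), y)) \<longlonglongrightarrow> \<phi> (x, y) + cnj c * \<phi> (x', y)"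
    using P' that by (simp add: bounded_antibilinear_def)
  qed
  moreover have "\<phi> (x, hadd G y (hscale G c y')) = \<phi> (x, y) + cnj c * \<phi> (x, y')"
   if "x \<in> hc H" "y \<in> hc G" "y' \<in> hc G" for x y y' c
  proof (rule LIMSEQ_unique[OF lim])
   have "(\<lambda>n. \<Phi> n (x, y) + cnj c * \<Phi> n (x, y')) \<longlonglongrightarrow> \<phi> (x, y) + cnj c * \<phi> (x, y')"
    by (intro tendsto_intros lim)
   then show "(\<lambda>n. \<Phi> n (x, hadd G y (hscale G c y'))) \<longlonglongrightarrow> \<phi> (x, y) + cnj c * \<phi> (x, y')"
    using P' that by (simp add: bounded_antibilinear_def)
  qed
  moreover have "cmod (\<phi> (x, y)) \<le> C * hnorm H x * hnorm G y" if "x \<in> hc H" "y \<in> hc G" for x y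
  proof (rule LIMSEQ_le_const2)
   show "(\<lambda>n. cmod (\<Phi> n (x, y))) \<longlonglongrightarrow> cmod (\<phi> (x, y))" by (intro tendsto_intros lim)
   have "sqrt (Re (?t (x, y) (x, y))) = hnorm H x * hnorm G y"
    using that by (simp add: tensor_vec_def H.inner_self G.inner_self real_sqrt_mult)
   then show "\<exists>N. \<forall>n\<ge>N. cmod (\<Phi> n (x, y)) \<le> C * hnorm H x * hnorm G y"
    using b[of "(x, y)"] that by (simp add: mult.assoc)
  qed
  ultimately show ?thesis by (rule bounded_antibilinearI)
 qed
qed

lemma
 assumes H: "hilbert_space H" and G: "hilbert_space G"
 shows hilbert_tensor: "hilbert_space (tensor H G)"
  and tensor_vec_closed: "\<And>x y. x \<in> hc H ==> y \<in> hc G ==> tensor_vec H G x y \<in> hc (tensor H G)"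
  and inner_tensor_vec: "\<And>x y \<phi>. x \<in> hc H ==> y \<in> hc G ==> \<phi> \<in> hc (tensor H G)
   ==> hinner (tensor H G) (tensor_vec H G x y) \<phi> = \<phi> (x, y)"
  and tensor_total: "closed_span (tensor H G) ((\<lambda>(x, y). tensor_vec H G x y) ` (hc H \<times> hc G)) = hc (tensor H G)"
proof -
 interpret K: reproducing_kernel "hc H \<times> hc G" "some_basis H \<times> some_basis G"
  "bounded_antibilinear H G" "\<lambda>(x, y). tensor_vec H G x y" by (rule tensor_kernel[OF H G])
 show "hilbert_space (tensor H G)" unfolding tensor_def by (rule K.hilbert_S)
 show "tensor_vec H G x y \<in> hc (tensor H G)" if "x \<in> hc H" "y \<in> hc G" for x y
  using K.tv[of "(x, y)"] that by (simp add: tensor_def)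
 show "hinner (tensor H G) (tensor_vec H G x y) \<phi> = \<phi> (x, y)"
  if "x \<in> hc H" "y \<in> hc G" "\<phi> \<in> hc (tensor H G)" for x y \<phi>
  using K.inner_tv[of "(x, y)" \<phi>] that by (simp add: tensor_def)
 show "closed_span (tensor H G) ((\<lambda>(x, y). tensor_vec H G x y) ` (hc H \<times> hc G)) = hc (tensor H G)"
  unfolding tensor_def by (rule K.tv_total)
qed

lemma inner_tensor_vec_vec:
 assumes "hilbert_space H" "hilbert_space G" "x \<in> hc H" "y \<in> hc G" "x' \<in> hc H" "y' \<in> hc G"
 shows "hinner (tensor H G) (tensor_vec H G x y) (tensor_vec H G x' y') = hinner H x x' * hinner G y y'"
 using assms by (subst inner_tensor_vec) (auto simp: tensor_vec_closed, simp add: tensor_vec_def)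

declare functional_space_simps [simp del]

section \<open>Tensor products of lists of spaces\<close>

lemma in_listset_iff:
 "xs \<in> listset As \<longleftrightarrow> length xs = length As \<and> (\<forall>i<length As. xs ! i \<in> As ! i)"
proof (induction As arbitrary: xs)
 case (Cons A As)
 show ?case
  by (cases xs) (auto simp: set_Cons_def Cons.IH nth_Cons split: nat.splits)
qed auto

lemma listset_Cons_image: "listset (A # As) = (\<lambda>(x, xs). x # xs) ` (A \<times> listset As)"
 by (auto simp: set_Cons_def)

lemma Cons_in_listset [simp]: "x # xs \<in> listset (A # As) \<longleftrightarrow> x \<in> A \<and> xs \<in> listset As"
 by (auto simp: set_Cons_def)

lemma listset_mono: "(\<And>i. i < length As ==> As ! i \<subseteq> Bs ! i) ==> length As = length Bs ==> listset As \<subseteq> listset Bs"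
 by (fastforce simp: in_listset_iff)

lemma listset_update: "xs \<in> listset As ==> i < length As ==> x \<in> As ! i ==> xs[i := x] \<in> listset As"
 by (auto simp: in_listset_iff nth_list_update)

text \<open>The inner product of the elementary tensors of \<open>xs\<close> and \<open>ys\<close>,
  see \<open>inner_tensor_list_vec_vec\<close>.\<close>

definition pinner :: "'a hilb list \<Rightarrow> 'a list \<Rightarrow> 'a list \<Rightarrow> complex" where
 "pinner Hs xs ys = (\<Prod>i<length Hs. hinner (Hs ! i) (xs ! i) (ys ! i))"

lemma pinner_Nil [simp]: "pinner [] xs ys = 1"
 by (simp add: pinner_def)

lemma pinner_Cons [simp]: "pinner (H # Hs) (x # xs) (y # ys) = hinner H x y * pinner Hs xs ys"
 unfolding pinner_def by (simp add: prod.lessThan_Suc_shift del: prod.lessThan_Suc)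

lemma tensor_list_vec_eq:
 "tensor_list_vec Hs xs ys = (if ys \<in> listset (map hc Hs) then pinner Hs ys xs else 0)"
 by (simp add: tensor_list_vec_def pinner_def)

lemma pinner_commute:
 assumes "\<And>H. H \<in> set Hs ==> hilbert_space H" "xs \<in> listset (map hc Hs)" "ys \<in> listset (map hc Hs)"
 shows "pinner Hs ys xs = cnj (pinner Hs xs ys)"
 unfolding pinner_def cnj_prod
 by (rule prod.cong) (use assms in \<open>auto simp: in_listset_iff intro!: pre_hilbert_space.inner_commute\<close>)

lemma pinner_update:
 assumes "i < length Hs" "length xs = length Hs"
 shows "pinner Hs (xs[i := x]) ys = hinner (Hs ! i) x (ys ! i) * (\<Prod>j\<in>{..<length Hs} - {i}. hinner (Hs ! j) (xs ! j) (ys ! j))"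
 unfolding pinner_def using assms
 by (subst prod.remove[of _ i]) (auto intro!: prod.cong arg_cong2[of _ _ _ _ times] simp: nth_list_update)

lemma bounded_antimultilinearI:
 assumes "\<And>xs i x x' c. xs \<in> listset (map hc Hs) ==> i < length Hs ==> x \<in> hc (Hs ! i) ==>
   x' \<in> hc (Hs ! i) ==>
   \<phi> (xs[i := hadd (Hs ! i) x (hscale (Hs ! i) c x')]) = \<phi> (xs[i := x]) + cnj c * \<phi> (xs[i := x'])"
  "\<And>xs. xs \<in> listset (map hc Hs) ==> cmod (\<phi> xs) \<le> C * (\<Prod>i<length Hs. hnorm (Hs ! i) (xs ! i))"
 shows "\<phi> \<in> bounded_antimultilinear Hs"
 using assms unfolding bounded_antimultilinear_def by blast

lemma bounded_antimultilinearD: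
 assumes "\<phi> \<in> bounded_antimultilinear Hs"
 shows "\<And>xs i x x' c. xs \<in> listset (map hc Hs) ==> i < length Hs ==> x \<in> hc (Hs ! i) ==>
   x' \<in> hc (Hs ! i) ==>
   \<phi> (xs[i := hadd (Hs ! i) x (hscale (Hs ! i) c x')]) = \<phi> (xs[i := x]) + cnj c * \<phi> (xs[i := x'])"
  "\<exists>C. \<forall>xs. xs \<in> listset (map hc Hs) \<longrightarrow> cmod (\<phi> xs) \<le> C * (\<Prod>i<length Hs. hnorm (Hs ! i) (xs ! i))"
 using assms unfolding bounded_antimultilinear_def by blast+

text \<open>Both claims go through one induction on the factors, because expanding a functional on
  the longer list uses the square summability of the kernel of the tail.\<close>

lemma list_kernel_reproducing:
 assumes "\<And>H. H \<in> set Hs ==> hilbert_space H"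
  and "xs \<in> listset (map hc Hs)"
 shows "(\<lambda>es. (cmod (pinner Hs xs es))\<^sup>2) summable_on listset (map some_basis Hs)
  \<and> (\<forall>\<phi>. \<phi> \<in> bounded_antimultilinear Hs \<longrightarrow> (\<lambda>es. (cmod (\<phi> es))\<^sup>2) summable_on listset (map some_basis Hs) \<longrightarrow>
   ((\<lambda>es. pinner Hs xs es * \<phi> es) has_sum \<phi> xs) (listset (map some_basis Hs)))"
 using assms
proof (induction Hs arbitrary: xs)
 case Nil
 then show ?case by (auto intro: has_sum_finiteI)
next
 case (Cons H Hs)
 have H: "hilbert_space H" using Cons.prems(1) by simp
 interpret H: hilbert_space H by (rule H)
 obtain x xs' where xs: "xs = x # xs'" "x \<in> hc H" "xs' \<in> listset (map hc Hs)"
  using Cons.prems(2) by (auto simp: set_Cons_def)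
 let ?B = "some_basis H" and ?L = "listset (map some_basis Hs)"
 note bH = some_basis_subset[OF H]
 have bL: "?L \<subseteq> listset (map hc Hs)"
  by (rule listset_mono) (use some_basis_subset[OF Cons.prems(1)] in \<open>auto simp: subset_iff\<close>)
 have inj: "inj_on (\<lambda>(x, xs). x # xs) A" for A :: "('a \<times> 'a list) set" by (auto simp: inj_on_def)
 have IH: "(\<lambda>es. (cmod (pinner Hs xs' es))\<^sup>2) summable_on ?L"
  "\<And>\<phi>. \<phi> \<in> bounded_antimultilinear Hs ==> (\<lambda>es. (cmod (\<phi> es))\<^sup>2) summable_on ?L ==>
   ((\<lambda>es. pinner Hs xs' es * \<phi> es) has_sum \<phi> xs') ?L"
  using Cons.IH[OF _ xs(3)] Cons.prems(1) by auto
 have "(\<lambda>e. (cmod (hinner H e x))\<^sup>2) summable_on ?B"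
  using parseval_norm[OF H xs(2)] by (auto simp: summable_on_def)
 also have "?this \<longleftrightarrow> (\<lambda>e. (cmod (hinner H x e))\<^sup>2) summable_on ?B"
  by (rule summable_on_cong) (use bH xs(2) H.inner_commute[of x] in \<open>auto simp: subset_iff\<close>)
 finally have sx: "(\<lambda>e. (cmod (hinner H x e))\<^sup>2) summable_on ?B" .
 have 1: "(\<lambda>es. (cmod (pinner (H # Hs) xs es))\<^sup>2) summable_on listset (map some_basis (H # Hs))"
  using product_square_summable[OF sx IH(1)]
  by (simp only: list.map listset_Cons_image summable_on_reindex[OF inj]) (simp add: xs(1) o_def case_prod_unfold)
 have 2: "((\<lambda>es. pinner (H # Hs) xs es * \<phi> es) has_sum \<phi> xs) (listset (map some_basis (H # Hs)))"
  if m: "\<phi> \<in> bounded_antimultilinear (H # Hs)"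
   and s: "(\<lambda>es. (cmod (\<phi> es))\<^sup>2) summable_on listset (map some_basis (H # Hs))" for \<phi>
 proof -
  obtain C where C: "\<And>ys. ys \<in> listset (map hc (H # Hs)) ==>
    cmod (\<phi> ys) \<le> C * (\<Prod>i<length (H # Hs). hnorm ((H # Hs) ! i) (ys ! i))"
   using m unfolding bounded_antimultilinear_def by blast
  have C': "cmod (\<phi> (y # ys)) \<le> C * hnorm H y * (\<Prod>i<length Hs. hnorm (Hs ! i) (ys ! i))"
   if "y \<in> hc H" "ys \<in> listset (map hc Hs)" for y ys
   using C[of "y # ys"] that by (simp add: set_Cons_def prod.lessThan_Suc_shift mult.assoc del: prod.lessThan_Suc)
  have lin: "\<phi> (ys[i := hadd ((H # Hs) ! i) z (hscale ((H # Hs) ! i) c z')]) = \<phi> (ys[i := z]) + cnj c * \<phi> (ys[i := z'])"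
   if "ys \<in> listset (map hc (H # Hs))" "i < length (H # Hs)"
    "z \<in> hc ((H # Hs) ! i)" "z' \<in> hc ((H # Hs) ! i)" for ys i z z' c
   using m that unfolding bounded_antimultilinear_def by blast
  have s2: "(\<lambda>p. (cmod (\<phi> (fst p # snd p)))\<^sup>2) summable_on ?B \<times> ?L"
   using s by (simp only: list.map listset_Cons_image summable_on_reindex[OF inj]) (simp add: o_def case_prod_unfold)
  have "((\<lambda>(e, es). hinner H x e * pinner Hs xs' es * \<phi> (fst (e, es) # snd (e, es))) has_sum \<phi> (x # xs')) (?B \<times> ?L)"
  proof (rule has_sum_product_square[OF sx IH(1) s2])
   fix e assume e: "e \<in> ?B"
   then have eH: "e \<in> hc H" using bH by blast
   \<comment> \<open>With the first slot frozen at a basis vector the functional is antimultilinear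
     in the remaining ones, so the induction hypothesis applies to it.\<close>
   have "(\<lambda>es. \<phi> (e # es)) \<in> bounded_antimultilinear Hs"
    unfolding bounded_antimultilinear_def
   proof (intro CollectI conjI ballI allI impI)
    show "\<phi> (e # ys[i := hadd (Hs ! i) z (hscale (Hs ! i) c z')]) = \<phi> (e # ys[i := z]) + cnj c * \<phi> (e # ys[i := z'])"
     if "ys \<in> listset (map hc Hs)" "i < length Hs" "z \<in> hc (Hs ! i)" "z' \<in> hc (Hs ! i)" for ys i z z' c
     using lin[of "e # ys" "Suc i" z z' c] that eH by (simp add: set_Cons_def)
    show "\<exists>C. \<forall>ys\<in>listset (map hc Hs). cmod (\<phi> (e # ys)) \<le> C * (\<Prod>i<length Hs. hnorm (Hs ! i) (ys ! i))"
     using C' eH by blast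
   qed
   moreover have "(\<lambda>es. (cmod (\<phi> (e # es)))\<^sup>2) summable_on ?L"
    using summable_on_SigmaD1[of "\<lambda>e es. (cmod (\<phi> (e # es)))\<^sup>2" ?B "\<lambda>_. ?L" e] s2 e by (simp add: case_prod_unfold)
   ultimately show "((\<lambda>es. pinner Hs xs' es * \<phi> (fst (e, es) # snd (e, es))) has_sum \<phi> (e # xs')) ?L"
    using IH(2)[of "\<lambda>es. \<phi> (e # es)"] by simp
  next
   show "((\<lambda>e. hinner H x e * \<phi> (e # xs')) has_sum \<phi> (x # xs')) ?B"
   proof (rule antilinear_expansion[OF H, of "\<lambda>x. \<phi> (x # xs')" "C * (\<Prod>i<length Hs. hnorm (Hs ! i) (xs' ! i))"])
    show "\<phi> (hadd H z (hscale H c z') # xs') = \<phi> (z # xs') + cnj c * \<phi> (z' # xs')"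
     if "z \<in> hc H" "z' \<in> hc H" for z z' c
     using lin[of "z # xs'" 0 z z' c] that xs(3) by (simp add: set_Cons_def)
    show "cmod (\<phi> (z # xs')) \<le> C * (\<Prod>i<length Hs. hnorm (Hs ! i) (xs' ! i)) * hnorm H z"
     if "z \<in> hc H" for z
     using C'[OF that xs(3)] by (simp add: mult_ac)
   qed (use xs(2) in auto)
  qed
  then show ?thesis
   by (simp only: list.map listset_Cons_image has_sum_reindex[OF inj]) (simp add: xs(1) o_def case_prod_unfold)
 qed
 from 1 2 show ?case by blast
qed

lemma tensor_list_kernel:
 assumes Hs: "\<And>H. H \<in> set Hs ==> hilbert_space H"
 shows "reproducing_kernel (listset (map hc Hs)) (listset (map some_basis Hs))
  (bounded_antimultilinear Hs) (tensor_list_vec Hs)"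
proof
 let ?X = "listset (map hc Hs)" and ?B = "listset (map some_basis Hs)" and ?F = "bounded_antimultilinear Hs"
 let ?S = "functional_space ?X ?B ?F"
 have pre: "pre_hilbert_space (Hs ! i)" if "i < length Hs" for i using Hs that by simp
 show BX: "?B \<subseteq> ?X" by (rule listset_mono) (use some_basis_subset[OF Hs] in \<open>auto simp: subset_iff\<close>)
 show "(\<lambda>x. 0) \<in> ?F" by (auto simp: bounded_antimultilinear_def intro!: exI[of _ 0])
 show "(\<lambda>x. \<phi> x + \<psi> x) \<in> ?F" if FF: "\<phi> \<in> ?F" "\<psi> \<in> ?F" for \<phi> \<psi>
 proof -
  obtain C where C: "\<And>xs. xs \<in> ?X ==> cmod (\<phi> xs) \<le> C * (\<Prod>i<length Hs. hnorm (Hs ! i) (xs ! i))"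
   using bounded_antimultilinearD(2)[OF FF(1)] by blast
  obtain D where D: "\<And>xs. xs \<in> ?X ==> cmod (\<psi> xs) \<le> D * (\<Prod>i<length Hs. hnorm (Hs ! i) (xs ! i))"
   using bounded_antimultilinearD(2)[OF FF(2)] by blast
  show ?thesis
  proof (rule bounded_antimultilinearI[where C = "C + D"])
   show "cmod (\<phi> xs + \<psi> xs) \<le> (C + D) * (\<Prod>i<length Hs. hnorm (Hs ! i) (xs ! i))" if "xs \<in> ?X" for xs
    using C[OF that] D[OF that] norm_triangle_ineq[of "\<phi> xs" "\<psi> xs"] by (simp add: algebra_simps)
  qed (simp add: bounded_antimultilinearD(1)[OF FF(1)] bounded_antimultilinearD(1)[OF FF(2)] algebra_simps)
 qed
 show "(\<lambda>x. c * \<phi> x) \<in> ?F" if FF: "\<phi> \<in> ?F" for c \<phi>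
 proof -
  obtain C where C: "\<And>xs. xs \<in> ?X ==> cmod (\<phi> xs) \<le> C * (\<Prod>i<length Hs. hnorm (Hs ! i) (xs ! i))"
   using bounded_antimultilinearD(2)[OF FF(1)] by blast
  show ?thesis
  proof (rule bounded_antimultilinearI[where C = "cmod c * C"])
   show "cmod (c * \<phi> xs) \<le> cmod c * C * (\<Prod>i<length Hs. hnorm (Hs ! i) (xs ! i))" if "xs \<in> ?X" for xs
    using mult_left_mono[OF C[OF that], of "cmod c"] by (simp add: norm_mult mult.assoc)
  qed (simp add: bounded_antimultilinearD(1)[OF FF(1)] algebra_simps)
 qed
 show "tensor_list_vec Hs xs \<in> hc ?S" if xs: "xs \<in> ?X" for xs
 proof -
  have lin: "tensor_list_vec Hs xs (ys[i := hadd (Hs ! i) z (hscale (Hs ! i) c z')])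
    = tensor_list_vec Hs xs (ys[i := z]) + cnj c * tensor_list_vec Hs xs (ys[i := z'])"
   if "ys \<in> ?X" "i < length Hs" "z \<in> hc (Hs ! i)" "z' \<in> hc (Hs ! i)" for ys i z z' c
  proof -
   have len: "length ys = length Hs" using that(1) by (simp add: in_listset_iff)
   have xi: "xs ! i \<in> hc (Hs ! i)" using xs that(2) by (simp add: in_listset_iff)
   have u: "ys[i := w] \<in> ?X" if "w \<in> hc (Hs ! i)" for w
    using listset_update[OF \<open>ys \<in> ?X\<close>] \<open>i < length Hs\<close> that by simp
   show ?thesis
    using that pre[OF that(2)] xi by (simp add: tensor_list_vec_eq u pinner_update[OF that(2) len] algebra_simps)
  qed
  have bd: "cmod (tensor_list_vec Hs xs ys) \<le> (\<Prod>i<length Hs. hnorm (Hs ! i) (xs ! i)) * (\<Prod>i<length Hs. hnorm (Hs ! i) (ys ! i))"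
   if ys: "ys \<in> ?X" for ys
  proof -
   have "cmod (pinner Hs ys xs) \<le> (\<Prod>i<length Hs. hnorm (Hs ! i) (ys ! i) * hnorm (Hs ! i) (xs ! i))"
    unfolding pinner_def prod_norm[symmetric]
    by (rule prod_mono) (use xs ys pre in \<open>auto simp: in_listset_iff intro!: pre_hilbert_space.cauchy_schwarz\<close>)
   then show ?thesis using ys by (simp add: tensor_list_vec_eq prod.distrib mult.commute)
  qed
  have "tensor_list_vec Hs xs \<in> ?F" using lin bd unfolding bounded_antimultilinear_def by blast
  moreover have "(\<lambda>es. (cmod (tensor_list_vec Hs xs es))\<^sup>2) summable_on ?B"
  proof -
   have "(\<lambda>es. (cmod (pinner Hs xs es))\<^sup>2) summable_on ?B" using list_kernel_reproducing[OF Hs xs] by blast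
   also have "?this \<longleftrightarrow> ?thesis"
    by (rule summable_on_cong) (use BX pinner_commute[OF Hs xs] in \<open>auto simp: tensor_list_vec_eq subset_iff\<close>)
   finally show ?thesis .
  qed
  ultimately show ?thesis by (simp add: functional_space_carrier tensor_list_vec_eq)
 qed
 show "((\<lambda>es. cnj (tensor_list_vec Hs xs es) * \<phi> es) has_sum \<phi> xs) ?B"
  if p: "\<phi> \<in> hc ?S" and xs: "xs \<in> ?X" for \<phi> xs
 proof -
  have "((\<lambda>es. pinner Hs xs es * \<phi> es) has_sum \<phi> xs) ?B"
   using list_kernel_reproducing[OF Hs xs] p by (auto simp: functional_space_carrier)
  also have "?this \<longleftrightarrow> ?thesis"
   by (rule has_sum_cong) (use BX pinner_commute[OF Hs xs] in \<open>auto simp: tensor_list_vec_eq subset_iff\<close>)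
  finally show ?thesis .
 qed
 show "\<phi> \<in> ?F" if P: "\<And>n. \<Phi> n \<in> hc ?S" and lim: "\<And>x. (\<lambda>n. \<Phi> n x) \<longlonglongrightarrow> \<phi> x"
  and b: "\<And>x n. x \<in> ?X ==> cmod (\<Phi> n x) \<le> C * sqrt (Re (tensor_list_vec Hs x x))" for \<Phi> :: "nat \<Rightarrow> _" and \<phi> C
 proof -
  have P': "\<Phi> n \<in> ?F" for n using P by (simp add: functional_space_carrier)
  have "\<phi> (ys[i := hadd (Hs ! i) z (hscale (Hs ! i) c z')]) = \<phi> (ys[i := z]) + cnj c * \<phi> (ys[i := z'])"
   if "ys \<in> ?X" "i < length Hs" "z \<in> hc (Hs ! i)" "z' \<in> hc (Hs ! i)" for ys i z z' c
  proof (rule LIMSEQ_unique[OF lim])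
   have "(\<lambda>n. \<Phi> n (ys[i := z]) + cnj c * \<Phi> n (ys[i := z'])) \<longlonglongrightarrow> \<phi> (ys[i := z]) + cnj c * \<phi> (ys[i := z'])"
    by (intro tendsto_intros lim)
   then show "(\<lambda>n. \<Phi> n (ys[i := hadd (Hs ! i) z (hscale (Hs ! i) c z')])) \<longlonglongrightarrow> \<phi> (ys[i := z]) + cnj c * \<phi> (ys[i := z'])"
    using P' that by (simp add: bounded_antimultilinear_def)
  qed
  moreover have "cmod (\<phi> xs) \<le> C * (\<Prod>i<length Hs. hnorm (Hs ! i) (xs ! i))" if xs: "xs \<in> ?X" for xs
  proof (rule LIMSEQ_le_const2)
   show "(\<lambda>n. cmod (\<Phi> n xs)) \<longlonglongrightarrow> cmod (\<phi> xs)" by (intro tendsto_intros lim)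
   have "pinner Hs xs xs = (\<Prod>i<length Hs. complex_of_real ((hnorm (Hs ! i) (xs ! i))\<^sup>2))"
    unfolding pinner_def
    by (rule prod.cong) (use xs pre in \<open>auto simp: in_listset_iff pre_hilbert_space.inner_self\<close>)
   also have "\<dots> = complex_of_real ((\<Prod>i<length Hs. hnorm (Hs ! i) (xs ! i))\<^sup>2)"
    by (simp add: prod_power_distrib)
   finally have "sqrt (Re (tensor_list_vec Hs xs xs)) = \<bar>\<Prod>i<length Hs. hnorm (Hs ! i) (xs ! i)\<bar>"
    using xs by (simp add: tensor_list_vec_eq del: of_real_power)
   also have "\<dots> = (\<Prod>i<length Hs. hnorm (Hs ! i) (xs ! i))"
    using xs pre by (intro abs_of_nonneg prod_nonneg) (auto simp: in_listset_iff)
   finally show "\<exists>N. \<forall>n\<ge>N. cmod (\<Phi> n xs) \<le> C * (\<Prod>i<length Hs. hnorm (Hs ! i) (xs ! i))"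
    using b[OF xs] by simp
  qed
  ultimately show ?thesis unfolding bounded_antimultilinear_def by blast
 qed
qed

lemma
 assumes Hs: "\<And>H. H \<in> set Hs ==> hilbert_space H"
 shows hilbert_tensor_list: "hilbert_space (tensor_list Hs)"
  and tensor_list_vec_closed: "\<And>xs. xs \<in> listset (map hc Hs) ==> tensor_list_vec Hs xs \<in> hc (tensor_list Hs)"
  and inner_tensor_list_vec: "\<And>xs \<phi>. xs \<in> listset (map hc Hs) ==> \<phi> \<in> hc (tensor_list Hs)
   ==> hinner (tensor_list Hs) (tensor_list_vec Hs xs) \<phi> = \<phi> xs"
  and tensor_list_total: "closed_span (tensor_list Hs) (tensor_list_vec Hs ` listset (map hc Hs)) = hc (tensor_list Hs)"
proof -
 interpret K: reproducing_kernel "listset (map hc Hs)" "listset (map some_basis Hs)"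
  "bounded_antimultilinear Hs" "tensor_list_vec Hs" by (rule tensor_list_kernel[OF Hs])
 show "hilbert_space (tensor_list Hs)" unfolding tensor_list_def by (rule K.hilbert_S)
 show "tensor_list_vec Hs xs \<in> hc (tensor_list Hs)" if "xs \<in> listset (map hc Hs)" for xs
  using K.tv[OF that] by (simp add: tensor_list_def)
 show "hinner (tensor_list Hs) (tensor_list_vec Hs xs) \<phi> = \<phi> xs"
  if "xs \<in> listset (map hc Hs)" "\<phi> \<in> hc (tensor_list Hs)" for xs \<phi>
  using K.inner_tv[of xs \<phi>] that by (simp add: tensor_list_def)
 show "closed_span (tensor_list Hs) (tensor_list_vec Hs ` listset (map hc Hs)) = hc (tensor_list Hs)"
  unfolding tensor_list_def by (rule K.tv_total)
qed

lemma inner_tensor_list_vec_vec: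
 assumes "\<And>H. H \<in> set Hs ==> hilbert_space H" "xs \<in> listset (map hc Hs)" "ys \<in> listset (map hc Hs)"
 shows "hinner (tensor_list Hs) (tensor_list_vec Hs xs) (tensor_list_vec Hs ys) = pinner Hs xs ys"
 using assms by (subst inner_tensor_list_vec) (auto simp: tensor_list_vec_closed tensor_list_vec_eq)

section \<open>Total sets and operators on tensor products\<close>

lemma tensor_norm_has_sum:
 assumes H: "hilbert_space H" and G: "hilbert_space G" and p: "\<phi> \<in> hc (tensor H G)"
 shows "((\<lambda>p. (cmod (\<phi> p))\<^sup>2) has_sum (hnorm (tensor H G) \<phi>)\<^sup>2) (some_basis H \<times> some_basis G)"
proof -
 interpret K: reproducing_kernel "hc H \<times> hc G" "some_basis H \<times> some_basis G"
  "bounded_antibilinear H G" "\<lambda>(x, y). tensor_vec H G x y" by (rule tensor_kernel[OF H G])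
 show ?thesis using p K.norm_sq(2)[of \<phi>] unfolding tensor_def functional_space_carrier
  by (auto intro: has_sum_infsum)
qed

lemma tensor_carrier:
 "\<phi> \<in> hc (tensor H G) \<longleftrightarrow> \<phi> \<in> bounded_antibilinear H G \<and>
  (\<forall>x. x \<notin> hc H \<times> hc G \<longrightarrow> \<phi> x = 0) \<and>
  (\<lambda>p. (cmod (\<phi> p))\<^sup>2) summable_on (some_basis H \<times> some_basis G)"
 unfolding tensor_def functional_space_carrier ..

lemma tensor_ops:
 "hzero (tensor H G) = (\<lambda>x. 0)" "hadd (tensor H G) = (\<lambda>\<phi> \<psi> x. \<phi> x + \<psi> x)"
 "hscale (tensor H G) = (\<lambda>c \<phi> x. c * \<phi> x)"
 by (simp_all add: tensor_def functional_space_simps)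

lemma has_sum_swap_product: "((\<lambda>(f, e). q (e, f)) has_sum s) (B \<times> A) \<longleftrightarrow> (q has_sum s) (A \<times> B)"
proof -
 have "bij_betw prod.swap (B \<times> A) (A \<times> B)" by (rule bij_betwI[where g = prod.swap]) auto
 from has_sum_reindex_bij_betw[OF this, of q s] show ?thesis by (simp add: case_prod_unfold prod.swap_def)
qed

text \<open>Orthogonality to an elementary tensor is vanishing at its pair of factors, and vanishing
  spreads from \<open>S \<times> T\<close> to all pairs one slot at a time.\<close>

lemma tensor_total_total:
 assumes H: "hilbert_space H" and G: "hilbert_space G" and S: "S \<subseteq> hc H" "closed_span H S = hc H"
  and T: "T \<subseteq> hc G" "closed_span G T = hc G"
 shows "closed_span (tensor H G) ((\<lambda>(x, y). tensor_vec H G x y) ` (S \<times> T)) = hc (tensor H G)"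
proof (rule hilbert_space.totalI[OF hilbert_tensor[OF H G]])
 show "(\<lambda>(x, y). tensor_vec H G x y) ` (S \<times> T) \<subseteq> hc (tensor H G)"
  using S T tensor_vec_closed[OF H G] by fast
 fix \<phi> assume p: "\<phi> \<in> hc (tensor H G)"
  and o: "\<And>s. s \<in> (\<lambda>(x, y). tensor_vec H G x y) ` (S \<times> T) ==> hinner (tensor H G) s \<phi> = 0"
 have pF: "\<phi> \<in> bounded_antibilinear H G" using p by (simp add: tensor_carrier)
 obtain C where C: "\<And>x y. x\<in>hc H ==> y\<in>hc G ==> cmod (\<phi> (x, y)) \<le> C * hnorm H x * hnorm G y"
  using bounded_antibilinearD(3)[OF pF] by blast
 have 0: "\<phi> (x, y) = 0" if "x \<in> S" "y \<in> T" for x y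
 proof -
  have "hinner (tensor H G) (tensor_vec H G x y) \<phi> = 0" by (rule o) (use that in auto)
  then show ?thesis using inner_tensor_vec[OF H G _ _ p, of x y] that S T by auto
 qed
 have 1: "\<phi> (x, y) = 0" if x: "x \<in> hc H" and y: "y \<in> T" for x y
 proof -
  have yG: "y \<in> hc G" using T y by blast
  obtain z where z: "z \<in> hc H" "\<And>x. x \<in> hc H ==> \<phi> (x, y) = hinner H x z"
   by (rule antilinear_expansion[OF H, of "\<lambda>x. \<phi> (x, y)" "C * hnorm G y"])
    (use bounded_antibilinearD(1)[OF pF] C yG in \<open>auto simp: mult_ac\<close>)
  have "z = hzero H"
   by (rule pre_hilbert_space.total_eqI[OF hilbert_pre[OF H] S(2,1) z(1)])
    (use H S(1) z(2) 0[OF _ y] in \<open>auto simp: subset_iff\<close>)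
  then show ?thesis using z(2)[OF x] x H by simp
 qed
 have "\<phi> (x, y) = 0" if x: "x \<in> hc H" and y: "y \<in> hc G" for x y
 proof -
  obtain z where z: "z \<in> hc G" "\<And>y. y \<in> hc G ==> \<phi> (x, y) = hinner G y z"
   by (rule antilinear_expansion[OF G, of "\<lambda>y. \<phi> (x, y)" "C * hnorm H x"])
    (use bounded_antibilinearD(2)[OF pF] C x in \<open>auto simp: mult_ac\<close>)
  have "z = hzero G"
   by (rule pre_hilbert_space.total_eqI[OF hilbert_pre[OF G] T(2,1) z(1)])
    (use G T(1) z(2) 1[OF x] in \<open>auto simp: subset_iff\<close>)
  then show ?thesis using z(2)[OF y] y G by simp
 qed
 then have "\<phi> q = 0" for q using p by (cases q) (auto simp: tensor_carrier)
 then show "\<phi> = hzero (tensor H G)" by (auto simp: tensor_ops)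
qed

lemma tensor_vec_bop_left:
 assumes H: "hilbert_space H" and G: "hilbert_space G" and x: "x \<in> hc H"
 shows "(\<lambda>y\<in>hc G. tensor_vec H G x y) \<in> bop G (tensor H G)"
proof (rule bopI[where C = "hnorm H x"])
 interpret H: hilbert_space H by (rule H)
 interpret G: hilbert_space G by (rule G)
 show "hnorm (tensor H G) ((\<lambda>y\<in>hc G. tensor_vec H G x y) y) \<le> hnorm H x * hnorm G y"
  if y: "y \<in> hc G" for y
  using inner_tensor_vec_vec[OF H G x y x y] x y by (simp add: hnorm_def[of "tensor H G"] H.inner_self G.inner_self real_sqrt_mult)
qed (use assms tensor_vec_closed[OF H G x] in \<open>auto simp: tensor_ops tensor_vec_def algebra_simps\<close>)

lemma tensor_vec_bop_right:
 assumes H: "hilbert_space H" and G: "hilbert_space G" and y: "y \<in> hc G"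
 shows "(\<lambda>x\<in>hc H. tensor_vec H G x y) \<in> bop H (tensor H G)"
proof (rule bopI[where C = "hnorm G y"])
 interpret H: hilbert_space H by (rule H)
 interpret G: hilbert_space G by (rule G)
 show "hnorm (tensor H G) ((\<lambda>x\<in>hc H. tensor_vec H G x y) x) \<le> hnorm G y * hnorm H x"
  if x: "x \<in> hc H" for x
  using inner_tensor_vec_vec[OF H G x y x y] x y by (simp add: hnorm_def[of "tensor H G"] H.inner_self G.inner_self real_sqrt_mult mult.commute)
qed (use assms tensor_vec_closed[OF H G _ y] in \<open>auto simp: tensor_ops tensor_vec_def algebra_simps\<close>)

text \<open>On functionals the operator acts by composition with the adjoint of \<open>S\<close> in
  the first slot. Its norm is controlled slice by slice: at a basis vector \<open>f\<close> of
  \<open>G\<close> the slice of \<open>\<phi>\<close> is represented by a vector \<open>z f\<close>,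
  that of the image by \<open>S (z f)\<close>, and the bound \<open>D\<close> of \<open>S\<close>
  survives the sum over \<open>f\<close>.\<close>

lemma tensor_op_exists:
 assumes H: "hilbert_space H" and G: "hilbert_space G" and S: "S \<in> bops H"
 obtains X where "X \<in> bops (tensor H G)"
  "\<And>x y. x \<in> hc H ==> y \<in> hc G ==> X (tensor_vec H G x y) = tensor_vec H G (S x) y"
proof -
 interpret H: hilbert_space H by (rule H)
 interpret G: hilbert_space G by (rule G)
 note bH = some_basis_subset[OF H] and bG = some_basis_subset[OF G]
 define S' where "S' = hadj H H S"
 note a = hadj_props[OF H H S, folded S'_def]
 note a' = bopD[OF a(1)]
 obtain D where D: "D > 0" "\<And>x. x \<in> hc H ==> hnorm H (S x) \<le> D * hnorm H x"
  using bop_bound[OF S] by auto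
 obtain D' where D': "D' > 0" "\<And>x. x \<in> hc H ==> hnorm H (S' x) \<le> D' * hnorm H x"
  using bop_bound[OF a(1)] by auto
 define X where "X = (\<lambda>\<phi>\<in>hc (tensor H G). \<lambda>(x, y).
  if x \<in> hc H \<and> y \<in> hc G then \<phi> (S' x, y) else 0 :: complex)"
 have key: "X \<phi> \<in> hc (tensor H G) \<and> hnorm (tensor H G) (X \<phi>) \<le> D * hnorm (tensor H G) \<phi>"
  if p: "\<phi> \<in> hc (tensor H G)" for \<phi>
 proof -
  have pF: "\<phi> \<in> bounded_antibilinear H G" using p by (simp add: tensor_carrier)
  obtain C where C0: "\<And>x y. x\<in>hc H ==> y\<in>hc G ==> cmod (\<phi> (x, y)) \<le> C * hnorm H x * hnorm G y"
   using bounded_antibilinearD(3)[OF pF] by blast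
  have C: "cmod (\<phi> (x, y)) \<le> \<bar>C\<bar> * hnorm H x * hnorm G y" if "x\<in>hc H" "y\<in>hc G" for x y
  proof (rule order.trans[OF C0[OF that]])
   show "C * hnorm H x * hnorm G y \<le> \<bar>C\<bar> * hnorm H x * hnorm G y"
    using that by (intro mult_right_mono) auto
  qed
  have Xp: "X \<phi> (x, y) = \<phi> (S' x, y)" if "x \<in> hc H" "y \<in> hc G" for x y
   using that p by (simp add: X_def)
  have XF: "X \<phi> \<in> bounded_antibilinear H G"
  proof (rule bounded_antibilinearI[where C = "\<bar>C\<bar> * D'"])
   show "cmod (X \<phi> (x, y)) \<le> \<bar>C\<bar> * D' * hnorm H x * hnorm G y"
    if "x \<in> hc H" "y \<in> hc G" for x y
   proof -
    have "\<bar>C\<bar> * hnorm H (S' x) * hnorm G y \<le> \<bar>C\<bar> * (D' * hnorm H x) * hnorm G y"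
     using that D'(2)[of x] by (intro mult_right_mono mult_left_mono) auto
    then show ?thesis using C[of "S' x" y] that a' by (simp add: Xp mult.assoc)
   qed
  qed (use bounded_antibilinearD(1,2)[OF pF] a' in \<open>simp_all add: Xp\<close>)
  have "\<exists>z\<in>hc H. \<forall>x\<in>hc H. \<phi> (x, f) = hinner H x z" if f: "f \<in> some_basis G" for f
  proof -
   have fG: "f \<in> hc G" using f bG by blast
   obtain z where "z \<in> hc H" "\<And>x. x \<in> hc H ==> \<phi> (x, f) = hinner H x z"
    by (rule antilinear_expansion[OF H, of "\<lambda>x. \<phi> (x, f)" "\<bar>C\<bar> * hnorm G f"])
     (use bounded_antibilinearD(1)[OF pF] C fG in \<open>auto simp: mult_ac\<close>)
   then show ?thesis by blast
  qed
  then obtain z where z: "\<And>f. f \<in> some_basis G ==> z f \<in> hc H"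
   "\<And>f x. f \<in> some_basis G ==> x \<in> hc H ==> \<phi> (x, f) = hinner H x (z f)" by metis
  have Sz: "S (z f) \<in> hc H" if "f \<in> some_basis G" for f using bopD(1)[OF S] z(1)[OF that] by simp
  have in1: "((\<lambda>e. (cmod (\<phi> (e, f)))\<^sup>2) has_sum (hnorm H (z f))\<^sup>2) (some_basis H)" if f: "f \<in> some_basis G" for f
   by (rule has_sum_cong[THEN iffD1, OF _ parseval_norm[OF H z(1)[OF f]]]) (use z(2)[OF f] bH in auto)
  have in2: "((\<lambda>e. (cmod (X \<phi> (e, f)))\<^sup>2) has_sum (hnorm H (S (z f)))\<^sup>2) (some_basis H)" if f: "f \<in> some_basis G" for f
  proof (rule has_sum_cong[THEN iffD1, OF _ parseval_norm[OF H Sz[OF f]]])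
   fix e assume e: "e \<in> some_basis H"
   have eH: "e \<in> hc H" "f \<in> hc G" using e f bH bG by auto
   have "X \<phi> (e, f) = hinner H (S' e) (z f)" using Xp eH z(2)[OF f] a' by simp
   also have "\<dots> = hinner H e (S (z f))" using a(3)[OF z(1)[OF f] eH(1)] .
   finally show "(cmod (hinner H e (S (z f))))\<^sup>2 = (cmod (X \<phi> (e, f)))\<^sup>2" by simp
  qed
  have zs: "((\<lambda>f. (hnorm H (z f))\<^sup>2) has_sum (hnorm (tensor H G) \<phi>)\<^sup>2) (some_basis G)"
  proof (rule has_sum_SigmaD)
   show "((\<lambda>(f, e). (cmod (\<phi> (e, f)))\<^sup>2) has_sum (hnorm (tensor H G) \<phi>)\<^sup>2) (some_basis G \<times> some_basis H)"
    using tensor_norm_has_sum[OF H G p] has_sum_swap_product[of "\<lambda>p. (cmod (\<phi> p))\<^sup>2"] by simp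
  qed (use in1 in simp)
  have le: "(hnorm H (S (z f)))\<^sup>2 \<le> D\<^sup>2 * (hnorm H (z f))\<^sup>2" if f: "f \<in> some_basis G" for f
   using power_mono[OF D(2)[OF z(1)[OF f]], of 2] Sz[OF f] by (simp add: power_mult_distrib)
  have ss: "(\<lambda>f. (hnorm H (S (z f)))\<^sup>2) summable_on some_basis G"
   by (rule summable_on_comparison_test[OF summable_on_cmult_right[OF has_sum_imp_summable[OF zs], of "D\<^sup>2"]])
    (use le in auto)
  have sw: "(\<lambda>(f, e). (cmod (X \<phi> (e, f)))\<^sup>2) summable_on some_basis G \<times> some_basis H"
   by (rule summable_on_SigmaI[OF _ ss]) (use in2 in auto)
  then obtain s where s: "((\<lambda>(f, e). (cmod (X \<phi> (e, f)))\<^sup>2) has_sum s) (some_basis G \<times> some_basis H)"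
   by (auto simp: summable_on_def)
  have s1: "((\<lambda>p. (cmod (X \<phi> p))\<^sup>2) has_sum s) (some_basis H \<times> some_basis G)"
   using s has_sum_swap_product[of "\<lambda>p. (cmod (X \<phi> p))\<^sup>2"] by simp
  have XC: "X \<phi> \<in> hc (tensor H G)"
   unfolding tensor_carrier using XF has_sum_imp_summable[OF s1] p by (auto simp: X_def)
  have "s = (hnorm (tensor H G) (X \<phi>))\<^sup>2" using has_sum_unique[OF s1 tensor_norm_has_sum[OF H G XC]] .
  moreover have "s \<le> D\<^sup>2 * (hnorm (tensor H G) \<phi>)\<^sup>2"
  proof (rule has_sum_mono)
   show "((\<lambda>f. (hnorm H (S (z f)))\<^sup>2) has_sum s) (some_basis G)"
    by (rule has_sum_SigmaD[OF s]) (use in2 in simp)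
   show "((\<lambda>f. D\<^sup>2 * (hnorm H (z f))\<^sup>2) has_sum D\<^sup>2 * (hnorm (tensor H G) \<phi>)\<^sup>2) (some_basis G)"
    by (rule has_sum_cmult_right[OF zs])
  qed (use le in auto)
  ultimately have "(hnorm (tensor H G) (X \<phi>))\<^sup>2 \<le> (D * hnorm (tensor H G) \<phi>)\<^sup>2" by (simp add: power_mult_distrib)
  then have "hnorm (tensor H G) (X \<phi>) \<le> D * hnorm (tensor H G) \<phi>"
   by (rule power2_le_imp_le) (use D(1) p hilbert_tensor[OF H G] in simp)
  with XC show ?thesis by blast
 qed
 have "X \<in> bops (tensor H G)"
 proof (rule bopI[where C = D])
  interpret T: hilbert_space "tensor H G" by (rule hilbert_tensor[OF H G])
  show "X (hadd (tensor H G) \<phi> \<psi>) = hadd (tensor H G) (X \<phi>) (X \<psi>)"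
   if "\<phi> \<in> hc (tensor H G)" "\<psi> \<in> hc (tensor H G)" for \<phi> \<psi>
   using that T.add_closed[OF that] by (auto simp: X_def tensor_ops fun_eq_iff)
  show "X (hscale (tensor H G) c \<phi>) = hscale (tensor H G) c (X \<phi>)"
   if "\<phi> \<in> hc (tensor H G)" for c \<phi>
   using that T.scale_closed[OF that] by (auto simp: X_def tensor_ops fun_eq_iff)
 qed (use key in \<open>auto simp: X_def\<close>)
 moreover have "X (tensor_vec H G x y) = tensor_vec H G (S x) y" if "x \<in> hc H" "y \<in> hc G" for x y
  using that tensor_vec_closed[OF H G that] a' a(3) by (auto simp: X_def fun_eq_iff tensor_vec_def)
 ultimately show ?thesis using that by blast
qed

lemma tensor_op_one:
 assumes H: "hilbert_space H" and G: "hilbert_space G" and S: "S \<in> bops H"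
 shows "tensor_op H G S (scalar_op G 1) \<in> bops (tensor H G)"
  "\<And>x y. x \<in> hc H ==> y \<in> hc G ==>
   tensor_op H G S (scalar_op G 1) (tensor_vec H G x y) = tensor_vec H G (S x) y"
proof -
 obtain X where X: "X \<in> bops (tensor H G)"
  "\<And>x y. x \<in> hc H ==> y \<in> hc G ==> X (tensor_vec H G x y) = tensor_vec H G (S x) y"
  using tensor_op_exists[OF assms] by blast
 have "tensor_op H G S (scalar_op G 1) = X"
  unfolding tensor_op_def
 proof (rule the_equality)
  show "X \<in> bops (tensor H G) \<and> (\<forall>x\<in>hc H. \<forall>y\<in>hc G.
    X (tensor_vec H G x y) = tensor_vec H G (S x) (scalar_op G 1 y))" using X G by simp
  show "Y = X" if "Y \<in> bops (tensor H G) \<and> (\<forall>x\<in>hc H. \<forall>y\<in>hc G.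
    Y (tensor_vec H G x y) = tensor_vec H G (S x) (scalar_op G 1 y))" for Y
   by (rule bop_eq_total[OF hilbert_tensor[OF H G] hilbert_tensor[OF H G] _ X(1) tensor_total[OF H G]])
    (use that X tensor_vec_closed[OF H G] G in auto)
 qed
 with X show "tensor_op H G S (scalar_op G 1) \<in> bops (tensor H G)"
  "\<And>x y. x \<in> hc H ==> y \<in> hc G ==>
   tensor_op H G S (scalar_op G 1) (tensor_vec H G x y) = tensor_vec H G (S x) y" by auto
qed

text \<open>Unitary factors preserve the Gram matrix of the elementary tensors and permute these
  tensors, so \<open>unitary_extension\<close> supplies the operator; agreement on a total set
  settles the \<open>THE\<close>.\<close>

lemma tensor_list_op_unitary:
 assumes Hs: "\<And>H. H \<in> set Hs ==> hilbert_space H" and len: "length Us = length Hs"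
  and U: "\<And>i. i < length Hs ==> unitary_op (Hs ! i) (Hs ! i) (Us ! i)"
 shows "unitary_op (tensor_list Hs) (tensor_list Hs) (tensor_list_op Hs Us)"
  "\<And>xs. xs \<in> listset (map hc Hs) ==>
   tensor_list_op Hs Us (tensor_list_vec Hs xs) = tensor_list_vec Hs (map2 (\<lambda>R \<xi>. R \<xi>) Us xs)"
proof -
 let ?X = "listset (map hc Hs)" and ?m = "map2 (\<lambda>R \<xi>. R \<xi>) Us"
 note T = hilbert_tensor_list[OF Hs]
 note U' = unitary_opD[OF U]
 have hi: "hilbert_space (Hs ! i)" if "i < length Hs" for i using Hs that by simp
 have m: "?m xs \<in> ?X" if "xs \<in> ?X" for xs
  using that len bopD(1)[OF U'(1)] by (auto simp: in_listset_iff)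
 have surj: "\<exists>ys\<in>?X. ?m ys = xs" if xs: "xs \<in> ?X" for xs
 proof (intro bexI)
  let ?ys = "map2 (\<lambda>i x. hadj (Hs ! i) (Hs ! i) (Us ! i) x) [0..<length Hs] xs"
  show "?ys \<in> ?X"
   using xs bopD(1)[OF hadj_props(1)[OF hi hi U'(1)]] by (auto simp: in_listset_iff)
  show "?m ?ys = xs"
   by (rule nth_equalityI) (use xs len hadj_unitary_right[OF hi hi U] in \<open>auto simp: in_listset_iff\<close>)
 qed
 have gram: "pinner Hs (?m xs) (?m ys) = pinner Hs xs ys" if "xs \<in> ?X" "ys \<in> ?X" for xs ys
  unfolding pinner_def using that len U'(2) by (intro prod.cong) (auto simp: in_listset_iff)
 have tot: "closed_span (tensor_list Hs) ((\<lambda>xs. tensor_list_vec Hs (?m xs)) ` ?X) = hc (tensor_list Hs)"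
 proof -
  have "(\<lambda>xs. tensor_list_vec Hs (?m xs)) ` ?X = tensor_list_vec Hs ` ?X"
   using m surj by (force simp: image_iff)
  then show ?thesis using tensor_list_total[OF Hs] by simp
 qed
 obtain X where X: "unitary_op (tensor_list Hs) (tensor_list Hs) X"
  "\<And>xs. xs \<in> ?X ==> X (tensor_list_vec Hs xs) = tensor_list_vec Hs (?m xs)"
  by (rule unitary_extension[OF T T, where I = ?X and v = "tensor_list_vec Hs" and u = "\<lambda>xs. tensor_list_vec Hs (?m xs)"])
   (use tensor_list_vec_closed[OF Hs] m gram inner_tensor_list_vec_vec[OF Hs] tensor_list_total[OF Hs] tot Hs in auto)
 have "tensor_list_op Hs Us = X"
  unfolding tensor_list_op_def
 proof (rule the_equality)
  show "X \<in> bops (tensor_list Hs) \<and> (\<forall>xs\<in>?X. X (tensor_list_vec Hs xs) = tensor_list_vec Hs (?m xs))"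
   using X unitary_opD(1) by blast
  show "Y = X" if "Y \<in> bops (tensor_list Hs) \<and> (\<forall>xs\<in>?X. Y (tensor_list_vec Hs xs) = tensor_list_vec Hs (?m xs))" for Y
   by (rule bop_eq_total[OF T T _ unitary_opD(1)[OF X(1)] tensor_list_total[OF Hs]])
    (use that X tensor_list_vec_closed[OF Hs] Hs in auto)
 qed
 with X show "unitary_op (tensor_list Hs) (tensor_list Hs) (tensor_list_op Hs Us)"
  "\<And>xs. xs \<in> ?X ==> tensor_list_op Hs Us (tensor_list_vec Hs xs) = tensor_list_vec Hs (?m xs)" by auto
qed

context hilbert_family
begin

lemma hsum_op_unitary:
 assumes U: "\<And>i. i \<in> I ==> unitary_op (H i) (H i) (U i)"
 shows "unitary_op HS HS (hsum_op I H U)"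
  "\<And>i x. i \<in> I ==> x \<in> hc (H i) ==> hsum_op I H U (hsum_inj I H i x) = hsum_inj I H i (U i x)"
proof -
 note U' = unitary_opD[OF U]
 have Ub: "U i x \<in> hc (H i)" if "i \<in> I" "x \<in> hc (H i)" for i x
  using bopD(1)[OF U'(1)] that by simp
 have app: "hsum_op I H U v = (\<lambda>i\<in>I. U i (v i))" if "v \<in> hc HS" for v
  using that by (simp add: hsum_op_def)
 have cl: "hsum_op I H U v \<in> hc HS" if v: "v \<in> hc HS" for v
 proof -
  have "(\<lambda>i. (hnorm (H i) (v i))\<^sup>2) summable_on I" using v by (simp add: hsum_carrier)
  also have "?this \<longleftrightarrow> (\<lambda>i. (hnorm (H i) ((\<lambda>i\<in>I. U i (v i)) i))\<^sup>2) summable_on I"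
   by (rule summable_on_cong) (use U'(4) hsum_comp[OF v] in simp)
  finally show ?thesis using Ub hsum_comp[OF v] by (simp add: app[OF v] hsum_carrier)
 qed
 have inn: "hinner HS (hsum_op I H U v) (hsum_op I H U w) = hinner HS v w"
  if "v \<in> hc HS" "w \<in> hc HS" for v w
  unfolding hsum_simps by (rule infsum_cong) (use that U'(2) hsum_comp in \<open>simp add: app\<close>)
 interpret S: hilbert_space HS by (rule hilbert_hsum)
 have bo: "hsum_op I H U \<in> bops HS"
 proof (rule bopI[where C = 1])
  show "hsum_op I H U (hadd HS v w) = hadd HS (hsum_op I H U v) (hsum_op I H U w)"
   if "v \<in> hc HS" "w \<in> hc HS" for v w
  proof -
   have "hsum_op I H U (hadd HS v w) = (\<lambda>i\<in>I. U i (hadd HS v w i))"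
    by (rule app[OF S.add_closed[OF that]])
   also have "\<dots> = hadd HS (\<lambda>i\<in>I. U i (v i)) (\<lambda>i\<in>I. U i (w i))"
    unfolding hsum_simps by (rule restrict_ext) (use that bopD(2)[OF U'(1)] hsum_comp in simp)
   finally show ?thesis using that by (simp add: app)
  qed
  show "hsum_op I H U (hscale HS c v) = hscale HS c (hsum_op I H U v)"
   if "v \<in> hc HS" for c v
  proof -
   have "hsum_op I H U (hscale HS c v) = (\<lambda>i\<in>I. U i (hscale HS c v i))"
    by (rule app[OF S.scale_closed[OF that]])
   also have "\<dots> = hscale HS c (\<lambda>i\<in>I. U i (v i))"
    unfolding hsum_simps by (rule restrict_ext) (use that bopD(3)[OF U'(1)] hsum_comp in simp)
   finally show ?thesis using that by (simp add: app)
  qed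
  show "hnorm HS (hsum_op I H U v) \<le> 1 * hnorm HS v" if "v \<in> hc HS" for v
   using inn[OF that that] by (simp add: hnorm_def)
  show "hsum_op I H U \<in> hc HS \<rightarrow>\<^sub>E hc HS"
   using cl by (auto simp: hsum_op_def)
 qed
 have "hc HS \<subseteq> hsum_op I H U ` hc HS"
 proof
  fix w assume w: "w \<in> hc HS"
  define v where "v = (\<lambda>i\<in>I. hadj (H i) (H i) (U i) (w i))"
  have vi: "hadj (H i) (H i) (U i) (w i) \<in> hc (H i)" "U i (hadj (H i) (H i) (U i) (w i)) = w i" if "i \<in> I" for i
   using bopD(1)[OF hadj_props(1)[OF hilb[OF that] hilb[OF that] U'(1)[OF that]]]
    hadj_unitary_right[OF hilb[OF that] hilb[OF that] U[OF that]] hsum_comp[OF w that] by auto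
  have "(\<lambda>i. (hnorm (H i) (w i))\<^sup>2) summable_on I" using w by (simp add: hsum_carrier)
  also have "?this \<longleftrightarrow> (\<lambda>i. (hnorm (H i) (v i))\<^sup>2) summable_on I"
   by (rule summable_on_cong) (use U'(4)[OF _ vi(1)] vi in \<open>simp add: v_def\<close>)
  finally have v: "v \<in> hc HS" using vi by (simp add: hsum_carrier v_def)
  have "hsum_op I H U v = w"
   unfolding app[OF v] using w vi
   by (intro extensionalityI[of _ I]) (auto simp: hsum_carrier PiE_iff v_def)
  then show "w \<in> hsum_op I H U ` hc HS" using v by blast
 qed
 then show "unitary_op HS HS (hsum_op I H U)"
  unfolding unitary_op_def using bo inn cl by blast
 show "hsum_op I H U (hsum_inj I H i x) = hsum_inj I H i (U i x)" if "i \<in> I" "x \<in> hc (H i)" for i x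
  unfolding app[OF hsum_inj_closed[OF that]]
  by (auto simp: hsum_inj_def bop_zero[OF U'(1) pre_hilb pre_hilb] intro!: restrict_ext)
qed

end

section \<open>The free product Hilbert space\<close>

lemma closed_span_hsub:
 assumes h: "hilbert_space H" and S: "S \<subseteq> hc H"
 shows "closed_span (hsub H (closed_span H S)) S = closed_span H S"
proof -
 interpret hilbert_space H by (rule h)
 let ?L = "closed_span H S"
 have L: "closed_subspace H ?L" by (rule closed_span_closed[OF S])
 have LC: "?L \<subseteq> hc H" using closed_subspaceD(1)[OF L] .
 have "closed_span (hsub H ?L) S = hc (hsub H ?L)"
 proof (rule hilbert_space.totalI[OF hilbert_hsub[OF h L]])
  show "S \<subseteq> hc (hsub H ?L)" using closed_span_superset by simp
  fix x assume "x \<in> hc (hsub H ?L)" and o: "\<And>s. s \<in> S ==> hinner (hsub H ?L) s x = 0"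
  then have x: "x \<in> ?L" "x \<in> hc H" using LC by auto
  have "hinner H x s = 0" if "s \<in> S" for s
   using o[OF that] inner_commute[of s x] x that S by auto
  then have "?L \<subseteq> {y \<in> hc H. \<forall>z\<in>{x}. hinner H z y = 0}"
   using S x by (intro closed_span_least[OF orthogonal_closed_subspace]) auto
  then have "hinner H x x = 0" using x by blast
  then show "x = hzero (hsub H ?L)" using inner_eq_zero[OF x(2)] by simp
 qed
 then show ?thesis by simp
qed

lemma distinct_adj_Cons_iff: "distinct_adj (x # xs) \<longleftrightarrow> distinct_adj xs \<and> (xs = [] \<or> hd xs \<noteq> x)"
 by (cases xs) auto

locale free_product =
 fixes K :: "'k set" and H :: "'k \<Rightarrow> 'a hilb" and \<Omega> :: "'k \<Rightarrow> 'a"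
 assumes hilb: "k \<in> K ==> hilbert_space (H k)"
  and vac_in: "k \<in> K ==> \<Omega> k \<in> hc (H k)"
  and vac_norm: "k \<in> K ==> hnorm (H k) (\<Omega> k) = 1"
begin

abbreviation "W \<equiv> alternating_words K"
abbreviation "F \<equiv> free_hilb K H \<Omega>"
abbreviation "fv \<equiv> free_vec K H \<Omega>"
abbreviation "vac \<equiv> free_vacuum K H \<Omega>"
abbreviation "cplus k \<equiv> {x \<in> hc (H k). hinner (H k) (\<Omega> k) x = 0}"
abbreviation "args w \<equiv> listset (map hc (word_factors H \<Omega> w))"
abbreviation "fip w \<equiv> pinner (word_factors H \<Omega> w)"
abbreviation "starts k w \<equiv> w \<noteq> [] \<and> hd w = k"

definition idx :: "('k list \<times> 'a list) set" where
 "idx = {(w, xs). w \<in> W \<and> xs \<in> args w}"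

text \<open>The words that carry H(k). The empty word, hence the vacuum, is among them.\<close>

definition idx_off :: "'k \<Rightarrow> ('k list \<times> 'a list) set" where
 "idx_off k = {(w, xs). w \<in> W \<and> \<not> starts k w \<and> xs \<in> args w}"

lemma pre_hilb [simp]: "k \<in> K ==> pre_hilbert_space (H k)"
 using hilb by (rule hilbert_pre)

lemma hilb' [simp]: "k \<in> K ==> hilbert_space (H k)"
 by (rule hilb)

lemma vac_vac [simp]: "k \<in> K ==> hinner (H k) (\<Omega> k) (\<Omega> k) = 1"
 by (simp add: pre_hilbert_space.inner_self vac_in vac_norm)

lemma word_factors_simps [simp]:
 "word_factors H \<Omega> [] = []" "word_factors H \<Omega> (k # w) = hcompl (H k) (\<Omega> k) # word_factors H \<Omega> w"
 by (simp_all add: word_factors_def)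

lemma words_simps [simp]:
 "[] \<in> W" "k # w \<in> W \<longleftrightarrow> k \<in> K \<and> w \<in> W \<and> \<not> starts k w"
 by (auto simp: alternating_words_def distinct_adj_Cons_iff)

lemma word_hilb: "w \<in> W ==> G \<in> set (word_factors H \<Omega> w) ==> hilbert_space G"
 by (auto simp: word_factors_def alternating_words_def intro!: hilbert_hcompl hilb vac_in)

sublocale family: hilbert_family W "word_space H \<Omega>"
 by (rule hilbert_family.intro) (auto simp: word_space_def intro!: hilbert_tensor_list word_hilb)

lemma hilbert_F [simp]: "hilbert_space F"
 unfolding free_hilb_def by (rule family.hilbert_hsum)

sublocale F: hilbert_space F
 by (rule hilbert_F)

lemma word_vec_closed: "w \<in> W ==> xs \<in> args w ==> tensor_list_vec (word_factors H \<Omega> w) xs \<in> hc (word_space H \<Omega> w)"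
 unfolding word_space_def by (rule tensor_list_vec_closed[OF word_hilb])

lemma fv_closed [simp]: "w \<in> W ==> xs \<in> args w ==> fv w xs \<in> hc F"
 unfolding free_vec_def free_inj_def free_hilb_def
 by (rule family.hsum_inj_closed) (simp_all add: word_vec_closed)

lemma inner_fv:
 assumes "w \<in> W" "xs \<in> args w" "w' \<in> W" "ys \<in> args w'"
 shows "hinner F (fv w xs) (fv w' ys) = (if w = w' then fip w xs ys else 0)"
 unfolding free_vec_def free_inj_def free_hilb_def
 using assms family.inner_hsum_inj_inj[OF assms(1) word_vec_closed[OF assms(1,2)] assms(3) word_vec_closed[OF assms(3,4)]]
  inner_tensor_list_vec_vec[where Hs = "word_factors H \<Omega> w" and xs = xs and ys = ys, OF word_hilb[OF assms(1)]]
 by (cases "w = w'") (auto simp: word_space_def)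

lemma fv_total: "closed_span F ((\<lambda>(w, xs). fv w xs) ` idx) = hc F"
proof -
 have "closed_span F (\<Union>w\<in>W. free_inj K H \<Omega> w ` (tensor_list_vec (word_factors H \<Omega> w) ` args w)) = hc F"
  unfolding free_hilb_def free_inj_def
 proof (rule family.hsum_inj_total)
  fix w assume w: "w \<in> W"
  show "tensor_list_vec (word_factors H \<Omega> w) ` args w \<subseteq> hc (word_space H \<Omega> w)"
   using word_vec_closed[OF w] by blast
  show "closed_span (word_space H \<Omega> w) (tensor_list_vec (word_factors H \<Omega> w) ` args w) = hc (word_space H \<Omega> w)"
   unfolding word_space_def by (rule tensor_list_total[OF word_hilb[OF w]])
 qed
 also have "(\<Union>w\<in>W. free_inj K H \<Omega> w ` (tensor_list_vec (word_factors H \<Omega> w) ` args w)) = (\<lambda>(w, xs). fv w xs) ` idx"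
  by (auto simp: idx_def free_vec_def)
 finally show ?thesis .
qed

lemma fv_sub: "(\<lambda>(w, xs). fv w xs) ` idx \<subseteq> hc F"
 by (auto simp: idx_def)

lemma vac_eq: "vac = fv [] []"
 by (simp add: free_vacuum_def)

lemma vac_closed [simp]: "vac \<in> hc F"
 by (simp add: vac_eq)

lemma vac_inner [simp]: "hinner F vac vac = 1"
 by (simp add: vac_eq inner_fv)

lemma vac_norm_F: "hnorm F vac = 1"
 by (simp add: hnorm_def)

subsection \<open>The subspace of words that do not start with a given letter\<close>

abbreviation "G k \<equiv> free_sub K H \<Omega> k"

text \<open>The definition of H(k) spans by whole word spaces; elementary tensors suffice. If
  \<open>?d\<close> is the part of a vector of the summand \<open>w\<close> off their span, its
  component at \<open>w\<close> is orthogonal to all elementary tensors and hence zero. So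
  \<open>?d\<close> is orthogonal to that vector and to its projection, that is, to itself.\<close>

lemma G_eq: "G k = hsub F (closed_span F ((\<lambda>(w, xs). fv w xs) ` idx_off k))"
proof -
 let ?S = "insert vac (\<Union>w\<in>{w \<in> W. w \<noteq> [] \<and> hd w \<noteq> k}. free_inj K H \<Omega> w ` hc (word_space H \<Omega> w))"
 let ?T = "(\<lambda>(w, xs). fv w xs) ` idx_off k"
 have inj: "free_inj K H \<Omega> w \<phi> \<in> hc F" if "w \<in> W" "\<phi> \<in> hc (word_space H \<Omega> w)" for w \<phi>
  using family.hsum_inj_closed[OF that] by (simp add: free_inj_def free_hilb_def)
 have S: "?S \<subseteq> hc F" using inj by auto
 have T: "?T \<subseteq> hc F" by (auto simp: idx_off_def)
 have TS: "?T \<subseteq> ?S"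
 proof
  fix v assume "v \<in> ?T"
  then obtain w xs where v: "v = fv w xs" "w \<in> W" "\<not> starts k w" "xs \<in> args w" by (auto simp: idx_off_def)
  show "v \<in> ?S"
  proof (cases "w = []")
   case True then show ?thesis using v by (simp add: vac_eq)
  next
   case False then show ?thesis using v word_vec_closed[of w xs] by (auto simp: free_vec_def)
  qed
 qed
 have "?S \<subseteq> closed_span F ?T"
 proof -
  have LT: "closed_subspace F (closed_span F ?T)" by (rule F.closed_span_closed[OF T])
  have "free_inj K H \<Omega> w \<phi> \<in> closed_span F ?T"
   if w: "w \<in> W" "\<not> starts k w" and p: "\<phi> \<in> hc (word_space H \<Omega> w)" for w \<phi>
  proof -
   let ?v = "free_inj K H \<Omega> w \<phi>"
   let ?d = "hdiff F ?v (F.hproj (closed_span F ?T) ?v)"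
   have v: "?v \<in> hc F" using inj w p by blast
   have pc: "F.hproj (closed_span F ?T) ?v \<in> closed_span F ?T" using F.hproj_props(1)[OF LT v] .
   have dc: "?d \<in> hc F" using v LT by simp
   have "?d w = hzero (word_space H \<Omega> w)"
   proof (rule pre_hilbert_space.total_eqI[OF family.pre_hilb[OF w(1)]])
    show "closed_span (word_space H \<Omega> w) (tensor_list_vec (word_factors H \<Omega> w) ` args w) = hc (word_space H \<Omega> w)"
     unfolding word_space_def by (rule tensor_list_total[OF word_hilb[OF w(1)]])
    fix z assume "z \<in> tensor_list_vec (word_factors H \<Omega> w) ` args w"
    then obtain xs where z: "z = tensor_list_vec (word_factors H \<Omega> w) xs" "xs \<in> args w" by blast
    have zc: "z \<in> hc (word_space H \<Omega> w)" using z word_vec_closed[OF w(1)] by simp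
    have "fv w xs \<in> closed_span F ?T"
     using w z by (intro F.closed_span_superset[THEN subsetD]) (auto simp: idx_off_def)
    then have "hinner F (fv w xs) ?d = 0" by (rule F.hproj_props(2)[OF LT v])
    then have "hinner (word_space H \<Omega> w) z (?d w) = 0"
     using family.inner_hsum_inj[OF w(1) zc, of ?d] dc z by (simp add: free_vec_def free_inj_def free_hilb_def)
    then show "hinner (word_space H \<Omega> w) z (?d w) = hinner (word_space H \<Omega> w) z (hzero (word_space H \<Omega> w))"
     using zc family.pre_hilb[OF w(1)] by simp
   qed (use word_vec_closed[OF w(1)] family.hsum_comp[OF dc[unfolded free_hilb_def] w(1)] family.pre_hilb[OF w(1)]
    in \<open>auto simp: free_hilb_def\<close>)
   then have "hinner F ?v ?d = 0"
    using family.inner_hsum_inj[OF w(1) p, of ?d] dc p family.pre_hilb[OF w(1)]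
    by (simp add: free_inj_def free_hilb_def)
   moreover have "hinner F (F.hproj (closed_span F ?T) ?v) ?d = 0" by (rule F.hproj_props(2)[OF LT v pc])
   ultimately have "hinner F ?d ?d = 0" using v LT dc by simp
   then have "?v = F.hproj (closed_span F ?T) ?v"
    using F.inner_eq_zero[OF dc] F.diff_zero_iff[OF v] LT v by simp
   then show ?thesis using pc by simp
  qed
  moreover have "vac \<in> closed_span F ?T"
   by (intro F.closed_span_superset[THEN subsetD]) (auto simp: idx_off_def vac_eq intro!: image_eqI[of _ _ "([], [])"])
  ultimately show ?thesis by auto
 qed
 then have "closed_span F ?S = closed_span F ?T"
  using F.closed_span_least[OF F.closed_span_closed[OF T]] F.closed_span_least[OF F.closed_span_closed[OF S]]
   TS F.closed_span_superset[of ?S] by (meson subset_antisym subset_trans)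
 then show ?thesis by (simp add: free_sub_def)
qed

lemma off_sub: "(\<lambda>(w, xs). fv w xs) ` idx_off k \<subseteq> hc F"
 by (auto simp: idx_off_def)

lemma G_closed: "closed_subspace F (closed_span F ((\<lambda>(w, xs). fv w xs) ` idx_off k))"
 by (rule F.closed_span_closed[OF off_sub])

lemma hilbert_G [simp]: "hilbert_space (G k)"
 unfolding G_eq by (rule hilbert_hsub[OF hilbert_F G_closed])

lemma G_ops [simp]:
 "hadd (G k) = hadd F" "hscale (G k) = hscale F" "hinner (G k) = hinner F" "hzero (G k) = hzero F"
 "hnorm (G k) = hnorm F"
 by (simp_all add: G_eq)

lemma G_sub: "hc (G k) \<subseteq> hc F"
 unfolding G_eq using F.closed_subspaceD(1)[OF G_closed] by simp

lemma G_in_F: "\<eta> \<in> hc (G k) ==> \<eta> \<in> hc F"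
 using G_sub by blast

lemma G_total: "closed_span (G k) ((\<lambda>(w, xs). fv w xs) ` idx_off k) = hc (G k)"
 unfolding G_eq using closed_span_hsub[OF hilbert_F off_sub] by simp

lemma fv_in_G: "w \<in> W ==> \<not> starts k w ==> xs \<in> args w ==> fv w xs \<in> hc (G k)"
 unfolding G_eq using F.closed_span_superset[of "(\<lambda>(w, xs). fv w xs) ` idx_off k"] by (auto simp: idx_off_def)

lemma fv_off_in_G: "(\<lambda>(w, xs). fv w xs) ` idx_off k \<subseteq> hc (G k)"
 using fv_in_G by (auto simp: idx_off_def)

lemma vac_in_G [simp]: "vac \<in> hc (G k)"
 unfolding vac_eq by (rule fv_in_G) auto

subsection \<open>The unitary \<open>V\<close>\<close>

definition vc :: "'k \<Rightarrow> 'a \<Rightarrow> complex" where "vc k x = hinner (H k) (\<Omega> k) x"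
definition pp :: "'k \<Rightarrow> 'a \<Rightarrow> 'a" where "pp k x = hdiff (H k) x (hscale (H k) (vc k x) (\<Omega> k))"

lemma pp_in: "k \<in> K ==> x \<in> hc (H k) ==> pp k x \<in> cplus k"
 by (simp add: pp_def vc_def vac_in)

lemma vc_pp:
 assumes "k \<in> K" "x \<in> hc (H k)"
 shows "x = hadd (H k) (hscale (H k) (vc k x) (\<Omega> k)) (pp k x)"
 by (rule pre_hilbert_space.eqI[OF pre_hilb[OF assms(1)]]) (use assms in \<open>simp_all add: pp_def vac_in\<close>)

lemma vc_vac [simp]: "k \<in> K ==> vc k (\<Omega> k) = 1"
 by (simp add: vc_def)

lemma vc_cplus [simp]: "x \<in> cplus k ==> vc k x = 0"
 by (simp add: vc_def)

lemma pp_cplus: "k \<in> K ==> x \<in> cplus k ==> pp k x = x"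
 by (simp add: pp_def vc_def vac_in)

lemma pp_vac: "k \<in> K ==> pp k (\<Omega> k) = hzero (H k)"
 by (simp add: pp_def vac_in)

lemma inner_vc_pp:
 assumes "k \<in> K" "x \<in> hc (H k)" "y \<in> hc (H k)"
 shows "hinner (H k) x y = cnj (vc k x) * vc k y + hinner (H k) (pp k x) (pp k y)"
 using assms pre_hilbert_space.inner_commute[OF pre_hilb[OF assms(1)], of "\<Omega> k" x]
 by (simp add: pp_def vac_in vc_def algebra_simps)

lemma args_Cons [simp]: "x # xs \<in> args (k # w) \<longleftrightarrow> x \<in> cplus k \<and> xs \<in> args w"
 by (simp del: listset.simps)

lemma fv_Cons_zero:
 assumes "k # w \<in> W" "xs \<in> args w"
 shows "fv (k # w) (hzero (H k) # xs) = hzero F"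
proof -
 have k: "k \<in> K" using assms by simp
 then have c: "fv (k # w) (hzero (H k) # xs) \<in> hc F"
  using assms vac_in[OF k] by (intro fv_closed) (simp_all del: words_simps listset.simps)
 have "hinner F (fv (k # w) (hzero (H k) # xs)) (fv (k # w) (hzero (H k) # xs)) = 0"
  using assms k vac_in[OF k] by (subst inner_fv) (simp_all del: words_simps listset.simps)
 then show ?thesis using F.inner_eq_zero[OF c] by simp
qed

text \<open>The value that V must take on the tensor of \<open>x\<close> with
  \<open>fv w xs\<close>. Splitting \<open>x\<close> into its vacuum part and the rest merges the
  four defining cases of V into one formula, the empty word included.\<close>

definition act0 :: "'k \<Rightarrow> 'a \<Rightarrow> 'k list \<Rightarrow> 'a list \<Rightarrow> 'k list \<Rightarrow> 'a list \<Rightarrow> complex" where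
 "act0 k x w xs = hadd F (hscale F (vc k x) (fv w xs)) (fv (k # w) (pp k x # xs))"

lemma idx_off_Cons:
 assumes "k \<in> K" "(w, xs) \<in> idx_off k"
 shows "w \<in> W" "xs \<in> args w" "k # w \<in> W" "\<not> starts k w"
  "\<And>x. x \<in> hc (H k) ==> pp k x # xs \<in> args (k # w)" "fv w xs \<in> hc (G k)"
 using assms pp_in fv_in_G by (auto simp: idx_off_def simp del: listset.simps)

lemma act0_closed:
 assumes "k \<in> K" "(w, xs) \<in> idx_off k" "x \<in> hc (H k)"
 shows "act0 k x w xs \<in> hc F"
 unfolding act0_def using idx_off_Cons[OF assms(1,2)] assms(3)
 by (intro F.add_closed F.scale_closed fv_closed) auto

text \<open>No word of \<open>idx_off k\<close> starts with \<open>k\<close>, so the cross terms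
  between \<open>w\<close> and \<open>k # w'\<close> vanish. The right side is the Gram matrix of
  the tensors of \<open>x\<close> with \<open>fv w xs\<close>, which is what
  \<open>unitary_extension\<close> asks for to produce V.\<close>

lemma act0_gram:
 assumes k: "k \<in> K" and 1: "(w, xs) \<in> idx_off k" "x \<in> hc (H k)"
  and 2: "(w', ys) \<in> idx_off k" "y \<in> hc (H k)"
 shows "hinner F (act0 k x w xs) (act0 k y w' ys) = hinner (H k) x y * hinner F (fv w xs) (fv w' ys)"
proof -
 note i = idx_off_Cons[OF k 1(1)] and j = idx_off_Cons[OF k 2(1)]
 note a = i(5)[OF 1(2)] and b = j(5)[OF 2(2)]
 have ne: "k # w \<noteq> w'" "k # w' \<noteq> w" using i(4) j(4) by auto
 note c = fv_closed[OF i(1,2)] fv_closed[OF i(3) a] fv_closed[OF j(1,2)] fv_closed[OF j(3) b]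
 have "hinner F (act0 k x w xs) (act0 k y w' ys)
   = cnj (vc k x) * vc k y * hinner F (fv w xs) (fv w' ys)
    + hinner F (fv (k # w) (pp k x # xs)) (fv (k # w') (pp k y # ys))"
  unfolding act0_def using c ne
  by (simp add: inner_fv[OF i(1,2) j(3) b] inner_fv[OF i(3) a j(1,2)] algebra_simps del: words_simps listset.simps)
 also have "hinner F (fv (k # w) (pp k x # xs)) (fv (k # w') (pp k y # ys))
   = hinner (H k) (pp k x) (pp k y) * hinner F (fv w xs) (fv w' ys)"
  unfolding inner_fv[OF i(3) a j(3) b] inner_fv[OF i(1,2) j(1,2)] by simp
 finally show ?thesis unfolding inner_vc_pp[OF k 1(2) 2(2)] by (simp add: algebra_simps)
qed

lemma words_cases:
 assumes k: "k \<in> K" and w: "w \<in> W" "xs \<in> args w"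
 obtains "(w, xs) \<in> idx_off k"
 | x w' xs' where "w = k # w'" "xs = x # xs'" "x \<in> cplus k" "(w', xs') \<in> idx_off k"
proof (cases "starts k w")
 case False
 then show ?thesis using that(1) w by (simp add: idx_off_def)
next
 case True
 then obtain w' where w': "w = k # w'" by (cases w) auto
 with w obtain x xs' where "xs = x # xs'" "x \<in> cplus k" "xs' \<in> args w'" by (auto simp: set_Cons_def)
 then show ?thesis using that(2) w w' by (simp add: idx_off_def)
qed

lemma act0_vac: "k \<in> K ==> (w, xs) \<in> idx_off k ==> act0 k (\<Omega> k) w xs = fv w xs"
 using idx_off_Cons[of k w xs] by (simp add: act0_def pp_vac fv_Cons_zero)

lemma act0_cplus:
 assumes "k \<in> K" "(w, xs) \<in> idx_off k" "x \<in> cplus k"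
 shows "act0 k x w xs = fv (k # w) (x # xs)"
proof -
 note i = idx_off_Cons[OF assms(1,2)]
 have "fv (k # w) (x # xs) \<in> hc F"
  using i(5)[of x] assms by (intro fv_closed i(3)) (simp add: pp_cplus del: listset.simps)
 then show ?thesis
  using i(1,2) assms by (simp add: act0_def pp_cplus del: words_simps listset.simps)
qed

definition idx_act :: "'k \<Rightarrow> ('a \<times> 'k list \<times> 'a list) set" where
 "idx_act k = hc (H k) \<times> idx_off k"

text \<open>Every elementary tensor is of this form: \<open>x\<close> is the vacuum vector, or the
  first letter if the word starts with \<open>k\<close>.\<close>

lemma act0_total:
 assumes k: "k \<in> K"
 shows "closed_span F ((\<lambda>(x, w, xs). act0 k x w xs) ` idx_act k) = hc F"
proof -
 let ?T = "(\<lambda>(x, w, xs). act0 k x w xs) ` idx_act k"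
 have sub: "?T \<subseteq> hc F" using act0_closed[OF k] by (auto simp: idx_act_def)
 have "(\<lambda>(w, xs). fv w xs) ` idx \<subseteq> ?T"
 proof
  fix v assume "v \<in> (\<lambda>(w, xs). fv w xs) ` idx"
  then obtain w xs where v: "v = fv w xs" "w \<in> W" "xs \<in> args w" by (auto simp: idx_def)
  from k v(2,3) show "v \<in> ?T"
  proof (cases rule: words_cases)
   case 1
   then have "v = act0 k (\<Omega> k) w xs" using v act0_vac[OF k] by simp
   then show ?thesis using 1 vac_in[OF k] by (auto simp: idx_act_def intro!: image_eqI[of _ _ "(\<Omega> k, w, xs)"])
  next
   case (2 x w' xs')
   then have "v = act0 k x w' xs'" using v act0_cplus[OF k] by simp
   then show ?thesis using 2 by (auto simp: idx_act_def intro!: image_eqI[of _ _ "(x, w', xs')"])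
  qed
 qed
 then show ?thesis
  using F.total_induct[OF fv_total F.closed_span_closed[OF sub]] F.closed_span_superset[of ?T] by blast
qed

abbreviation "HG k \<equiv> tensor (H k) (G k)"
abbreviation "tv k \<equiv> tensor_vec (H k) (G k)"

lemma HG [simp]: "k \<in> K ==> hilbert_space (HG k)"
 by (rule hilbert_tensor) auto

lemma tv_closed [simp]: "k \<in> K ==> x \<in> hc (H k) ==> \<eta> \<in> hc (G k) ==> tv k x \<eta> \<in> hc (HG k)"
 by (rule tensor_vec_closed) auto

lemma tv_total:
 assumes k: "k \<in> K"
 shows "closed_span (HG k) ((\<lambda>(x, w, xs). tv k x (fv w xs)) ` idx_act k) = hc (HG k)"
proof -
 have "(\<lambda>(x, w, xs). tv k x (fv w xs)) ` idx_act k
   = (\<lambda>(x, y). tv k x y) ` (hc (H k) \<times> (\<lambda>(w, xs). fv w xs) ` idx_off k)"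
  by (force simp: idx_act_def)
 moreover have "closed_span (H k) (hc (H k)) = hc (H k)"
 proof (rule hilbert_space.totalI)
  show "x = hzero (H k)" if "x \<in> hc (H k)" "\<And>s. s \<in> hc (H k) ==> hinner (H k) s x = 0" for x
   using that pre_hilbert_space.inner_eq_zero[OF pre_hilb[OF k]] by blast
 qed (use k in auto)
 ultimately show ?thesis
  using tensor_total_total[OF hilb[OF k] hilbert_G subset_refl _ fv_off_in_G G_total] by simp
qed

lemma tv_left:
 assumes k: "k \<in> K" and x: "x \<in> hc (H k)" and e: "\<eta> \<in> hc (G k)"
 shows "tv k x \<eta> = hadd (HG k) (hscale (HG k) (vc k x) (tv k (\<Omega> k) \<eta>)) (tv k (pp k x) \<eta>)"
proof -
 let ?f = "\<lambda>x\<in>hc (H k). tv k x \<eta>"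
 have f: "?f \<in> bop (H k) (HG k)" by (rule tensor_vec_bop_right) (use k e in auto)
 have "?f x = ?f (hadd (H k) (hscale (H k) (vc k x) (\<Omega> k)) (pp k x))" using vc_pp[OF k x] by simp
 also have "\<dots> = hadd (HG k) (hscale (HG k) (vc k x) (?f (\<Omega> k))) (?f (pp k x))"
  using k vac_in[OF k] pp_in[OF k x] bopD(2,3)[OF f] by simp
 finally show ?thesis using k x vac_in[OF k] pp_in[OF k x] by simp
qed

definition V_spec :: "'k \<Rightarrow>
  (('a \<times> ('k list \<Rightarrow> 'a list \<Rightarrow> complex) \<Rightarrow> complex) \<Rightarrow> 'k list \<Rightarrow> 'a list \<Rightarrow> complex) \<Rightarrow> bool" where
 "V_spec k V \<longleftrightarrow> unitary_op (HG k) F V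
   \<and> V (tv k (\<Omega> k) vac) = vac
   \<and> (\<forall>\<xi>\<in>cplus k. V (tv k \<xi> vac) = fv [k] [\<xi>])
   \<and> (\<forall>\<eta>\<in>hc (hcompl (G k) vac). V (tv k (\<Omega> k) \<eta>) = \<eta>)
   \<and> (\<forall>\<xi>\<in>cplus k. \<forall>w\<in>W. w \<noteq> [] \<longrightarrow> hd w \<noteq> k \<longrightarrow>
     (\<forall>\<eta>s\<in>args w. V (tv k \<xi> (fv w \<eta>s)) = fv (k # w) (\<xi> # \<eta>s)))"

text \<open>The defining clauses determine V on a total set; this is its uniqueness, and the link
  from \<open>free_V\<close> to \<open>act0\<close>.\<close>

lemma V_spec_act0:
 assumes k: "k \<in> K" and V: "V_spec k V" and x: "x \<in> hc (H k)" and i: "(w, xs) \<in> idx_off k"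
 shows "V (tv k x (fv w xs)) = act0 k x w xs"
proof -
 note i' = idx_off_Cons[OF k i]
 have b: "V \<in> bop (HG k) F" using V by (simp add: V_spec_def unitary_op_def)
 have 1: "V (tv k (\<Omega> k) (fv w xs)) = fv w xs"
 proof (cases "w = []")
  case True then show ?thesis using V i' by (simp add: V_spec_def vac_eq)
 next
  case False
  then have "fv w xs \<in> hc (hcompl (G k) vac)" using i' by (simp add: vac_eq inner_fv)
  then show ?thesis using V unfolding V_spec_def by blast
 qed
 have 2: "V (tv k (pp k x) (fv w xs)) = fv (k # w) (pp k x # xs)"
 proof (cases "w = []")
  case True then show ?thesis using V i' pp_in[OF k x] by (simp add: V_spec_def vac_eq)
 next
  case False
  then show ?thesis using V i' pp_in[OF k x] unfolding V_spec_def by blast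
 qed
 show ?thesis
  unfolding tv_left[OF k x i'(6)] act0_def
  using k x i' pp_in[OF k x] vac_in[OF k] by (simp add: bopD(2,3)[OF b] 1 2)
qed

lemma V_exists:
 assumes k: "k \<in> K"
 shows "\<exists>V. V_spec k V \<and> (\<forall>\<eta>\<in>hc (G k). V (tv k (\<Omega> k) \<eta>) = \<eta>)"
proof -
 obtain V where V: "unitary_op (HG k) F V"
  "\<And>i. i \<in> idx_act k ==> V ((\<lambda>(x, w, xs). tv k x (fv w xs)) i) = (\<lambda>(x, w, xs). act0 k x w xs) i"
 proof (rule unitary_extension[OF HG[OF k] hilbert_F _ _ tv_total[OF k] act0_total[OF k]])
  show "(\<lambda>(x, w, xs). tv k x (fv w xs)) i \<in> hc (HG k)" if "i \<in> idx_act k" for i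
   using that k idx_off_Cons[OF k] by (auto simp: idx_act_def)
  show "(\<lambda>(x, w, xs). act0 k x w xs) i \<in> hc F" if "i \<in> idx_act k" for i
   using that act0_closed[OF k] by (auto simp: idx_act_def)
  show "hinner F ((\<lambda>(x, w, xs). act0 k x w xs) i) ((\<lambda>(x, w, xs). act0 k x w xs) j)
    = hinner (HG k) ((\<lambda>(x, w, xs). tv k x (fv w xs)) i) ((\<lambda>(x, w, xs). tv k x (fv w xs)) j)"
   if "i \<in> idx_act k" "j \<in> idx_act k" for i j
  proof -
   obtain x w xs where i: "i = (x, w, xs)" "x \<in> hc (H k)" "(w, xs) \<in> idx_off k"
    using \<open>i \<in> idx_act k\<close> by (cases i) (auto simp: idx_act_def)
   obtain y w' ys where j: "j = (y, w', ys)" "y \<in> hc (H k)" "(w', ys) \<in> idx_off k"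
    using \<open>j \<in> idx_act k\<close> by (cases j) (auto simp: idx_act_def)
   show ?thesis
    using inner_tensor_vec_vec[OF hilb[OF k] hilbert_G i(2) idx_off_Cons(6)[OF k i(3)] j(2) idx_off_Cons(6)[OF k j(3)]]
     act0_gram[OF k i(3,2) j(3,2)] by (simp add: i(1) j(1))
  qed
 qed blast
 have V': "V (tv k x (fv w xs)) = act0 k x w xs" if "x \<in> hc (H k)" "(w, xs) \<in> idx_off k" for x w xs
  using V(2)[of "(x, w, xs)"] that by (simp add: idx_act_def)
 note b = unitary_opD(1)[OF V(1)]
 \<comment> \<open>The clause for the tensors of the vacuum with \<open>\<eta>\<close> ranges over
   all vectors of H(k), not only over elementary tensors, so it needs a density argument.\<close>
 have vacfix: "V (tv k (\<Omega> k) \<eta>) = \<eta>" if e: "\<eta> \<in> hc (G k)" for \<eta>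
 proof -
  let ?f = "\<lambda>\<eta>\<in>hc (G k). tv k (\<Omega> k) \<eta>"
  have f: "?f \<in> bop (G k) (HG k)" by (rule tensor_vec_bop_left) (use k vac_in in auto)
  have "compose (hc (G k)) V ?f = (\<lambda>\<eta>\<in>hc (G k). \<eta>)"
  proof (rule bop_eq_total[OF hilbert_G hilbert_F _ _ G_total fv_off_in_G])
   show "compose (hc (G k)) V ?f \<in> bop (G k) F" using k by (intro bop_compose[OF f b]) auto
   show "(\<lambda>\<eta>\<in>hc (G k). \<eta>) \<in> bop (G k) F"
   proof (rule bopI[where C = 1])
    show "(\<lambda>\<eta>\<in>hc (G k). \<eta>) (hadd (G k) \<xi> \<eta>) = hadd F ((\<lambda>\<eta>\<in>hc (G k). \<eta>) \<xi>) ((\<lambda>\<eta>\<in>hc (G k). \<eta>) \<eta>)"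
     if "\<xi> \<in> hc (G k)" "\<eta> \<in> hc (G k)" for \<xi> \<eta>
     using that pre_hilbert_space.add_closed[OF hilbert_pre[OF hilbert_G], of \<xi> k \<eta>] by auto
    show "(\<lambda>\<eta>\<in>hc (G k). \<eta>) (hscale (G k) c \<xi>) = hscale F c ((\<lambda>\<eta>\<in>hc (G k). \<eta>) \<xi>)"
     if "\<xi> \<in> hc (G k)" for \<xi> c
     using that pre_hilbert_space.scale_closed[OF hilbert_pre[OF hilbert_G], of \<xi> k] by auto
   qed (use G_sub in auto)
   show "compose (hc (G k)) V ?f s = (\<lambda>\<eta>\<in>hc (G k). \<eta>) s"
    if "s \<in> (\<lambda>(w, xs). fv w xs) ` idx_off k" for s
    using that V'[OF vac_in[OF k]] act0_vac[OF k] idx_off_Cons(6)[OF k] by (auto simp: compose_def)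
  qed
  from fun_cong[OF this, of \<eta>] show ?thesis using e by (simp add: compose_def)
 qed
 have "V_spec k V"
  unfolding V_spec_def
 proof (intro conjI ballI impI)
  show "V (tv k \<xi> vac) = fv [k] [\<xi>]" if "\<xi> \<in> cplus k" for \<xi>
  proof -
   have "([], []) \<in> idx_off k" by (simp add: idx_off_def)
   then show ?thesis using V'[of \<xi> "[]" "[]"] act0_cplus[OF k _ that] that by (simp add: vac_eq)
  qed
  show "V (tv k \<xi> (fv w \<eta>s)) = fv (k # w) (\<xi> # \<eta>s)"
   if "\<xi> \<in> cplus k" "w \<in> W" "w \<noteq> []" "hd w \<noteq> k" "\<eta>s \<in> args w" for \<xi> w \<eta>s
  proof -
   have "(w, \<eta>s) \<in> idx_off k" using that by (simp add: idx_off_def)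
   then show ?thesis using V'[of \<xi> w \<eta>s] act0_cplus[OF k _ that(1)] that by simp
  qed
 qed (use V(1) vacfix in auto)
 with vacfix show ?thesis by blast
qed

lemma V_unique:
 assumes k: "k \<in> K" and "V_spec k V" "V_spec k V'"
 shows "V = V'"
proof (rule bop_eq_total[OF HG[OF k] hilbert_F _ _ tv_total[OF k]])
 show "V \<in> bop (HG k) F" "V' \<in> bop (HG k) F" using assms by (simp_all add: V_spec_def unitary_op_def)
qed (use V_spec_act0[OF k assms(2)] V_spec_act0[OF k assms(3)] k idx_off_Cons(6)[OF k] in \<open>auto simp: idx_act_def\<close>)

abbreviation "V \<equiv> free_V K H \<Omega>"

lemma V_spec_V:
 assumes k: "k \<in> K"
 shows "V_spec k (V k)" "\<And>\<eta>. \<eta> \<in> hc (G k) ==> V k (tv k (\<Omega> k) \<eta>) = \<eta>"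
proof -
 obtain V0 where V0: "V_spec k V0" "\<And>\<eta>. \<eta> \<in> hc (G k) ==> V0 (tv k (\<Omega> k) \<eta>) = \<eta>"
  using V_exists[OF k] by blast
 have "V k = (THE V. V_spec k V)" unfolding free_V_def V_spec_def Let_def hcompl_simps(1)[of "H k"] ..
 also have "\<dots> = V0" using V0(1) V_unique[OF k] by blast
 finally show "V_spec k (V k)" "\<And>\<eta>. \<eta> \<in> hc (G k) ==> V k (tv k (\<Omega> k) \<eta>) = \<eta>" using V0 by auto
qed

lemma V_unitary: "k \<in> K ==> unitary_op (HG k) F (V k)"
 using V_spec_V(1) by (simp add: V_spec_def)

end

section \<open>Left and right actions on the free product\<close>

context free_product
begin

text \<open>In these coordinates \<open>lam k S\<close> acts on the first argument alone, see
  \<open>lam_act\<close>; on H(k) itself only \<open>S (\<Omega> k)\<close> matters, see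
  \<open>lam_G\<close>.\<close>

definition act :: "'k \<Rightarrow> 'a \<Rightarrow> ('k list \<Rightarrow> 'a list \<Rightarrow> complex) \<Rightarrow> 'k list \<Rightarrow> 'a list \<Rightarrow> complex" where
 "act k x \<eta> = V k (tv k x \<eta>)"

abbreviation "lam \<equiv> free_lambda K H \<Omega>"

lemma V_bop: "k \<in> K ==> V k \<in> bop (HG k) F"
 by (rule unitary_opD(1)[OF V_unitary])

lemma act_closed [simp]:
 "k \<in> K ==> x \<in> hc (H k) ==> \<eta> \<in> hc (G k) ==> act k x \<eta> \<in> hc F"
 unfolding act_def by (rule bopD(1)[OF V_bop]) simp_all

lemma inner_act:
 assumes "k \<in> K" "x \<in> hc (H k)" "y \<in> hc (H k)" "\<eta> \<in> hc (G k)" "\<zeta> \<in> hc (G k)"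
 shows "hinner F (act k x \<eta>) (act k y \<zeta>) = hinner (H k) x y * hinner F \<eta> \<zeta>"
 unfolding act_def unitary_opD(2)[OF V_unitary[OF assms(1)] tv_closed[OF assms(1,2,4)] tv_closed[OF assms(1,3,5)]]
 using inner_tensor_vec_vec[OF hilb[OF assms(1)] hilbert_G assms(2,4,3,5)] by simp

lemma act_bop_left:
 assumes "k \<in> K" "\<eta> \<in> hc (G k)"
 shows "(\<lambda>x\<in>hc (H k). act k x \<eta>) \<in> bop (H k) F"
proof -
 have "compose (hc (H k)) (V k) (\<lambda>x\<in>hc (H k). tv k x \<eta>) \<in> bop (H k) F"
  using assms by (intro bop_compose[OF tensor_vec_bop_right V_bop]) auto
 also have "compose (hc (H k)) (V k) (\<lambda>x\<in>hc (H k). tv k x \<eta>) = (\<lambda>x\<in>hc (H k). act k x \<eta>)"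
  by (auto simp: compose_def act_def)
 finally show ?thesis .
qed

lemma act_bop_right:
 assumes "k \<in> K" "x \<in> hc (H k)"
 shows "(\<lambda>\<eta>\<in>hc (G k). act k x \<eta>) \<in> bop (G k) F"
proof -
 have "compose (hc (G k)) (V k) (\<lambda>\<eta>\<in>hc (G k). tv k x \<eta>) \<in> bop (G k) F"
  using assms by (intro bop_compose[OF tensor_vec_bop_left V_bop]) auto
 also have "compose (hc (G k)) (V k) (\<lambda>\<eta>\<in>hc (G k). tv k x \<eta>) = (\<lambda>\<eta>\<in>hc (G k). act k x \<eta>)"
  by (auto simp: compose_def act_def)
 finally show ?thesis .
qed

lemma act_fv: "k \<in> K ==> x \<in> hc (H k) ==> (w, xs) \<in> idx_off k ==> act k x (fv w xs) = act0 k x w xs"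
 unfolding act_def by (rule V_spec_act0[OF _ V_spec_V(1)])

lemma act_vac: "k \<in> K ==> \<eta> \<in> hc (G k) ==> act k (\<Omega> k) \<eta> = \<eta>"
 unfolding act_def by (rule V_spec_V(2))

lemma act_cplus_fv: "k \<in> K ==> x \<in> cplus k ==> (w, xs) \<in> idx_off k ==> act k x (fv w xs) = fv (k # w) (x # xs)"
 by (simp add: act_fv act0_cplus)

lemma act_split:
 assumes "k \<in> K" "x \<in> hc (H k)" "\<eta> \<in> hc (G k)"
 shows "act k x \<eta> = hadd F (hscale F (vc k x) \<eta>) (act k (pp k x) \<eta>)"
 unfolding act_def tv_left[OF assms]
 using assms pp_in[OF assms(1,2)] vac_in[OF assms(1)] act_vac[OF assms(1,3), unfolded act_def]
 by (simp add: bopD(2,3)[OF V_bop[OF assms(1)]])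

lemma act_total:
 assumes k: "k \<in> K"
 shows "closed_span F ((\<lambda>(x, w, xs). act k x (fv w xs)) ` idx_act k) = hc F"
proof -
 have "(\<lambda>(x, w, xs). act k x (fv w xs)) ` idx_act k = (\<lambda>(x, w, xs). act0 k x w xs) ` idx_act k"
  by (rule image_cong) (auto simp: idx_act_def act_fv k)
 then show ?thesis using act0_total[OF k] by simp
qed

lemma act_total_sub: "k \<in> K ==> (\<lambda>(x, w, xs). act k x (fv w xs)) ` idx_act k \<subseteq> hc F"
 using idx_off_Cons(6) by (auto simp: idx_act_def)

lemma bop_eq_act:
 assumes k: "k \<in> K" and "hilbert_space L" "X \<in> bop F L" "Y \<in> bop F L"
  and "\<And>x \<eta>. x \<in> hc (H k) ==> \<eta> \<in> hc (G k) ==> X (act k x \<eta>) = Y (act k x \<eta>)"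
 shows "X = Y"
 by (rule bop_eq_total[OF hilbert_F assms(2-4) act_total[OF k] act_total_sub[OF k]])
  (use assms(5) idx_off_Cons(6)[OF k] in \<open>auto simp: idx_act_def\<close>)

lemma
 assumes k: "k \<in> K" and S: "S \<in> bops (H k)"
 shows lam_bop: "lam k S \<in> bops F"
  and lam_act: "\<And>x \<eta>. x \<in> hc (H k) ==> \<eta> \<in> hc (G k) ==> lam k S (act k x \<eta>) = act k (S x) \<eta>"
proof -
 note t = tensor_op_one[OF hilb[OF k] hilbert_G S]
 note a = hadj_props(1)[OF HG[OF k] hilbert_F V_bop[OF k]]
 have e: "lam k S = compose (hc F) (V k) (compose (hc F)
   (tensor_op (H k) (G k) S (scalar_op (G k) 1)) (hadj (HG k) F (V k)))"
  by (simp add: free_lambda_def Let_def)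
 show "lam k S \<in> bops F"
  unfolding e using k by (intro bop_compose[OF bop_compose[OF a t(1)] V_bop]) auto
 show "lam k S (act k x \<eta>) = act k (S x) \<eta>" if "x \<in> hc (H k)" "\<eta> \<in> hc (G k)" for x \<eta>
  unfolding e using that k act_closed[OF k that] hadj_unitary_left[OF HG[OF k] hilbert_F V_unitary[OF k], of "tv k x \<eta>"]
  by (simp add: compose_def act_def t(2))
qed

lemma lam_G:
 assumes k: "k \<in> K" and S: "S \<in> bops (H k)" and e: "\<eta> \<in> hc (G k)"
 shows "lam k S \<eta> = act k (S (\<Omega> k)) \<eta>"
 using lam_act[OF k S vac_in[OF k] e] act_vac[OF k e] by simp

lemma lam_hadj:
 assumes k: "k \<in> K" and S: "S \<in> bops (H k)"
 shows "hadj F F (lam k S) = lam k (hadj (H k) (H k) S)"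
proof (rule bop_eq_act[OF k hilbert_F])
 note a = hadj_props[OF hilb[OF k] hilb[OF k] S]
 note b = hadj_props[OF hilbert_F hilbert_F lam_bop[OF k S]]
 show "hadj F F (lam k S) \<in> bops F" by (rule b(1))
 show l: "lam k (hadj (H k) (H k) S) \<in> bops F" by (rule lam_bop[OF k a(1)])
 fix x \<eta> assume x: "x \<in> hc (H k)" and e: "\<eta> \<in> hc (G k)"
 note c = act_closed[OF k x e]
 show "hadj F F (lam k S) (act k x \<eta>) = lam k (hadj (H k) (H k) S) (act k x \<eta>)"
 proof (rule F.total_eqI[OF act_total[OF k] act_total_sub[OF k]])
  fix z assume "z \<in> (\<lambda>(x, w, xs). act k x (fv w xs)) ` idx_act k"
  then obtain y \<zeta> where z: "z = act k y \<zeta>" "y \<in> hc (H k)" "\<zeta> \<in> hc (G k)"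
   using idx_off_Cons(6)[OF k] by (auto simp: idx_act_def)
  have zc: "z \<in> hc F" using z k by simp
  have "hinner F z (hadj F F (lam k S) (act k x \<eta>)) = hinner F (lam k S z) (act k x \<eta>)"
   by (rule b(2)[OF zc c])
  also have "\<dots> = hinner (H k) (S y) x * hinner F \<zeta> \<eta>"
   using z x e k lam_act[OF k S] bopD(1)[OF S] by (simp add: inner_act)
  also have "hinner (H k) (S y) x = hinner (H k) y (hadj (H k) (H k) S x)" by (rule a(2)[OF z(2) x, symmetric])
  also have "\<dots> * hinner F \<zeta> \<eta> = hinner F z (lam k (hadj (H k) (H k) S) (act k x \<eta>))"
   using z x e k lam_act[OF k a(1)] bopD(1)[OF a(1)] by (simp add: inner_act)
  finally show "hinner F z (hadj F F (lam k S) (act k x \<eta>)) = hinner F z (lam k (hadj (H k) (H k) S) (act k x \<eta>))" .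
 qed (use c bopD(1)[OF b(1)] bopD(1)[OF l] in auto)
qed

subsection \<open>The flip\<close>

lemma rev_words: "w \<in> W ==> rev w \<in> W"
 by (auto simp: alternating_words_def distinct_adj_rev)

lemma word_factors_rev: "word_factors H \<Omega> (rev w) = rev (word_factors H \<Omega> w)"
 by (simp add: word_factors_def rev_map)

lemma rev_args: "xs \<in> args w ==> rev xs \<in> args (rev w)"
 by (auto simp: in_listset_iff word_factors_rev rev_nth rev_map[symmetric])

lemma fip_rev:
 assumes "xs \<in> args w" "ys \<in> args w"
 shows "fip (rev w) (rev xs) (rev ys) = fip w xs ys"
 unfolding pinner_def word_factors_rev
 by (rule prod.reindex_bij_witness[where i = "\<lambda>i. length w - 1 - i" and j = "\<lambda>i. length w - 1 - i"])
  (use assms in \<open>auto simp: in_listset_iff rev_nth word_factors_def\<close>)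

text \<open>Reversal permutes the alternating words and merely reorders the factors of the Gram
  matrix.\<close>

lemma flip_exists: "\<exists>J. unitary_op F F J \<and> (\<forall>w\<in>W. \<forall>xs\<in>args w. J (fv w xs) = fv (rev w) (rev xs))"
proof -
 have im: "(\<lambda>(w, xs). fv (rev w) (rev xs)) ` idx = (\<lambda>(w, xs). fv w xs) ` idx"
 proof -
  have "(\<lambda>(w, xs). (rev w, rev xs)) ` idx = idx"
  proof
   show sub: "(\<lambda>(w, xs). (rev w, rev xs)) ` idx \<subseteq> idx"
    using rev_words rev_args by (auto simp: idx_def)
   show "idx \<subseteq> (\<lambda>(w, xs). (rev w, rev xs)) ` idx"
   proof
    fix p assume "p \<in> idx"
    then have "(rev (fst p), rev (snd p)) \<in> idx" using sub by (auto simp: case_prod_unfold)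
    then show "p \<in> (\<lambda>(w, xs). (rev w, rev xs)) ` idx" by (auto intro!: image_eqI[of _ _ "(rev (fst p), rev (snd p))"])
   qed
  qed
  then have "(\<lambda>(w, xs). fv w xs) ` idx = (\<lambda>(w, xs). fv w xs) ` (\<lambda>(w, xs). (rev w, rev xs)) ` idx" by simp
  also have "\<dots> = (\<lambda>(w, xs). fv (rev w) (rev xs)) ` idx" by (auto simp: image_image case_prod_unfold)
  finally show ?thesis by simp
 qed
 obtain J where J: "unitary_op F F J"
  "\<And>i. i \<in> idx ==> J ((\<lambda>(w, xs). fv w xs) i) = (\<lambda>(w, xs). fv (rev w) (rev xs)) i"
 proof (rule unitary_extension[OF hilbert_F hilbert_F _ _ fv_total])
  show "closed_span F ((\<lambda>(w, xs). fv (rev w) (rev xs)) ` idx) = hc F" unfolding im by (rule fv_total)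
  show "hinner F ((\<lambda>(w, xs). fv (rev w) (rev xs)) i) ((\<lambda>(w, xs). fv (rev w) (rev xs)) j)
    = hinner F ((\<lambda>(w, xs). fv w xs) i) ((\<lambda>(w, xs). fv w xs) j)" if "i \<in> idx" "j \<in> idx" for i j
   using that rev_words rev_args fip_rev by (auto simp: idx_def inner_fv)
 qed (use rev_words rev_args in \<open>auto simp: idx_def\<close>)
 then show ?thesis by (intro exI[of _ J]) (auto simp: idx_def)
qed

text \<open>The flip is linear: in spite of the letter it is not the antilinear modular
  conjugation.\<close>

definition J :: "('k list \<Rightarrow> 'a list \<Rightarrow> complex) \<Rightarrow> 'k list \<Rightarrow> 'a list \<Rightarrow> complex" where
 "J = (SOME J. unitary_op F F J \<and> (\<forall>w\<in>W. \<forall>xs\<in>args w. J (fv w xs) = fv (rev w) (rev xs)))"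

lemma J_unitary: "unitary_op F F J" and J_fv: "w \<in> W ==> xs \<in> args w ==> J (fv w xs) = fv (rev w) (rev xs)"
 using someI_ex[OF flip_exists] unfolding J_def by blast+

lemmas J_bop = unitary_opD(1)[OF J_unitary]

lemma J_closed [simp]: "\<xi> \<in> hc F ==> J \<xi> \<in> hc F"
 by (rule bopD(1)[OF J_bop])

lemma J_J [simp]: "\<xi> \<in> hc F ==> J (J \<xi>) = \<xi>"
proof -
 assume x: "\<xi> \<in> hc F"
 have "compose (hc F) J J = scalar_op F 1"
 proof (rule bop_eq_total[OF hilbert_F hilbert_F _ _ fv_total fv_sub])
  show "compose (hc F) J J \<in> bops F" by (intro bop_compose[OF J_bop J_bop]) auto
  show "scalar_op F 1 \<in> bops F" by (rule scalar_op_bop) simp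
  show "compose (hc F) J J s = scalar_op F 1 s" if "s \<in> (\<lambda>(w, xs). fv w xs) ` idx" for s
   using that rev_words rev_args J_fv by (auto simp: idx_def compose_def)
 qed
 from fun_cong[OF this, of \<xi>] show ?thesis using x by (simp add: compose_def)
qed

lemma J_vac [simp]: "J vac = vac"
 unfolding vac_eq by (subst J_fv) auto

definition rho :: "'k \<Rightarrow> ('a \<Rightarrow> 'a) \<Rightarrow> ('k list \<Rightarrow> 'a list \<Rightarrow> complex) \<Rightarrow> 'k list \<Rightarrow> 'a list \<Rightarrow> complex" where
 "rho k S = compose (hc F) J (compose (hc F) (lam k S) J)"

lemma rho_bop: "k \<in> K ==> S \<in> bops (H k) ==> rho k S \<in> bops F"
 unfolding rho_def by (intro bop_compose[OF bop_compose[OF J_bop lam_bop] J_bop]) auto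

lemma rho_apply: "\<xi> \<in> hc F ==> rho k S \<xi> = J (lam k S (J \<xi>))"
 by (simp add: rho_def compose_def)

definition ends :: "'k \<Rightarrow> 'k list \<Rightarrow> bool" where "ends k w \<longleftrightarrow> w \<noteq> [] \<and> last w = k"

lemma starts_rev: "starts k (rev w) \<longleftrightarrow> ends k w"
 by (cases w rule: rev_cases) (auto simp: ends_def)

lemma off_rev: "w \<in> W ==> xs \<in> args w ==> \<not> ends k w ==> (rev w, rev xs) \<in> idx_off k"
 unfolding idx_off_def using rev_words rev_args starts_rev[of w k] by auto

text \<open>The mirror image of \<open>act\<close>: the letter enters at the right end of the word,
  see \<open>ract_fv\<close>.\<close>

definition ract :: "'k \<Rightarrow> 'a \<Rightarrow> ('k list \<Rightarrow> 'a list \<Rightarrow> complex) \<Rightarrow> 'k list \<Rightarrow> 'a list \<Rightarrow> complex" where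
 "ract k y \<eta> = J (act k y (J \<eta>))"

lemma ract_fv:
 assumes k: "k \<in> K" and w: "w \<in> W" "xs \<in> args w" "\<not> ends k w" and y: "y \<in> hc (H k)"
 shows "w @ [k] \<in> W" "xs @ [pp k y] \<in> args (w @ [k])"
  "ract k y (fv w xs) = hadd F (hscale F (vc k y) (fv w xs)) (fv (w @ [k]) (xs @ [pp k y]))"
  "S \<in> bops (H k) ==> rho k S (ract k y (fv w xs)) = ract k (S y) (fv w xs)"
proof -
 note o = off_rev[OF w] and i = idx_off_Cons[OF k off_rev[OF w]]
 show 1: "w @ [k] \<in> W" using rev_words[OF i(3)] by simp
 show 2: "xs @ [pp k y] \<in> args (w @ [k])" using rev_args[OF i(5)[OF y]] by (simp del: listset.simps)
 note c = fv_closed[OF w(1,2)] fv_closed[OF 1 2] fv_closed[OF i(1,2)] fv_closed[OF i(3) i(5)[OF y]]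
 have "ract k y (fv w xs) = J (act0 k y (rev w) (rev xs))"
  unfolding ract_def J_fv[OF w(1,2)] act_fv[OF k y o] ..
 also have "\<dots> = hadd F (hscale F (vc k y) (J (fv (rev w) (rev xs)))) (J (fv (k # rev w) (pp k y # rev xs)))"
  unfolding act0_def using c by (simp add: bopD(2,3)[OF J_bop])
 also have "J (fv (rev w) (rev xs)) = fv w xs" using J_fv[OF i(1,2)] by simp
 also have "J (fv (k # rev w) (pp k y # rev xs)) = fv (w @ [k]) (xs @ [pp k y])"
  using J_fv[OF i(3) i(5)[OF y]] by simp
 finally show "ract k y (fv w xs) = hadd F (hscale F (vc k y) (fv w xs)) (fv (w @ [k]) (xs @ [pp k y]))" .
 assume S: "S \<in> bops (H k)"
 have g: "J (fv w xs) \<in> hc (G k)" unfolding J_fv[OF w(1,2)] by (rule i(6))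
 have "ract k y (fv w xs) \<in> hc F" using k y g by (simp add: ract_def)
 then show "rho k S (ract k y (fv w xs)) = ract k (S y) (fv w xs)"
  using k y g lam_act[OF k S y g] by (simp add: rho_apply) (simp add: ract_def)
qed

text \<open>The two-sided vectors \<open>x \<cdot> \<eta> \<cdot> y\<close> on which the left and the right action both become
 transparent.\<close>

definition bvec :: "'k \<Rightarrow> 'k \<Rightarrow> 'a \<Rightarrow> 'a \<Rightarrow> 'k list \<Rightarrow> 'a list \<Rightarrow> 'k list \<Rightarrow> 'a list \<Rightarrow> complex" where
 "bvec k \<mu> x y w xs = act k x (ract \<mu> y (fv w xs))"

text \<open>The two letters stand at opposite ends of the word and do not interfere. The last
  condition on \<open>w\<close> excludes the one exception, an empty middle word with
  \<open>k = \<mu>\<close>, where both would occupy the same place.\<close>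

lemma bvec_props:
 assumes k: "k \<in> K" "\<mu> \<in> K" and w: "w \<in> W" "xs \<in> args w" "\<not> starts k w" "\<not> ends \<mu> w" "w \<noteq> [] \<or> k \<noteq> \<mu>"
  and x: "x \<in> hc (H k)" and y: "y \<in> hc (H \<mu>)"
 shows "bvec k \<mu> x y w xs \<in> hc F"
  "S \<in> bops (H k) ==> lam k S (bvec k \<mu> x y w xs) = bvec k \<mu> (S x) y w xs"
  "S \<in> bops (H \<mu>) ==> rho \<mu> S (bvec k \<mu> x y w xs) = bvec k \<mu> x (S y) w xs"
proof -
 have off: "(w, xs) \<in> idx_off k" using w by (simp add: idx_off_def)
 note i = idx_off_Cons[OF k(1) off]
 have e: "\<not> ends \<mu> (k # w)" using w by (auto simp: ends_def)
 have st: "\<not> starts k (w @ [\<mu>])" using w by (cases w) auto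
 \<comment> \<open>By definition the vector has its left letter exposed. Expanding in
   \<open>x\<close> writes it as a combination of right actions on \<open>w\<close> and on
   \<open>k # w\<close>, which exposes the right letter instead.\<close>
 have main: "ract \<mu> y (fv w xs) \<in> hc (G k)"
  "bvec k \<mu> x y w xs = hadd F (hscale F (vc k x) (ract \<mu> y (fv w xs))) (ract \<mu> y (fv (k # w) (pp k x # xs)))"
  if y: "y \<in> hc (H \<mu>)" for y
 proof -
  note r = ract_fv[OF k(2) w(1,2,4) y]
  have g: "fv (w @ [\<mu>]) (xs @ [pp \<mu> y]) \<in> hc (G k)" by (rule fv_in_G[OF r(1) st r(2)])
  have offm: "(w @ [\<mu>], xs @ [pp \<mu> y]) \<in> idx_off k" using r(1,2) st by (simp add: idx_off_def)
  show rg: "ract \<mu> y (fv w xs) \<in> hc (G k)" unfolding r(3)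
   using pre_hilbert_space.add_closed[OF hilbert_pre[OF hilbert_G], of _ k]
    pre_hilbert_space.scale_closed[OF hilbert_pre[OF hilbert_G], of _ k] g i(6) by simp
  let ?f = "\<lambda>\<eta>\<in>hc (G k). act k (pp k x) \<eta>"
  have px: "pp k x \<in> hc (H k)" "pp k x \<in> cplus k" using pp_in[OF k(1) x] by auto
  have f: "?f \<in> bop (G k) F" by (rule act_bop_right[OF k(1) px(1)])
  have "act k (pp k x) (ract \<mu> y (fv w xs)) = ?f (hadd (G k) (hscale (G k) (vc \<mu> y) (fv w xs)) (fv (w @ [\<mu>]) (xs @ [pp \<mu> y])))"
   using rg by (simp add: r(3))
  also have "\<dots> = hadd F (hscale F (vc \<mu> y) (?f (fv w xs))) (?f (fv (w @ [\<mu>]) (xs @ [pp \<mu> y])))"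
   using g i(6) by (simp only: bopD(2,3)[OF f] pre_hilbert_space.scale_closed[OF hilbert_pre[OF hilbert_G]])
  also have "\<dots> = hadd F (hscale F (vc \<mu> y) (fv (k # w) (pp k x # xs))) (fv (k # w @ [\<mu>]) (pp k x # xs @ [pp \<mu> y]))"
   using g i(6) act_cplus_fv[OF k(1) px(2) off] act_cplus_fv[OF k(1) px(2) offm] by simp
  also have "\<dots> = ract \<mu> y (fv (k # w) (pp k x # xs))"
   using ract_fv(3)[OF k(2) i(3) i(5)[OF x] e y] by simp
  finally show "bvec k \<mu> x y w xs = hadd F (hscale F (vc k x) (ract \<mu> y (fv w xs))) (ract \<mu> y (fv (k # w) (pp k x # xs)))"
   unfolding bvec_def act_split[OF k(1) x rg] by simp
 qed
 show "bvec k \<mu> x y w xs \<in> hc F" unfolding bvec_def using main(1)[OF y] k x by simp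
 show "lam k S (bvec k \<mu> x y w xs) = bvec k \<mu> (S x) y w xs" if "S \<in> bops (H k)"
  unfolding bvec_def by (rule lam_act[OF k(1) that x main(1)[OF y]])
 show "rho \<mu> S (bvec k \<mu> x y w xs) = bvec k \<mu> x (S y) w xs" if S: "S \<in> bops (H \<mu>)"
 proof -
  note rS = ract_fv(4)[OF k(2) w(1,2,4) y S] and rS' = ract_fv(4)[OF k(2) i(3) i(5)[OF x] e y S]
  have c1: "ract \<mu> y (fv w xs) \<in> hc F" using main(1)[OF y] G_in_F by blast
  have "J (fv (k # w) (pp k x # xs)) \<in> hc (G \<mu>)"
   using idx_off_Cons(6)[OF k(2) off_rev[OF i(3) i(5)[OF x] e]] J_fv[OF i(3) i(5)[OF x]] by simp
  then have c2: "ract \<mu> y (fv (k # w) (pp k x # xs)) \<in> hc F" unfolding ract_def using k y by simp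
  have "rho \<mu> S (bvec k \<mu> x y w xs) = hadd F (hscale F (vc k x) (ract \<mu> (S y) (fv w xs))) (ract \<mu> (S y) (fv (k # w) (pp k x # xs)))"
   unfolding main(2)[OF y] using c1 c2 rS rS' by (simp add: bopD(2,3)[OF rho_bop[OF k(2) S]])
  then show ?thesis using main(2)[OF bopD(1)[OF S y]] by simp
 qed
qed

lemma ends_cases:
 assumes k: "\<mu> \<in> K" and w: "w \<in> W" "xs \<in> args w"
 obtains "\<not> ends \<mu> w"
 | y w' xs' where "w = w' @ [\<mu>]" "xs = xs' @ [y]" "y \<in> cplus \<mu>" "w' \<in> W" "xs' \<in> args w'" "\<not> ends \<mu> w'"
proof (cases "ends \<mu> w")
 case False then show ?thesis using that(1) by simp
next
 case True
 have s: "\<not> (rev w, rev xs) \<in> idx_off \<mu>" using True starts_rev[of w \<mu>] by (auto simp: idx_off_def)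
 from k rev_words[OF w(1)] rev_args[OF w(2)] show ?thesis
 proof (cases rule: words_cases)
  case 1 then show ?thesis using s by simp
 next
  case (2 y w' xs')
  have "w = rev w' @ [\<mu>]" "xs = rev xs' @ [y]" using arg_cong[OF 2(1), of rev] arg_cong[OF 2(2), of rev] by auto
  moreover have "rev w' \<in> W" "rev xs' \<in> args (rev w')" "\<not> ends \<mu> (rev w')"
   using 2(4) rev_words rev_args starts_rev[of "rev w'" \<mu>] by (auto simp: idx_off_def)
  ultimately show ?thesis using that(2)[of "rev w'" "rev xs'" y] 2(3) by blast
 qed
qed

text \<open>Almost every elementary tensor is a two-sided vector, on which the operators act in
  different slots. What is left is the case of a single slot seen from both sides, and there
  \<open>comm\<close> enters.\<close>

lemma lam_rho_commute:
 assumes k: "k \<in> K" "\<mu> \<in> K" and S: "S \<in> bops (H k)" and T: "T \<in> bops (H \<mu>)"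
  and comm: "k = \<mu> ==> compose (hc (H k)) S T = compose (hc (H k)) T S"
 shows "compose (hc F) (lam k S) (rho \<mu> T) = compose (hc F) (rho \<mu> T) (lam k S)"
proof (rule bop_eq_total[OF hilbert_F hilbert_F _ _ fv_total fv_sub])
 note L = lam_bop[OF k(1) S] and R = rho_bop[OF k(2) T]
 show "compose (hc F) (lam k S) (rho \<mu> T) \<in> bops F" by (intro bop_compose[OF R L]) auto
 show "compose (hc F) (rho \<mu> T) (lam k S) \<in> bops F" by (intro bop_compose[OF L R]) auto
 fix v assume "v \<in> (\<lambda>(w, xs). fv w xs) ` idx"
 then obtain w xs where v: "v = fv w xs" "w \<in> W" "xs \<in> args w" by (auto simp: idx_def)
 have vF: "v \<in> hc F" using v by simp
 have bv: "lam k S (rho \<mu> T v) = rho \<mu> T (lam k S v)"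
  if "v = bvec k \<mu> x y w' ys" "w' \<in> W" "ys \<in> args w'" "\<not> starts k w'" "\<not> ends \<mu> w'" "w' \<noteq> [] \<or> k \<noteq> \<mu>"
   "x \<in> hc (H k)" "y \<in> hc (H \<mu>)" for x y w' ys
  unfolding that(1)
  using bvec_props[OF k that(2-8)] bvec_props(2,3)[OF k that(2-6) bopD(1)[OF S that(7)] that(8)]
   bvec_props(2,3)[OF k that(2-7) bopD(1)[OF T that(8)]] S T by simp
 \<comment> \<open>The exceptional case: on words of length at most one the left and the right
   action of the same letter coincide, so commuting of \<open>S\<close> and \<open>T\<close> is what
   counts.\<close>
 have single: "lam k S (rho \<mu> T v) = rho \<mu> T (lam k S v)"
  if eq: "k = \<mu>" and vx: "v = act k x vac" and x: "x \<in> hc (H k)" for x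
 proof -
  have ra: "ract \<mu> z vac = act \<mu> z vac" if z: "z \<in> hc (H \<mu>)" for z
  proof -
   have o: "([], []) \<in> idx_off \<mu>" by (simp add: idx_off_def)
   have e: "\<not> ends \<mu> []" by (simp add: ends_def)
   show ?thesis using ract_fv(3)[OF k(2) _ _ e z, of "[]"] act_fv[OF k(2) z o] by (simp add: vac_eq act0_def)
  qed
  have rv: "rho \<mu> T (act \<mu> z vac) = act \<mu> (T z) vac" if z: "z \<in> hc (H \<mu>)" for z
   using ract_fv(4)[OF k(2) _ _ _ z T, of "[]" "[]"] ra[OF z] ra[OF bopD(1)[OF T z]] by (simp add: vac_eq ends_def)
  have lv: "lam k S (act k z vac) = act k (S z) vac" if z: "z \<in> hc (H k)" for z
   by (rule lam_act[OF k(1) S z vac_in_G])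
  have "S (T x) = T (S x)" using fun_cong[OF comm[OF eq], of x] x by (simp add: compose_def)
  then show ?thesis
   unfolding vx using rv[of x] rv[of "S x"] lv[of x] lv[of "T x"] bopD(1)[OF S x] bopD(1)[OF T, of x] x
   by (simp add: eq)
 qed
 have "lam k S (rho \<mu> T v) = rho \<mu> T (lam k S v)"
 proof -
  \<comment> \<open>A vacuum vector in the left or in the right slot is invisible. So words without
    a letter \<open>k\<close> in front or \<open>\<mu>\<close> at the end are two-sided vectors too,
    with the vacuum as missing letter (\<open>bE\<close> on the left, \<open>rO\<close> on the
    right).\<close>
  have bE: "bvec k \<mu> (\<Omega> k) y w' ys = fv (w' @ [\<mu>]) (ys @ [y])"
   if "y \<in> cplus \<mu>" "w' \<in> W" "ys \<in> args w'" "\<not> starts k w'" "\<not> ends \<mu> w'" "w' \<noteq> [] \<or> k \<noteq> \<mu>" for y w' ys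
  proof -
   have y: "y \<in> hc (H \<mu>)" using that by simp
   note r = ract_fv[OF k(2) that(2,3,5) y]
   have st: "\<not> starts k (w' @ [\<mu>])" using that by (cases w') auto
   have "ract \<mu> y (fv w' ys) = fv (w' @ [\<mu>]) (ys @ [y])"
    using r(3) fv_closed[OF r(1,2)] fv_closed[OF that(2,3)] that(1) by (simp add: pp_cplus[OF k(2)])
   moreover have "fv (w' @ [\<mu>]) (ys @ [y]) \<in> hc (G k)"
    using fv_in_G[OF r(1) st r(2)] that(1) by (simp add: pp_cplus[OF k(2)])
   ultimately show ?thesis by (simp add: bvec_def act_vac[OF k(1)])
  qed
  have rO: "ract \<mu> (\<Omega> \<mu>) (fv w' ys) = fv w' ys" if "w' \<in> W" "ys \<in> args w'" "\<not> ends \<mu> w'" for w' ys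
  proof -
   have g: "J (fv w' ys) \<in> hc (G \<mu>)"
    unfolding J_fv[OF that(1,2)] by (rule idx_off_Cons(6)[OF k(2) off_rev[OF that]])
   show ?thesis unfolding ract_def act_vac[OF k(2) g] by (rule J_J[OF fv_closed[OF that(1,2)]])
  qed
  show ?thesis
   using k(1) v(2,3)
  proof (cases rule: words_cases)
   case 1
   show ?thesis
    using k(2) v(2,3)
   proof (cases rule: ends_cases)
    case e: 1
    show ?thesis
    proof (cases "w = [] \<and> k = \<mu>")
     case True
     then have "v = act k (\<Omega> k) vac" using v act_vac[OF k(1) vac_in_G] by (simp add: vac_eq)
     then show ?thesis using single[of "\<Omega> k"] True vac_in[OF k(1)] by blast
    next
     case False
     have "v = bvec k \<mu> (\<Omega> k) (\<Omega> \<mu>) w xs"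
      using rO[OF v(2,3) e] act_vac[OF k(1) idx_off_Cons(6)[OF k(1) 1]] v by (simp add: bvec_def)
     then show ?thesis using bv[of "\<Omega> k" "\<Omega> \<mu>" w xs] v e 1 False vac_in k by (auto simp: idx_off_def)
    qed
   next
    case (2 y w' ys)
    have st: "\<not> starts k w'" "w' \<noteq> [] \<or> k \<noteq> \<mu>" using 1 2(1) by (cases w'; auto simp: idx_off_def)+
    then have "v = bvec k \<mu> (\<Omega> k) y w' ys" using bE 2 v by simp
    then show ?thesis using bv[of "\<Omega> k" y w' ys] 2 st vac_in[OF k(1)] by auto
   qed
  next
   case (2 x w' ys)
   note o = idx_off_Cons[OF k(1) 2(4)]
   have vx: "v = act k x (fv w' ys)" using act_cplus_fv[OF k(1) 2(3,4)] 2(1,2) v by simp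
   show ?thesis
    using k(2) o(1,2)
   proof (cases rule: ends_cases)
    case e: 1
    show ?thesis
    proof (cases "w' = [] \<and> k = \<mu>")
     case True
     then have "v = act k x vac" using vx o(2) by (simp add: vac_eq)
     then show ?thesis using single[of x] True 2(3) by auto
    next
     case False
     have "v = bvec k \<mu> x (\<Omega> \<mu>) w' ys" using rO[OF o(1,2) e] vx by (simp add: bvec_def)
     then show ?thesis using bv[of x "\<Omega> \<mu>" w' ys] o e False 2(3) vac_in[OF k(2)] by auto
    qed
   next
    case e: (2 y w'' zs)
    have st: "\<not> starts k w''" "w'' \<noteq> [] \<or> k \<noteq> \<mu>" using o(4) e(1) by (cases w''; auto)+
    have y: "y \<in> hc (H \<mu>)" using e(3) by simp
    note r = ract_fv[OF k(2) e(4,5,6) y]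
    have "ract \<mu> y (fv w'' zs) = fv w' ys"
     using r(3) fv_closed[OF r(1,2)] fv_closed[OF e(4,5)] e(1,2,3) by (simp add: pp_cplus[OF k(2)])
    then have "v = bvec k \<mu> x y w'' zs" using vx by (simp add: bvec_def)
    then show ?thesis using bv[of x y w'' zs] e st 2(3) by auto
   qed
  qed
 qed
 then show "compose (hc F) (lam k S) (rho \<mu> T) v = compose (hc F) (rho \<mu> T) (lam k S) v"
  using vF by (simp add: compose_def)
qed

end

section \<open>Commutants\<close>

lemma commutantI:
 assumes "x \<in> bops H" "\<And>y \<xi>. y \<in> S ==> \<xi> \<in> hc H ==> x (y \<xi>) = y (x \<xi>)"
 shows "x \<in> commutant H S"
 using assms by (auto simp: commutant_def compose_def intro!: restrict_ext)

lemma commutantD: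
 assumes "x \<in> commutant H S"
 shows "x \<in> bops H" "\<And>y \<xi>. y \<in> S ==> \<xi> \<in> hc H ==> x (y \<xi>) = y (x \<xi>)"
proof -
 show "x \<in> bops H" using assms by (simp add: commutant_def)
 show "x (y \<xi>) = y (x \<xi>)" if "y \<in> S" "\<xi> \<in> hc H" for y \<xi>
 proof -
  have "compose (hc H) x y = compose (hc H) y x" using assms that(1) by (simp add: commutant_def)
  from fun_cong[OF this, of \<xi>] show ?thesis using that(2) by (simp add: compose_def)
 qed
qed

lemma commutant_antimono: "S \<subseteq> T ==> commutant H T \<subseteq> commutant H S"
 by (auto simp: commutant_def)

lemma commutant_bops: "commutant H S \<subseteq> bops H"
 by (auto simp: commutant_def)

lemma double_commutant_superset: "S \<subseteq> bops H ==> S \<subseteq> commutant H (commutant H S)"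
 by (auto simp: commutant_def)

lemma triple_commutant:
 assumes "S \<subseteq> bops H"
 shows "commutant H (commutant H (commutant H S)) = commutant H S"
proof
 show "commutant H (commutant H (commutant H S)) \<subseteq> commutant H S"
  by (rule commutant_antimono[OF double_commutant_superset[OF assms]])
 show "commutant H S \<subseteq> commutant H (commutant H (commutant H S))"
  by (rule double_commutant_superset[OF commutant_bops])
qed

lemma commutant_hadj:
 assumes h: "hilbert_space H" and S: "S \<subseteq> bops H" "\<And>y. y \<in> S ==> hadj H H y \<in> S" and x: "x \<in> commutant H S"
 shows "hadj H H x \<in> commutant H S"
proof -
 have xb: "x \<in> bops H" using x by (simp add: commutant_def)
 have "compose (hc H) (hadj H H x) y = compose (hc H) y (hadj H H x)" if y: "y \<in> S" for y
 proof -
  have yb: "y \<in> bops H" "hadj H H y \<in> bops H" using S y by auto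
  have "compose (hc H) x (hadj H H y) = compose (hc H) (hadj H H y) x"
   using x S(2)[OF y] by (simp add: commutant_def)
  then have "hadj H H (compose (hc H) x (hadj H H y)) = hadj H H (compose (hc H) (hadj H H y) x)" by simp
  then show ?thesis
   by (simp add: hadj_compose[OF h h h yb(2) xb] hadj_compose[OF h h h xb yb(2)] hadj_hadj[OF h h yb(1)])
 qed
 then show ?thesis using hadj_props(1)[OF h h xb] by (simp add: commutant_def)
qed

lemma commutant_scalar: "hilbert_space H ==> S \<subseteq> bops H ==> scalar_op H c \<in> commutant H S"
proof (rule commutantI)
 assume h: "hilbert_space H" and S: "S \<subseteq> bops H"
 show "scalar_op H c \<in> bops H" using h by (intro scalar_op_bop) simp
 fix y \<xi> assume "y \<in> S" and x: "\<xi> \<in> hc H"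
 then have "y \<in> bops H" using S by blast
 from bopD(1,3)[OF this x] show "scalar_op H c (y \<xi>) = y (scalar_op H c \<xi>)" using x by simp
qed

lemma commutant_compose:
 assumes h: "hilbert_space H" and S: "S \<subseteq> bops H" and x: "x \<in> commutant H S" and y: "y \<in> commutant H S"
 shows "compose (hc H) x y \<in> commutant H S"
proof (rule commutantI)
 note x' = commutantD[OF x] and y' = commutantD[OF y]
 show "compose (hc H) x y \<in> bops H" using h by (intro bop_compose[OF y'(1) x'(1)]) auto
 show "compose (hc H) x y (z \<xi>) = z (compose (hc H) x y \<xi>)" if "z \<in> S" "\<xi> \<in> hc H" for z \<xi>
 proof -
  have "z \<in> bops H" using S that by blast
  then show ?thesis using that x'(2)[OF that(1) bopD(1)[OF y'(1) that(2)]] y'(2)[OF that] bopD(1)[of z H H \<xi>]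
   by (simp add: compose_def)
 qed
qed

lemma bop_add:
 assumes h: "hilbert_space H" and x: "x \<in> bop G H" and y: "y \<in> bop G H" and g: "hilbert_space G"
 shows "(\<lambda>\<xi>\<in>hc G. hadd H (x \<xi>) (y \<xi>)) \<in> bop G H"
proof -
 interpret H: hilbert_space H by (rule h)
 interpret G: hilbert_space G by (rule g)
 note x' = bopD[OF x] and y' = bopD[OF y]
 obtain C where C: "\<And>\<xi>. \<xi> \<in> hc G ==> hnorm H (x \<xi>) \<le> C * hnorm G \<xi>" using bop_bound[OF x G.pre] by blast
 obtain D where D: "\<And>\<xi>. \<xi> \<in> hc G ==> hnorm H (y \<xi>) \<le> D * hnorm G \<xi>" using bop_bound[OF y G.pre] by blast
 show ?thesis
 proof (rule bopI[where C = "C + D"])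
  fix \<xi> assume "\<xi> \<in> hc G"
  then show "hnorm H ((\<lambda>\<xi>\<in>hc G. hadd H (x \<xi>) (y \<xi>)) \<xi>) \<le> (C + D) * hnorm G \<xi>"
   using H.hnorm_triangle[of "x \<xi>" "y \<xi>"] C[of \<xi>] D[of \<xi>] x' y' by (simp add: distrib_right)
 next
  fix \<xi> \<eta> assume "\<xi> \<in> hc G" "\<eta> \<in> hc G"
  then show "(\<lambda>\<xi>\<in>hc G. hadd H (x \<xi>) (y \<xi>)) (hadd G \<xi> \<eta>)
   = hadd H ((\<lambda>\<xi>\<in>hc G. hadd H (x \<xi>) (y \<xi>)) \<xi>) ((\<lambda>\<xi>\<in>hc G. hadd H (x \<xi>) (y \<xi>)) \<eta>)"
   by (intro H.eqI) (simp_all add: x' y')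
 qed (use x' y' in \<open>auto simp: H.scale_add_right\<close>)
qed

lemma commutant_add:
 assumes h: "hilbert_space H" and S: "S \<subseteq> bops H" and x: "x \<in> commutant H S" and y: "y \<in> commutant H S"
 shows "(\<lambda>\<xi>\<in>hc H. hadd H (x \<xi>) (y \<xi>)) \<in> commutant H S"
proof (rule commutantI)
 note x' = commutantD[OF x] and y' = commutantD[OF y]
 show "(\<lambda>\<xi>\<in>hc H. hadd H (x \<xi>) (y \<xi>)) \<in> bops H" by (rule bop_add[OF h x'(1) y'(1) h])
 fix z \<xi> assume z: "z \<in> S" "\<xi> \<in> hc H"
 then have zb: "z \<in> bops H" using S by blast
 show "(\<lambda>\<xi>\<in>hc H. hadd H (x \<xi>) (y \<xi>)) (z \<xi>) = z ((\<lambda>\<xi>\<in>hc H. hadd H (x \<xi>) (y \<xi>)) \<xi>)"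
  using z x'(2)[OF z] y'(2)[OF z] bopD(1)[OF x'(1)] bopD(1)[OF y'(1)] by (simp add: bopD(1,2)[OF zb])
qed

lemma (in pre_hilbert_space) closure_superset:
 assumes "S \<subseteq> hc H"
 shows "S \<subseteq> htop H closure_of S"
proof
 fix x assume "x \<in> S"
 then show "x \<in> htop H closure_of S"
  unfolding closure_of_iff[OF assms] using assms by (auto intro!: bexI[of _ x])
qed

text \<open>Stated for a commutant because both M' and M'' are commutants, and the proof uses of
  them only that they contain the scalars and are closed under sums and products.\<close>

lemma orbit_closed_subspace:
 assumes h: "hilbert_space H" and S: "S \<subseteq> bops H" and v: "v \<in> hc H"
 shows "closed_subspace H (htop H closure_of {x v |x. x \<in> commutant H S})"
proof -
 interpret hilbert_space H by (rule h)
 let ?O = "{x v |x. x \<in> commutant H S}"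
 have O: "?O \<subseteq> hc H" using v commutantD(1) bopD(1) by fast
 note cl = closure_of_iff[OF O]
 have D: "\<exists>y\<in>?O. hnorm H (hdiff H x y) < e" if "x \<in> htop H closure_of ?O" "e > 0" for x e using that cl by blast
 have C: "x \<in> hc H" if "x \<in> htop H closure_of ?O" for x using that cl by blast
 show ?thesis
 proof (rule closed_subspaceI)
  show "htop H closure_of ?O \<subseteq> hc H" using C by blast
  have "hzero H = scalar_op H 0 v" using v by simp
  then have "hzero H \<in> ?O" using commutant_scalar[OF h S] by blast
  then show "hzero H \<in> htop H closure_of ?O" using closure_superset[OF O] by blast
  fix x y assume xy: "x \<in> htop H closure_of ?O" "y \<in> htop H closure_of ?O"
  note c = C[OF xy(1)] C[OF xy(2)]
  show "hadd H x y \<in> htop H closure_of ?O"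
   unfolding cl
  proof (intro conjI allI impI)
   fix e :: real assume e: "e > 0"
   obtain a where a: "a \<in> commutant H S" "hnorm H (hdiff H x (a v)) < e / 2" using D[OF xy(1), of "e / 2"] e by auto
   obtain b where b: "b \<in> commutant H S" "hnorm H (hdiff H y (b v)) < e / 2" using D[OF xy(2), of "e / 2"] e by auto
   have ab: "a v \<in> hc H" "b v \<in> hc H" using a b v commutantD(1) bopD(1) by fast+
   have "hdiff H (hadd H x y) (hadd H (a v) (b v)) = hadd H (hdiff H x (a v)) (hdiff H y (b v))"
    by (rule eqI) (use c ab in simp_all)
   then have "hnorm H (hdiff H (hadd H x y) (hadd H (a v) (b v))) < e"
    using hnorm_triangle[of "hdiff H x (a v)" "hdiff H y (b v)"] a b c ab by simp
   moreover have "hadd H (a v) (b v) \<in> ?O"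
    using commutant_add[OF h S a(1) b(1)] v by (intro CollectI exI[of _ "\<lambda>\<xi>\<in>hc H. hadd H (a \<xi>) (b \<xi>)"]) simp
   ultimately show "\<exists>z\<in>?O. hnorm H (hdiff H (hadd H x y) z) < e" by blast
  qed (use c in simp)
 next
  fix c x assume x: "x \<in> htop H closure_of ?O"
  note xc = C[OF x]
  show "hscale H c x \<in> htop H closure_of ?O"
   unfolding cl
  proof (intro conjI allI impI)
   fix e :: real assume e: "e > 0"
   define k where "k = cmod c + 1"
   have k: "k > 0" "cmod c \<le> k" by (simp_all add: k_def add_nonneg_pos)
   obtain a where a: "a \<in> commutant H S" "hnorm H (hdiff H x (a v)) < e / k" using D[OF x, of "e / k"] e k by auto
   have ac: "a v \<in> hc H" using a v commutantD(1) bopD(1) by fast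
   have "hdiff H (hscale H c x) (hscale H c (a v)) = hscale H c (hdiff H x (a v))"
    by (rule eqI) (use xc ac in \<open>simp_all add: algebra_simps\<close>)
   moreover have "cmod c * hnorm H (hdiff H x (a v)) \<le> k * hnorm H (hdiff H x (a v))"
    using k xc ac by (intro mult_right_mono) auto
   moreover have "k * hnorm H (hdiff H x (a v)) < e" using a(2) k by (simp add: pos_less_divide_eq mult.commute)
   ultimately have "hnorm H (hdiff H (hscale H c x) (hscale H c (a v))) < e" using xc ac by simp
   moreover have "hscale H c (a v) \<in> ?O"
    using commutant_compose[OF h S commutant_scalar[OF h S, of c] a(1)] v ac
    by (intro CollectI exI[of _ "compose (hc H) (scalar_op H c) a"]) (simp add: compose_def)
   ultimately show "\<exists>z\<in>?O. hnorm H (hdiff H (hscale H c x) z) < e" by blast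
  qed (use xc in simp)
 next
  fix x assume xc: "x \<in> hc H" and a: "\<And>e. e > 0 ==> \<exists>y\<in>htop H closure_of ?O. hnorm H (hdiff H x y) < e"
  show "x \<in> htop H closure_of ?O"
   unfolding cl
  proof (intro conjI allI impI)
   fix e :: real assume e: "e > 0"
   obtain y where y: "y \<in> htop H closure_of ?O" "hnorm H (hdiff H x y) < e / 2" using a[of "e / 2"] e by auto
   obtain z where z: "z \<in> ?O" "hnorm H (hdiff H y z) < e / 2" using D[OF y(1), of "e / 2"] e by auto
   have "hnorm H (hdiff H x z) < e"
    using hnorm_diff_triangle[OF xc C[OF y(1)], of z] O z y(2) by fastforce
   with z(1) show "\<exists>z\<in>?O. hnorm H (hdiff H x z) < e" by blast
  qed (use xc in simp)
 qed
qed

lemma orbit_invariant: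
 assumes h: "hilbert_space H" and S: "S \<subseteq> bops H" and v: "v \<in> hc H"
  and y: "y \<in> commutant H S" and x: "\<xi> \<in> htop H closure_of {x v |x. x \<in> commutant H S}"
 shows "y \<xi> \<in> htop H closure_of {x v |x. x \<in> commutant H S}"
proof -
 interpret hilbert_space H by (rule h)
 let ?O = "{x v |x. x \<in> commutant H S}"
 have O: "?O \<subseteq> hc H" using v commutantD(1) bopD(1) by fast
 have L: "closed_subspace H (htop H closure_of ?O)" by (rule orbit_closed_subspace[OF h S v])
 note yb = commutantD(1)[OF y]
 have vL: "closed_subspace H {\<xi> \<in> hc H. y \<xi> \<in> htop H closure_of ?O}"
  by (rule bop_vimage_closed[OF yb _ _ L]) auto
 have "?O \<subseteq> {\<xi> \<in> hc H. y \<xi> \<in> htop H closure_of ?O}"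
 proof
  fix z assume "z \<in> ?O"
  then obtain a where a: "z = a v" "a \<in> commutant H S" by blast
  have "y z = compose (hc H) y a v" using v a by (simp add: compose_def)
  then have "y z \<in> ?O" using commutant_compose[OF h S y a(2)] by blast
  then have "y z \<in> htop H closure_of ?O" by (rule closure_superset[OF O, THEN subsetD])
  then show "z \<in> {\<xi> \<in> hc H. y \<xi> \<in> htop H closure_of ?O}" using subsetD[OF O \<open>z \<in> ?O\<close>] by simp
 qed
 moreover have "\<xi> \<in> {\<xi> \<in> hc H. y \<xi> \<in> htop H closure_of ?O}"
  if "?O \<subseteq> {\<xi> \<in> hc H. y \<xi> \<in> htop H closure_of ?O}"
 proof (rule closed_subspaceD(5)[OF vL])
  have c: "\<xi> \<in> hc H \<and> (\<forall>e>0. \<exists>y\<in>?O. hnorm H (hdiff H \<xi> y) < e)"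
   using x unfolding closure_of_iff[OF O] .
  then show "\<xi> \<in> hc H" by (rule conjunct1)
  fix e :: real assume "e > 0"
  then obtain z where z: "z \<in> ?O" "hnorm H (hdiff H \<xi> z) < e" using c by meson
  show "\<exists>z\<in>{\<xi> \<in> hc H. y \<xi> \<in> htop H closure_of ?O}. hnorm H (hdiff H \<xi> z) < e"
   using z(2) subsetD[OF that z(1)] by (rule bexI)
 qed
 ultimately show ?thesis by blast
qed

lemma cyclic_vector_iff:
 assumes h: "hilbert_space H" and S: "S \<subseteq> bops H" and v: "v \<in> hc H"
 shows "cyclic_vector H S v \<longleftrightarrow> (\<forall>x\<in>hc H. \<forall>e>0. \<exists>y\<in>S. hnorm H (hdiff H x (y v)) < e)"
proof -
 interpret hilbert_space H by (rule h)
 have O: "{x v |x. x \<in> S} \<subseteq> hc H" using v S bopD(1) by fast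
 show ?thesis unfolding cyclic_vector_def using closure_of_iff[OF O] by blast
qed

lemma hproj_bop:
 assumes h: "hilbert_space H" and L: "closed_subspace H L"
 shows "hilbert_space.hproj H L \<in> bops H"
proof -
 interpret hilbert_space H by (rule h)
 note L' = closed_subspaceD[OF L]
 note p = hproj_props(1)[OF L]
 show ?thesis
 proof (rule bopI[where C = 1])
  fix \<xi> \<eta> assume x: "\<xi> \<in> hc H" "\<eta> \<in> hc H"
  show "hproj L (hadd H \<xi> \<eta>) = hadd H (hproj L \<xi>) (hproj L \<eta>)"
  proof (rule hproj_unique[OF L])
   show "hinner H y (hadd H (hproj L \<xi>) (hproj L \<eta>)) = hinner H y (hadd H \<xi> \<eta>)" if "y \<in> L" for y
    using that x L L'(1) inner_hproj[OF L] by (simp add: subset_iff)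
  qed (use x p L'(3) in auto)
 next
  fix c \<xi> assume x: "\<xi> \<in> hc H"
  show "hproj L (hscale H c \<xi>) = hscale H c (hproj L \<xi>)"
  proof (rule hproj_unique[OF L])
   show "hinner H y (hscale H c (hproj L \<xi>)) = hinner H y (hscale H c \<xi>)" if "y \<in> L" for y
    using that x L L'(1) inner_hproj[OF L] by (simp add: subset_iff)
  qed (use x p L'(4) in auto)
 next
  fix \<xi> assume x: "\<xi> \<in> hc H"
  have "hinner H (hproj L \<xi>) (hproj L \<xi>) = hinner H (hproj L \<xi>) \<xi>" by (rule inner_hproj[OF L x p[OF x]])
  then have "(hnorm H (hproj L \<xi>))\<^sup>2 \<le> hnorm H (hproj L \<xi>) * hnorm H \<xi>"
   using x L cauchy_schwarz[of "hproj L \<xi>" \<xi>] complex_Re_le_cmod[of "hinner H (hproj L \<xi>) \<xi>"] by (simp add: hnorm_sq)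
  then show "hnorm H (hproj L \<xi>) \<le> 1 * hnorm H \<xi>"
   using x L by (cases "hnorm H (hproj L \<xi>) = 0") (auto simp: power2_eq_square order_less_le)
 next
  have "hproj L \<in> extensional (hc H)" by (simp add: hproj_def)
  then show "hproj L \<in> hc H \<rightarrow>\<^sub>E hc H" using L by (auto simp: PiE_iff)
 qed
qed

text \<open>A separating vector of a von Neumann algebra is cyclic for the commutant: the projection onto
 the closed orbit of the commutant lies in the algebra and fixes the vector.\<close>

lemma separating_imp_cyclic_commutant:
 assumes h: "hilbert_space H" and M: "von_neumann_algebra H M" and v: "v \<in> hc H" and sep: "separating_vector H M v"
 shows "cyclic_vector H (commutant H M) v"
proof -
 interpret hilbert_space H by (rule h)
 have MB: "M \<subseteq> bops H" and Ma: "\<And>y. y \<in> M ==> hadj H H y \<in> M" and MM: "commutant H (commutant H M) = M"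
  using M by (auto simp: von_neumann_algebra_def)
 let ?O = "{x v |x. x \<in> commutant H M}"
 let ?L = "htop H closure_of ?O"
 have O: "?O \<subseteq> hc H" using v commutantD(1) bopD(1) by fast
 have L: "closed_subspace H ?L" by (rule orbit_closed_subspace[OF h MB v])
 let ?P = "hproj ?L"
 note Pb = hproj_bop[OF h L]
 have "?P \<in> commutant H (commutant H M)"
 proof (rule commutantI[OF Pb])
  fix y \<xi> assume y: "y \<in> commutant H M" and x: "\<xi> \<in> hc H"
  note yb = commutantD(1)[OF y]
  note a = hadj_props[OF h h yb]
  have ya: "hadj H H y \<in> commutant H M" by (rule commutant_hadj[OF h MB Ma y])
  show "?P (y \<xi>) = y (?P \<xi>)"
  proof (rule hproj_unique[OF L bopD(1)[OF yb x]])
   show "y (?P \<xi>) \<in> ?L" by (rule orbit_invariant[OF h MB v y hproj_props(1)[OF L x]])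
   fix z assume z: "z \<in> ?L"
   then have zc: "z \<in> hc H" using closed_subspaceD(1)[OF L] by blast
   have "hinner H z (y (?P \<xi>)) = hinner H (hadj H H y z) (?P \<xi>)" using a(3)[OF hproj_closed[OF L x] zc] by simp
   also have "\<dots> = hinner H (hadj H H y z) \<xi>" by (rule inner_hproj[OF L x orbit_invariant[OF h MB v ya z]])
   also have "\<dots> = hinner H z (y \<xi>)" by (rule a(3)[OF x zc])
   finally show "hinner H z (y (?P \<xi>)) = hinner H z (y \<xi>)" .
  qed
 qed
 then have PM: "?P \<in> M" unfolding MM .
 have vL: "v \<in> ?L"
 proof -
  have "v = scalar_op H 1 v" using v by simp
  then have "v \<in> ?O" using commutant_scalar[OF h MB] by blast
  then show ?thesis using closure_superset[OF O] by blast
 qed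
 \<comment> \<open>\<open>?Q\<close> is the complementary projection \<open>1 - P\<close>. It lies
   in \<open>M\<close> and kills \<open>v\<close>, so it vanishes and the orbit is dense.\<close>
 let ?mP = "compose (hc H) (scalar_op H (-1)) ?P"
 let ?Q = "\<lambda>\<xi>\<in>hc H. hadd H (scalar_op H 1 \<xi>) (?mP \<xi>)"
 have cb: "commutant H M \<subseteq> bops H" by (rule commutant_bops)
 have "?Q \<in> commutant H (commutant H M)"
  by (intro commutant_add[OF h cb] commutant_compose[OF h cb] commutant_scalar[OF h cb]) (simp_all add: MM PM)
 then have QM: "?Q \<in> M" unfolding MM .
 have Q: "?Q \<xi> = hdiff H \<xi> (?P \<xi>)" if "\<xi> \<in> hc H" for \<xi> using that L by (simp add: compose_def)
 have "?Q v = hzero H" using Q[OF v] hproj_ident[OF L vL] v by simp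
 then have "?Q = scalar_op H 0" using sep QM by (simp add: separating_vector_def)
 then have "hdiff H \<xi> (?P \<xi>) = hzero H" if "\<xi> \<in> hc H" for \<xi>
  using Q[OF that] that by simp
 then have "\<xi> \<in> ?L" if "\<xi> \<in> hc H" for \<xi>
  using diff_zero_iff[OF that hproj_closed[OF L that]] hproj_props(1)[OF L that] that by simp
 then show ?thesis unfolding cyclic_vector_def using closed_subspaceD(1)[OF L] by blast
qed

section \<open>The vacuum is cyclic and separating for the free product algebra\<close>

context free_product
begin

lemma J_zero [simp]: "J (hzero F) = hzero F"
 by (rule bop_zero[OF J_bop F.pre F.pre])

text \<open>On H(k) the vector \<open>lam k S \<eta>\<close> depends on \<open>S\<close> only
  through \<open>S (\<Omega> k)\<close>, which runs through a dense set; so any letter can be put in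
  front of a word already reached. \<open>L\<close> is left general because it is used twice: as the
  closed orbit of the vacuum, with the algebras themselves, and as the kernel of an operator, with
  their commutants.\<close>

lemma vacuum_generates:
 assumes L: "closed_subspace F L" and v: "vac \<in> L"
  and inv: "\<And>k S \<xi>. k \<in> K ==> S \<in> N k ==> \<xi> \<in> L ==> lam k S \<xi> \<in> L"
  and N: "\<And>k. k \<in> K ==> N k \<subseteq> bops (H k)"
  and cyc: "\<And>k. k \<in> K ==> cyclic_vector (H k) (N k) (\<Omega> k)"
 shows "L = hc F"
proof (rule F.total_induct[OF fv_total L])
 have "fv w xs \<in> L" if "w \<in> W" "xs \<in> args w" for w xs
  using that
 proof (induction w arbitrary: xs)
  case Nil
  then show ?case using v by (simp add: vac_eq)
 next
  case (Cons k w)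
  then obtain x xs' where xs: "xs = x # xs'" "x \<in> cplus k" "xs' \<in> args w" by (auto simp: set_Cons_def)
  have k: "k \<in> K" and o: "(w, xs') \<in> idx_off k" using Cons.prems xs by (auto simp: idx_off_def)
  note i = idx_off_Cons[OF k o]
  have IH: "fv w xs' \<in> L" using Cons.IH[OF i(1,2)] .
  let ?f = "\<lambda>x\<in>hc (H k). act k x (fv w xs')"
  have f: "?f \<in> bop (H k) F" by (rule act_bop_left[OF k i(6)])
  have cs: "closed_subspace (H k) {x \<in> hc (H k). ?f x \<in> L}"
   by (rule bop_vimage_closed[OF f _ _ L]) (use k in auto)
  have "S (\<Omega> k) \<in> {x \<in> hc (H k). ?f x \<in> L}" if S: "S \<in> N k" for S
  proof -
   have Sb: "S \<in> bops (H k)" using N[OF k] S by blast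
   then show ?thesis using inv[OF k S IH] lam_G[OF k Sb i(6)] bopD(1)[OF Sb vac_in[OF k]] by simp
  qed
  then have "x \<in> {x \<in> hc (H k). ?f x \<in> L}"
   using cyc[OF k] xs(2) unfolding cyclic_vector_iff[OF hilb[OF k] N[OF k] vac_in[OF k]]
   by (intro pre_hilbert_space.closed_subspaceD(5)[OF pre_hilb[OF k] cs]) blast+
  then show ?case using act_cplus_fv[OF k xs(2) o] xs(1,2) by fastforce
 qed
 then show "(\<lambda>(w, xs). fv w xs) ` idx \<subseteq> L" by (auto simp: idx_def)
qed

end

locale free_product_vN = free_product +
 fixes M :: "'a \<Rightarrow> ('b \<Rightarrow> 'b) set"
 assumes vN: "k \<in> K ==> von_neumann_algebra (H k) (M k)"
  and cyc: "k \<in> K ==> cyclic_vector (H k) (M k) (\<Omega> k)"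
  and sep: "k \<in> K ==> separating_vector (H k) (M k) (\<Omega> k)"
begin

abbreviation "gens \<equiv> \<Union>k\<in>K. lam k ` M k"
abbreviation "MM \<equiv> free_vN K H \<Omega> M"

lemma M_bops: "k \<in> K ==> M k \<subseteq> bops (H k)"
 using vN by (simp add: von_neumann_algebra_def)

lemma MM_eq: "MM = commutant F (commutant F gens)"
 by (simp add: free_vN_def vN_join_def)

lemma gens_bops: "gens \<subseteq> bops F"
 using lam_bop M_bops by blast

lemma gens_hadj: "y \<in> gens ==> hadj F F y \<in> gens"
 using lam_hadj M_bops vN by (fastforce simp: von_neumann_algebra_def)

lemma lam_in_MM: "k \<in> K ==> S \<in> M k ==> lam k S \<in> MM"
 unfolding MM_eq using double_commutant_superset[OF gens_bops] by blast

lemma MM_vN: "von_neumann_algebra F MM"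
 unfolding von_neumann_algebra_def
proof (intro conjI ballI)
 show "MM \<subseteq> bops F" unfolding MM_eq by (rule commutant_bops)
 show "hadj F F x \<in> MM" if "x \<in> MM" for x
  using that unfolding MM_eq
  by (intro commutant_hadj[OF hilbert_F commutant_bops] commutant_hadj[OF hilbert_F gens_bops gens_hadj])
 show "commutant F (commutant F MM) = MM"
  unfolding MM_eq by (rule triple_commutant[OF commutant_bops])
qed

lemma MM_cyclic: "cyclic_vector F MM vac"
proof -
 note cb = commutant_bops[of F gens]
 have "htop F closure_of {x vac |x. x \<in> MM} = hc F"
 proof (rule vacuum_generates[where N = M])
  show "closed_subspace F (htop F closure_of {x vac |x. x \<in> MM})"
   unfolding MM_eq by (rule orbit_closed_subspace[OF hilbert_F cb vac_closed])
  have O: "{x vac |x. x \<in> MM} \<subseteq> hc F" unfolding MM_eq using commutantD(1) bopD(1) vac_closed by fast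
  have "vac = scalar_op F 1 vac" by simp
  then have "vac \<in> {x vac |x. x \<in> MM}" unfolding MM_eq using commutant_scalar[OF hilbert_F cb] by blast
  then show "vac \<in> htop F closure_of {x vac |x. x \<in> MM}"
   using F.closure_superset[OF O] by blast
  show "lam k S \<xi> \<in> htop F closure_of {x vac |x. x \<in> MM}"
   if "k \<in> K" "S \<in> M k" "\<xi> \<in> htop F closure_of {x vac |x. x \<in> MM}" for k S \<xi>
   using orbit_invariant[OF hilbert_F cb vac_closed, of "lam k S" \<xi>] lam_in_MM[OF that(1,2)] that(3)
   unfolding MM_eq by blast
 qed (use M_bops cyc in auto)
 then show ?thesis by (simp add: cyclic_vector_def)
qed

lemma rho_in_commutant:
 assumes k: "k \<in> K" and T: "T \<in> commutant (H k) (M k)"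
 shows "rho k T \<in> commutant F gens"
proof (rule commutantI)
 note Tb = commutantD[OF T]
 show "rho k T \<in> bops F" by (rule rho_bop[OF k Tb(1)])
 fix y \<xi> assume "y \<in> gens" and x: "\<xi> \<in> hc F"
 then obtain \<mu> S where y: "y = lam \<mu> S" "\<mu> \<in> K" "S \<in> M \<mu>" by blast
 have "compose (hc F) (lam \<mu> S) (rho k T) = compose (hc F) (rho k T) (lam \<mu> S)"
  by (rule lam_rho_commute[OF y(2) k])
   (use y M_bops Tb T in \<open>auto simp: commutant_def\<close>)
 from fun_cong[OF this, of \<xi>] show "rho k T (y \<xi>) = y (rho k T \<xi>)" using x y by (simp add: compose_def)
qed

lemma MM_rho:
 assumes "k \<in> K" "T \<in> commutant (H k) (M k)" "x \<in> MM" "\<xi> \<in> hc F"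
 shows "x (rho k T \<xi>) = rho k T (x \<xi>)"
 using commutantD(2)[of x F "commutant F gens" "rho k T" \<xi>] rho_in_commutant[OF assms(1,2)] assms(3,4)
 by (simp add: MM_eq)

text \<open>\<open>x\<close> commutes with the right actions of the commutants. Conjugated by the
  flip, this says that the kernel of \<open>y = J x J\<close> is invariant under their left actions;
  as it contains the vacuum, \<open>vacuum_generates\<close> makes it everything.\<close>

lemma MM_separating: "separating_vector F MM vac"
 unfolding separating_vector_def
proof (intro ballI impI)
 fix x assume x: "x \<in> MM" and x0: "x vac = hzero F"
 have xb: "x \<in> bops F" using x unfolding MM_eq by (rule commutantD(1))
 define y where "y = compose (hc F) J (compose (hc F) x J)"
 have yb: "y \<in> bops F" unfolding y_def by (intro bop_compose[OF bop_compose[OF J_bop xb] J_bop]) auto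
 have y: "y \<xi> = J (x (J \<xi>))" if "\<xi> \<in> hc F" for \<xi> using that by (simp add: y_def compose_def)
 \<comment> \<open>This makes the kernel of \<open>y\<close> the preimage of a closed
   subspace.\<close>
 have z: "closed_subspace F {hzero F}"
 proof (rule F.closed_subspaceI)
  fix v assume v: "v \<in> hc F" and a: "\<And>e. e > 0 ==> \<exists>y\<in>{hzero F}. hnorm F (hdiff F v y) < e"
  have "hnorm F v \<le> 0"
  proof (rule field_le_epsilon)
   show "hnorm F v \<le> 0 + e" if "e > 0" for e using a[OF that] v by simp
  qed
  then show "v \<in> {hzero F}" using F.hnorm_eq_zero[OF v] v F.hnorm_nonneg[OF v] by simp
 qed auto
 have "{\<xi> \<in> hc F. y \<xi> \<in> {hzero F}} = hc F"
 proof (rule vacuum_generates[where N = "\<lambda>k. commutant (H k) (M k)"])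
  show "closed_subspace F {\<xi> \<in> hc F. y \<xi> \<in> {hzero F}}" by (rule bop_vimage_closed[OF yb _ _ z]) auto
  show "vac \<in> {\<xi> \<in> hc F. y \<xi> \<in> {hzero F}}" using x0 by (simp add: y J_zero)
  show "cyclic_vector (H k) (commutant (H k) (M k)) (\<Omega> k)" if "k \<in> K" for k
   using that by (intro separating_imp_cyclic_commutant hilb vN vac_in sep)
  fix k T \<xi> assume k: "k \<in> K" and T: "T \<in> commutant (H k) (M k)" and "\<xi> \<in> {\<xi> \<in> hc F. y \<xi> \<in> {hzero F}}"
  then have xi: "\<xi> \<in> hc F" "y \<xi> = hzero F" by auto
  note lb = lam_bop[OF k commutantD(1)[OF T]]
  have lc: "lam k T \<xi> \<in> hc F" using bopD(1)[OF lb xi(1)] .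
  have "x (J \<xi>) = J (y \<xi>)" using y[OF xi(1)] J_J[OF bopD(1)[OF xb J_closed[OF xi(1)]]] by simp
  then have xJ: "x (J \<xi>) = hzero F" unfolding xi(2) by simp
  have "J (lam k T \<xi>) = rho k T (J \<xi>)" using xi by (simp add: rho_apply)
  then have "y (lam k T \<xi>) = J (rho k T (x (J \<xi>)))" using y[OF lc] MM_rho[OF k T x, of "J \<xi>"] xi by simp
  also have "\<dots> = hzero F" using bop_zero[OF rho_bop[OF k commutantD(1)[OF T]]] by (simp add: xJ)
  finally show "lam k T \<xi> \<in> {\<xi> \<in> hc F. y \<xi> \<in> {hzero F}}" using lc by simp
 qed (auto simp: commutant_bops)
 then have y0: "y \<xi> = hzero F" if "\<xi> \<in> hc F" for \<xi> using that by blast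
 have "x \<xi> = scalar_op F 0 \<xi>" if xi: "\<xi> \<in> hc F" for \<xi>
 proof -
  have "x \<xi> = J (y (J \<xi>))" using xi y[of "J \<xi>"] bopD(1)[OF xb xi] by simp
  then show ?thesis using y0[of "J \<xi>"] xi by (simp add: J_zero)
 qed
 then show "x = scalar_op F 0" by (intro bop_eqI[OF xb scalar_op_bop]) auto
qed

end

section \<open>Free products of unitaries\<close>

lemma Ad_bop:
 assumes h: "hilbert_space L" and u: "unitary_op L L u" and x: "x \<in> bops L"
 shows "Ad L u x \<in> bops L" "\<And>\<xi>. \<xi> \<in> hc L ==> Ad L u x (u \<xi>) = u (x \<xi>)"
proof -
 note a = hadj_props(1)[OF h h unitary_opD(1)[OF u]]
 show "Ad L u x \<in> bops L" unfolding Ad_def using h by (intro bop_compose[OF bop_compose[OF a x] unitary_opD(1)[OF u]]) auto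
 show "Ad L u x (u \<xi>) = u (x \<xi>)" if "\<xi> \<in> hc L" for \<xi>
  unfolding Ad_def using that bopD(1)[OF unitary_opD(1)[OF u] that] hadj_unitary_left[OF h h u that] by (simp add: compose_def)
qed

locale free_unitaries = free_product +
 fixes U :: "'a \<Rightarrow> 'b \<Rightarrow> 'b"
 assumes U_unitary: "k \<in> K ==> unitary_op (H k) (H k) (U k)"
  and U_fix: "k \<in> K ==> U k (\<Omega> k) = \<Omega> k"
begin

abbreviation "FU \<equiv> free_unitary K H \<Omega> U"

lemmas U_bop = unitary_opD(1)[OF U_unitary]

lemma U_closed: "k \<in> K ==> x \<in> hc (H k) ==> U k x \<in> hc (H k)"
 by (rule bopD(1)[OF U_bop])

lemma vc_U:
 assumes "k \<in> K" "x \<in> hc (H k)"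
 shows "vc k (U k x) = vc k x"
 unfolding vc_def
 using unitary_opD(2)[OF U_unitary[OF assms(1)] vac_in[OF assms(1)] assms(2)] by (simp add: U_fix assms(1))

lemma cplus_U: "k \<in> K ==> x \<in> cplus k ==> U k x \<in> cplus k"
 using vc_U[of k x] U_closed by (simp add: vc_def)

lemma pp_U:
 assumes k: "k \<in> K" and x: "x \<in> hc (H k)"
 shows "pp k (U k x) = U k (pp k x)"
 unfolding pp_def vc_U[OF assms]
 using k x vac_in[OF k] by (simp add: bopD(2,3)[OF U_bop[OF k]] U_fix)

lemma restrict_U_unitary:
 assumes k: "k \<in> K"
 shows "unitary_op (hcompl (H k) (\<Omega> k)) (hcompl (H k) (\<Omega> k)) (restrict (U k) (hc (hcompl (H k) (\<Omega> k))))"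
 unfolding unitary_op_def
proof (intro conjI ballI)
 note u = unitary_opD[OF U_unitary[OF k]]
 show "restrict (U k) (hc (hcompl (H k) (\<Omega> k))) \<in> bops (hcompl (H k) (\<Omega> k))"
  by (rule bopI[where C = 1]) (use k cplus_U[OF k] u(4) vac_in[OF k] in \<open>auto simp: bopD(2,3)[OF u(1)]\<close>)
 show "restrict (U k) (hc (hcompl (H k) (\<Omega> k))) ` hc (hcompl (H k) (\<Omega> k)) = hc (hcompl (H k) (\<Omega> k))"
 proof
  show "hc (hcompl (H k) (\<Omega> k)) \<subseteq> restrict (U k) (hc (hcompl (H k) (\<Omega> k))) ` hc (hcompl (H k) (\<Omega> k))"
  proof
   fix y assume y: "y \<in> hc (hcompl (H k) (\<Omega> k))"
   then obtain x where x: "x \<in> hc (H k)" "y = U k x" using u(3) by auto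
   then have "x \<in> cplus k" using y vc_U[OF k x(1)] by (simp add: vc_def)
   then show "y \<in> restrict (U k) (hc (hcompl (H k) (\<Omega> k))) ` hc (hcompl (H k) (\<Omega> k))"
    using x by (auto intro!: image_eqI[of _ _ x])
  qed
 qed (use cplus_U[OF k] in auto)
qed (use unitary_opD(2)[OF U_unitary[OF k]] in auto)

definition mapU :: "'a list \<Rightarrow> 'b list \<Rightarrow> 'b list" where
 "mapU w xs = map2 (\<lambda>k x. U k x) w xs"

lemma mapU_simps [simp]: "mapU [] xs = []" "mapU (k # w) (x # xs) = U k x # mapU w xs"
 by (simp_all add: mapU_def)

lemma mapU_args: "w \<in> W ==> xs \<in> args w ==> mapU w xs \<in> args w"
 by (induction w arbitrary: xs) (use cplus_U U_closed in \<open>auto simp: set_Cons_def\<close>)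

lemma mapU_eq:
 "w \<in> W ==> xs \<in> args w ==>
  map2 (\<lambda>R \<xi>. R \<xi>) (map (\<lambda>k. restrict (U k) (hc (hcompl (H k) (\<Omega> k)))) w) xs = mapU w xs"
 by (induction w arbitrary: xs) (auto simp: set_Cons_def)

lemma word_op:
 assumes w: "w \<in> W"
 defines "T \<equiv> tensor_list_op (word_factors H \<Omega> w) (map (\<lambda>k. restrict (U k) (hc (hcompl (H k) (\<Omega> k)))) w)"
 shows "unitary_op (word_space H \<Omega> w) (word_space H \<Omega> w) T"
  "\<And>xs. xs \<in> args w ==> T (tensor_list_vec (word_factors H \<Omega> w) xs) = tensor_list_vec (word_factors H \<Omega> w) (mapU w xs)"
proof -
 have len: "length (map (\<lambda>k. restrict (U k) (hc (hcompl (H k) (\<Omega> k)))) w) = length (word_factors H \<Omega> w)"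
  by (simp add: word_factors_def)
 have u: "unitary_op (word_factors H \<Omega> w ! i) (word_factors H \<Omega> w ! i) (map (\<lambda>k. restrict (U k) (hc (hcompl (H k) (\<Omega> k)))) w ! i)"
  if i: "i < length (word_factors H \<Omega> w)" for i
 proof -
  have "i < length w" using i by (simp add: word_factors_def)
  moreover have "w ! i \<in> K" using w \<open>i < length w\<close> nth_mem[of i w] by (auto simp: alternating_words_def)
  ultimately show ?thesis using restrict_U_unitary[of "w ! i"] by (simp add: word_factors_def)
 qed
 show "unitary_op (word_space H \<Omega> w) (word_space H \<Omega> w) T" unfolding T_def word_space_def by (rule tensor_list_op_unitary(1)) (use word_hilb[OF w] len u in auto)
 show "T (tensor_list_vec (word_factors H \<Omega> w) xs) = tensor_list_vec (word_factors H \<Omega> w) (mapU w xs)" if "xs \<in> args w" for xs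
  unfolding T_def mapU_eq[OF w that, symmetric]
  by (rule tensor_list_op_unitary(2)) (use word_hilb[OF w] len u that in auto)
qed

lemma FU_unitary: "unitary_op F F FU"
 unfolding free_unitary_def free_hilb_def by (rule family.hsum_op_unitary(1)) (rule word_op(1))

lemmas FU_bop = unitary_opD(1)[OF FU_unitary]

lemma FU_fv:
 assumes "w \<in> W" "xs \<in> args w"
 shows "FU (fv w xs) = fv w (mapU w xs)"
 unfolding free_unitary_def free_vec_def free_inj_def
 using family.hsum_op_unitary(2)[OF word_op(1) assms(1) word_vec_closed[OF assms]] word_op(2)[OF assms] by simp

lemma FU_vac: "FU vac = vac"
 unfolding vac_eq by (subst FU_fv) auto

text \<open>\<open>U k\<close> fixes the vacuum vector and thus commutes with the splitting of a
  letter, so \<open>FU\<close> acts slot by slot on \<open>act\<close> vectors and not only on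
  elementary tensors.\<close>

lemma FU_act:
 assumes k: "k \<in> K" and o: "(w, xs) \<in> idx_off k" and x: "x \<in> hc (H k)"
 shows "FU (act k x (fv w xs)) = act k (U k x) (fv w (mapU w xs))" "(w, mapU w xs) \<in> idx_off k"
proof -
 note i = idx_off_Cons[OF k o]
 show o': "(w, mapU w xs) \<in> idx_off k" using i mapU_args[OF i(1,2)] by (simp add: idx_off_def)
 note c = fv_closed[OF i(1,2)] fv_closed[OF i(3) i(5)[OF x]]
 have "FU (act k x (fv w xs)) = hadd F (hscale F (vc k x) (FU (fv w xs))) (FU (fv (k # w) (pp k x # xs)))"
  unfolding act_fv[OF k x o] act0_def using c by (simp add: bopD(2,3)[OF FU_bop])
 then show "FU (act k x (fv w xs)) = act k (U k x) (fv w (mapU w xs))"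
  unfolding act_fv[OF k U_closed[OF k x] o'] act0_def FU_fv[OF i(1,2)] FU_fv[OF i(3) i(5)[OF x]]
  by (simp add: vc_U[OF k x] pp_U[OF k x])
qed

lemma Ad_lam:
 assumes k: "k \<in> K" and S: "S \<in> bops (H k)"
 shows "Ad F FU (lam k S) = lam k (Ad (H k) (U k) S)"
proof -
 note l = lam_bop[OF k S]
 note A = Ad_bop[OF hilb[OF k] U_unitary[OF k] S]
 note l' = lam_bop[OF k A(1)] and B = Ad_bop[OF hilbert_F FU_unitary l]
 have "compose (hc F) FU (lam k S) = compose (hc F) (lam k (Ad (H k) (U k) S)) FU"
 proof (rule bop_eq_total[OF hilbert_F hilbert_F _ _ act_total[OF k] act_total_sub[OF k]])
  show "compose (hc F) FU (lam k S) \<in> bops F" by (intro bop_compose[OF l FU_bop]) auto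
  show "compose (hc F) (lam k (Ad (H k) (U k) S)) FU \<in> bops F" by (intro bop_compose[OF FU_bop l']) auto
  fix s assume "s \<in> (\<lambda>(x, w, xs). act k x (fv w xs)) ` idx_act k"
  then obtain x w xs where s: "s = act k x (fv w xs)" "x \<in> hc (H k)" "(w, xs) \<in> idx_off k"
   by (auto simp: idx_act_def)
  note g = idx_off_Cons(6)[OF k s(3)]
  note f = FU_act[OF k s(3) s(2)]
  have Sx: "S x \<in> hc (H k)" using bopD(1)[OF S s(2)] .
  have "FU (lam k S s) = act k (U k (S x)) (fv w (mapU w xs))"
   unfolding s(1) lam_act[OF k S s(2) g] by (rule FU_act(1)[OF k s(3) Sx])
  also have "\<dots> = lam k (Ad (H k) (U k) S) (FU s)"
   unfolding s(1) f(1) lam_act[OF k A(1) U_closed[OF k s(2)] idx_off_Cons(6)[OF k f(2)]] A(2)[OF s(2)] ..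
  finally show "compose (hc F) FU (lam k S) s = compose (hc F) (lam k (Ad (H k) (U k) S)) FU s"
   using act_closed[OF k s(2) g] by (simp add: compose_def s(1))
 qed
 note c = this
 have e: "FU (lam k S \<xi>) = lam k (Ad (H k) (U k) S) (FU \<xi>)" if "\<xi> \<in> hc F" for \<xi>
  using fun_cong[OF c, of \<xi>] that by (simp add: compose_def)
 show ?thesis
 proof (rule bop_eqI[OF B(1) l'])
  fix \<xi> assume "\<xi> \<in> hc F"
  then obtain \<eta> where "\<xi> = FU \<eta>" "\<eta> \<in> hc F" using unitary_opD(3)[OF FU_unitary] by blast
  then show "Ad F FU (lam k S) \<xi> = lam k (Ad (H k) (U k) S) \<xi>" using B(2) e by simp
 qed
qed

end

text \<open>For \<open>y\<close> in the commutant of \<open>C\<close> the operator \<open>z\<close>,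
  which is \<open>y\<close> conjugated back by \<open>u\<close>, commutes with \<open>B\<close>. So
  \<open>x\<close> commutes with \<open>z\<close>, and conjugating forward again gives the
  claim.\<close>

lemma Ad_double_commutant:
 assumes h: "hilbert_space L" and u: "unitary_op L L u" and B: "B \<subseteq> bops L"
  and AdB: "\<And>y. y \<in> B ==> Ad L u y \<in> C" and C: "C \<subseteq> bops L" and x: "x \<in> commutant L (commutant L B)"
 shows "Ad L u x \<in> commutant L (commutant L C)"
proof (rule commutantI)
 note ub = unitary_opD(1)[OF u]
 note a = hadj_props(1)[OF h h ub]
 note xb = commutantD(1)[OF x]
 have p: "pre_hilbert_space L" using h by simp
 have ad: "Ad L u x \<xi> = u (x (hadj L L u \<xi>))" if "\<xi> \<in> hc L" for x \<xi>
  using that by (simp add: Ad_def compose_def)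
 show "Ad L u x \<in> bops L" unfolding Ad_def by (intro bop_compose[OF bop_compose[OF a xb] ub] p)
 fix y \<xi> assume y: "y \<in> commutant L C" and xi: "\<xi> \<in> hc L"
 note yb = commutantD(1)[OF y]
 define z where "z = compose (hc L) (hadj L L u) (compose (hc L) y u)"
 have z: "z \<eta> = hadj L L u (y (u \<eta>))" if "\<eta> \<in> hc L" for \<eta> using that by (simp add: z_def compose_def)
 note ul = hadj_unitary_left[OF h h u] and ur = hadj_unitary_right[OF h h u]
 have "z \<in> commutant L B"
 proof (rule commutantI)
  show "z \<in> bops L" unfolding z_def by (intro bop_compose[OF bop_compose[OF ub yb] a] p)
  fix b \<eta> assume b: "b \<in> B" and e: "\<eta> \<in> hc L"
  have bb: "b \<in> bops L" using B b by blast
  note c = bopD(1)[OF bb e] bopD(1)[OF ub e] bopD(1)[OF yb bopD(1)[OF ub e]]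
  have "y (Ad L u b (u \<eta>)) = Ad L u b (y (u \<eta>))" by (rule commutantD(2)[OF y AdB[OF b] c(2)])
  then have "y (u (b \<eta>)) = u (b (hadj L L u (y (u \<eta>))))" using ad[OF c(2)] ad[OF c(3)] ul[OF e] by simp
  then show "z (b \<eta>) = b (z \<eta>)" using z[OF c(1)] z[OF e] ul[OF bopD(1)[OF bb bopD(1)[OF a c(3)]]] by simp
 qed
 note xz = commutantD(2)[OF x this]
 let ?e = "hadj L L u \<xi>"
 note e = bopD(1)[OF a xi]
 note yx = bopD(1)[OF yb xi]
 have "Ad L u x (y \<xi>) = u (x (hadj L L u (y \<xi>)))" by (rule ad[OF yx])
 also have "hadj L L u (y \<xi>) = z ?e" using z[OF e] ur[OF xi] by simp
 also have "x (z ?e) = z (x ?e)" by (rule xz[OF e])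
 also have "z (x ?e) = hadj L L u (y (u (x ?e)))" by (rule z[OF bopD(1)[OF xb e]])
 also have "u \<dots> = y (u (x ?e))" by (rule ur) (intro bopD(1)[OF yb] bopD(1)[OF ub] bopD(1)[OF xb] e)
 also have "u (x ?e) = Ad L u x \<xi>" using ad[OF xi] by simp
 finally show "Ad L u x (y \<xi>) = y (Ad L u x \<xi>)" .
qed

section \<open>The representation of the translations\<close>

locale free_rep = free_product +
 fixes T :: "'a \<Rightarrow> real \<times> real \<Rightarrow> 'b \<Rightarrow> 'b"
 assumes rep: "k \<in> K ==> unitary_rep (H k) (T k)"
  and T_fix: "k \<in> K ==> T k a (\<Omega> k) = \<Omega> k"
begin

abbreviation "TT \<equiv> \<lambda>a. free_unitary K H \<Omega> (\<lambda>k. T k a)"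

lemma free_unitaries_T: "free_unitaries K H \<Omega> (\<lambda>k. T k a)"
 using rep T_fix unfolding unitary_rep_def by unfold_locales blast+

sublocale U: free_unitaries K H \<Omega> "\<lambda>k. T k a" for a
 by (rule free_unitaries_T)

lemma TT_mult: "TT (a + b) = compose (hc F) (TT a) (TT b)"
proof (rule bop_eq_total[OF hilbert_F hilbert_F U.FU_bop _ fv_total fv_sub])
 show "compose (hc F) (TT a) (TT b) \<in> bops F" by (intro bop_compose[OF U.FU_bop U.FU_bop]) auto
 fix s assume "s \<in> (\<lambda>(w, xs). fv w xs) ` idx"
 then obtain w xs where s: "s = fv w xs" "w \<in> W" "xs \<in> args w" by (auto simp: idx_def)
 have "U.mapU (a + b) w xs = U.mapU a w (U.mapU b w xs)"
  using s(2,3)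
 proof (induction w arbitrary: xs)
  case (Cons k w)
  then obtain x xs' where xs: "xs = x # xs'" "x \<in> cplus k" "xs' \<in> args w" by (auto simp: set_Cons_def)
  have "T k (a + b) = compose (hc (H k)) (T k a) (T k b)"
   using rep[of k] Cons.prems(1) unfolding unitary_rep_def words_simps by blast
  then show ?case using Cons.IH[OF _ xs(3)] Cons.prems xs by (simp add: compose_def)
 qed simp
 then show "TT (a + b) s = compose (hc F) (TT a) (TT b) s"
  using s U.mapU_args[OF s(2,3)] by (simp add: compose_def U.FU_fv)
qed
end

section \<open>Projection-valued measures\<close>

locale pvm_space = hilbert_space H for H :: "'a hilb" +
 fixes E :: "(real \<times> real) set \<Rightarrow> 'a \<Rightarrow> 'a"
 assumes pvm: "pvm H E"
begin

abbreviation "mu \<equiv> pvm_scalar H E"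

lemma E_bop: "B \<in> sets borel ==> E B \<in> bops H"
 using pvm by (simp add: pvm_def projection_op_def)

lemma E_closed [simp]: "B \<in> sets borel ==> x \<in> hc H ==> E B x \<in> hc H"
 using bopD(1)[OF E_bop] by blast

lemma E_E:
 assumes "A \<in> sets borel" "B \<in> sets borel" "x \<in> hc H"
 shows "E A (E B x) = E (A \<inter> B) x"
proof -
 have "E (A \<inter> B) = compose (hc H) (E A) (E B)" using pvm assms by (simp add: pvm_def)
 then show ?thesis using assms by (simp add: compose_def)
qed

lemma E_self:
 assumes "B \<in> sets borel" "x \<in> hc H" "y \<in> hc H"
 shows "hinner H (E B x) y = hinner H x (E B y)"
proof -
 have "hadj H H (E B) = E B" using pvm assms by (simp add: pvm_def projection_op_def)
 then show ?thesis using hadj_props(2)[OF hil hil E_bop[OF assms(1)] assms(2,3)] by simp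
qed

lemma inner_E_E:
 assumes "A \<in> sets borel" "B \<in> sets borel" "x \<in> hc H" "y \<in> hc H"
 shows "hinner H (E A x) (E B y) = hinner H x (E (A \<inter> B) y)"
 using assms by (simp add: E_self E_E)

lemma E_UNIV: "x \<in> hc H ==> E UNIV x = x"
 using pvm by (simp add: pvm_def)

lemma inner_E: "B \<in> sets borel ==> x \<in> hc H ==> hinner H x (E B x) = complex_of_real ((hnorm H (E B x))\<^sup>2)"
 using inner_E_E[of B B x x] inner_self[of "E B x"] by simp

lemma E_sums:
 fixes B :: "nat \<Rightarrow> (real \<times> real) set"
 assumes "x \<in> hc H" "range B \<subseteq> sets borel" "disjoint_family B"
 shows "(\<lambda>n. (hnorm H (E (B n) x))\<^sup>2) sums (hnorm H (E (\<Union>n. B n) x))\<^sup>2"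
proof -
 have "(\<lambda>n. hinner H x (E (B n) x)) sums hinner H x (E (\<Union>n. B n) x)"
  using pvm assms unfolding pvm_def by blast
 then have "(\<lambda>n. Re (hinner H x (E (B n) x))) sums Re (hinner H x (E (\<Union>n. B n) x))" by (rule sums_Re)
 moreover have "Re (hinner H x (E A x)) = (hnorm H (E A x))\<^sup>2" if "A \<in> sets borel" for A
  using inner_E[OF that assms(1)] by simp
 moreover have "B n \<in> sets borel" "(\<Union>n. B n) \<in> sets borel" for n using assms(2) by auto
 ultimately show ?thesis by simp
qed

lemma E_empty:
 assumes x: "x \<in> hc H"
 shows "E {} x = hzero H"
proof -
 have "(\<lambda>n::nat. (hnorm H (E {} x))\<^sup>2) sums (hnorm H (E {} x))\<^sup>2"
  using E_sums[OF x, of "\<lambda>_. {}"] by (simp add: disjoint_family_on_def)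
 then have "(\<lambda>n::nat. (hnorm H (E {} x))\<^sup>2) \<longlonglongrightarrow> 0" by (intro summable_LIMSEQ_zero sums_summable)
 then show ?thesis using x hnorm_eq_zero[of "E {} x"] by (simp add: LIMSEQ_const_iff)
qed

text \<open>\<open>measure_of\<close> has the intended values only once countable additivity is
  known. Since the projections are self-adjoint idempotents, the weak additivity in
  \<open>pvm\<close> is additivity of squared norms.\<close>

lemma
 assumes x: "x \<in> hc H"
 shows sets_mu [simp, measurable_cong]: "sets (mu x) = sets borel"
  and space_mu [simp]: "space (mu x) = UNIV"
  and emeasure_mu: "B \<in> sets borel ==> emeasure (mu x) B = ennreal ((hnorm H (E B x))\<^sup>2)"
proof -
 have sa: "sigma_algebra UNIV (sets (borel :: (real \<times> real) measure))"
  using sets.sigma_algebra_axioms[of "borel :: (real \<times> real) measure"] by simp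
 show "sets (mu x) = sets borel" unfolding pvm_scalar_def
  by (simp add: sigma_algebra.sets_measure_of_eq[OF sa])
 show "space (mu x) = UNIV" unfolding pvm_scalar_def by (simp add: space_measure_of_conv)
 assume B: "B \<in> sets borel"
 have "emeasure (mu x) B = ennreal (Re (hinner H x (E B x)))"
  unfolding pvm_scalar_def
 proof (rule emeasure_measure_of_sigma[OF sa _ _ B])
  show "positive (sets borel) (\<lambda>B. ennreal (Re (hinner H x (E B x))))"
   using x by (simp add: positive_def E_empty)
  show "countably_additive (sets borel) (\<lambda>B. ennreal (Re (hinner H x (E B x))))"
  proof (rule countably_additiveI)
   fix A :: "nat \<Rightarrow> (real \<times> real) set"
   assume A: "range A \<subseteq> sets borel" "disjoint_family A" "(\<Union>i. A i) \<in> sets borel"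
   have r: "Re (hinner H x (E (A i) x)) = (hnorm H (E (A i) x))\<^sup>2" for i
    using inner_E[of "A i" x] A x by auto
   have "(\<Sum>i. ennreal ((hnorm H (E (A i) x))\<^sup>2)) = ennreal ((hnorm H (E (\<Union>i. A i) x))\<^sup>2)"
    by (rule suminf_ennreal_eq[OF _ E_sums[OF x A(1,2)]]) simp
   then show "(\<Sum>i. ennreal (Re (hinner H x (E (A i) x)))) = ennreal (Re (hinner H x (E (\<Union>i. A i) x)))"
    using r inner_E[OF A(3) x] by simp
  qed
 qed
 then show "emeasure (mu x) B = ennreal ((hnorm H (E B x))\<^sup>2)" using inner_E[OF B x] by simp
qed

lemma finite_mu: "x \<in> hc H ==> finite_measure (mu x)"
 by (rule finite_measureI) (simp add: emeasure_mu)

lemma measure_mu: "x \<in> hc H ==> B \<in> sets borel ==> measure (mu x) B = (hnorm H (E B x))\<^sup>2"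
 by (simp add: measure_def emeasure_mu)

lemma inner_E_measure:
 assumes "A \<in> sets borel" "B \<in> sets borel" "x \<in> hc H"
 shows "hinner H (E A x) (E B x) = complex_of_real (measure (mu x) (A \<inter> B))"
 using assms inner_E[of "A \<inter> B" x] by (simp add: inner_E_E measure_mu)

lemma measure_mu_compl:
 assumes x: "x \<in> hc H" and A: "A \<in> sets borel"
 shows "measure (mu x) (- A) = (hnorm H x)\<^sup>2 - measure (mu x) A"
proof -
 interpret finite_measure "mu x" by (rule finite_mu[OF x])
 show ?thesis using finite_measure_compl[of A] A x measure_mu[OF x, of UNIV] E_UNIV[OF x] by (simp add: Compl_eq_Diff_UNIV)
qed

lemma E_diff_norm:
 assumes x: "x \<in> hc H" and A: "A \<in> sets borel"
 shows "(hnorm H (hdiff H x (E A x)))\<^sup>2 = measure (mu x) (- A)"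
 using x A hnorm_diff_sq[of x "E A x"] inner_E[OF A x] measure_mu_compl[OF x A] measure_mu[OF x A] by simp

lemma E_eq_self:
 assumes x: "x \<in> hc H" and A: "A \<in> sets borel" and 0: "emeasure (mu x) (- A) = 0"
 shows "E A x = x"
proof -
 have "(hnorm H (hdiff H x (E A x)))\<^sup>2 = 0" using E_diff_norm[OF x A] 0 by (simp add: measure_def)
 then have "hdiff H x (E A x) = hzero H" using hnorm_eq_zero[of "hdiff H x (E A x)"] x A by simp
 then show ?thesis using diff_zero_iff[OF x, of "E A x"] x A by simp
qed

lemma E_compl_add:
 assumes x: "x \<in> hc H" and A: "A \<in> sets borel"
 shows "hadd H (E A x) (E (- A) x) = x"
proof -
 have cA: "- A \<in> sets borel" using A by auto
 have "hinner H (E A x) (E (- A) x) = 0" using inner_E_measure[OF A cA x] by simp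
 moreover have "hinner H x (E A x) = complex_of_real (measure (mu x) A)" "hinner H x (E (- A) x) = complex_of_real (measure (mu x) (- A))"
  using inner_E[OF A x] inner_E[OF cA x] measure_mu[OF x] A cA by auto
 ultimately have "(hnorm H (hdiff H x (hadd H (E A x) (E (- A) x))))\<^sup>2 = 0"
  using x A cA measure_mu_compl[OF x A] measure_mu[OF x A] measure_mu[OF x cA]
  by (simp add: hnorm_diff_sq hnorm_add_sq)
 then have "hdiff H x (hadd H (E A x) (E (- A) x)) = hzero H"
  using hnorm_eq_zero[of "hdiff H x (hadd H (E A x) (E (- A) x))"] x A cA by simp
 then show ?thesis using diff_zero_iff[OF x, of "hadd H (E A x) (E (- A) x)"] x A cA by simp
qed

lemma mu_E:
 assumes x: "x \<in> hc H" and D: "D \<in> sets borel"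
 shows "mu (E D x) = density (mu x) (indicator D)"
proof (rule measure_eqI)
 show "sets (mu (E D x)) = sets (density (mu x) (indicator D))" using x D by simp
 fix A assume "A \<in> sets (mu (E D x))"
 then have A: "A \<in> sets borel" using x D by simp
 have "emeasure (density (mu x) (indicator D)) A = (\<integral>\<^sup>+ p. indicator D p * indicator A p \<partial>mu x)"
  using x A D by (intro emeasure_density) auto
 also have "\<dots> = (\<integral>\<^sup>+ p. indicator (D \<inter> A) p \<partial>mu x)"
  by (rule nn_integral_cong) (simp split: split_indicator)
 also have "\<dots> = emeasure (mu x) (D \<inter> A)" using x A D by simp
 finally show "emeasure (mu (E D x)) A = emeasure (density (mu x) (indicator D)) A"
  using x A D by (simp add: emeasure_mu E_E Int_commute)
qed

text \<open>The complement of the support is a union of open null sets, of which countably many suffice.\<close>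

lemma emeasure_outside_support:
 assumes x: "x \<in> hc H" and C: "closed C" and s: "pvm_support H E \<subseteq> C"
 shows "emeasure (mu x) (- C) = 0"
proof -
 define \<U> where "\<U> = {U. open U \<and> E U = scalar_op H 0}"
 have sub: "- C \<subseteq> \<Union>\<U>" using s by (auto simp: pvm_support_def \<U>_def)
 obtain \<V> where V: "\<V> \<subseteq> \<U>" "countable \<V>" "\<Union>\<V> = \<Union>\<U>" using Lindelof[of \<U>] by (auto simp: \<U>_def)
 have n: "U \<in> null_sets (mu x)" if "U \<in> \<V>" for U
  using that V(1) x by (auto simp: \<U>_def null_sets_def emeasure_mu)
 have "(\<Union>U\<in>\<V>. U) \<in> null_sets (mu x)" by (rule null_sets_UN'[OF V(2) n])
 then have "\<Union>\<U> \<in> null_sets (mu x)" using V(3) by simp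
 then have "- C \<in> null_sets (mu x)"
  by (rule null_sets_subset[OF _ _ sub]) (use x C in auto)
 then show ?thesis by blast
qed

end

section \<open>Representations with a spectral measure\<close>

definition phase :: "real \<times> real \<Rightarrow> real \<times> real \<Rightarrow> complex" where
 "phase a p = exp (\<i> * complex_of_real (lorentz a p))"

lemma norm_phase [simp]: "cmod (phase a p) = 1"
 by (simp add: phase_def)

lemma phase_zero [simp]: "phase a 0 = 1"
 by (simp add: phase_def lorentz_def)

lemma continuous_phase: "continuous_on UNIV (phase a)"
 unfolding phase_def lorentz_def by (intro continuous_intros)

lemma measurable_phase [measurable]: "phase a \<in> borel_measurable borel"
 by (rule borel_measurable_continuous_onI[OF continuous_phase])

lemma phase_add: "phase a (p + q) = phase a p * phase a q"
 by (simp add: phase_def lorentz_def exp_add[symmetric] algebra_simps)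

text \<open>For large n the angle has modulus below 1, and the only multiple of 2 pi there is 0. The
  point is that countably many translations suffice to recognize momentum 0 almost
  everywhere.\<close>

lemma cos_eq_1_all:
 assumes "\<And>n::nat. cos (t / Suc n) = 1"
 shows "t = 0"
proof -
 obtain n :: nat where n: "\<bar>t\<bar> < n" using reals_Archimedean2 by blast
 have a: "\<bar>t / Suc n\<bar> < 1" using n by (simp add: divide_less_eq)
 obtain k :: int where k: "t / Suc n = k * 2 * pi" using assms[of n] cos_one_2pi_int by auto
 have "k = 0"
 proof (rule ccontr)
  assume "k \<noteq> 0"
  then have "1 \<le> \<bar>real_of_int k\<bar>" by linarith
  then have "1 * 2 \<le> \<bar>real_of_int k\<bar> * (2 * pi)" using pi_gt3 by (intro mult_mono) auto
  then have "2 \<le> \<bar>real_of_int k * 2 * pi\<bar>" by (simp add: abs_mult)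
  then show False using a k by linarith
 qed
 then show ?thesis using k by simp
qed

locale spectral_rep = pvm_space +
 fixes T :: "real \<times> real \<Rightarrow> 'a \<Rightarrow> 'a"
 assumes unitary: "unitary_op H H (T a)"
  and formula: "\<xi> \<in> hc H ==> hinner H \<xi> (T a \<xi>) = (LINT p|mu \<xi>. phase a p)"
begin

lemma T_closed [simp]: "x \<in> hc H ==> T a x \<in> hc H"
 using bopD(1)[OF unitary_opD(1)[OF unitary]] by blast

text \<open>The spectral formula is given for diagonal matrix elements only, and that E(D) respects
  T(a) has to be extracted from it. Multiplying \<open>x2\<close> by a number \<open>c\<close> of
  modulus 1 does not change the scalar measure of \<open>x1 + x2\<close>, so
  \<open>K + c * P + cnj c * Q\<close> is independent of \<open>c\<close>. The values 1, -1, i, -i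
  force the cross term \<open>P\<close> to vanish, and the diagonal formula for \<open>x1\<close>
  remains.\<close>

lemma inner_E_T:
 assumes x: "x \<in> hc H" and D: "D \<in> sets borel"
 shows "hinner H (E D x) (T a x) = (LINT p|mu x. indicator D p *\<^sub>R phase a p)"
proof -
 define x1 x2 where "x1 = E D x" and "x2 = E (- D) x"
 have cD: "- D \<in> sets borel" using D by auto
 have c: "x1 \<in> hc H" "x2 \<in> hc H" using x D cD by (simp_all add: x1_def x2_def)
 note Tb = bopD[OF unitary_opD(1)[OF unitary]]
 have xs: "x = hadd H x1 x2" using E_compl_add[OF x D] by (simp add: x1_def x2_def)
 have mu_rot: "mu (hadd H x1 (hscale H c x2)) = mu x" if c1: "cmod c = 1" for c
 proof (rule measure_eqI)
  have cl: "hadd H x1 (hscale H c x2) \<in> hc H" using c by simp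
  show "sets (mu (hadd H x1 (hscale H c x2))) = sets (mu x)" using cl x by simp
  fix A assume "A \<in> sets (mu (hadd H x1 (hscale H c x2)))"
  then have A: "A \<in> sets borel" using cl by simp
  have e: "(hnorm H (E A (hadd H x1 (hscale H d x2))))\<^sup>2 = (hnorm H (E A x1))\<^sup>2 + (hnorm H (E A x2))\<^sup>2"
   if "cmod d = 1" for d
  proof -
   have z: "hinner H (E A x1) (E A x2) = 0"
   proof -
    have "A \<inter> D \<inter> (A \<inter> - D) = {}" by blast
    then show ?thesis
     using inner_E_measure[of "A \<inter> D" "A \<inter> - D" x] x A D cD by (simp add: x1_def x2_def E_E)
   qed
   show ?thesis using c A that
    by (simp add: z bopD(2,3)[OF E_bop[OF A]] hnorm_add_sq power_mult_distrib)
  qed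
  have "hadd H x1 (hscale H 1 x2) = x" using xs c by simp
  then show "emeasure (mu (hadd H x1 (hscale H c x2))) A = emeasure (mu x) A"
   using e[OF c1] e[of 1] cl x A by (simp add: emeasure_mu)
 qed
 define K where "K = hinner H x1 (T a x1) + hinner H x2 (T a x2)"
 define P Q where "P = hinner H x1 (T a x2)" and "Q = hinner H x2 (T a x1)"
 have rot: "K + c * P + cnj c * Q = (LINT p|mu x. phase a p)" if "cmod c = 1" for c
 proof -
  have cl: "hadd H x1 (hscale H c x2) \<in> hc H" using \<open>x1 \<in> hc H\<close> \<open>x2 \<in> hc H\<close> by simp
  have "c * cnj c = 1" using that complex_norm_square[of c] by simp
  then have cc: "cnj c * (c * z) = z" for z by (simp add: mult.assoc[symmetric] mult.commute)
  have "hinner H (hadd H x1 (hscale H c x2)) (T a (hadd H x1 (hscale H c x2))) = K + c * P + cnj c * Q"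
   using \<open>x1 \<in> hc H\<close> \<open>x2 \<in> hc H\<close> cc by (simp add: Tb(2,3) K_def P_def Q_def algebra_simps)
  then show ?thesis using formula[OF cl] mu_rot[OF that] by simp
 qed
 have "P + Q = - P - Q" using rot[of 1] rot[of "-1"] by (simp add: algebra_simps)
 moreover have "P = Q"
 proof -
  have "2 * (\<i> * (P - Q)) = (K + \<i> * P + cnj \<i> * Q) - (K + (- \<i>) * P + cnj (- \<i>) * Q)"
   by (simp add: algebra_simps)
  also have "\<dots> = 0" using rot[of \<i>] rot[of "- \<i>"] by simp
  finally show ?thesis by simp
 qed
 ultimately have "P = 0" by (simp add: complex_eq_iff)
 then have "hinner H x1 (T a x) = hinner H x1 (T a x1)" using c by (subst xs) (simp add: Tb(2) P_def)
 also have "\<dots> = (LINT p|density (mu x) (indicator D). phase a p)"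
  using formula[OF c(1)] mu_E[OF x D] by (simp add: x1_def)
 also have "density (mu x) (indicator D) = density (mu x) (\<lambda>p. ennreal (indicator D p :: real))"
  by (simp add: ennreal_indicator)
 also have "(LINT p|density (mu x) (\<lambda>p. ennreal (indicator D p :: real)). phase a p) = (LINT p|mu x. indicator D p *\<^sub>R phase a p)"
  using x D by (intro integral_density) (simp_all add: measurable_cong_sets[OF sets_mu[OF x] refl])
 finally show ?thesis by (simp add: x1_def)
qed

text \<open>The scalar measure of a vector in the range of \<open>E {0}\<close> sits at 0, where
  every phase is 1. Then the vector and its translate have inner product equal to the common squared
  norm, so they coincide.\<close>

lemma E_zero_invariant:
 assumes x: "x \<in> hc H"
 shows "T a (E {0} x) = E {0} x"
proof -
 let ?y = "E {0} x"
 have s: "{0} \<in> sets (borel :: (real \<times> real) measure)" by simp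
 have y: "?y \<in> hc H" using x s by simp
 have "emeasure (mu ?y) (- {0}) = 0"
  using x s by (simp add: emeasure_mu[OF y] E_E E_empty)
 then have "AE p in mu ?y. p = 0"
  using y by (intro AE_I[of _ _ "- {0}"]) auto
 then have "(LINT p|mu ?y. phase a p) = (LINT p|mu ?y. 1)"
  using y by (intro integral_cong_AE) (auto simp: measurable_cong_sets[OF sets_mu[OF y] refl] elim: eventually_mono)
 also have "\<dots> = complex_of_real (measure (mu ?y) UNIV)" using y by (simp add: scaleR_conv_of_real)
 also have "\<dots> = complex_of_real ((hnorm H ?y)\<^sup>2)" using measure_mu[OF y, of UNIV] E_UNIV[OF y] by simp
 finally have "Re (hinner H ?y (T a ?y)) = (hnorm H ?y)\<^sup>2" using formula[OF y] by simp
 then have "(hnorm H (hdiff H ?y (T a ?y)))\<^sup>2 = 0"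
  using hnorm_diff_sq[OF y T_closed[OF y]] unitary_opD(4)[OF unitary y] by simp
 then have "hdiff H ?y (T a ?y) = hzero H" using hnorm_eq_zero[of "hdiff H ?y (T a ?y)"] y by simp
 then show ?thesis using diff_zero_iff[OF y T_closed[OF y]] by simp
qed

text \<open>Invariance makes the integral of 1 - cos(a.p) vanish. The integrand is nonnegative, so
  cos(a.p) = 1 almost everywhere, simultaneously for the countably many \<open>a\<close> of
  \<open>cos_eq_1_all\<close> along the two axes; so p = 0 almost everywhere.\<close>

lemma invariant_E_zero:
 assumes x: "x \<in> hc H" and inv: "\<And>a. T a x = x"
 shows "E {0} x = x"
proof (rule E_eq_self[OF x])
 interpret finite_measure "mu x" by (rule finite_mu[OF x])
 have int: "integrable (mu x) (phase a)" for a
  by (rule integrable_const_bound[where B = 1]) (simp_all add: measurable_cong_sets[OF sets_mu[OF x] refl])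
 have cosae: "AE p in mu x. cos (lorentz a p) = 1" for a
 proof -
  have "(LINT p|mu x. phase a p) = complex_of_real ((hnorm H x)\<^sup>2)"
   using formula[OF x, of a] inv inner_self[OF x] by simp
  moreover have "Re (LINT p|mu x. phase a p) = (LINT p|mu x. Re (phase a p))" by (rule integral_Re[symmetric]) (rule int)
  moreover have "Re (phase a p) = cos (lorentz a p)" for p by (simp add: phase_def Re_exp)
  ultimately have c: "(LINT p|mu x. cos (lorentz a p)) = (hnorm H x)\<^sup>2" by simp
  have ic: "integrable (mu x) (\<lambda>p. cos (lorentz a p))"
   using integrable_Re[OF int[of a]] by (simp add: phase_def Re_exp)
  have "(LINT p|mu x. 1 - cos (lorentz a p)) = 0"
   using c ic measure_mu[OF x, of UNIV] E_UNIV[OF x] x by (simp add: Bochner_Integration.integral_diff)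
  then have "AE p in mu x. 1 - cos (lorentz a p) = 0"
   by (subst (asm) integral_nonneg_eq_0_iff_AE) (use ic in \<open>auto\<close>)
  then show ?thesis by (auto elim: eventually_mono)
 qed
 have "AE p in mu x. \<forall>n::nat. cos (lorentz (1 / Suc n, 0) p) = 1 \<and> cos (lorentz (0, 1 / Suc n) p) = 1"
  using cosae by (simp add: AE_all_countable AE_conj_iff)
 then have "AE p in mu x. p = 0"
 proof (rule eventually_mono)
  fix p assume a: "\<forall>n::nat. cos (lorentz (1 / Suc n, 0) p) = 1 \<and> cos (lorentz (0, 1 / Suc n) p) = 1"
  have "fst p = 0" by (rule cos_eq_1_all) (use a in \<open>simp add: lorentz_def\<close>)
  moreover have "snd p = 0" by (rule cos_eq_1_all) (use a in \<open>simp add: lorentz_def\<close>)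
  ultimately show "p = 0" by (simp add: prod_eq_iff)
 qed
 then show "emeasure (mu x) (- {0}) = 0"
  using x by (subst (asm) AE_iff_measurable[where N = "- {0}"]) auto
qed simp

text \<open>Unitarity and the group law reduce the squared distance of two translates to the
  integral of the phase of \<open>a - b\<close>, to which dominated convergence applies.\<close>

lemma strongly_continuous:
 assumes mult: "\<And>a b. T (a + b) = compose (hc H) (T a) (T b)"
 shows "unitary_rep H T"
proof -
 interpret M: Metric_space "hc H" "hdist H" by (rule metric)
 have "continuous_map euclidean (htop H) (\<lambda>a. T a \<xi>)" if x: "\<xi> \<in> hc H" for \<xi>
 proof -
  interpret finite_measure "mu \<xi>" by (rule finite_mu[OF x])
  have mp: "phase a \<in> borel_measurable (mu \<xi>)" for a
   by (simp only: measurable_cong_sets[OF sets_mu[OF x] refl] measurable_phase)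
  have ev: "\<forall>\<^sub>F a in nhds b. hdist H (T b \<xi>) (T a \<xi>) < e" if e: "e > 0" for b e
  proof -
   have dist: "(hdist H (T b \<xi>) (T a \<xi>))\<^sup>2 = 2 * (hnorm H \<xi>)\<^sup>2 - 2 * Re (LINT p|mu \<xi>. phase (a - b) p)" for a
   proof -
    have "T a \<xi> = T b (T (a - b) \<xi>)" using mult[of b "a - b"] x by (simp add: compose_def)
    then have "hinner H (T b \<xi>) (T a \<xi>) = (LINT p|mu \<xi>. phase (a - b) p)"
     using unitary_opD(2)[OF unitary x T_closed[OF x], of b "a - b"] formula[OF x, of "a - b"] by simp
    then show ?thesis
     using hnorm_diff_sq[OF T_closed[OF x] T_closed[OF x], of b a] unitary_opD(4)[OF unitary x] T_closed[OF x]
     by (simp add: hdist_eq)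
   qed
   have "((\<lambda>a. LINT p|mu \<xi>. phase (a - b) p) \<longlongrightarrow> (LINT p|mu \<xi>. phase (b - b) p)) (at b)"
    unfolding tendsto_at_iff_sequentially o_def
   proof (intro allI impI, rule integral_dominated_convergence[where w = "\<lambda>_. 1"])
    fix X assume "X \<longlonglongrightarrow> b"
    then show "AE p in mu \<xi>. (\<lambda>n. phase (X n - b) p) \<longlonglongrightarrow> phase (b - b) p"
     unfolding phase_def lorentz_def by (intro AE_I2 tendsto_intros)
   qed (use mp in auto)
   moreover have "(LINT p|mu \<xi>. phase (b - b) p) = complex_of_real ((hnorm H \<xi>)\<^sup>2)"
    using measure_mu[OF x, of UNIV] E_UNIV[OF x] x by (simp add: phase_def lorentz_def scaleR_conv_of_real)
   ultimately have "((\<lambda>a. (hdist H (T b \<xi>) (T a \<xi>))\<^sup>2) \<longlongrightarrow>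
     2 * (hnorm H \<xi>)\<^sup>2 - 2 * Re (complex_of_real ((hnorm H \<xi>)\<^sup>2))) (at b)"
    unfolding dist by (intro tendsto_intros) simp
   then have "\<forall>\<^sub>F a in at b. (hdist H (T b \<xi>) (T a \<xi>))\<^sup>2 < e\<^sup>2" by (rule order_tendstoD(2)) (use e in simp)
   then have "\<forall>\<^sub>F a in at b. hdist H (T b \<xi>) (T a \<xi>) < e"
    by (rule eventually_mono) (erule power2_less_imp_less, use e in simp)
   moreover have "hdist H (T b \<xi>) (T b \<xi>) < e" using T_closed[OF x] e by simp
   ultimately show ?thesis by (auto simp: eventually_at_filter elim: eventually_mono)
  qed
  show ?thesis
   unfolding M.continuous_map_to_metric
  proof (intro ballI allI impI)
   fix b and e :: real assume "e > 0"
   then obtain N where N: "open N" "b \<in> N" "\<And>a. a \<in> N ==> hdist H (T b \<xi>) (T a \<xi>) < e"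
    using ev[of e b] unfolding eventually_nhds by blast
   then show "\<exists>N. openin euclidean N \<and> b \<in> N \<and> (\<forall>a\<in>N. T a \<xi> \<in> M.mball (T b \<xi>) e)"
    using T_closed[OF x] by (intro exI[of _ N]) (simp add: M.in_mball)
  qed
 qed
 then show ?thesis unfolding unitary_rep_def using unitary mult by blast
qed

end

section \<open>Vectors indexed by measurable sets\<close>

text \<open>Complex measures, kept as bare set functions; the Dynkin argument
  \<open>sigma_additive_agree\<close> asks for no more structure.\<close>

definition sigma_additive :: "'p measure \<Rightarrow> ('p set \<Rightarrow> complex) \<Rightarrow> bool" where
 "sigma_additive N f \<longleftrightarrow> (\<forall>A :: nat \<Rightarrow> 'p set. range A \<subseteq> sets N \<longrightarrow> disjoint_family A \<longrightarrow>
  (\<lambda>n. f (A n)) sums f (\<Union>n. A n))"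

lemma sigma_additiveD:
 fixes A :: "nat \<Rightarrow> 'p set"
 assumes "sigma_additive N f" "range A \<subseteq> sets N" "disjoint_family A"
 shows "(\<lambda>n. f (A n)) sums f (\<Union>n. A n)"
 using assms unfolding sigma_additive_def by blast

lemma sigma_additive_empty:
 assumes "sigma_additive N f"
 shows "f {} = 0"
proof -
 have "(\<lambda>n::nat. f {}) sums f {}"
  using sigma_additiveD[OF assms, of "\<lambda>_. {}"] by (simp add: disjoint_family_on_def)
 then have "(\<lambda>n::nat. f {}) \<longlonglongrightarrow> 0" by (intro summable_LIMSEQ_zero sums_summable)
 then show ?thesis by (simp add: LIMSEQ_const_iff)
qed

lemma sigma_additive_Un:
 assumes s: "sigma_additive N f" and A: "A \<in> sets N" "B \<in> sets N" "A \<inter> B = {}"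
 shows "f (A \<union> B) = f A + f B"
proof -
 have "range (binaryset A B) \<subseteq> sets N" "disjoint_family (binaryset A B)"
  using A by (auto simp: binaryset_def disjoint_family_on_def)
 from sigma_additiveD[OF s this] have "(\<lambda>n. f (binaryset A B n)) sums f (A \<union> B)" by (simp add: UN_binaryset_eq)
 moreover have "(\<lambda>n. f (binaryset A B n)) sums (f A + f B)" by (rule binaryset_sums) (rule sigma_additive_empty[OF s])
 ultimately show ?thesis by (rule sums_unique2)
qed

lemma sigma_additive_agree:
 assumes f: "sigma_additive N f" and g: "sigma_additive N g"
  and G: "Int_stable G" "G \<subseteq> Pow (space N)" "sets N = sigma_sets (space N) G" "space N \<in> G"
  and agree: "\<And>A. A \<in> G ==> f A = g A" and A: "A \<in> sets N"
 shows "f A = g A"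
proof -
 have "A \<in> sigma_sets (space N) G" using A G(3) by simp
 then show ?thesis
 proof (induction rule: sigma_sets_induct_disjoint[OF G(1,2), consumes 1, case_names basic empty compl union])
  case (basic A) then show ?case by (rule agree)
 next
  case empty then show ?case using sigma_additive_empty f g by metis
 next
  case (compl A)
  have A: "A \<in> sets N" "space N - A \<in> sets N" using compl(1) G(3) by (auto intro: sigma_sets.Compl)
  have "A \<subseteq> space N" using A(1) sets.sets_into_space by blast
  then have u: "A \<union> (space N - A) = space N" "A \<inter> (space N - A) = {}" by auto
  have "f (space N) = f A + f (space N - A)" "g (space N) = g A + g (space N - A)"
   using sigma_additive_Un[OF f A u(2)] sigma_additive_Un[OF g A u(2)] u(1) by auto
  then show ?case using compl(2) agree[OF G(4)] by simp
 next
  case (union A)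
  have r: "range A \<subseteq> sets N" using union(2) G(3) by simp
  show ?case using sigma_additiveD[OF f r union(1)] sigma_additiveD[OF g r union(1)] union(3) sums_unique2 by simp
 qed
qed

text \<open>A family of vectors whose Gram matrix is given by the measures of intersections extends to
 all measurable sets. The vector of a set \<open>A\<close> represents the functional \<open>u d \<mapsto> N (rs d \<inter> A)\<close>,
 whose boundedness is the Cauchy-Schwarz inequality for step functions.\<close>

locale set_vectors = hilbert_space L for L :: "'a hilb" +
 fixes N :: "'p measure" and D :: "'d set" and rs :: "'d \<Rightarrow> 'p set" and u :: "'d \<Rightarrow> 'a"
 assumes fin: "finite_measure N"
  and rs: "d \<in> D ==> rs d \<in> sets N"
  and u: "d \<in> D ==> u d \<in> hc L"
  and gram: "d \<in> D ==> d' \<in> D ==> hinner L (u d) (u d') = complex_of_real (measure N (rs d \<inter> rs d'))"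
begin

definition step :: "(complex \<times> 'd) list \<Rightarrow> 'p \<Rightarrow> complex" where
 "step ps x = (\<Sum>p\<leftarrow>ps. fst p * indicator (rs (snd p)) x)"

lemma ind_int [simp]: "A \<in> sets N ==> integrable N (indicator A :: 'p \<Rightarrow> complex)"
 by (rule finite_measure.integrable_const_bound[OF fin, where B = 1]) (auto simp: indicator_def)

lemma ind_LINT: "A \<in> sets N ==> (LINT x|N. (indicator A x :: complex)) = complex_of_real (measure N A)"
proof -
 assume "A \<in> sets N"
 then have "(LINT x|N. (indicator A x :: real)) = measure N A"
  using sets.sets_into_space[of A N] by (simp add: Int_absorb2)
 moreover have "(indicator A x :: complex) = complex_of_real (indicator A x)" for x by (simp add: indicator_def)
 ultimately show ?thesis by (simp only: integral_complex_of_real)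
qed

lemma step_int: "snd ` set ps \<subseteq> D ==> integrable N (step ps)"
 by (induction ps) (use rs in \<open>auto simp: step_def[abs_def]\<close>)

lemma step_mult_int:
 assumes "snd ` set ps \<subseteq> D" "integrable N g"
 shows "integrable N (\<lambda>x. cnj (step ps x) * g x)"
 using assms
proof (induction ps)
 case (Cons p ps)
 then have p: "rs (snd p) \<in> sets N" using rs by auto
 have "integrable N (\<lambda>x. cnj (fst p) * (indicator (rs (snd p)) x * g x))"
  using p Cons.prems(2) by (intro integrable_mult_right Bochner_Integration.integrable_bound[OF Cons.prems(2)]) (auto split: split_indicator)
 moreover have "cnj (step (p # ps) x) * g x = cnj (fst p) * (indicator (rs (snd p)) x * g x) + cnj (step ps x) * g x" for x
  by (simp add: step_def algebra_simps indicator_def)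
 ultimately show ?case using Cons by simp
qed (simp add: step_def)

lemma ind_step:
 assumes ps: "snd ` set ps \<subseteq> D" and A: "A \<in> sets N"
 shows "integrable N (\<lambda>x. indicator A x * step ps x)"
  "(LINT x|N. indicator A x * step ps x) = (\<Sum>p\<leftarrow>ps. fst p * complex_of_real (measure N (rs (snd p) \<inter> A)))"
proof -
 have "integrable N (\<lambda>x. indicator A x * step ps x) \<and>
  (LINT x|N. indicator A x * step ps x) = (\<Sum>p\<leftarrow>ps. fst p * complex_of_real (measure N (rs (snd p) \<inter> A)))"
  using ps
 proof (induction ps)
  case (Cons p ps)
  then have p: "rs (snd p) \<inter> A \<in> sets N" using rs A by auto
  have e: "indicator A x * step (p # ps) x = fst p * indicator (rs (snd p) \<inter> A) x + indicator A x * step ps x" for x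
   by (auto simp: step_def algebra_simps split: split_indicator)
  show ?case unfolding e using Cons p by (simp add: ind_LINT)
 qed (simp add: step_def)
 then show "integrable N (\<lambda>x. indicator A x * step ps x)"
  "(LINT x|N. indicator A x * step ps x) = (\<Sum>p\<leftarrow>ps. fst p * complex_of_real (measure N (rs (snd p) \<inter> A)))" by auto
qed

lemma inner_u_lc: "d \<in> D ==> snd ` set ps \<subseteq> D ==> hinner L (u d) (lc u ps) = (LINT x|N. indicator (rs d) x * step ps x)"
 by (subst inner_lc_right)
  (use u rs in \<open>auto simp: ind_step(2) gram Int_commute image_subset_iff subset_iff intro!: arg_cong[of _ _ sum_list] map_cong\<close>)

lemma inner_lc_lc:
 assumes "snd ` set ps \<subseteq> D" "snd ` set qs \<subseteq> D"
 shows "hinner L (lc u ps) (lc u qs) = (LINT x|N. cnj (step ps x) * step qs x)"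
 using assms(1)
proof (induction ps)
 case Nil
 have "lc u qs \<in> hc L" by (rule lc_closed) (use u assms(2) in auto)
 then show ?case by (simp add: step_def)
next
 case (Cons p ps)
 have c: "lc u qs \<in> hc L" by (rule lc_closed) (use u assms(2) in auto)
 have c2: "lc u ps \<in> hc L" by (rule lc_closed) (use u Cons.prems in auto)
 have p: "snd p \<in> D" using Cons.prems by simp
 have e: "cnj (step (p # ps) x) * step qs x = cnj (fst p) * (indicator (rs (snd p)) x * step qs x) + cnj (step ps x) * step qs x" for x
  by (simp add: step_def algebra_simps indicator_def)
 have i: "integrable N (\<lambda>x. indicator (rs (snd p)) x * step qs x)" by (rule ind_step(1)[OF assms(2) rs[OF p]])
 have j: "integrable N (\<lambda>x. cnj (step ps x) * step qs x)" using Cons.prems step_mult_int[OF _ step_int[OF assms(2)]] by simp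
 show ?case unfolding e using Cons c c2 p u[OF p] i j inner_u_lc[OF p assms(2)] by simp
qed

lemma step_bound:
 assumes ps: "snd ` set ps \<subseteq> D" and A: "A \<in> sets N"
 shows "cmod (LINT x|N. indicator A x * step ps x) \<le> sqrt (measure N A) * hnorm L (lc u ps)"
proof -
 define a where "a = (LINT x|N. indicator A x * step ps x)"
 define m where "m = measure N A"
 define l where "l = (hnorm L (lc u ps))\<^sup>2"
 have c: "lc u ps \<in> hc L" by (rule lc_closed) (use u ps in auto)
 have m0: "m \<ge> 0" by (simp add: m_def)
 have I1: "integrable N (\<lambda>x. cnj (step ps x) * step ps x)" by (rule step_mult_int[OF ps step_int[OF ps]])
 have I2: "integrable N (\<lambda>x. indicator A x * step ps x)" by (rule ind_step(1)[OF ps A])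
 have I3: "integrable N (\<lambda>x. cnj (indicator A x * step ps x))" using I2 by (rule integrable_cnj)
 have l: "(LINT x|N. cnj (step ps x) * step ps x) = complex_of_real l"
  using inner_lc_lc[OF ps ps] inner_self[OF c] by (simp add: l_def)
 \<comment> \<open>The integral of \<open>|step - s * a * indicator A|^2\<close> is nonnegative;
   expanding it gives this quadratic inequality in \<open>s\<close>.\<close>
 have ineq: "2 * s * (cmod a)\<^sup>2 \<le> l + s\<^sup>2 * (cmod a)\<^sup>2 * m" for s :: real
 proof -
  let ?t = "complex_of_real s * a"
  have e: "complex_of_real ((cmod (step ps x - ?t * indicator A x))\<^sup>2)
    = cnj (step ps x) * step ps x - ?t * cnj (indicator A x * step ps x) - cnj ?t * (indicator A x * step ps x)
     + (cnj ?t * ?t) * indicator A x" for x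
   unfolding complex_norm_square by (auto simp: algebra_simps split: split_indicator)
  have "complex_of_real (LINT x|N. (cmod (step ps x - ?t * indicator A x))\<^sup>2)
    = (LINT x|N. complex_of_real ((cmod (step ps x - ?t * indicator A x))\<^sup>2))" by (rule integral_complex_of_real[symmetric])
  also have "\<dots> = complex_of_real l - ?t * cnj a - cnj ?t * a + (cnj ?t * ?t) * complex_of_real m"
   unfolding e using I1 I2 I3 A ind_int[OF A]
   by (simp add: l a_def[symmetric] m_def ind_LINT del: complex_cnj_mult)
  also have "\<dots> = complex_of_real (l - 2 * s * (cmod a)\<^sup>2 + s\<^sup>2 * (cmod a)\<^sup>2 * m)"
  proof -
   have aa: "a * cnj a = complex_of_real ((cmod a)\<^sup>2)" by (rule complex_norm_square[symmetric])
   have "?t * cnj a = complex_of_real s * (a * cnj a)" "cnj ?t * a = complex_of_real s * (a * cnj a)"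
    "cnj ?t * ?t = complex_of_real (s\<^sup>2) * (a * cnj a)" by (simp_all add: power2_eq_square)
   then show ?thesis by (simp only: aa of_real_mult[symmetric] of_real_diff[symmetric] of_real_add[symmetric]) (simp add: algebra_simps)
  qed
  finally have "(LINT x|N. (cmod (step ps x - ?t * indicator A x))\<^sup>2) = l - 2 * s * (cmod a)\<^sup>2 + s\<^sup>2 * (cmod a)\<^sup>2 * m"
   by (simp only: of_real_eq_iff)
  moreover have "0 \<le> (LINT x|N. (cmod (step ps x - ?t * indicator A x))\<^sup>2)" by simp
  ultimately show ?thesis by linarith
 qed
 have "(cmod a)\<^sup>2 \<le> m * l + e" if e: "e > 0" for e
 proof -
  \<comment> \<open>The optimal \<open>s\<close> would be \<open>1 / m\<close>. The summand
    \<open>e / (l + 1)\<close> avoids division by zero for null sets, and after multiplication by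
    \<open>l\<close> it costs at most \<open>e\<close>.\<close>
  define d where "d = m + e / (l + 1)"
  have l0: "l \<ge> 0" by (simp add: l_def)
  have d: "d > 0" "m \<le> d" using m0 e l0 by (simp_all add: d_def add_nonneg_pos)
  have "(1 / d)\<^sup>2 * (cmod a)\<^sup>2 * m \<le> (1 / d)\<^sup>2 * (cmod a)\<^sup>2 * d" using d by (intro mult_left_mono) auto
  also have "\<dots> = (cmod a)\<^sup>2 / d" using d by (simp add: power2_eq_square)
  finally have "2 * (1 / d) * (cmod a)\<^sup>2 \<le> l + (cmod a)\<^sup>2 / d" using ineq[of "1 / d"] by linarith
  then have "(cmod a)\<^sup>2 / d \<le> l" by simp
  then have "(cmod a)\<^sup>2 \<le> l * d" using d by (simp add: pos_divide_le_eq)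
  also have "\<dots> = m * l + e * (l / (l + 1))" by (simp add: d_def algebra_simps)
  also have "\<dots> \<le> m * l + e * 1" using e l0 by (intro add_left_mono mult_left_mono) (auto simp: divide_le_eq_1)
  finally show ?thesis by simp
 qed
 then have "(cmod a)\<^sup>2 \<le> m * l" by (rule field_le_epsilon)
 also have "m * l = (sqrt m * hnorm L (lc u ps))\<^sup>2" using m0 by (simp add: l_def power_mult_distrib)
 finally have "cmod a \<le> sqrt m * hnorm L (lc u ps)" by (rule power2_le_imp_le) (simp add: c m0)
 then show ?thesis by (simp add: a_def m_def)
qed

abbreviation "cspan \<equiv> closed_span L (u ` D)"

lemma u_sub: "u ` D \<subseteq> hc L" using u by blast

lemma span_closed: "closed_subspace L cspan" by (rule closed_span_closed[OF u_sub])

lemma span_eqI: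
 assumes "y \<in> cspan" "y' \<in> cspan" "\<And>d. d \<in> D ==> hinner L (u d) y = hinner L (u d) y'"
 shows "y = y'"
proof -
 have c: "y \<in> hc L" "y' \<in> hc L" using assms closed_subspaceD(1)[OF span_closed] by auto
 have "y = y'"
 proof (rule pre_hilbert_space.total_eqI[of "hsub L cspan" "u ` D"])
  show "pre_hilbert_space (hsub L cspan)" using hilbert_hsub[OF hil span_closed] by simp
  show "closed_span (hsub L cspan) (u ` D) = hc (hsub L cspan)" using closed_span_hsub[OF hil u_sub] by simp
  show "u ` D \<subseteq> hc (hsub L cspan)" using closed_span_superset by simp
 qed (use assms in auto)
 then show ?thesis .
qed

lemma zv_exists:
 assumes A: "A \<in> sets N"
 shows "\<exists>z\<in>cspan. (\<forall>d\<in>D. hinner L (u d) z = complex_of_real (measure N (rs d \<inter> A))) \<and> (hnorm L z)\<^sup>2 \<le> measure N A"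
proof -
 obtain z where z: "z \<in> cspan" "\<And>d. d \<in> D ==> hinner L z (u d) = complex_of_real (measure N (rs d \<inter> A))"
  "hnorm L z \<le> \<bar>sqrt (measure N A)\<bar>"
 proof (rule family_functional[of D u "\<lambda>d. complex_of_real (measure N (rs d \<inter> A))" "sqrt (measure N A)"])
  show "cmod (\<Sum>p\<leftarrow>ps. fst p * complex_of_real (measure N (rs (snd p) \<inter> A))) \<le> sqrt (measure N A) * hnorm L (lc u ps)"
   if "snd ` set ps \<subseteq> D" for ps
   using step_bound[OF that A] ind_step(2)[OF that A] by simp
 qed (use u in auto)
 have zc: "z \<in> hc L" using z(1) closed_subspaceD(1)[OF span_closed] by blast
 have "hinner L (u d) z = complex_of_real (measure N (rs d \<inter> A))" if "d \<in> D" for d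
  using z(2)[OF that] inner_commute[OF zc u[OF that]] by simp
 moreover have "(hnorm L z)\<^sup>2 \<le> measure N A" using power_mono[OF z(3), of 2] zc by simp
 ultimately show ?thesis using z(1) by blast
qed

text \<open>Membership in \<open>cspan\<close> makes the vector unique, so identities between such
  vectors can be tested on the family \<open>u\<close> (\<open>span_eqI\<close>). The norm bound is
  the source of countable additivity.\<close>

definition zv :: "'p set \<Rightarrow> 'a" where
 "zv A = (SOME z. z \<in> cspan \<and> (\<forall>d\<in>D. hinner L (u d) z = complex_of_real (measure N (rs d \<inter> A))) \<and> (hnorm L z)\<^sup>2 \<le> measure N A)"

lemma zv:
 assumes "A \<in> sets N"
 shows "zv A \<in> cspan" "\<And>d. d \<in> D ==> hinner L (u d) (zv A) = complex_of_real (measure N (rs d \<inter> A))"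
  "(hnorm L (zv A))\<^sup>2 \<le> measure N A" "zv A \<in> hc L"
proof -
 have "zv A \<in> cspan \<and> (\<forall>d\<in>D. hinner L (u d) (zv A) = complex_of_real (measure N (rs d \<inter> A))) \<and> (hnorm L (zv A))\<^sup>2 \<le> measure N A"
  unfolding zv_def by (rule someI_ex) (use zv_exists[OF assms] in \<open>simp only: Bex_def\<close>)
 then show "zv A \<in> cspan" "\<And>d. d \<in> D ==> hinner L (u d) (zv A) = complex_of_real (measure N (rs d \<inter> A))"
  "(hnorm L (zv A))\<^sup>2 \<le> measure N A" by blast+
 then show "zv A \<in> hc L" using closed_subspaceD(1)[OF span_closed] by blast
qed

lemma zv_rs: "d \<in> D ==> zv (rs d) = u d"
 using closed_span_superset[of "u ` D"] by (intro span_eqI) (auto simp: zv rs gram)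

lemma zv_null:
 assumes "A \<in> sets N" "measure N A = 0"
 shows "zv A = hzero L"
 using zv(3)[OF assms(1)] assms(2) hnorm_eq_zero[OF zv(4)[OF assms(1)]] by simp

lemma zv_Un:
 assumes A: "A \<in> sets N" "B \<in> sets N" "A \<inter> B = {}"
 shows "zv (A \<union> B) = hadd L (zv A) (zv B)"
proof (rule span_eqI)
 show "zv (A \<union> B) \<in> cspan" using A by (intro zv) auto
 show "hadd L (zv A) (zv B) \<in> cspan" using zv(1) A closed_subspaceD(3)[OF span_closed] by blast
 show "hinner L (u d) (zv (A \<union> B)) = hinner L (u d) (hadd L (zv A) (zv B))" if d: "d \<in> D" for d
 proof -
  interpret finite_measure N by (rule fin)
  have "measure N (rs d \<inter> A \<union> rs d \<inter> B) = measure N (rs d \<inter> A) + measure N (rs d \<inter> B)"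
   using A rs[OF d] by (intro finite_measure_Union) auto
  then show ?thesis using d A u[OF d] zv(4) by (simp add: zv Int_Un_distrib)
 qed
qed

lemma zv_diff:
 assumes A: "A \<in> sets N" "B \<in> sets N" "B \<subseteq> A"
 shows "hdiff L (zv A) (zv B) = zv (A - B)"
proof -
 have "zv A = hadd L (zv B) (zv (A - B))"
  using zv_Un[of B "A - B"] A by (simp add: Un_absorb1 sets.Diff)
 then show ?thesis using zv(4)[OF A(2)] zv(4)[of "A - B"] A
  by (intro eqI) (auto simp: sets.Diff)
qed

text \<open>Finite additivity leaves the vector of the tail, whose squared norm is at most the
  measure of the tail and so tends to 0.\<close>

lemma zv_sigma_additive:
 assumes z: "\<zeta> \<in> hc L"
 shows "sigma_additive N (\<lambda>A. hinner L \<zeta> (zv A))"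
 unfolding sigma_additive_def
proof (intro allI impI)
 fix A :: "nat \<Rightarrow> 'p set" assume A: "range A \<subseteq> sets N" "disjoint_family A"
 interpret finite_measure N by (rule fin)
 have An: "A n \<in> sets N" for n using A by blast
 define U where "U n = (\<Union>i<n. A i)" for n
 have Un: "U n \<in> sets N" for n using An by (simp add: U_def)
 have UU: "(\<Union>n. A n) \<in> sets N" using An by blast
 have part: "(\<Sum>i<n. hinner L \<zeta> (zv (A i))) = hinner L \<zeta> (zv (U n))" for n
 proof (induction n)
  case 0
  have "zv {} = hzero L" by (rule zv_null) auto
  then show ?case using z by (simp add: U_def)
 next
  case (Suc n)
  have "U (Suc n) = U n \<union> A n" by (auto simp: U_def lessThan_Suc)
  moreover have "A i \<inter> A n = {}" if "i < n" for i using disjoint_family_onD[OF A(2), of i n] that by simp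
  then have "U n \<inter> A n = {}" by (auto simp: U_def)
  ultimately have "zv (U (Suc n)) = hadd L (zv (U n)) (zv (A n))" using zv_Un[OF Un An] by simp
  then show ?case using Suc z zv(4)[OF Un] zv(4)[OF An] by simp
 qed
 have "(\<lambda>n. hinner L \<zeta> (zv (U n))) \<longlonglongrightarrow> hinner L \<zeta> (zv (\<Union>n. A n))"
 proof (rule inner_right_limit[OF zv(4)[OF Un] zv(4)[OF UU] z])
  have "(\<lambda>n. measure N (U n)) \<longlonglongrightarrow> measure N (\<Union>n. U n)"
   using Un by (intro finite_Lim_measure_incseq) (fastforce simp: U_def incseq_def)+
  also have "(\<Union>n. U n) = (\<Union>n. A n)" by (auto simp: U_def)
  finally have "(\<lambda>n. sqrt (measure N (\<Union>n. A n) - measure N (U n))) \<longlonglongrightarrow> sqrt (measure N (\<Union>n. A n) - measure N (\<Union>n. A n))"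
   by (intro tendsto_intros)
  then have l: "(\<lambda>n. sqrt (measure N (\<Union>n. A n) - measure N (U n))) \<longlonglongrightarrow> 0" by simp
  show "(\<lambda>n. hnorm L (hdiff L (zv (U n)) (zv (\<Union>n. A n)))) \<longlonglongrightarrow> 0"
  proof (rule Lim_null_comparison[OF always_eventually l], intro allI)
   fix n
   have s: "U n \<subseteq> (\<Union>n. A n)" by (auto simp: U_def)
   have "hnorm L (hdiff L (zv (U n)) (zv (\<Union>n. A n))) = hnorm L (zv ((\<Union>n. A n) - U n))"
    using hnorm_diff_commute[OF zv(4)[OF Un] zv(4)[OF UU]] zv_diff[OF UU Un s] by simp
   moreover have "(hnorm L (zv ((\<Union>n. A n) - U n)))\<^sup>2 \<le> measure N (\<Union>n. A n) - measure N (U n)"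
    using zv(3)[of "(\<Union>n. A n) - U n"] UU Un finite_measure_Diff[OF UU Un s] by simp
   ultimately show "norm (hnorm L (hdiff L (zv (U n)) (zv (\<Union>n. A n)))) \<le> sqrt (measure N (\<Union>n. A n) - measure N (U n))"
    using real_le_rsqrt zv(4)[of "(\<Union>n. A n) - U n"] UU Un by simp
  qed
 qed
 then show "(\<lambda>n. hinner L \<zeta> (zv (A n))) sums hinner L \<zeta> (zv (\<Union>n. A n))"
  unfolding sums_def part .
qed

end

section \<open>Simple spectral integrals\<close>

text \<open>The standard approximation argument for strong convergence, phrased for seminorms so as
  to serve twice: for T(a) minus simple spectral integrals, and for the projections of a shrinking
  sequence of sets.\<close>

lemma (in pre_hilbert_space) seminorms_tendsto_total:
 fixes d :: "nat \<Rightarrow> 'a \<Rightarrow> real"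
 assumes S: "closed_span H S = hc H"
  and add: "\<And>k x y. x \<in> hc H ==> y \<in> hc H ==> d k (hadd H x y) \<le> d k x + d k y"
  and scale: "\<And>k c x. x \<in> hc H ==> d k (hscale H c x) = cmod c * d k x"
  and nonneg: "\<And>k x. x \<in> hc H ==> 0 \<le> d k x"
  and bound: "\<And>k x. x \<in> hc H ==> d k x \<le> C * hnorm H x" and C: "C > 0"
  and onS: "\<And>x. x \<in> S ==> x \<in> hc H \<and> (\<lambda>k. d k x) \<longlonglongrightarrow> 0"
  and x: "x \<in> hc H"
 shows "(\<lambda>k. d k x) \<longlonglongrightarrow> 0"
proof -
 let ?L = "{x \<in> hc H. (\<lambda>k. d k x) \<longlonglongrightarrow> 0}"
 have "closed_subspace H ?L"
 proof (rule closed_subspaceI)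
  have "d k (hzero H) = 0" for k
   using bound[of "hzero H" k] nonneg[of "hzero H" k] by (simp add: zero_closed)
  then show "hzero H \<in> ?L" by (simp add: zero_closed)
  show "hadd H x y \<in> ?L" if "x \<in> ?L" "y \<in> ?L" for x y
  proof -
   have "(\<lambda>k. d k x + d k y) \<longlonglongrightarrow> 0 + 0" using that by (intro tendsto_add) auto
   then have l: "(\<lambda>k. d k x + d k y) \<longlonglongrightarrow> 0" by simp
   have "norm (d k (hadd H x y)) \<le> d k x + d k y" for k
    using add[of x y k] nonneg[of "hadd H x y" k] that by (simp add: add_closed)
   then have "(\<lambda>k. d k (hadd H x y)) \<longlonglongrightarrow> 0"
    by (intro Lim_null_comparison[OF always_eventually l] allI)
   then show ?thesis using that by (simp add: add_closed)
  qed
  show "hscale H c x \<in> ?L" if "x \<in> ?L" for c x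
   using that tendsto_mult_right_zero[of "\<lambda>k. d k x" sequentially "cmod c"] by (simp add: scale scale_closed)
  fix x assume xc: "x \<in> hc H" and ap: "\<And>e. e > 0 ==> \<exists>y\<in>?L. hnorm H (hdiff H x y) < e"
  have "(\<lambda>k. d k x) \<longlonglongrightarrow> 0"
  proof (rule LIMSEQ_I)
   fix r :: real assume r: "r > 0"
   obtain y where y: "y \<in> hc H" "(\<lambda>k. d k y) \<longlonglongrightarrow> 0" "hnorm H (hdiff H x y) < r / (2 * C)"
    using ap[of "r / (2 * C)"] r C by auto
   obtain N where N: "\<And>k. k \<ge> N ==> norm (d k y) < r / 2" using LIMSEQ_D[OF y(2), of "r / 2"] r by auto
   have yc: "hdiff H x y \<in> hc H" using xc y by (simp add: add_closed scale_closed)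
   have "d k x < r" if "k \<ge> N" for k
   proof -
    have "x = hadd H (hdiff H x y) y" by (rule eqI) (use xc y yc in \<open>simp_all add: add_closed scale_closed inner_add_right inner_scale_right\<close>)
    then have "d k x \<le> d k (hdiff H x y) + d k y" using add[OF yc y(1), of k] by simp
    also have "\<dots> \<le> C * hnorm H (hdiff H x y) + d k y" using bound[OF yc, of k] by simp
    also have "\<dots> < r" using N[OF that] y(3) C by (simp add: abs_less_iff field_simps)
    finally show ?thesis .
   qed
   then show "\<exists>no. \<forall>n\<ge>no. norm (d n x - 0) < r" using nonneg[OF xc] by auto
  qed
  with xc show "x \<in> ?L" by blast
 qed blast
 from total_induct[OF S this] onS x show ?thesis by blast
qed

context pvm_space
begin

text \<open>The spectral integral of a simple function. The chosen enumeration of its range is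
  immaterial, since only inner products with the result are used.\<close>

definition sint :: "(real \<times> real \<Rightarrow> complex) \<Rightarrow> 'a \<Rightarrow> 'a" where
 "sint s \<xi> = lc (\<lambda>c. E (s -` {c}) \<xi>) (map (\<lambda>c. (c, c)) (SOME cs. distinct cs \<and> set cs = range s))"

lemma
 assumes s: "simple_function borel s" and x: "\<xi> \<in> hc H"
 shows sint_closed: "sint s \<xi> \<in> hc H"
  and inner_sint: "\<And>\<eta>. \<eta> \<in> hc H ==> hinner H \<eta> (sint s \<xi>) = (\<Sum>c\<in>range s. c * hinner H \<eta> (E (s -` {c}) \<xi>))"
  and inner_sint_left: "\<And>\<eta>. \<eta> \<in> hc H ==> hinner H (sint s \<xi>) \<eta> = (\<Sum>c\<in>range s. cnj c * hinner H (E (s -` {c}) \<xi>) \<eta>)"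
proof -
 have B: "s -` {c} \<in> sets borel" for c using simple_functionD(2)[OF s, of "{c}"] by simp
 define cs where "cs = (SOME cs. distinct cs \<and> set cs = range s)"
 have cs: "distinct cs" "set cs = range s"
  using someI_ex[OF finite_distinct_list[OF simple_functionD(1)[OF s]]] unfolding cs_def by (auto simp: conj_commute)
 have Ec: "E (s -` {c}) \<xi> \<in> hc H" for c using B x by simp
 show c: "sint s \<xi> \<in> hc H" unfolding sint_def by (rule lc_closed) (rule Ec)
 show e: "hinner H \<eta> (sint s \<xi>) = (\<Sum>c\<in>range s. c * hinner H \<eta> (E (s -` {c}) \<xi>))" if "\<eta> \<in> hc H" for \<eta>
  unfolding sint_def cs_def[symmetric] using cs
  by (subst inner_lc_right) (auto simp: Ec that o_def sum_list_distinct_conv_sum_set)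
 show "hinner H (sint s \<xi>) \<eta> = (\<Sum>c\<in>range s. cnj c * hinner H (E (s -` {c}) \<xi>) \<eta>)" if "\<eta> \<in> hc H" for \<eta>
  using inner_commute[OF that c] e[OF that] inner_commute[OF that Ec] by (simp add: cnj_sum)
qed

lemma simple_integral_sum:
 fixes g :: "real \<times> real \<Rightarrow> complex"
 assumes s: "simple_function borel s" and x: "\<xi> \<in> hc H" and g: "integrable (mu \<xi>) g"
 shows "(LINT p|mu \<xi>. h (s p) * g p) = (\<Sum>c\<in>range s. h c * (LINT p|mu \<xi>. indicator (s -` {c}) p *\<^sub>R g p))"
  "integrable (mu \<xi>) (\<lambda>p. h (s p) * g p)"
proof -
 have fin: "finite (range s)" using simple_functionD(1)[OF s] by simp
 have B: "s -` {c} \<in> sets (mu \<xi>)" for c using simple_functionD(2)[OF s, of "{c}"] x by simp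
 have i: "integrable (mu \<xi>) (\<lambda>p. indicator (s -` {c}) p *\<^sub>R g p)" for c
  by (rule integrable_mult_indicator[OF B g])
 have e: "h (s p) * g p = (\<Sum>c\<in>range s. h c * (indicator (s -` {c}) p *\<^sub>R g p))" for p
 proof -
  have "(\<Sum>c\<in>range s. h c * (indicator (s -` {c}) p *\<^sub>R g p)) = (\<Sum>c\<in>range s. if c = s p then h c * g p else 0)"
   by (rule sum.cong) (auto simp: indicator_def)
  then show ?thesis using fin by simp
 qed
 show "integrable (mu \<xi>) (\<lambda>p. h (s p) * g p)" unfolding e by (intro Bochner_Integration.integrable_sum integrable_mult_right i)
 show "(LINT p|mu \<xi>. h (s p) * g p) = (\<Sum>c\<in>range s. h c * (LINT p|mu \<xi>. indicator (s -` {c}) p *\<^sub>R g p))"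
  unfolding e by (simp only: Bochner_Integration.integral_sum[OF integrable_mult_right[OF i]] integral_mult_right_zero)
qed

lemma integral_mu_indicator:
 assumes "\<xi> \<in> hc H" "B \<in> sets borel"
 shows "(LINT p|mu \<xi>. indicator B p *\<^sub>R (1::complex)) = complex_of_real ((hnorm H (E B \<xi>))\<^sup>2)"
 using assms by (simp add: measure_mu scaleR_conv_of_real)

lemma one_integrable: "\<xi> \<in> hc H ==> integrable (mu \<xi>) (\<lambda>_. 1 :: complex)"
 using finite_mu by (intro finite_measure.integrable_const)

text \<open>Different level sets of \<open>s\<close> are disjoint, so their projections have
  orthogonal ranges and the double sum collapses to its diagonal.\<close>

lemma sint_quadratic:
 assumes s: "simple_function borel s" and x: "\<xi> \<in> hc H"
 shows "hinner H \<xi> (sint s \<xi>) = (LINT p|mu \<xi>. s p)"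
  "(hnorm H (sint s \<xi>))\<^sup>2 = (LINT p|mu \<xi>. (cmod (s p))\<^sup>2)"
proof -
 have B: "s -` {c} \<in> sets borel" for c using simple_functionD(2)[OF s, of "{c}"] by simp
 show "hinner H \<xi> (sint s \<xi>) = (LINT p|mu \<xi>. s p)"
  using simple_integral_sum(1)[OF s x one_integrable[OF x], of "\<lambda>c. c"]
  by (simp only: inner_sint[OF s x x] integral_mu_indicator[OF x B] inner_E[OF B x] mult_1_right)
 have fin: "finite (range s)" using simple_functionD(1)[OF s] by simp
 have "hinner H (sint s \<xi>) (sint s \<xi>) = (\<Sum>c\<in>range s. c * hinner H (sint s \<xi>) (E (s -` {c}) \<xi>))"
  by (rule inner_sint[OF s x sint_closed[OF s x]])
 also have "\<dots> = (\<Sum>c\<in>range s. complex_of_real ((cmod c)\<^sup>2) * complex_of_real ((hnorm H (E (s -` {c}) \<xi>))\<^sup>2))"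
 proof (rule sum.cong[OF refl])
  fix c assume c: "c \<in> range s"
  have "hinner H (sint s \<xi>) (E (s -` {c}) \<xi>) = (\<Sum>d\<in>range s. cnj d * hinner H (E (s -` {d}) \<xi>) (E (s -` {c}) \<xi>))"
   by (rule inner_sint_left[OF s x]) (use B x in simp)
  also have "\<dots> = (\<Sum>d\<in>range s. if d = c then cnj c * complex_of_real ((hnorm H (E (s -` {c}) \<xi>))\<^sup>2) else 0)"
  proof (rule sum.cong[OF refl])
   fix d
   have "d \<noteq> c ==> s -` {d} \<inter> s -` {c} = {}" by auto
   then show "cnj d * hinner H (E (s -` {d}) \<xi>) (E (s -` {c}) \<xi>)
     = (if d = c then cnj c * complex_of_real ((hnorm H (E (s -` {c}) \<xi>))\<^sup>2) else 0)"
    using inner_E_measure[OF B B x, of d c] measure_mu[OF x B] by auto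
  qed
  also have "\<dots> = cnj c * complex_of_real ((hnorm H (E (s -` {c}) \<xi>))\<^sup>2)" using fin c by simp
  finally show "c * hinner H (sint s \<xi>) (E (s -` {c}) \<xi>) = complex_of_real ((cmod c)\<^sup>2) * complex_of_real ((hnorm H (E (s -` {c}) \<xi>))\<^sup>2)"
   by (simp only: complex_norm_square[of c] mult.assoc)
 qed
 also have "\<dots> = (LINT p|mu \<xi>. complex_of_real ((cmod (s p))\<^sup>2))"
  using simple_integral_sum(1)[OF s x one_integrable[OF x], of "\<lambda>c. complex_of_real ((cmod c)\<^sup>2)"]
  by (simp only: integral_mu_indicator[OF x B] mult_1_right)
 finally have "complex_of_real ((hnorm H (sint s \<xi>))\<^sup>2) = complex_of_real (LINT p|mu \<xi>. (cmod (s p))\<^sup>2)"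
  unfolding inner_self[OF sint_closed[OF s x]] integral_complex_of_real .
 then show "(hnorm H (sint s \<xi>))\<^sup>2 = (LINT p|mu \<xi>. (cmod (s p))\<^sup>2)" by (simp only: of_real_eq_iff)
qed

lemma sint_bound:
 assumes s: "simple_function borel s" and x: "\<xi> \<in> hc H" and b: "\<And>p. cmod (s p) \<le> 2"
 shows "hnorm H (sint s \<xi>) \<le> 2 * hnorm H \<xi>"
proof -
 have m: "s \<in> borel_measurable (mu \<xi>)"
  using borel_measurable_simple_function[OF s] by (simp add: measurable_cong_sets[OF sets_mu[OF x] refl])
 interpret finite_measure "mu \<xi>" by (rule finite_mu[OF x])
 have sq: "(cmod (s p))\<^sup>2 \<le> 4" for p using power_mono[OF b[of p], of 2] by simp
 have "(LINT p|mu \<xi>. (cmod (s p))\<^sup>2) \<le> (LINT p|mu \<xi>. 4)"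
 proof (rule integral_mono)
  show "integrable (mu \<xi>) (\<lambda>p. (cmod (s p))\<^sup>2)"
   by (rule integrable_const_bound[where B = 4]) (use m sq in auto)
 qed (use sq in auto)
 also have "\<dots> = 4 * (hnorm H \<xi>)\<^sup>2" using measure_mu[OF x, of UNIV] E_UNIV[OF x] x by simp
 finally have "(hnorm H (sint s \<xi>))\<^sup>2 \<le> (2 * hnorm H \<xi>)\<^sup>2" by (simp add: sint_quadratic(2)[OF s x])
 then show ?thesis by (rule power2_le_imp_le) (simp add: x)
qed

lemma sint_linear:
 assumes s: "simple_function borel s" and x: "\<xi> \<in> hc H" "\<eta> \<in> hc H"
 shows "sint s (hadd H \<xi> \<eta>) = hadd H (sint s \<xi>) (sint s \<eta>)" "sint s (hscale H c \<xi>) = hscale H c (sint s \<xi>)"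
proof -
 have B: "s -` {c} \<in> sets borel" for c using simple_functionD(2)[OF s, of "{c}"] by simp
 note Eb = bopD(2,3)[OF E_bop[OF B]]
 show "sint s (hadd H \<xi> \<eta>) = hadd H (sint s \<xi>) (sint s \<eta>)"
  by (rule eqI) (use x B sint_closed[OF s] in \<open>auto simp: inner_sint[OF s] Eb sum.distrib algebra_simps\<close>)
 show "sint s (hscale H c \<xi>) = hscale H c (sint s \<xi>)"
  by (rule eqI) (use x B sint_closed[OF s] in \<open>auto simp: inner_sint[OF s] Eb sum_distrib_left algebra_simps\<close>)
qed

text \<open>The spectral formula need only be checked, in the sharper form with \<open>E(B)\<close> inserted, on a total
 set: there it says that simple spectral integrals converge strongly to \<open>T(a)\<close>.\<close>

lemma formula_from_total:
 assumes U: "unitary_op H H U" and S: "S \<subseteq> hc H" "closed_span H S = hc H"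
  and f: "\<And>x B. x \<in> S ==> B \<in> sets borel ==> hinner H (E B x) (U x) = (LINT p|mu x. indicator B p *\<^sub>R phase a p)"
  and x: "\<xi> \<in> hc H"
 shows "hinner H \<xi> (U \<xi>) = (LINT p|mu \<xi>. phase a p)"
proof -
 note u = unitary_opD[OF U]
 note uc = bopD(1)[OF u(1)]
 \<comment> \<open>The approximants are at most twice as far from 0 as the limit, which has modulus
   1; this is the origin of the constant 2.\<close>
 obtain s where s: "\<And>k. simple_function borel (s k)" "\<And>p. (\<lambda>k. s k p) \<longlonglongrightarrow> phase a p" "\<And>k p. cmod (s k p) \<le> 2"
  using borel_measurable_implies_sequence_metric[OF measurable_phase[of a], of 0] by (auto simp: dist_norm)
 have ms: "s k \<in> borel_measurable (mu x)" if "x \<in> hc H" for k x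
  by (simp only: measurable_cong_sets[OF sets_mu[OF that] refl] borel_measurable_simple_function[OF s(1)])
 have mp: "phase a \<in> borel_measurable (mu x)" if "x \<in> hc H" for x
  by (simp only: measurable_cong_sets[OF sets_mu[OF that] refl] measurable_phase)
 define d where "d k x = hnorm H (hdiff H (U x) (sint (s k) x))" for k x
 have cd: "U x \<in> hc H" "sint (s k) x \<in> hc H" if "x \<in> hc H" for k x
  using uc[OF that] sint_closed[OF s(1) that] by auto
 have onS: "(\<lambda>k. d k x) \<longlonglongrightarrow> 0" if xS: "x \<in> S" for x
 proof -
  have xc: "x \<in> hc H" using xS S by blast
  interpret finite_measure "mu x" by (rule finite_mu[OF xc])
  have B: "s k -` {c} \<in> sets borel" for c k using simple_functionD(2)[OF s(1)[of k], of "{c}"] by simp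
  have ip: "integrable (mu x) (phase a)" by (rule integrable_const_bound[where B = 1]) (use mp[OF xc] in auto)
  \<comment> \<open>Here the sharper hypothesis enters: it evaluates the cross term between
    \<open>U x\<close> and the simple integral, so that their distance becomes an L2 distance of
    functions.\<close>
  have key: "(d k x)\<^sup>2 = (LINT p|mu x. (cmod (phase a p - s k p))\<^sup>2)" for k
  proof -
   have "hinner H (sint (s k) x) (U x) = (\<Sum>c\<in>range (s k). cnj c * (LINT p|mu x. indicator (s k -` {c}) p *\<^sub>R phase a p))"
    by (simp only: inner_sint_left[OF s(1) xc uc[OF xc]] f[OF xS B])
   also have "\<dots> = (LINT p|mu x. cnj (s k p) * phase a p)" by (rule simple_integral_sum(1)[OF s(1) xc ip, symmetric])
   finally have cr: "hinner H (sint (s k) x) (U x) = (LINT p|mu x. cnj (s k p) * phase a p)" .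
   have ic: "integrable (mu x) (\<lambda>p. cnj (s k p) * phase a p)" by (rule simple_integral_sum(2)[OF s(1) xc ip])
   have i2: "integrable (mu x) (\<lambda>p. (cmod (s k p))\<^sup>2)"
   proof (rule integrable_const_bound[where B = 4])
    show "AE p in mu x. norm ((cmod (s k p))\<^sup>2) \<le> 4"
     by (rule AE_I2) (use power_mono[OF s(3), of _ _ 2] in simp)
   qed (use ms[OF xc] in simp)
   have pt: "(cmod (phase a p - s k p))\<^sup>2 = 1 - 2 * Re (cnj (s k p) * phase a p) + (cmod (s k p))\<^sup>2" for p
   proof -
    have "(cmod (phase a p))\<^sup>2 = 1" by simp
    then show ?thesis unfolding cmod_power2 by (simp add: power2_eq_square algebra_simps)
   qed
   have "(d k x)\<^sup>2 = (hnorm H x)\<^sup>2 - 2 * Re (hinner H (sint (s k) x) (U x)) + (hnorm H (sint (s k) x))\<^sup>2"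
    unfolding d_def hnorm_diff_sq[OF cd[OF xc]] using u(4)[OF xc] inner_commute[OF cd(1)[OF xc] cd(2)[OF xc, of k]] by simp
   also have "\<dots> = (LINT p|mu x. 1) - 2 * Re (LINT p|mu x. cnj (s k p) * phase a p) + (LINT p|mu x. (cmod (s k p))\<^sup>2)"
    using measure_mu[OF xc, of UNIV] E_UNIV[OF xc] xc by (simp add: cr sint_quadratic(2)[OF s(1) xc])
   also have "Re (LINT p|mu x. cnj (s k p) * phase a p) = (LINT p|mu x. Re (cnj (s k p) * phase a p))"
    by (rule integral_Re[OF ic, symmetric])
   finally show ?thesis unfolding pt using i2 integrable_Re[OF ic] by (simp del: times_complex.sel complex_cnj)
  qed
  have "(\<lambda>k. LINT p|mu x. (cmod (phase a p - s k p))\<^sup>2) \<longlonglongrightarrow> (LINT p|mu x. 0)"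
  \<comment> \<open>The dominating constant is \<open>9 = (1 + 2)^2\<close>.\<close>
  proof (rule integral_dominated_convergence[where w = "\<lambda>_. 9"])
   show "AE p in mu x. (\<lambda>k. (cmod (phase a p - s k p))\<^sup>2) \<longlonglongrightarrow> 0"
   proof (rule AE_I2)
    fix p
    have "(\<lambda>k. (cmod (phase a p - s k p))\<^sup>2) \<longlonglongrightarrow> (cmod (phase a p - phase a p))\<^sup>2" by (intro tendsto_intros s(2))
    then show "(\<lambda>k. (cmod (phase a p - s k p))\<^sup>2) \<longlonglongrightarrow> 0" by simp
   qed
   show "AE p in mu x. norm ((cmod (phase a p - s k p))\<^sup>2) \<le> 9" for k
   proof (rule AE_I2)
    fix p
    have "cmod (phase a p - s k p) \<le> 3" using norm_triangle_ineq4[of "phase a p" "s k p"] s(3)[of k p] by simp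
    from power_mono[OF this, of 2] show "norm ((cmod (phase a p - s k p))\<^sup>2) \<le> 9" by simp
   qed
  qed (use ms[OF xc] mp[OF xc] in auto)
  then have "(\<lambda>k. sqrt ((d k x)\<^sup>2)) \<longlonglongrightarrow> sqrt 0" unfolding key by (intro tendsto_real_sqrt) simp
  moreover have "d k x \<ge> 0" for k using cd[OF xc] by (simp add: d_def)
  ultimately show ?thesis by simp
 qed
 have lim: "(\<lambda>k. d k \<xi>) \<longlonglongrightarrow> 0"
 \<comment> \<open>\<open>3 = 1 + 2\<close>: \<open>U\<close> is isometric and the simple integrals
   are bounded by 2.\<close>
 proof (rule seminorms_tendsto_total[OF S(2), where C = 3])
  fix k x y c assume xc: "x \<in> hc H"
  show "d k (hadd H x y) \<le> d k x + d k y" if y: "y \<in> hc H"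
  proof -
   have "hdiff H (U (hadd H x y)) (sint (s k) (hadd H x y)) = hadd H (hdiff H (U x) (sint (s k) x)) (hdiff H (U y) (sint (s k) y))"
    unfolding sint_linear(1)[OF s(1) xc y] bopD(2)[OF u(1) xc y] by (rule eqI) (use cd xc y in simp_all)
   then show ?thesis unfolding d_def using cd xc y by (simp add: hnorm_triangle)
  qed
  have "hdiff H (U (hscale H c x)) (sint (s k) (hscale H c x)) = hscale H c (hdiff H (U x) (sint (s k) x))"
   unfolding sint_linear(2)[OF s(1) xc xc] bopD(3)[OF u(1) xc] by (rule eqI) (use cd xc in \<open>simp_all add: algebra_simps\<close>)
  then show "d k (hscale H c x) = cmod c * d k x" unfolding d_def using cd xc by simp
  show "0 \<le> d k x" using cd[OF xc] by (simp add: d_def)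
  have "d k x \<le> hnorm H (U x) + hnorm H (hscale H (-1) (sint (s k) x))"
   unfolding d_def by (rule hnorm_triangle) (use cd[OF xc] in auto)
  then show "d k x \<le> 3 * hnorm H x" using u(4)[OF xc] sint_bound[OF s(1) xc s(3), of k] cd[OF xc] by simp
 qed (use onS S(1) x in auto)
 have "(\<lambda>k. hinner H \<xi> (sint (s k) \<xi>)) \<longlonglongrightarrow> hinner H \<xi> (U \<xi>)"
  by (rule inner_right_limit) (use cd[OF x] x lim in \<open>auto simp: d_def hnorm_diff_commute\<close>)
 moreover have "(\<lambda>k. LINT p|mu \<xi>. s k p) \<longlonglongrightarrow> (LINT p|mu \<xi>. phase a p)"
 proof (rule integral_dominated_convergence[where w = "\<lambda>_. 2"])
  interpret finite_measure "mu \<xi>" by (rule finite_mu[OF x])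
  show "integrable (mu \<xi>) (\<lambda>_. 2 :: real)" by simp
 qed (use ms[OF x] mp[OF x] s(2,3) in auto)
 ultimately show ?thesis using sint_quadratic(1)[OF s(1) x] LIMSEQ_unique by simp
qed

end

section \<open>Spectral measures from families of vector measures\<close>

text \<open>Finite partial sums miss the total by the value on the tail, so countable additivity
  reduces to tails tending to 0.\<close>

lemma additive_tail:
 fixes f :: "'p set \<Rightarrow> complex" and B :: "nat \<Rightarrow> 'p set"
 assumes add: "\<And>A B. A \<in> sets N ==> B \<in> sets N ==> A \<inter> B = {} ==> f (A \<union> B) = f A + f B"
  and B: "range B \<subseteq> sets N" "disjoint_family B"
 shows "(\<Sum>k<n. f (B k)) = f (\<Union>k. B k) - f ((\<Union>k. B k) - (\<Union>k<n. B k))"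
proof (induction n)
 case (Suc n)
 let ?R = "\<lambda>n. (\<Union>k. B k) - (\<Union>k<n. B k)"
 have "B k \<inter> B n = {}" if "k < n" for k using disjoint_family_onD[OF B(2), of k n] that by simp
 then have e: "?R n = B n \<union> ?R (Suc n)" "B n \<inter> ?R (Suc n) = {}" by (auto simp: lessThan_Suc)
 have "B k \<in> sets N" for k using B(1) by blast
 then have "f (?R n) = f (B n) + f (?R (Suc n))" unfolding e(1) by (intro add e(2)) auto
 then show ?case using Suc by simp
qed simp

text \<open>A spectral measure seen through a total family of vectors: \<open>y i B\<close> is meant
  to be E(B) applied to \<open>y i UNIV\<close>, and the rule for inner products is what E(A) E(B) =
  E(A \<inter> B) and self-adjointness dictate.\<close>

locale vector_measures = hilbert_space L for L :: "'a hilb" +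
 fixes I :: "'i set" and y :: "'i \<Rightarrow> (real \<times> real) set \<Rightarrow> 'a"
 assumes y_closed: "i \<in> I ==> B \<in> sets borel ==> y i B \<in> hc L"
  and y_inner: "i \<in> I ==> j \<in> I ==> A \<in> sets borel ==> B \<in> sets borel
   ==> hinner L (y i A) (y j B) = hinner L (y i UNIV) (y j (A \<inter> B))"
  and y_sigma: "i \<in> I ==> j \<in> I ==> sigma_additive (borel :: (real \<times> real) measure) (\<lambda>B. hinner L (y i UNIV) (y j B))"
  and y_total: "closed_span L ((\<lambda>i. y i UNIV) ` I) = hc L"
begin

definition ys :: "(real \<times> real) set \<Rightarrow> 'a set" where
 "ys B = {y i A |i A. i \<in> I \<and> A \<in> sets borel \<and> A \<subseteq> B}"

text \<open>Taking a projection onto a span avoids defining E(B) linearly on dependent vectors: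
  boundedness and self-adjointness come for free, and the action on the family is computed in
  \<open>EF_y\<close>.\<close>

definition EF :: "(real \<times> real) set \<Rightarrow> 'a \<Rightarrow> 'a" where
 "EF B = hproj (closed_span L (ys B))"

lemma ys_sub: "ys B \<subseteq> hc L"
 using y_closed by (auto simp: ys_def)

lemma ys_cl: "closed_subspace L (closed_span L (ys B))"
 by (rule closed_span_closed[OF ys_sub])

lemma EF_bop: "EF B \<in> bops L"
 unfolding EF_def by (rule hproj_bop[OF hil ys_cl])

text \<open>The remainder \<open>y i A - y i (A \<inter> B)\<close> is orthogonal to every
  \<open>y j A'\<close> with \<open>A' \<subseteq> B\<close>, because then
  \<open>A \<inter> A'\<close> and \<open>A \<inter> B \<inter> A'\<close> coincide.\<close>

lemma EF_y:
 assumes i: "i \<in> I" and A: "A \<in> sets borel" and B: "B \<in> sets borel"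
 shows "EF B (y i A) = y i (A \<inter> B)"
 unfolding EF_def
proof (rule hproj_unique[OF ys_cl y_closed[OF i A]])
 have AB: "A \<inter> B \<in> sets borel" using A B by blast
 let ?d = "hdiff L (y i A) (y i (A \<inter> B))"
 have c: "y i A \<in> hc L" "y i (A \<inter> B) \<in> hc L" using y_closed i A AB by auto
 show "y i (A \<inter> B) \<in> closed_span L (ys B)"
  using closed_span_superset[of "ys B"] i AB by (auto simp: ys_def)
 have "closed_span L (ys B) \<subseteq> {x \<in> hc L. \<forall>z\<in>{?d}. hinner L z x = 0}"
 proof (rule closed_span_least[OF orthogonal_closed_subspace])
  show "ys B \<subseteq> {x \<in> hc L. \<forall>z\<in>{?d}. hinner L z x = 0}"
  proof
   fix v assume v: "v \<in> ys B"
   then obtain j A' where j: "j \<in> I" "A' \<in> sets borel" "A' \<subseteq> B" "v = y j A'" by (auto simp: ys_def)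
   have "A \<inter> B \<inter> A' = A \<inter> A'" using j(3) by blast
   then have "hinner L (y i A) v = hinner L (y i (A \<inter> B)) v"
    using y_inner[OF i j(1) A j(2)] y_inner[OF i j(1) AB j(2)] j(4) by simp
   then show "v \<in> {x \<in> hc L. \<forall>z\<in>{?d}. hinner L z x = 0}" using c ys_sub v by (simp add: subset_iff)
  qed
 qed (use c in simp)
 then show "hinner L v (y i (A \<inter> B)) = hinner L v (y i A)" if "v \<in> closed_span L (ys B)" for v
 proof -
  have v: "v \<in> hc L" "hinner L ?d v = 0" using that \<open>_ \<subseteq> _\<close> by auto
  then have "hinner L (y i A) v = hinner L (y i (A \<inter> B)) v" using c by simp
  then show ?thesis using inner_commute c v(1) by metis
 qed
qed

lemma EF_self:
 assumes "x \<in> hc L" "z \<in> hc L"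
 shows "hinner L (EF B x) z = hinner L x (EF B z)"
proof -
 note p = hproj_props(1)[OF ys_cl] and i = inner_hproj[OF ys_cl]
 have c: "EF B x \<in> hc L" "EF B z \<in> hc L" using bopD(1)[OF EF_bop] assms by auto
 have "hinner L (EF B x) z = hinner L (EF B x) (EF B z)" "hinner L (EF B z) x = hinner L (EF B z) (EF B x)"
  using i[OF _ p] assms unfolding EF_def by auto
 then show ?thesis using inner_commute assms c by metis
qed

lemma EF_eqI:
 assumes "X \<in> bops L" "Y \<in> bops L" "\<And>i. i \<in> I ==> X (y i UNIV) = Y (y i UNIV)"
 shows "X = Y"
 by (rule bop_eq_total[OF hil hil assms(1,2) y_total]) (use assms(3) y_closed in auto)

lemma EF_Int:
 assumes "A \<in> sets borel" "B \<in> sets borel"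
 shows "EF (A \<inter> B) = compose (hc L) (EF A) (EF B)"
 by (rule EF_eqI) (use assms y_closed in \<open>auto simp: bop_compose[OF EF_bop EF_bop pre pre] EF_bop EF_y compose_eq Int_commute\<close>)

lemma y_Un:
 assumes i: "i \<in> I" and A: "A \<in> sets borel" "B \<in> sets borel" "A \<inter> B = {}"
 shows "y i (A \<union> B) = hadd L (y i A) (y i B)"
proof (rule total_eqI[OF y_total])
 have AB: "A \<union> B \<in> sets borel" using A by blast
 show "hinner L z (y i (A \<union> B)) = hinner L z (hadd L (y i A) (y i B))" if "z \<in> (\<lambda>i. y i UNIV) ` I" for z
  using that sigma_additive_Un[OF y_sigma[OF _ i] A] y_closed i A by auto
 show "y i (A \<union> B) \<in> hc L" "hadd L (y i A) (y i B) \<in> hc L" using y_closed i A AB add_closed by auto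
qed (use y_closed in auto)

lemma EF_Un:
 assumes A: "A \<in> sets borel" "B \<in> sets borel" "A \<inter> B = {}" and x: "x \<in> hc L"
 shows "EF (A \<union> B) x = hadd L (EF A x) (EF B x)"
proof -
 have AB: "A \<union> B \<in> sets borel" using A by blast
 have "EF (A \<union> B) = (\<lambda>x\<in>hc L. hadd L (EF A x) (EF B x))"
  by (rule EF_eqI[OF EF_bop bop_add[OF hil EF_bop EF_bop hil]])
   (use A AB y_closed in \<open>auto simp: EF_y y_Un\<close>)
 then show ?thesis using x by simp
qed

lemma inner_EF:
 assumes "B \<in> sets borel" "x \<in> hc L"
 shows "hinner L x (EF B x) = complex_of_real ((hnorm L (EF B x))\<^sup>2)"
proof -
 have c: "EF B x \<in> hc L" using bopD(1)[OF EF_bop] assms by auto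
 have "EF B x = EF B (EF B x)" using EF_Int[OF assms(1,1)] assms(2) by (metis Int_absorb compose_eq)
 then show ?thesis using EF_self[OF assms(2) c, of B] inner_self[OF c] by simp
qed

lemma EF_pvm: "pvm L EF"
 unfolding pvm_def
proof (intro conjI ballI allI impI)
 have c: "EF B x \<in> hc L" if "x \<in> hc L" for B x using bopD(1)[OF EF_bop that] .
 show "projection_op L (EF B)" if "B \<in> sets borel" for B
  unfolding projection_op_def
  using EF_bop EF_Int[OF that that] hadj_eq[OF pre EF_bop, of "EF B" B] EF_self by simp
 show "EF UNIV = scalar_op L 1"
  by (rule EF_eqI[OF EF_bop scalar_op_bop]) (use y_closed in \<open>auto simp: EF_y\<close>)
 show "EF (A \<inter> B) = compose (hc L) (EF A) (EF B)" if "A \<in> sets borel" "B \<in> sets borel" for A B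
  by (rule EF_Int[OF that])
 fix x and B :: "nat \<Rightarrow> (real \<times> real) set"
 assume x: "x \<in> hc L" and B: "range B \<subseteq> sets borel" "disjoint_family B"
 define R where "R n = (\<Union>k. B k) - (\<Union>k<n. B k)" for n
 have Bk: "B k \<in> sets borel" for k using B(1) by blast
 have U: "(\<Union>k. B k) \<in> sets borel" "(\<Union>k<n. B k) \<in> sets borel" for n using Bk by auto
 have R: "R n \<in> sets borel" for n unfolding R_def by (rule sets.Diff[OF U])
 \<comment> \<open>The projections of the tails tend to 0 strongly. On a generator
   \<open>EF (R n)\<close> yields \<open>y i (R n)\<close>, whose squared norm is a tail of the
   additive set function in \<open>y_sigma\<close>; the uniform bound 1 extends this to all
   vectors.\<close>
 have lim: "(\<lambda>n. hnorm L (EF (R n) x)) \<longlonglongrightarrow> 0"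
 proof (rule seminorms_tendsto_total[OF y_total, where C = 1 and d = "\<lambda>n x. hnorm L (EF (R n) x)"])
  fix k z u d assume z: "z \<in> hc L"
  show "hnorm L (EF (R k) (hadd L z u)) \<le> hnorm L (EF (R k) z) + hnorm L (EF (R k) u)" if "u \<in> hc L"
   unfolding bopD(2)[OF EF_bop z that] by (rule hnorm_triangle[OF c[OF z] c[OF that]])
  show "hnorm L (EF (R k) (hscale L d z)) = cmod d * hnorm L (EF (R k) z)"
   unfolding bopD(3)[OF EF_bop z] by (rule hnorm_scale[OF c[OF z]])
  show "0 \<le> hnorm L (EF (R k) z)" by (rule hnorm_nonneg[OF c[OF z]])
  have "(hnorm L (EF (R k) z))\<^sup>2 \<le> hnorm L z * hnorm L (EF (R k) z)"
   using cauchy_schwarz[OF z c[OF z, of "R k"]] unfolding inner_EF[OF R z] norm_of_real by simp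
  then show "hnorm L (EF (R k) z) \<le> 1 * hnorm L z"
   using hnorm_nonneg[OF c[OF z], of "R k"] hnorm_nonneg[OF z]
   by (cases "hnorm L (EF (R k) z) = 0") (auto simp: power2_eq_square)
 next
  fix z assume "z \<in> (\<lambda>i. y i UNIV) ` I"
  then obtain i where i: "i \<in> I" "z = y i UNIV" by blast
  have z: "z \<in> hc L" using i y_closed by simp
  let ?f = "\<lambda>A. hinner L (y i UNIV) (y i A)"
  have "(\<Sum>k<n. ?f (B k)) = ?f (\<Union>k. B k) - ?f (R n)" for n
   unfolding R_def by (rule additive_tail[OF sigma_additive_Un[OF y_sigma[OF i(1) i(1)]] B])
  then have fR: "?f (R n) = ?f (\<Union>k. B k) - (\<Sum>k<n. ?f (B k))" for n by simp
  have "(\<lambda>n. \<Sum>k<n. ?f (B k)) \<longlonglongrightarrow> ?f (\<Union>k. B k)"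
   using sigma_additiveD[OF y_sigma[OF i(1) i(1)] B] by (simp only: sums_def)
  then have "(\<lambda>n. ?f (\<Union>k. B k) - (\<Sum>k<n. ?f (B k))) \<longlonglongrightarrow> ?f (\<Union>k. B k) - ?f (\<Union>k. B k)"
   by (intro tendsto_diff tendsto_const)
  then have l: "(\<lambda>n. ?f (R n)) \<longlonglongrightarrow> complex_of_real 0" unfolding fR by auto
  have e: "EF (R n) z = y i (R n)" for n unfolding i(2) using EF_y[OF i(1) _ R] by simp
  have "?f (R n) = complex_of_real ((hnorm L (EF (R n) z))\<^sup>2)" for n
   using inner_EF[OF R z, of n] by (simp only: e i(2)[symmetric])
  then have "(\<lambda>n. (hnorm L (EF (R n) z))\<^sup>2) \<longlonglongrightarrow> 0" using l by (simp only: tendsto_of_real_iff)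
  then have "(\<lambda>n. sqrt ((hnorm L (EF (R n) z))\<^sup>2)) \<longlonglongrightarrow> sqrt 0" by (intro tendsto_real_sqrt)
  then show "z \<in> hc L \<and> (\<lambda>n. hnorm L (EF (R n) z)) \<longlonglongrightarrow> 0" using z c[OF z] by simp
 qed (use x in auto)
 let ?q = "\<lambda>A. hinner L x (EF A x)"
 have "(\<Sum>k<n. ?q (B k)) = ?q (\<Union>k. B k) - ?q (R n)" for n
  unfolding R_def by (rule additive_tail[OF _ B]) (use x c in \<open>auto simp: EF_Un\<close>)
 moreover have "(\<lambda>n. ?q (\<Union>k. B k) - ?q (R n)) \<longlonglongrightarrow> ?q (\<Union>k. B k) - complex_of_real (0\<^sup>2)"
  unfolding inner_EF[OF R x] by (intro tendsto_intros lim)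
 ultimately show "(\<lambda>n. ?q (B n)) sums ?q (\<Union>n. B n)" by (simp add: sums_def)
qed

end

lemma sigma_additive_cnj: "sigma_additive N f ==> sigma_additive N (\<lambda>A. cnj (f A))"
 by (simp add: sigma_additive_def sums_cnj)

lemma sigma_additive_Int:
 assumes f: "sigma_additive N f" and B: "B \<in> sets N"
 shows "sigma_additive N (\<lambda>A. f (A \<inter> B))"
 unfolding sigma_additive_def
proof (intro allI impI)
 fix A :: "nat \<Rightarrow> 'a set" assume A: "range A \<subseteq> sets N" "disjoint_family A"
 have "(\<lambda>n. f (A n \<inter> B)) sums f (\<Union>n. A n \<inter> B)"
  by (rule sigma_additiveD[OF f]) (use A B in \<open>auto simp: disjoint_family_on_def\<close>)
 then show "(\<lambda>n. f (A n \<inter> B)) sums f ((\<Union>n. A n) \<inter> B)" by simp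
qed

lemma sigma_additive_integral:
 fixes h :: "'p \<Rightarrow> complex"
 assumes h: "integrable N h"
 shows "sigma_additive N (\<lambda>A. LINT x|N. indicator A x *\<^sub>R h x)"
 unfolding sigma_additive_def sums_def
proof (intro allI impI)
 fix A :: "nat \<Rightarrow> 'p set" assume A: "range A \<subseteq> sets N" "disjoint_family A"
 have An: "A n \<in> sets N" for n using A by blast
 have UA: "(\<Union>n. A n) \<in> sets N" using An by blast
 have i: "integrable N (\<lambda>x. indicator (A n) x *\<^sub>R h x)" for n by (rule integrable_mult_indicator[OF An h])
 have s: "(\<Sum>k<n. indicator (A k) x *\<^sub>R h x) = (\<Sum>k<n. indicator (A k) x :: real) *\<^sub>R h x" for n x
  by (simp add: scaleR_sum_left)
 have ind: "(\<lambda>k. indicator (A k) x :: real) sums indicator (\<Union>k. A k) x" for x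
  by (rule indicator_sums) (use disjoint_family_onD[OF A(2)] in blast)
 have le: "(\<Sum>k<n. indicator (A k) x :: real) \<le> 1" for n x
 proof -
  have "(\<Sum>k<n. indicator (A k) x :: real) \<le> (\<Sum>k. indicator (A k) x)"
   by (rule sum_le_suminf[OF sums_summable[OF ind]]) auto
  also have "\<dots> = indicator (\<Union>k. A k) x" by (rule sums_unique[OF ind, symmetric])
  also have "\<dots> \<le> 1" by (rule indicator_le_1)
  finally show ?thesis .
 qed
 have "(\<lambda>n. LINT x|N. (\<Sum>k<n. indicator (A k) x *\<^sub>R h x)) \<longlonglongrightarrow> (LINT x|N. indicator (\<Union>n. A n) x *\<^sub>R h x)"
 proof (rule integral_dominated_convergence[where w = "\<lambda>x. norm (h x)"])
  show "(\<lambda>x. indicator (\<Union>n. A n) x *\<^sub>R h x) \<in> borel_measurable N" using UA h by auto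
  show "(\<lambda>x. \<Sum>k<n. indicator (A k) x *\<^sub>R h x) \<in> borel_measurable N" for n using An h by auto
  show "AE x in N. (\<lambda>n. \<Sum>k<n. indicator (A k) x *\<^sub>R h x) \<longlonglongrightarrow> indicator (\<Union>n. A n) x *\<^sub>R h x"
   unfolding s using ind by (intro AE_I2 tendsto_intros) (simp only: sums_def)
  show "AE x in N. norm (\<Sum>k<n. indicator (A k) x *\<^sub>R h x) \<le> norm (h x)" for n
  proof (rule AE_I2)
   fix x
   have "0 \<le> (\<Sum>k<n. indicator (A k) x :: real)" by (simp add: sum_nonneg)
   then have "norm (\<Sum>k<n. indicator (A k) x *\<^sub>R h x) = (\<Sum>k<n. indicator (A k) x) * norm (h x)"
    unfolding s by simp
   then show "norm (\<Sum>k<n. indicator (A k) x *\<^sub>R h x) \<le> norm (h x)"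
    using mult_right_mono[OF le[where n = n and x = x], of "norm (h x)"] by simp
  qed
 qed (use h in simp)
 then show "(\<lambda>n. \<Sum>k<n. LINT x|N. indicator (A k) x *\<^sub>R h x) \<longlonglongrightarrow> (LINT x|N. indicator (\<Union>n. A n) x *\<^sub>R h x)"
  by (simp only: Bochner_Integration.integral_sum[OF i])
qed

lemma phase_sum: "phase a (\<Sum>k\<in>S. p k) = (\<Prod>k\<in>S. phase a (p k))"
 by (induction S rule: infinite_finite_induct) (simp_all add: phase_add)

section \<open>The joint spectral measure of a free product\<close>

abbreviation "RP n \<equiv> PiM {..<n} (\<lambda>_::nat. borel :: (real \<times> real) measure)"

definition rect :: "nat \<Rightarrow> (nat \<Rightarrow> (real \<times> real) set) \<Rightarrow> (nat \<Rightarrow> real \<times> real) set" where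
 "rect n D = PiE {..<n} D"

definition Dset :: "nat \<Rightarrow> (nat \<Rightarrow> (real \<times> real) set) set" where
 "Dset n = {D. \<forall>k\<in>{..<n}. D k \<in> sets borel}"

text \<open>The total energy-momentum of a word whose letters carry the momenta
  \<open>p k\<close>.\<close>

definition sm :: "nat \<Rightarrow> (nat \<Rightarrow> real \<times> real) \<Rightarrow> real \<times> real" where
 "sm n p = (\<Sum>k<n. p k)"

definition pre :: "nat \<Rightarrow> (real \<times> real) set \<Rightarrow> (nat \<Rightarrow> real \<times> real) set" where
 "pre n B = sm n -` B \<inter> space (RP n)"

lemma rect_sets: "D \<in> Dset n ==> rect n D \<in> sets (RP n)"
 unfolding rect_def by (rule sets_PiM_I_finite) (auto simp: Dset_def)

lemma rect_UNIV: "rect n (\<lambda>_. UNIV) = space (RP n)" "(\<lambda>_. UNIV) \<in> Dset n"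
 by (simp_all add: rect_def space_PiM Dset_def)

lemma sets_RP: "sets (RP n) = sigma_sets (space (RP n)) (rect n ` Dset n)"
proof -
 have "prod_algebra {..<n} (\<lambda>_. borel :: (real \<times> real) measure) = rect n ` Dset n"
  by (auto simp: prod_algebra_eq_finite rect_def Dset_def Pi_iff image_iff)
 then show ?thesis by (simp add: sets_PiM space_PiM)
qed

lemma agree_rect:
 assumes "sigma_additive (RP n) f" "sigma_additive (RP n) g"
  and "\<And>D. D \<in> Dset n ==> f (rect n D) = g (rect n D)" and "A \<in> sets (RP n)"
 shows "f A = g A"
proof (rule sigma_additive_agree[OF assms(1,2) _ _ sets_RP _ _ assms(4)])
 have "rect n ` Dset n = {PiE {..<n} E |E. \<forall>i\<in>{..<n}. E i \<in> sets borel}" by (auto simp: rect_def Dset_def)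
 then show "Int_stable (rect n ` Dset n)"
  using Int_stable_PiE[of "{..<n}" "{..<n}" "\<lambda>_. borel"] by simp
 show "rect n ` Dset n \<subseteq> Pow (space (RP n))" using rect_sets sets.sets_into_space by blast
 show "space (RP n) \<in> rect n ` Dset n" using rect_UNIV by blast
 show "f A = g A" if "A \<in> rect n ` Dset n" for A using that assms(3) by blast
qed

lemma rect_Int: "rect n D \<inter> rect n D' = rect n (\<lambda>k. D k \<inter> D' k)"
 by (simp add: rect_def PiE_Int)

lemma sm_measurable [measurable]: "sm n \<in> RP n \<rightarrow>\<^sub>M borel"
 unfolding sm_def by measurable

lemma pre_sets: "B \<in> sets borel ==> pre n B \<in> sets (RP n)"
 unfolding pre_def by (rule measurable_sets[OF sm_measurable])

lemma pre_simps: "pre n UNIV = space (RP n)" "pre n (A \<inter> B) = pre n A \<inter> pre n B" "pre n (\<Union>i. X i) = (\<Union>i. pre n (X i))"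
 by (auto simp: pre_def)

lemma closed_cone: "closed closed_forward_cone"
 unfolding closed_forward_cone_def by (intro closed_Collect_le continuous_intros)

lemma sm_cone:
 assumes "\<And>k. k < n ==> p k \<in> closed_forward_cone"
 shows "sm n p \<in> closed_forward_cone" "sm n p = 0 ==> k < n ==> p k = 0"
proof -
 have p: "\<bar>snd (p k)\<bar> \<le> fst (p k)" if "k < n" for k using assms[OF that] by (simp add: closed_forward_cone_def)
 have "\<bar>\<Sum>k<n. snd (p k)\<bar> \<le> (\<Sum>k<n. fst (p k))"
  by (rule order_trans[OF sum_abs sum_mono]) (use p in simp)
 then show "sm n p \<in> closed_forward_cone" by (simp add: closed_forward_cone_def sm_def fst_sum snd_sum)
 assume "sm n p = 0" "k < n"
 have "0 \<le> fst (p j)" if "j < n" for j using p[OF that] by linarith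
 moreover have "(\<Sum>j<n. fst (p j)) = 0" using \<open>sm n p = 0\<close> by (simp add: sm_def fst_sum[symmetric])
 ultimately have "fst (p k) = 0" using \<open>k < n\<close> sum_nonneg_eq_0_iff[of "{..<n}" "\<lambda>j. fst (p j)"] by auto
 then show "p k = 0" using p[OF \<open>k < n\<close>] by (simp add: prod_eq_iff)
qed

section \<open>Spectral projections of letters and the product measure of a word\<close>

locale free_spectral = free_rep +
 fixes E :: "'a \<Rightarrow> (real \<times> real) set \<Rightarrow> 'b \<Rightarrow> 'b"
 assumes spec: "\<kappa> \<in> K ==> spectral_rep (H \<kappa>) (E \<kappa>) (T \<kappa>)"
  and supp: "\<kappa> \<in> K ==> pvm_support (H \<kappa>) (E \<kappa>) \<subseteq> closed_forward_cone"
  and inv: "\<kappa> \<in> K ==> \<xi> \<in> hc (H \<kappa>) ==> (\<And>a. T \<kappa> a \<xi> = \<xi>) ==> \<exists>c. \<xi> = hscale (H \<kappa>) c (\<Omega> \<kappa>)"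
begin

lemma pvms: "\<kappa> \<in> K ==> pvm_space (H \<kappa>) (E \<kappa>)"
 using spec spectral_rep.axioms(1) by blast

abbreviation "m \<kappa> x \<equiv> pvm_scalar (H \<kappa>) (E \<kappa>) x"

text \<open>Invariance concentrates the spectral measure of the vacuum vector at 0. As a consequence
  the spectral projections preserve its complement (\<open>E_cplus\<close>), so they act on the
  letters of a word.\<close>

lemma E_vac:
 assumes k: "\<kappa> \<in> K" and B: "B \<in> sets borel"
 shows "E \<kappa> B (\<Omega> \<kappa>) = (if 0 \<in> B then \<Omega> \<kappa> else hzero (H \<kappa>))"
proof -
 interpret S: spectral_rep "H \<kappa>" "E \<kappa>" "T \<kappa>" by (rule spec[OF k])
 have z: "E \<kappa> {0} (\<Omega> \<kappa>) = \<Omega> \<kappa>" by (rule S.invariant_E_zero[OF vac_in[OF k] T_fix[OF k]])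
 have "E \<kappa> B (\<Omega> \<kappa>) = E \<kappa> (B \<inter> {0}) (\<Omega> \<kappa>)" using S.E_E[OF B _ vac_in[OF k], of "{0}"] z by simp
 then show ?thesis using z S.E_empty[OF vac_in[OF k]] by (cases "0 \<in> B") auto
qed

lemma E_cplus:
 assumes k: "\<kappa> \<in> K" and B: "B \<in> sets borel" and x: "x \<in> cplus \<kappa>"
 shows "E \<kappa> B x \<in> cplus \<kappa>"
proof -
 interpret S: spectral_rep "H \<kappa>" "E \<kappa>" "T \<kappa>" by (rule spec[OF k])
 have "hinner (H \<kappa>) (\<Omega> \<kappa>) (E \<kappa> B x) = hinner (H \<kappa>) (E \<kappa> B (\<Omega> \<kappa>)) x"
  using S.E_self[OF B vac_in[OF k]] x by simp
 also have "\<dots> = 0" using x k by (auto simp: E_vac[OF k B])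
 finally show ?thesis using S.E_closed[OF B] x by simp
qed

text \<open>\<open>E \<kappa> {0} x\<close> is invariant and hence a multiple of the vacuum vector;
  it also lies in the complement of that vector, so it vanishes.\<close>

lemma E_zero_cplus:
 assumes k: "\<kappa> \<in> K" and x: "x \<in> cplus \<kappa>"
 shows "E \<kappa> {0} x = hzero (H \<kappa>)"
proof -
 interpret S: spectral_rep "H \<kappa>" "E \<kappa>" "T \<kappa>" by (rule spec[OF k])
 have c: "E \<kappa> {0} x \<in> cplus \<kappa>" by (rule E_cplus[OF k _ x]) simp
 obtain c where e: "E \<kappa> {0} x = hscale (H \<kappa>) c (\<Omega> \<kappa>)" using inv[OF k _ S.E_zero_invariant] c x by blast
 then have "c = 0" using c k vac_in[OF k] S.inner_scale_right by simp
 then show ?thesis using e S.scale_zero vac_in[OF k] by simp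
qed

lemma letter: "w \<in> W ==> k < length w ==> w ! k \<in> K"
 by (auto simp: alternating_words_def)

lemma args_nth: "xs \<in> args w \<longleftrightarrow> length xs = length w \<and> (\<forall>k<length w. xs ! k \<in> cplus (w ! k))"
 by (auto simp: in_listset_iff word_factors_def)

lemma fip_eq: "fip w xs ys = (\<Prod>k<length w. hinner (H (w ! k)) (xs ! k) (ys ! k))"
 by (simp add: pinner_def word_factors_def)

text \<open>Beyond the length of the word the null measure serves as default:
  \<open>product_sigma_finite\<close> demands a sigma-finite measure at every index.\<close>

definition Mi :: "'a list \<Rightarrow> 'b list \<Rightarrow> nat \<Rightarrow> (real \<times> real) measure" where
 "Mi w xs k = (if k < length w then m (w ! k) (xs ! k) else null_measure borel)"

definition Nm :: "'a list \<Rightarrow> 'b list \<Rightarrow> (nat \<Rightarrow> real \<times> real) measure" where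
 "Nm w xs = PiM {..<length w} (Mi w xs)"

definition EL :: "'a list \<Rightarrow> 'b list \<Rightarrow> (nat \<Rightarrow> (real \<times> real) set) \<Rightarrow> 'b list" where
 "EL w xs D = map (\<lambda>k. E (w ! k) (D k) (xs ! k)) [0..<length w]"

lemma EL_nth: "k < length w ==> EL w xs D ! k = E (w ! k) (D k) (xs ! k)"
 by (simp add: EL_def)

context
 fixes w xs assumes w: "w \<in> W" and xs: "xs \<in> args w"
begin

lemma xs_nth: "k < length w ==> xs ! k \<in> cplus (w ! k)"
 using xs args_nth by blast

lemma pvms_nth: "k < length w ==> pvm_space (H (w ! k)) (E (w ! k))"
 by (rule pvms[OF letter[OF w]])

lemma EL_args: "D \<in> Dset (length w) ==> EL w xs D \<in> args w"
 unfolding args_nth[of "EL w xs D"] using E_cplus[OF letter[OF w]] xs_nth by (simp add: EL_def Dset_def)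

lemma EL_UNIV: "EL w xs (\<lambda>_. UNIV) = xs"
 using xs args_nth pvm_space.E_UNIV[OF pvms_nth] xs_nth by (intro nth_equalityI) (auto simp: EL_def)

lemma Mi_props: "sets (Mi w xs k) = sets borel" "finite_measure (Mi w xs k)" "space (Mi w xs k) = UNIV"
proof -
 show s: "sets (Mi w xs k) = sets borel"
  using pvm_space.sets_mu[OF pvms_nth] xs_nth by (simp add: Mi_def)
 then show "space (Mi w xs k) = UNIV" using sets_eq_imp_space_eq[OF s] by simp
 show "finite_measure (Mi w xs k)"
  using pvm_space.finite_mu[OF pvms_nth] xs_nth by (auto simp: Mi_def intro!: finite_measureI)
qed

lemma Mi_measure: "k < length w ==> B \<in> sets borel ==> measure (Mi w xs k) B = (hnorm (H (w ! k)) (E (w ! k) B (xs ! k)))\<^sup>2"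
 using pvm_space.measure_mu[OF pvms_nth] xs_nth by (simp add: Mi_def)

lemma psf: "product_sigma_finite (Mi w xs)"
 using Mi_props(2) finite_measure.axioms(1) by (auto simp: product_sigma_finite_def)

lemma sets_Nm [measurable_cong]: "sets (Nm w xs) = sets (RP (length w))"
 unfolding Nm_def by (rule sets_PiM_cong) (simp_all add: Mi_props)

lemma space_Nm: "space (Nm w xs) = space (RP (length w))"
 by (rule sets_eq_imp_space_eq[OF sets_Nm])

lemma emeasure_Nm:
 assumes "D \<in> Dset (length w)"
 shows "emeasure (Nm w xs) (rect (length w) D) = ennreal (\<Prod>k<length w. measure (Mi w xs k) (D k))"
proof -
 have "emeasure (Nm w xs) (rect (length w) D) = (\<Prod>k<length w. emeasure (Mi w xs k) (D k))"
  unfolding Nm_def rect_def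
  by (rule product_sigma_finite.emeasure_PiM[OF psf]) (use assms Mi_props in \<open>auto simp: Dset_def\<close>)
 also have "\<dots> = (\<Prod>k<length w. ennreal (measure (Mi w xs k) (D k)))"
  using finite_measure.emeasure_eq_measure[OF Mi_props(2)] by (intro prod.cong) auto
 finally show ?thesis by (simp add: prod_ennreal)
qed

lemma measure_Nm:
 "D \<in> Dset (length w) ==> measure (Nm w xs) (rect (length w) D) = (\<Prod>k<length w. measure (Mi w xs k) (D k))"
 by (simp add: measure_def[of "Nm w xs"] emeasure_Nm prod_nonneg)

lemma Nm_finite: "finite_measure (Nm w xs)"
 using emeasure_Nm[OF rect_UNIV(2)] by (intro finite_measureI) (simp add: space_Nm rect_UNIV(1))

lemma Nm_null:
 assumes D: "D \<in> Dset (length w)" and k: "k < length w" and z: "measure (Mi w xs k) (D k) = 0"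
 shows "rect (length w) D \<in> null_sets (Nm w xs)"
proof -
 have "(\<Prod>k<length w. measure (Mi w xs k) (D k)) = 0" using k z by (auto intro: prod_zero)
 then have "emeasure (Nm w xs) (rect (length w) D) = 0" using emeasure_Nm[OF D] by (simp only: ennreal_0)
 then show ?thesis using rect_sets[OF D] by (simp add: null_sets_def sets_Nm)
qed

text \<open>Off this null set all momenta lie in the cone and \<open>sm_cone\<close> applies. It
  serves both the support of the joint measure and the absence of mass at 0.\<close>

definition "bad = {p \<in> space (RP (length w)). \<exists>k<length w. p k \<notin> closed_forward_cone}"

lemma bad_null: "bad \<in> null_sets (Nm w xs)"
proof -
 let ?D = "\<lambda>k j. if j = k then - closed_forward_cone else (UNIV :: (real \<times> real) set)"
 have b: "- closed_forward_cone \<in> sets borel" using closed_cone by auto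
 have D: "?D k \<in> Dset (length w)" for k using b by (simp add: Dset_def)
 have "bad = (\<Union>k\<in>{..<length w}. rect (length w) (?D k))"
 proof (intro set_eqI iffI)
  show "p \<in> (\<Union>k\<in>{..<length w}. rect (length w) (?D k))" if "p \<in> bad" for p
   using that by (auto simp: bad_def rect_def space_PiM PiE_iff)
  fix p assume "p \<in> (\<Union>k\<in>{..<length w}. rect (length w) (?D k))"
  then obtain k where k: "k < length w" "p \<in> rect (length w) (?D k)" by blast
  have "p k \<in> ?D k k" using PiE_mem[OF k(2)[unfolded rect_def], of k] k(1) by simp
  then show "p \<in> bad" using k by (auto simp: bad_def rect_def space_PiM PiE_iff)
 qed
 moreover have "rect (length w) (?D k) \<in> null_sets (Nm w xs)" if k: "k < length w" for k
 proof (rule Nm_null[OF D k])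
  have "emeasure (m (w ! k) (xs ! k)) (- closed_forward_cone) = 0"
   using pvm_space.emeasure_outside_support[OF pvms_nth[OF k] _ closed_cone supp[OF letter[OF w k]]] xs_nth[OF k] by simp
  then show "measure (Mi w xs k) (?D k k) = 0" using k by (simp add: Mi_def measure_def)
 qed
 ultimately show ?thesis by auto
qed

text \<open>The inner product of elementary tensors factorizes, and the k-th factor is the scalar
  measure of \<open>D k \<inter> D' k\<close>. So letterwise spectral projections of one tensor have
  the Gram matrix of rectangles under the product measure.\<close>

lemma sv: "set_vectors F (Nm w xs) (Dset (length w)) (rect (length w)) (\<lambda>D. fv w (EL w xs D))"
proof (intro set_vectors.intro F.hilbert_space_axioms set_vectors_axioms.intro Nm_finite)
 show "rect (length w) D \<in> sets (Nm w xs)" if "D \<in> Dset (length w)" for D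
  using rect_sets[OF that] by (simp add: sets_Nm)
 show "fv w (EL w xs D) \<in> hc F" if "D \<in> Dset (length w)" for D
  using fv_closed[OF w EL_args[OF that]] .
 fix D D' assume D: "D \<in> Dset (length w)" "D' \<in> Dset (length w)"
 have i: "(\<lambda>k. D k \<inter> D' k) \<in> Dset (length w)" using D by (auto simp: Dset_def)
 have "hinner F (fv w (EL w xs D)) (fv w (EL w xs D')) =
   (\<Prod>k<length w. hinner (H (w ! k)) (E (w ! k) (D k) (xs ! k)) (E (w ! k) (D' k) (xs ! k)))"
  using inner_fv[OF w EL_args[OF D(1)] w EL_args[OF D(2)]] by (simp add: fip_eq EL_nth)
 also have "\<dots> = (\<Prod>k<length w. complex_of_real (measure (Mi w xs k) (D k \<inter> D' k)))"
  using D xs_nth by (intro prod.cong) (auto simp: Mi_def Dset_def pvm_space.inner_E_measure[OF pvms_nth])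
 finally show "hinner F (fv w (EL w xs D)) (fv w (EL w xs D')) =
   complex_of_real (measure (Nm w xs) (rect (length w) D \<inter> rect (length w) D'))"
  by (simp add: rect_Int measure_Nm[OF i])
qed

end

text \<open>Plays the role of the tensor product of the spectral measures of the letters, evaluated
  at a set of momentum configurations and applied to \<open>fv w xs\<close>.\<close>

definition zz :: "'a list \<Rightarrow> 'b list \<Rightarrow> (nat \<Rightarrow> real \<times> real) set \<Rightarrow> 'a list \<Rightarrow> 'b list \<Rightarrow> complex" where
 "zz w xs = set_vectors.zv F (Nm w xs) (Dset (length w)) (rect (length w)) (\<lambda>D. fv w (EL w xs D))"

context
 fixes w xs assumes w: "w \<in> W" and xs: "xs \<in> args w"
begin

lemma zz_rect: "D \<in> Dset (length w) ==> zz w xs (rect (length w) D) = fv w (EL w xs D)"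
 unfolding zz_def by (rule set_vectors.zv_rs[OF sv[OF w xs]])

lemma zz_space: "zz w xs (space (RP (length w))) = fv w xs"
 using zz_rect[OF rect_UNIV(2)] by (simp add: rect_UNIV(1) EL_UNIV[OF w xs])

lemma zz_closed: "A \<in> sets (RP (length w)) ==> zz w xs A \<in> hc F"
 unfolding zz_def by (rule set_vectors.zv(4)[OF sv[OF w xs]]) (simp add: sets_Nm[OF w xs])

lemma zz_null:
 assumes Z: "Z \<in> null_sets (Nm w xs)" and A: "A \<in> sets (RP (length w))" "A \<subseteq> Z"
 shows "zz w xs A = hzero F"
proof -
 have "A \<in> null_sets (Nm w xs)" using null_sets_subset[OF Z _ A(2)] A(1) by (simp add: sets_Nm[OF w xs])
 then show ?thesis unfolding zz_def
  by (intro set_vectors.zv_null[OF sv[OF w xs]]) (auto simp: measure_def)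
qed

lemma fv_zz: "A \<in> sets (RP (length w)) ==> hinner F (fv w xs) (zz w xs A) = complex_of_real (measure (Nm w xs) A)"
proof -
 assume "A \<in> sets (RP (length w))"
 then have A: "A \<in> sets (Nm w xs)" by (simp add: sets_Nm[OF w xs])
 have "space (Nm w xs) \<inter> A = A" using sets.sets_into_space[OF A] by blast
 then show ?thesis
  using set_vectors.zv(2)[OF sv[OF w xs] A rect_UNIV(2)] EL_UNIV[OF w xs]
  by (simp add: zz_def rect_UNIV(1) space_Nm[OF w xs])
qed

lemma zz_sigma: "\<zeta> \<in> hc F ==> sigma_additive (RP (length w)) (\<lambda>A. hinner F \<zeta> (zz w xs A))"
 using set_vectors.zv_sigma_additive[OF sv[OF w xs]] unfolding zz_def sigma_additive_def sets_Nm[OF w xs] .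

end

text \<open>With two different tensors \<open>xs\<close> and \<open>ys\<close> the set functions are
  complex and no single product measure describes them. The identity is checked on rectangles,
  letter by letter, and extended by uniqueness, first in \<open>B\<close> with a rectangle in the
  other argument, then in \<open>A\<close>.\<close>

lemma zz_cross:
 assumes w: "w \<in> W" and xs: "xs \<in> args w" and ys: "ys \<in> args w"
  and A: "A \<in> sets (RP (length w))" and B: "B \<in> sets (RP (length w))"
 shows "hinner F (zz w xs A) (zz w ys B) = hinner F (fv w xs) (zz w ys (A \<inter> B))"
proof -
 let ?n = "length w"
 note c = fv_closed[OF w]
 have s: "sigma_additive (RP ?n) (\<lambda>A. hinner F (fv w xs) (zz w ys (A \<inter> B)))" if "B \<in> sets (RP ?n)" for B
  by (rule sigma_additive_Int[OF zz_sigma[OF w ys c[OF xs]] that])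
 have r: "hinner F (fv w (EL w xs D)) (zz w ys B) = hinner F (fv w xs) (zz w ys (B \<inter> rect ?n D))"
  if D: "D \<in> Dset ?n" for D
 proof (rule agree_rect[OF zz_sigma[OF w ys c[OF EL_args[OF w xs D]]] s[OF rect_sets[OF D]] _ B])
  fix D' assume D': "D' \<in> Dset ?n"
  have i: "(\<lambda>k. D' k \<inter> D k) \<in> Dset ?n" using D D' by (auto simp: Dset_def)
  have "hinner F (fv w (EL w xs D)) (fv w (EL w ys D')) = hinner F (fv w xs) (fv w (EL w ys (\<lambda>k. D' k \<inter> D k)))"
   unfolding inner_fv[OF w EL_args[OF w xs D] w EL_args[OF w ys D']] inner_fv[OF w xs w EL_args[OF w ys i]] if_P[OF refl] fip_eq
  proof (rule prod.cong[OF refl])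
   fix k assume "k \<in> {..<?n}"
   then have k: "k < ?n" by simp
   interpret S: pvm_space "H (w ! k)" "E (w ! k)" by (rule pvms[OF letter[OF w k]])
   show "hinner (H (w ! k)) (EL w xs D ! k) (EL w ys D' ! k) = hinner (H (w ! k)) (xs ! k) (EL w ys (\<lambda>k. D' k \<inter> D k) ! k)"
    using S.inner_E_E[of "D k" "D' k" "xs ! k" "ys ! k"] k D D' xs_nth[OF w xs k] xs_nth[OF w ys k]
    by (simp add: EL_nth Dset_def Int_commute)
  qed
  then show "hinner F (fv w (EL w xs D)) (zz w ys (rect ?n D')) = hinner F (fv w xs) (zz w ys (rect ?n D' \<inter> rect ?n D))"
   by (simp add: zz_rect[OF w ys] D' i rect_Int)
 qed
 have "cnj (hinner F (zz w ys B) (zz w xs A)) = hinner F (fv w xs) (zz w ys (A \<inter> B))"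
 proof (rule agree_rect[OF sigma_additive_cnj[OF zz_sigma[OF w xs zz_closed[OF w ys B]]] s[OF B] _ A])
  fix D assume D: "D \<in> Dset ?n"
  have "cnj (hinner F (zz w ys B) (zz w xs (rect ?n D))) = hinner F (fv w (EL w xs D)) (zz w ys B)"
   using F.inner_commute[OF zz_closed[OF w ys B] c[OF EL_args[OF w xs D]]] by (simp add: zz_rect[OF w xs D])
  then show "cnj (hinner F (zz w ys B) (zz w xs (rect ?n D))) = hinner F (fv w xs) (zz w ys (rect ?n D \<inter> B))"
   using r[OF D] by (simp add: Int_commute)
 qed
 then show ?thesis using F.inner_commute[OF zz_closed[OF w ys B] zz_closed[OF w xs A]] by simp
qed

lemma zz_orthogonal:
 assumes w: "w \<in> W" "xs \<in> args w" and v: "v \<in> W" "ys \<in> args v" and wv: "w \<noteq> v"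
  and A: "A \<in> sets (RP (length w))" and B: "B \<in> sets (RP (length v))"
 shows "hinner F (zz w xs A) (zz v ys B) = 0"
proof -
 have z: "sigma_additive (RP n) (\<lambda>_. 0)" for n by (simp add: sigma_additive_def)
 have r: "hinner F (fv w xs') (zz v ys B) = 0" if x: "xs' \<in> args w" for xs'
  by (rule agree_rect[OF zz_sigma[OF v fv_closed[OF w(1) x]] z _ B])
   (use inner_fv[OF w(1) x v(1) EL_args[OF v]] wv in \<open>simp add: zz_rect[OF v]\<close>)
 have "hinner F (zz v ys B) (zz w xs A) = 0"
 proof (rule agree_rect[OF zz_sigma[OF w zz_closed[OF v B]] z _ A])
  fix D assume D: "D \<in> Dset (length w)"
  show "hinner F (zz v ys B) (zz w xs (rect (length w) D)) = 0"
   using r[OF EL_args[OF w D]] F.inner_commute[OF fv_closed[OF w(1) EL_args[OF w D]] zz_closed[OF v B]]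
   by (simp add: zz_rect[OF w D])
 qed
 then show ?thesis using F.inner_commute[OF zz_closed[OF v B] zz_closed[OF w A]] by simp
qed

section \<open>Push-forward along addition of momenta\<close>

definition yy :: "'a list \<times> 'b list \<Rightarrow> (real \<times> real) set \<Rightarrow> 'a list \<Rightarrow> 'b list \<Rightarrow> complex" where
 "yy i B = zz (fst i) (snd i) (pre (length (fst i)) B)"

lemma yy_UNIV: "(w, xs) \<in> idx ==> yy (w, xs) UNIV = fv w xs"
 by (simp add: yy_def pre_simps zz_space idx_def)

text \<open>Preimages under addition commute with intersections and disjoint unions, so the rules
  for \<open>zz\<close> carry over. For two different words both sides of the product rule
  vanish.\<close>

sublocale Y: vector_measures F idx yy
proof (intro vector_measures.intro F.hilbert_space_axioms vector_measures_axioms.intro)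
 show "yy i B \<in> hc F" if "i \<in> idx" "B \<in> sets borel" for i B
  using that by (auto simp: idx_def yy_def intro: zz_closed pre_sets)
 show "hinner F (yy i A) (yy j B) = hinner F (yy i UNIV) (yy j (A \<inter> B))"
  if ij: "i \<in> idx" "j \<in> idx" and AB: "A \<in> sets borel" "B \<in> sets borel" for i j A B
 proof -
  obtain w xs v ys where e: "i = (w, xs)" "j = (v, ys)" by fastforce
  have w: "w \<in> W" "xs \<in> args w" "v \<in> W" "ys \<in> args v" using ij by (auto simp: e idx_def)
  have "A \<inter> B \<in> sets borel" using AB by blast
  note p = pre_sets[OF AB(1)] pre_sets[OF AB(2)] pre_sets[OF this]
  show ?thesis
  proof (cases "w = v")
   case True
   then show ?thesis using zz_cross[OF w(1,2) _ p(1,2)[of "length w"]] w ij yy_UNIV by (simp add: e yy_def pre_simps(2))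
  next
   case False
   have "fv w xs = zz w xs (space (RP (length w)))" by (rule zz_space[OF w(1,2), symmetric])
   then show ?thesis using zz_orthogonal[OF w False p(1,2)] zz_orthogonal[OF w False sets.top p(3)] yy_UNIV ij
    by (simp add: e yy_def)
  qed
 qed
 show "sigma_additive (borel :: (real \<times> real) measure) (\<lambda>B. hinner F (yy i UNIV) (yy j B))" if ij: "i \<in> idx" "j \<in> idx" for i j
  unfolding sigma_additive_def
 proof (intro allI impI)
  fix A :: "nat \<Rightarrow> (real \<times> real) set" assume A: "range A \<subseteq> sets borel" "disjoint_family A"
  obtain w xs v ys where e: "i = (w, xs)" "j = (v, ys)" by fastforce
  have w: "w \<in> W" "xs \<in> args w" "v \<in> W" "ys \<in> args v" using ij by (auto simp: e idx_def)
  have "pre (length v) (A i) \<inter> pre (length v) (A j) = {}" if "i \<noteq> j" for i j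
   unfolding pre_simps(2)[symmetric] using disjoint_family_onD[OF A(2) _ _ that] by (simp add: pre_def)
  then have "disjoint_family (\<lambda>n. pre (length v) (A n))" by (simp add: disjoint_family_on_def)
  moreover have "range (\<lambda>n. pre (length v) (A n)) \<subseteq> sets (RP (length v))" using A(1) pre_sets by auto
  ultimately show "(\<lambda>n. hinner F (yy i UNIV) (yy j (A n))) sums hinner F (yy i UNIV) (yy j (\<Union>n. A n))"
   using sigma_additiveD[OF zz_sigma[OF w(3,4) fv_closed[OF w(1,2)]], of "\<lambda>n. pre (length v) (A n)"] yy_UNIV ij
   by (simp add: e yy_def[of "(v, ys)"] pre_simps(3))
 qed
 have "(\<lambda>i. yy i UNIV) ` idx = (\<lambda>(w, xs). fv w xs) ` idx" using yy_UNIV by (intro image_cong) auto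
 then show "closed_span F ((\<lambda>i. yy i UNIV) ` idx) = hc F" using fv_total by simp
qed

abbreviation "EF \<equiv> Y.EF"

sublocale P: pvm_space F EF
 by (intro pvm_space.intro F.hilbert_space_axioms pvm_space_axioms.intro Y.EF_pvm)

lemma EF_fv:
 assumes "w \<in> W" "xs \<in> args w" "B \<in> sets borel"
 shows "EF B (fv w xs) = zz w xs (pre (length w) B)"
 using Y.EF_y[of "(w, xs)" UNIV B] yy_UNIV[of w xs] assms by (simp add: idx_def yy_def)

lemma mu_fv:
 assumes w: "w \<in> W" "xs \<in> args w"
 shows "P.mu (fv w xs) = distr (Nm w xs) borel (sm (length w))"
proof (rule measure_eqI)
 note c = fv_closed[OF w]
 show "sets (P.mu (fv w xs)) = sets (distr (Nm w xs) borel (sm (length w)))" using P.sets_mu[OF c] by simp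
 fix B assume "B \<in> sets (P.mu (fv w xs))"
 then have B: "B \<in> sets borel" using P.sets_mu[OF c] by simp
 have sm: "sm (length w) \<in> Nm w xs \<rightarrow>\<^sub>M borel" using sm_measurable by (simp add: measurable_cong_sets[OF sets_Nm[OF w] refl])
 have "complex_of_real ((hnorm F (EF B (fv w xs)))\<^sup>2) = complex_of_real (measure (Nm w xs) (pre (length w) B))"
  using P.inner_E[OF B c] fv_zz[OF w pre_sets[OF B]] by (simp add: EF_fv[OF w B])
 then have "(hnorm F (EF B (fv w xs)))\<^sup>2 = measure (Nm w xs) (pre (length w) B)" by (simp only: of_real_eq_iff)
 then show "emeasure (P.mu (fv w xs)) B = emeasure (distr (Nm w xs) borel (sm (length w))) B"
  using P.emeasure_mu[OF c B] emeasure_distr[OF sm B] finite_measure.emeasure_eq_measure[OF Nm_finite[OF w]]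
  by (simp add: pre_def space_Nm[OF w])
qed

end

section \<open>The spectral formula, the support and the invariant vectors\<close>

context free_spectral
begin

lemma mapU_nth: "k < length w ==> length xs = length w ==> U.mapU a w xs ! k = T (w ! k) a (xs ! k)"
 by (simp add: U.mapU_def)

text \<open>On a rectangle both sides split into the same product over the letters: the left by
  \<open>inner_E_T\<close>, the right by Fubini since the phase of a sum is the product of phases.
  Uniqueness of complex measures does the rest.\<close>

lemma zz_TT:
 assumes w: "w \<in> W" and xs: "xs \<in> args w" and A: "A \<in> sets (RP (length w))"
 shows "hinner F (zz w xs A) (TT a (fv w xs)) = (LINT p|Nm w xs. indicator A p *\<^sub>R phase a (sm (length w) p))"
proof -
 let ?n = "length w" and ?e = "fv w (U.mapU a w xs)"
 have m: "U.mapU a w xs \<in> args w" by (rule U.mapU_args[OF w xs])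
 note ec = fv_closed[OF w m]
 have sm: "sm ?n \<in> Nm w xs \<rightarrow>\<^sub>M borel" using sm_measurable by (simp add: measurable_cong_sets[OF sets_Nm[OF w xs] refl])
 have int: "integrable (Nm w xs) (\<lambda>p. phase a (sm ?n p))"
  by (rule finite_measure.integrable_const_bound[OF Nm_finite[OF w xs], where B = 1])
   (use measurable_compose[OF sm measurable_phase] in auto)
 have "cnj (hinner F ?e (zz w xs A)) = (LINT p|Nm w xs. indicator A p *\<^sub>R phase a (sm ?n p))"
 proof (rule agree_rect[OF sigma_additive_cnj[OF zz_sigma[OF w xs ec]] _ _ A])
  show "sigma_additive (RP ?n) (\<lambda>A. LINT p|Nm w xs. indicator A p *\<^sub>R phase a (sm ?n p))"
   using sigma_additive_integral[OF int] unfolding sigma_additive_def sets_Nm[OF w xs] .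
  fix D assume D: "D \<in> Dset ?n"
  let ?f = "\<lambda>k q. indicator (D k) q *\<^sub>R phase a q"
  have f: "integrable (Mi w xs k) (?f k)" if k: "k < ?n" for k
   by (rule finite_measure.integrable_const_bound[OF Mi_props(2)[OF w xs], where B = 1])
    (use k D in \<open>auto simp: measurable_cong_sets[OF Mi_props(1)[OF w xs] refl] Dset_def indicator_def\<close>)
  have "cnj (hinner F ?e (zz w xs (rect ?n D))) = hinner F (fv w (EL w xs D)) ?e"
   unfolding zz_rect[OF w xs D] by (rule F.inner_commute[OF ec fv_closed[OF w EL_args[OF w xs D]], symmetric])
  also have "\<dots> = (\<Prod>k<?n. hinner (H (w ! k)) (E (w ! k) (D k) (xs ! k)) (T (w ! k) a (xs ! k)))"
   using inner_fv[OF w EL_args[OF w xs D] w m] xs args_nth by (simp add: fip_eq EL_nth mapU_nth)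
  also have "\<dots> = (\<Prod>k<?n. (LINT q|Mi w xs k. ?f k q))"
   using D xs_nth[OF w xs] by (intro prod.cong refl) (simp add: Mi_def Dset_def spectral_rep.inner_E_T[OF spec[OF letter[OF w]]])
  also have "\<dots> = (LINT p|Nm w xs. (\<Prod>k<?n. ?f k (p k)))"
   unfolding Nm_def by (rule product_sigma_finite.product_integral_prod[OF psf[OF w xs], symmetric]) (use f in auto)
  also have "\<dots> = (LINT p|Nm w xs. indicator (rect ?n D) p *\<^sub>R phase a (sm ?n p))"
  proof (rule Bochner_Integration.integral_cong[OF refl])
   fix p assume p: "p \<in> space (Nm w xs)"
   show "(\<Prod>k<?n. ?f k (p k)) = indicator (rect ?n D) p *\<^sub>R phase a (sm ?n p)"
   proof (cases "p \<in> rect ?n D")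
    case True
    then have "p k \<in> D k" if "k < ?n" for k using that PiE_mem by (auto simp: rect_def)
    then show ?thesis using True by (simp add: sm_def phase_sum)
   next
    case False
    then obtain k where k: "k < ?n" "p k \<notin> D k" using p by (auto simp: rect_def space_Nm[OF w xs] space_PiM PiE_iff)
    then have "(\<Prod>k<?n. ?f k (p k)) = 0" by (intro prod_zero) (auto intro: bexI[of _ k])
    then show ?thesis using False by simp
   qed
  qed
  finally show "cnj (hinner F ?e (zz w xs (rect ?n D))) = (LINT p|Nm w xs. indicator (rect ?n D) p *\<^sub>R phase a (sm ?n p))" .
 qed
 then show ?thesis unfolding U.FU_fv[OF w xs] F.inner_commute[OF ec zz_closed[OF w xs A]] .
qed

text \<open>\<open>zz_TT\<close>, transported along addition, is the formula with E(B) inserted that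
  \<open>formula_from_total\<close> wants on elementary tensors.\<close>

sublocale R: spectral_rep F EF TT
proof (intro spectral_rep.intro P.pvm_space_axioms spectral_rep_axioms.intro)
 show u: "unitary_op F F (TT a)" for a by (rule U.FU_unitary)
 fix \<xi> a assume x: "\<xi> \<in> hc F"
 show "hinner F \<xi> (TT a \<xi>) = (LINT p|P.mu \<xi>. phase a p)"
 proof (rule P.formula_from_total[OF u fv_sub fv_total _ x])
  fix v and B :: "(real \<times> real) set" assume v: "v \<in> (\<lambda>(w, xs). fv w xs) ` idx" and B: "B \<in> sets borel"
  then obtain w xs where w: "v = fv w xs" "w \<in> W" "xs \<in> args w" by (auto simp: idx_def)
  have sm: "sm (length w) \<in> Nm w xs \<rightarrow>\<^sub>M borel" using sm_measurable by (simp add: measurable_cong_sets[OF sets_Nm[OF w(2,3)] refl])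
  have "(LINT p|P.mu v. indicator B p *\<^sub>R phase a p) =
    (LINT p|Nm w xs. indicator B (sm (length w) p) *\<^sub>R phase a (sm (length w) p))"
   unfolding w(1) mu_fv[OF w(2,3)] by (rule integral_distr[OF sm]) (use B in measurable)
  also have "\<dots> = (LINT p|Nm w xs. indicator (pre (length w) B) p *\<^sub>R phase a (sm (length w) p))"
   by (rule Bochner_Integration.integral_cong) (auto simp: pre_def space_Nm[OF w(2,3)] indicator_def)
  finally show "hinner F (EF B v) (TT a v) = (LINT p|P.mu v. indicator B p *\<^sub>R phase a p)"
   using zz_TT[OF w(2,3) pre_sets[OF B]] by (simp add: w(1) EF_fv[OF w(2,3) B])
 qed
qed

lemma TT_rep: "unitary_rep F TT"
 by (rule R.strongly_continuous[OF TT_mult])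

lemma EF_outside_cone: "EF (- closed_forward_cone) = scalar_op F 0"
proof (rule bop_eq_total[OF F.hil F.hil Y.EF_bop scalar_op_bop[OF F.pre] fv_total fv_sub])
 fix v assume "v \<in> (\<lambda>(w, xs). fv w xs) ` idx"
 then obtain w xs where w: "v = fv w xs" "w \<in> W" "xs \<in> args w" by (auto simp: idx_def)
 have b: "- closed_forward_cone \<in> sets borel" using closed_cone by auto
 have "pre (length w) (- closed_forward_cone) \<subseteq> bad w"
 proof
  fix p assume p: "p \<in> pre (length w) (- closed_forward_cone)"
  then have "sm (length w) p \<notin> closed_forward_cone" by (simp add: pre_def)
  then have "\<exists>k<length w. p k \<notin> closed_forward_cone" using sm_cone(1) by blast
  then show "p \<in> bad w" using p by (simp add: pre_def bad_def[OF w(2,3)])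
 qed
 then show "EF (- closed_forward_cone) v = scalar_op F 0 v"
  using zz_null[OF w(2,3) bad_null[OF w(2,3)] pre_sets[OF b]] fv_closed[OF w(2,3)]
  by (simp add: w(1) EF_fv[OF w(2,3) b] F.scale_zero)
qed

lemma support_F: "pvm_support F EF \<subseteq> closed_forward_cone"
 using EF_outside_cone closed_cone unfolding pvm_support_def by (blast intro: open_Compl)

lemma spectrum_condition_F: "spectrum_condition F TT"
 using P.pvm R.formula support_F unfolding spectrum_condition_def joint_spectral_measure_def phase_def by blast

text \<open>Momenta in the cone with sum 0 are all 0. In particular that of the first letter is, but
  a letter orthogonal to the vacuum has no mass at 0.\<close>

lemma EF_zero_fv:
 assumes w: "w \<in> W" "xs \<in> args w" "w \<noteq> []"
 shows "EF {0} (fv w xs) = hzero F"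
proof -
 have b: "{0} \<in> sets (borel :: (real \<times> real) measure)" by simp
 have D: "(\<lambda>_. {0}) \<in> Dset (length w)" by (simp add: Dset_def)
 have l: "0 < length w" using w by simp
 have "measure (Mi w xs 0) {0} = 0"
  using Mi_measure[OF w(1,2) l b] E_zero_cplus[OF letter[OF w(1) l] xs_nth[OF w(1,2) l]] letter[OF w(1) l] by simp
 from null_sets.Un[OF bad_null[OF w(1,2)] Nm_null[OF w(1,2) D l this]]
 have n: "bad w \<union> rect (length w) (\<lambda>_. {0}) \<in> null_sets (Nm w xs)" .
 have "pre (length w) {0} \<subseteq> bad w \<union> rect (length w) (\<lambda>_. {0})"
 proof
  fix p assume p: "p \<in> pre (length w) {0}"
  show "p \<in> bad w \<union> rect (length w) (\<lambda>_. {0})"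
  proof (cases "\<forall>k<length w. p k \<in> closed_forward_cone")
   case True
   then have "p k = 0" if "k < length w" for k using sm_cone(2)[of "length w" p k] that p by (simp add: pre_def)
   then have "p \<in> rect (length w) (\<lambda>_. {0})" unfolding rect_def PiE_iff using p by (simp add: pre_def space_PiM PiE_iff)
   then show ?thesis by blast
  qed (use p in \<open>auto simp: pre_def bad_def[OF w(1,2)]\<close>)
 qed
 from zz_null[OF w(1,2) n pre_sets[OF b] this] show ?thesis by (simp add: EF_fv[OF w(1,2) b])
qed

text \<open>An invariant vector is fixed by the self-adjoint \<open>EF {0}\<close>, which kills all
  nonempty words; so it is orthogonal to them.\<close>

lemma invariant_vac:
 assumes x: "\<xi> \<in> hc F"
 shows "(\<forall>a. TT a \<xi> = \<xi>) \<longleftrightarrow> (\<exists>c. \<xi> = hscale F c vac)"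
proof
 assume "\<forall>a. TT a \<xi> = \<xi>"
 then have e: "EF {0} \<xi> = \<xi>" using R.invariant_E_zero[OF x] by blast
 have "\<xi> = hscale F (hinner F vac \<xi>) vac"
 proof (rule F.total_eqI[OF fv_total fv_sub x])
  fix v assume "v \<in> (\<lambda>(w, xs). fv w xs) ` idx"
  then obtain w xs where w: "v = fv w xs" "w \<in> W" "xs \<in> args w" by (auto simp: idx_def)
  show "hinner F v \<xi> = hinner F v (hscale F (hinner F vac \<xi>) vac)"
  proof (cases "w = []")
   case True
   then have "v = vac" using w by (simp add: vac_eq)
   then show ?thesis by (simp add: F.inner_scale_right)
  next
   case False
   have c: "v \<in> hc F" using w by simp
   have "hinner F v \<xi> = hinner F (EF {0} v) \<xi>" using Y.EF_self[OF c x, of "{0}"] e by simp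
   moreover have "hinner F v vac = 0" using inner_fv[OF w(2,3), of "[]" "[]"] False by (simp add: w(1) vac_eq)
   ultimately show ?thesis using c x by (simp add: w(1) EF_zero_fv[OF w(2,3) False] F.inner_scale_right)
  qed
 qed (simp add: F.scale_closed)
 then show "\<exists>c. \<xi> = hscale F c vac" by blast
next
 assume "\<exists>c. \<xi> = hscale F c vac"
 then show "\<forall>a. TT a \<xi> = \<xi>" using bopD(3)[OF U.FU_bop vac_closed] U.FU_vac by auto
qed

end

section \<open>The relative commutant\<close>

text \<open>Bessel's inequality for vectors that are orthogonal and bounded but not normalized, and
  possibly zero. For \<open>s\<close>, the sum of the \<open>b i\<close> weighted by their
  coefficients \<open>?c i\<close>, one has \<open>hinner H s x = Q\<close> and
  \<open>|s|^2 \<le> Q * B^2\<close>; Cauchy-Schwarz gives \<open>Q \<le> (B * |x|)^2\<close>, which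
  limits the number of coefficients of size at least \<open>d\<close>.\<close>

lemma (in pre_hilbert_space) finite_large_coefficients:
 assumes b: "\<And>i. i \<in> I ==> b i \<in> hc H" "\<And>i. i \<in> I ==> hnorm H (b i) \<le> B"
  and o: "\<And>i j. i \<in> I ==> j \<in> I ==> i \<noteq> j ==> hinner H (b i) (b j) = 0"
  and x: "x \<in> hc H" and d: "d > 0"
 shows "finite {i \<in> I. d \<le> cmod (hinner H (b i) x)}"
proof (rule ccontr)
 assume "infinite {i \<in> I. d \<le> cmod (hinner H (b i) x)}"
 obtain n :: nat where n: "(\<bar>B\<bar> * hnorm H x / d)\<^sup>2 < n" using reals_Archimedean2 by blast
 obtain S where S: "S \<subseteq> {i \<in> I. d \<le> cmod (hinner H (b i) x)}" "card S = n" "finite S"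
  using infinite_arbitrarily_large[OF \<open>infinite _\<close>, of n] by blast
 obtain js where js: "set js = S" "distinct js" using finite_distinct_list[OF S(3)] by blast
 let ?c = "\<lambda>i. hinner H (b i) x"
 let ?ps = "map (\<lambda>i. (?c i, i)) js"
 define s where "s = lc b ?ps"
 define Q where "Q = (\<Sum>i\<in>S. (cmod (?c i))\<^sup>2)"
 have bS: "b i \<in> hc H" if "i \<in> S" for i using that S b by blast
 have sc: "s \<in> hc H" unfolding s_def by (rule lc_closed) (use bS js in auto)
 have i1: "hinner H s y = (\<Sum>i\<in>S. cnj (?c i) * hinner H (b i) y)" if "y \<in> hc H" for y
  unfolding s_def using js that bS by (subst inner_lc_left) (auto simp: o_def sum_list_distinct_conv_sum_set)
 have i2: "hinner H (b i) s = ?c i * complex_of_real ((hnorm H (b i))\<^sup>2)" if i: "i \<in> S" for i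
 proof -
  have "hinner H (b i) s = (\<Sum>j\<in>S. ?c j * hinner H (b i) (b j))"
   unfolding s_def using js bS i by (subst inner_lc_right) (auto simp: o_def sum_list_distinct_conv_sum_set)
  also have "\<dots> = (\<Sum>j\<in>S. if j = i then ?c i * hinner H (b i) (b i) else 0)"
   using o S i by (intro sum.cong) auto
  finally show ?thesis using S(3) i inner_self[OF bS[OF i]] by simp
 qed
 have sx: "hinner H s x = complex_of_real Q"
  unfolding i1[OF x] Q_def of_real_sum by (intro sum.cong refl) (simp add: complex_norm_square mult.commute del: of_real_power)
 have "hinner H s s = (\<Sum>i\<in>S. complex_of_real ((cmod (?c i))\<^sup>2 * (hnorm H (b i))\<^sup>2))"
  unfolding i1[OF sc] by (intro sum.cong refl) (simp add: i2 complex_norm_square mult.commute mult.left_commute del: of_real_power)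
 then have "(hnorm H s)\<^sup>2 = (\<Sum>i\<in>S. (cmod (?c i))\<^sup>2 * (hnorm H (b i))\<^sup>2)"
  unfolding inner_self[OF sc] of_real_sum[symmetric] by (simp only: of_real_eq_iff)
 also have "\<dots> \<le> (\<Sum>i\<in>S. (cmod (?c i))\<^sup>2 * B\<^sup>2)"
  using b S by (intro sum_mono mult_left_mono power_mono) (auto simp: hnorm_nonneg)
 finally have ss: "(hnorm H s)\<^sup>2 \<le> Q * B\<^sup>2" by (simp add: Q_def sum_distrib_right)
 have Q0: "0 \<le> Q" unfolding Q_def by (rule sum_nonneg) simp
 have "Q \<le> hnorm H s * hnorm H x" using cauchy_schwarz[OF sc x] Q0 unfolding sx by simp
 then have "Q * Q \<le> (hnorm H s * hnorm H x) * (hnorm H s * hnorm H x)" using Q0 by (intro mult_mono) auto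
 also have "\<dots> = (hnorm H s)\<^sup>2 * (hnorm H x)\<^sup>2" by (simp add: power2_eq_square)
 also have "\<dots> \<le> Q * B\<^sup>2 * (hnorm H x)\<^sup>2" by (rule mult_right_mono[OF ss]) simp
 finally have "Q \<le> (\<bar>B\<bar> * hnorm H x)\<^sup>2"
  using Q0 by (cases "Q = 0") (auto simp: power_mult_distrib mult.assoc)
 moreover have "n * d\<^sup>2 \<le> Q"
 proof -
  have "(\<Sum>i\<in>S. d\<^sup>2) \<le> Q" unfolding Q_def by (intro sum_mono power_mono) (use S d in auto)
  then show ?thesis using S(2) by simp
 qed
 ultimately have "n * d\<^sup>2 \<le> (\<bar>B\<bar> * hnorm H x)\<^sup>2" by linarith
 then have "n \<le> (\<bar>B\<bar> * hnorm H x / d)\<^sup>2" using d by (simp add: power_divide pos_le_divide_eq)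
 then show False using n by linarith
qed

text \<open>As \<open>u\<close> fixes \<open>v\<close>, conjugating \<open>S\<close> by
  \<open>u\<close> replaces \<open>S v\<close> by \<open>u (S v)\<close>, and a unitary carries
  dense sets to dense sets. This makes the choice of Y in the translated algebra possible.\<close>

lemma Ad_cyclic:
 assumes h: "hilbert_space L" and u: "unitary_op L L u" and M: "M \<subseteq> bops L" and v: "v \<in> hc L"
  and uv: "u v = v" and c: "cyclic_vector L M v" and x: "x \<in> hc L" and e: "e > 0"
 shows "\<exists>S\<in>M. hnorm L (hdiff L x (Ad L u S v)) < e"
proof -
 obtain x' where x': "x' \<in> hc L" "x = u x'" using unitary_opD(3)[OF u] x by blast
 obtain S where S: "S \<in> M" "hnorm L (hdiff L x' (S v)) < e" using c x'(1) e unfolding cyclic_vector_iff[OF h M v] by blast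
 have Sb: "S \<in> bops L" using S(1) M by blast
 have Sv: "S v \<in> hc L" by (rule bopD(1)[OF Sb v])
 have "Ad L u S v = u (S v)" using Ad_bop(2)[OF h u Sb v] uv by simp
 then have "hdiff L x (Ad L u S v) = u (hdiff L x' (S v))"
  using bop_diff[OF unitary_opD(1)[OF u] hilbert_pre[OF h] x'(1) Sv] x'(2) by simp
 moreover have "hdiff L x' (S v) \<in> hc L"
  using pre_hilbert_space.add_closed[OF hilbert_pre[OF h] x'(1) pre_hilbert_space.scale_closed[OF hilbert_pre[OF h] Sv]] .
 ultimately show ?thesis using S unitary_opD(4)[OF u] by metis
qed

section \<open>A fresh letter at either end of a word\<close>

context free_product
begin

lemma hnorm_act:
 assumes "k \<in> K" "x \<in> hc (H k)" "\<eta> \<in> hc (G k)"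
 shows "hnorm F (act k x \<eta>) = hnorm (H k) x * hnorm F \<eta>"
proof -
 have c: "act k x \<eta> \<in> hc F" "\<eta> \<in> hc F" using act_closed[OF assms] G_in_F[OF assms(3)] by auto
 have "complex_of_real ((hnorm F (act k x \<eta>))\<^sup>2) = complex_of_real ((hnorm (H k) x * hnorm F \<eta>)\<^sup>2)"
  using inner_act[OF assms(1,2,2,3,3)] pre_hilbert_space.inner_self[OF pre_hilb[OF assms(1)] assms(2)]
   F.inner_self[OF c(1)] F.inner_self[OF c(2)] by (simp add: power_mult_distrib)
 then have "(hnorm F (act k x \<eta>))\<^sup>2 = (hnorm (H k) x * hnorm F \<eta>)\<^sup>2" by (simp only: of_real_eq_iff)
 then show ?thesis by (rule power2_eq_imp_eq) (use c assms in simp_all)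
qed

lemma rho_adjoint:
 assumes k: "k \<in> K" and S: "S \<in> bops (H k)" and v: "v \<in> hc F" and x: "\<xi> \<in> hc F"
 shows "hinner F v (rho k S \<xi>) = hinner F (rho k (hadj (H k) (H k) S) v) \<xi>"
proof -
 note iso = unitary_opD(2)[OF J_unitary] and lc = bopD(1)[OF lam_bop[OF k S]]
 have l2: "lam k (hadj (H k) (H k) S) (J v) \<in> hc F"
  using bopD(1)[OF lam_bop[OF k hadj_props(1)[OF hilb[OF k] hilb[OF k] S]]] v by simp
 have "hinner F v (rho k S \<xi>) = hinner F (J v) (lam k S (J \<xi>))"
  using iso[OF v J_closed[OF lc[OF J_closed[OF x]]]] lc x by (simp add: rho_apply)
 also have "\<dots> = hinner F (lam k (hadj (H k) (H k) S) (J v)) (J \<xi>)"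
  using hadj_props(3)[OF hilbert_F hilbert_F lam_bop[OF k S] J_closed[OF x] J_closed[OF v]] by (simp add: lam_hadj[OF k S])
 also have "\<dots> = hinner F (rho k (hadj (H k) (H k) S) v) \<xi>"
  using iso[OF l2 J_closed[OF x]] x v by (simp add: rho_apply)
 finally show ?thesis .
qed

lemma rho_fv:
 assumes k: "k \<in> K" and S: "S \<in> bops (H k)" and w: "w \<in> W" "xs \<in> args w" "\<not> ends k w"
 shows "rho k S (fv w xs) = ract k (S (\<Omega> k)) (fv w xs)" "fv (rev w) (rev xs) \<in> hc (G k)"
proof -
 have "(rev w, rev xs) \<in> idx_off k" by (rule off_rev[OF w])
 then show g: "fv (rev w) (rev xs) \<in> hc (G k)" using idx_off_Cons(6)[OF k] by blast
 show "rho k S (fv w xs) = ract k (S (\<Omega> k)) (fv w xs)"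
  using w lam_G[OF k S g] by (simp add: rho_apply J_fv ract_def)
qed

lemma fresh_letter:
 assumes k: "k \<in> K" "k \<notin> set w" and w: "w \<in> W" "xs \<in> args w" "w \<noteq> []" and e: "e \<in> cplus k"
 shows "(w, xs) \<in> idx_off k" "k # w \<in> W" "e # xs \<in> args (k # w)" "\<not> ends k (k # w)"
  "act k e (fv w xs) = fv (k # w) (e # xs)" "fv w xs \<in> hc (G k)"
proof -
 have "hd w \<noteq> k" "last w \<noteq> k" using k(2) w(3) by auto
 then show i: "(w, xs) \<in> idx_off k" and "k # w \<in> W" "\<not> ends k (k # w)"
  using k w by (auto simp: idx_off_def ends_def)
 show "e # xs \<in> args (k # w)" using w e by (simp del: listset.simps)
 show "act k e (fv w xs) = fv (k # w) (e # xs)" by (rule act_cplus_fv[OF k(1) e i])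
 show "fv w xs \<in> hc (G k)" by (rule idx_off_Cons(6)[OF k(1) i])
qed

text \<open>Both operators are moved to the other side, onto \<open>e\<close> followed by the word
  of \<open>w\<close>. The adjoint of \<open>lam k Y\<close> replaces \<open>e\<close> by its image
  under the adjoint of \<open>Y\<close>; the vacuum component of this image strips the letter and
  returns \<open>fv w xs\<close> with the coefficient on the left. The adjoint of
  \<open>rho k Y'\<close> only works at the right end and leaves the letter \<open>k\<close> in
  front.\<close>

lemma fresh_letter_identity:
 assumes k: "k \<in> K" "k \<notin> set w" and w: "w \<in> W" "xs \<in> args w" "w \<noteq> []" and e: "e \<in> cplus k"
  and Y: "Y \<in> bops (H k)" "Y' \<in> bops (H k)" and x: "\<xi> \<in> hc F"
 shows "hinner (H k) e (Y (\<Omega> k)) * hinner F (fv w xs) \<xi>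
  = hinner F (fv (k # w) (e # xs)) (hdiff F (lam k Y \<xi>) (rho k Y' \<xi>))
   - hinner F (act k (pp k (hadj (H k) (H k) Y e)) (fv w xs)) \<xi>
   + hinner F (ract k (hadj (H k) (H k) Y' (\<Omega> k)) (fv (k # w) (e # xs))) \<xi>"
proof -
 let ?z = "fv w xs" and ?v = "fv (k # w) (e # xs)" and ?u = "hadj (H k) (H k) Y e"
 note f = fresh_letter[OF k w e] and hk = hilb[OF k(1)]
 have ec: "e \<in> hc (H k)" using e by simp
 have v: "?v \<in> hc F" and z: "?z \<in> hc F" using fv_closed[OF f(2,3)] fv_closed[OF w(1,2)] .
 note Yb = hadj_props[OF hk hk Y(1)] and Yb' = hadj_props[OF hk hk Y(2)]
 have uc: "?u \<in> hc (H k)" by (rule bopD(1)[OF Yb(1) ec])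
 have l: "lam k Y \<xi> \<in> hc F" by (rule bopD(1)[OF lam_bop[OF k(1) Y(1)] x])
 have r: "rho k Y' \<xi> \<in> hc F" by (rule bopD(1)[OF rho_bop[OF k(1) Y(2)] x])
 have pc: "act k (pp k ?u) ?z \<in> hc F" using pp_in[OF k(1) uc] by (intro act_closed[OF k(1) _ f(6)]) simp
 have "hinner F ?v (lam k Y \<xi>) = hinner F (lam k (hadj (H k) (H k) Y) ?v) \<xi>"
  using hadj_props(3)[OF hilbert_F hilbert_F lam_bop[OF k(1) Y(1)] x v] by (simp only: lam_hadj[OF k(1) Y(1)])
 also have "\<dots> = hinner F (act k ?u ?z) \<xi>"
  using lam_act[OF k(1) Yb(1) ec f(6)] by (simp only: f(5))
 also have "\<dots> = cnj (vc k ?u) * hinner F ?z \<xi> + hinner F (act k (pp k ?u) ?z) \<xi>"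
  unfolding act_split[OF k(1) uc f(6)] using z x pc by (simp add: F.scale_closed)
 also have "cnj (vc k ?u) = hinner (H k) e (Y (\<Omega> k))"
  unfolding vc_def Yb(2)[OF vac_in[OF k(1)] ec]
  by (rule pre_hilbert_space.inner_commute[OF pre_hilb[OF k(1)] bopD(1)[OF Y(1) vac_in[OF k(1)]] ec, symmetric])
 finally have 1: "hinner F ?v (lam k Y \<xi>) = hinner (H k) e (Y (\<Omega> k)) * hinner F ?z \<xi> + hinner F (act k (pp k ?u) ?z) \<xi>" .
 have 2: "hinner F ?v (rho k Y' \<xi>) = hinner F (ract k (hadj (H k) (H k) Y' (\<Omega> k)) ?v) \<xi>"
  unfolding rho_adjoint[OF k(1) Y(2) v x] rho_fv(1)[OF k(1) Yb'(1) f(2,3,4)] ..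
 show ?thesis using 1 2 v l r by (simp add: F.inner_add_right F.inner_scale_right F.scale_closed)
qed

end

section \<open>Translates of the free product algebra and their relative commutant\<close>

locale free_borchers = free_product_vN K H \<Omega> M + free_rep K H \<Omega> T
 for K :: "'k set" and H :: "'k \<Rightarrow> 'a hilb" and \<Omega> M T +
 assumes Ad_M: "k \<in> K ==> a \<in> right_wedge ==> Ad (H k) (T k a) ` M k \<subseteq> M k"
begin

lemma Ad_MM:
 assumes a: "a \<in> right_wedge"
 shows "Ad F (TT a) ` MM \<subseteq> MM"
proof
 have g: "Ad F (TT a) y \<in> gens" if y: "y \<in> gens" for y
 proof -
  obtain k S where k: "k \<in> K" "S \<in> M k" "y = lam k S" using y by blast
  have "Ad F (TT a) y = lam k (Ad (H k) (T k a) S)" using U.Ad_lam[OF k(1)] M_bops[OF k(1)] k by blast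
  then show ?thesis using Ad_M[OF k(1) a] k by blast
 qed
 fix y assume "y \<in> Ad F (TT a) ` MM"
 then show "y \<in> MM" unfolding MM_eq
  using Ad_double_commutant[OF hilbert_F U.FU_unitary gens_bops g gens_bops] by blast
qed

text \<open>If \<open>x\<close> is in the relative commutant, \<open>\<lambda>\<^sub>k(Y)\<close> and \<open>\<rho>\<^sub>k(Y')\<close> send \<open>x vac\<close> to nearly the same vector
 as soon as \<open>Y\<Omega>\<close> and \<open>Y'\<Omega>\<close> nearly agree.\<close>

lemma relative_commutant_near:
 assumes x: "x \<in> MM" "x \<in> commutant F (Ad F (TT a) ` MM)" and k: "k \<in> K"
  and S: "S \<in> M k" and Y': "Y' \<in> commutant (H k) (M k)"
  and C: "\<And>\<eta>. \<eta> \<in> hc F ==> hnorm F (x \<eta>) \<le> C * hnorm F \<eta>"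
 defines "Y \<equiv> Ad (H k) (T k a) S"
 shows "hnorm F (hdiff F (lam k Y (x vac)) (rho k Y' (x vac))) \<le> C * hnorm (H k) (hdiff (H k) (Y (\<Omega> k)) (Y' (\<Omega> k)))"
proof -
 have xb: "x \<in> bops F" by (rule commutantD(1)[OF x(2)])
 have Sb: "S \<in> bops (H k)" using M_bops[OF k] S by blast
 have Yb: "Y \<in> bops (H k)" unfolding Y_def by (rule Ad_bop(1)[OF hilb[OF k] U.U_unitary[OF k] Sb])
 have Yb': "Y' \<in> bops (H k)" by (rule commutantD(1)[OF Y'])
 have c: "Y (\<Omega> k) \<in> hc (H k)" "Y' (\<Omega> k) \<in> hc (H k)" using bopD(1)[OF Yb] bopD(1)[OF Yb'] vac_in[OF k] by auto
 let ?d = "hdiff (H k) (Y (\<Omega> k)) (Y' (\<Omega> k))"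
 have dc: "?d \<in> hc (H k)"
  using c pre_hilbert_space.add_closed[OF pre_hilb[OF k]] pre_hilbert_space.scale_closed[OF pre_hilb[OF k]] by blast
 have av: "act k u vac \<in> hc F" if "u \<in> hc (H k)" for u using k that by simp
 have "lam k Y \<in> Ad F (TT a) ` MM" unfolding Y_def U.Ad_lam[OF k Sb, symmetric] using lam_in_MM[OF k S] by blast
 then have "lam k Y (x vac) = x (lam k Y vac)" using commutantD(2)[OF x(2) _ vac_closed] by simp
 then have 1: "lam k Y (x vac) = x (act k (Y (\<Omega> k)) vac)" by (simp add: lam_G[OF k Yb vac_in_G])
 \<comment> \<open>Words of length one are palindromes, so the left and the right action agree on
   the vacuum; both then reduce to \<open>x\<close> applied to one-letter vectors.\<close>
 have Jv: "J (act k u vac) = act k u vac" if u: "u \<in> hc (H k)" for u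
 proof -
  have i: "([], []) \<in> idx_off k" by (simp add: idx_off_def)
  note j = idx_off_Cons[OF k i]
  have p: "fv [k] [pp k u] \<in> hc F" by (rule fv_closed[OF j(3) j(5)[OF u]])
  have "act k u vac = hadd F (hscale F (vc k u) vac) (fv [k] [pp k u])"
   using act_fv[OF k u i] by (simp add: act0_def vac_eq)
  moreover have "J (fv [k] [pp k u]) = fv [k] [pp k u]" using J_fv[OF j(3) j(5)[OF u]] by simp
  ultimately show ?thesis using p by (simp add: bopD(2,3)[OF J_bop] F.scale_closed)
 qed
 have "rho k Y' (x vac) = x (rho k Y' vac)" by (rule MM_rho[OF k Y' x(1) vac_closed, symmetric])
 also have "rho k Y' vac = act k (Y' (\<Omega> k)) vac"
  using lam_G[OF k Yb' vac_in_G] Jv[OF c(2)] by (simp add: rho_apply)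
 finally have 2: "rho k Y' (x vac) = x (act k (Y' (\<Omega> k)) vac)" .
 have "hdiff F (act k (Y (\<Omega> k)) vac) (act k (Y' (\<Omega> k)) vac) = act k ?d vac"
  using bop_diff[OF act_bop_left[OF k vac_in_G] pre_hilb[OF k] c] c dc by simp
 then have "hdiff F (lam k Y (x vac)) (rho k Y' (x vac)) = x (act k ?d vac)"
  unfolding 1 2 using bop_diff[OF xb F.pre av[OF c(1)] av[OF c(2)]] by simp
 then show ?thesis using C[OF av[OF dc]] by (simp add: hnorm_act[OF k dc vac_in_G] vac_norm_F)
qed

lemma relative_commutant_orthogonal:
 assumes K: "infinite K" and hom: "\<And>k. k \<in> K ==> H k = H0 \<and> M k = M0 \<and> T k = T0 \<and> \<Omega> k = \<Omega>0"
  and x: "x \<in> MM" "x \<in> commutant F (Ad F (TT a) ` MM)"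
  and w: "w \<in> W" "xs \<in> args w" "w \<noteq> []"
 shows "hinner F (fv w xs) (x vac) = 0"
proof -
 let ?z = "fv w xs" and ?x = "x vac"
 obtain \<mu> w' where w': "w = \<mu> # w'" using w(3) by (cases w) auto
 obtain e xs' where xs': "xs = e # xs'" "e \<in> cplus \<mu>" "xs' \<in> args w'" using w(2) unfolding w' by (cases xs) (auto simp del: listset.simps simp: in_listset_iff[of "[]"])
 have m: "\<mu> \<in> K" using w(1) w' by simp
 have e: "e \<in> hc H0" "hinner H0 \<Omega>0 e = 0" using xs'(2) hom[OF m] by auto
 have h0: "hilbert_space H0" "M0 \<subseteq> bops H0" "\<Omega>0 \<in> hc H0" "unitary_op H0 H0 (T0 a)" "T0 a \<Omega>0 = \<Omega>0"
  "cyclic_vector H0 M0 \<Omega>0" "cyclic_vector H0 (commutant H0 M0) \<Omega>0"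
  using hom[OF m] hilb[OF m] M_bops[OF m] vac_in[OF m] U.U_unitary[OF m, of a] T_fix[OF m, of a] cyc[OF m]
   separating_imp_cyclic_commutant[OF hilb[OF m] vN[OF m] vac_in[OF m] sep[OF m]] by auto
 interpret H0: hilbert_space H0 by (rule h0(1))
 have xb: "x \<in> bops F" by (rule commutantD(1)[OF x(2)])
 have xv: "?x \<in> hc F" by (rule bopD(1)[OF xb vac_closed])
 have z: "?z \<in> hc F" by (rule fv_closed[OF w(1,2)])
 obtain C where C: "C > 0" "\<And>\<eta>. \<eta> \<in> hc F ==> hnorm F (x \<eta>) \<le> C * hnorm F \<eta>" using bop_bound[OF xb F.pre] by blast
 define N where "N = hnorm H0 e"
 have N0: "N \<ge> 0" using e by (simp add: N_def)
 define c where "c = cmod (hinner F ?z ?x)"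
 \<comment> \<open>\<open>\<epsilon>\<close> measures how well \<open>Y \<Omega>0\<close> and
   \<open>Y' \<Omega>0\<close> approximate \<open>e\<close>. The first error term bounds the pairing
   with the difference of the two actions, where the distance is \<open>2 * \<epsilon>\<close>; the
   second pays for replacing \<open>hinner H0 e (Y \<Omega>0)\<close> by \<open>N^2\<close>.\<close>
 have key: "N\<^sup>2 * c \<le> \<epsilon> * (2 * C * N * hnorm F ?z + N * c)" if eps: "\<epsilon> > 0" for \<epsilon>
 proof -
  obtain S where S: "S \<in> M0" "hnorm H0 (hdiff H0 e (Ad H0 (T0 a) S \<Omega>0)) < \<epsilon>"
   using Ad_cyclic[OF h0(1,4,2,3,5,6) e(1) eps] by blast
  obtain Y' where Y': "Y' \<in> commutant H0 M0" "hnorm H0 (hdiff H0 e (Y' \<Omega>0)) < \<epsilon>"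
   using h0(7) e(1) eps unfolding cyclic_vector_iff[OF h0(1) commutant_bops h0(3)] by blast
  define Y where "Y = Ad H0 (T0 a) S"
  have Yb: "Y \<in> bops H0" unfolding Y_def using Ad_bop(1)[OF h0(1,4)] S(1) h0(2) by blast
  have Yb': "Y' \<in> bops H0" by (rule commutantD(1)[OF Y'(1)])
  have yc: "Y \<Omega>0 \<in> hc H0" "Y' \<Omega>0 \<in> hc H0" using bopD(1)[OF Yb h0(3)] bopD(1)[OF Yb' h0(3)] .
  have YY: "hnorm H0 (hdiff H0 (Y \<Omega>0) (Y' \<Omega>0)) \<le> 2 * \<epsilon>"
   using H0.hnorm_diff_triangle[OF yc(1) e(1) yc(2)] H0.hnorm_diff_commute[OF yc(1) e(1)] S(2) Y'(2) by (simp add: Y_def)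
  have eY: "N\<^sup>2 - N * \<epsilon> \<le> cmod (hinner H0 e (Y \<Omega>0))"
  proof -
   have dc: "hdiff H0 e (Y \<Omega>0) \<in> hc H0" using e yc by simp
   have "hinner H0 e (Y \<Omega>0) = complex_of_real (N\<^sup>2) - hinner H0 e (hdiff H0 e (Y \<Omega>0))"
    using e yc H0.inner_self[OF e(1)] by (simp add: N_def)
   moreover have "cmod (hinner H0 e (hdiff H0 e (Y \<Omega>0))) \<le> N * \<epsilon>"
    using H0.cauchy_schwarz[OF e(1) dc] mult_left_mono[OF less_imp_le[OF S(2)] N0] by (simp add: Y_def N_def)
   moreover have "N\<^sup>2 - cmod (hinner H0 e (hdiff H0 e (Y \<Omega>0))) \<le> cmod (complex_of_real (N\<^sup>2) - hinner H0 e (hdiff H0 e (Y \<Omega>0)))"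
    using norm_triangle_ineq2[of "complex_of_real (N\<^sup>2)" "hinner H0 e (hdiff H0 e (Y \<Omega>0))"] unfolding norm_of_real by simp
   ultimately show ?thesis by force
  qed
  define q where "q = hadj H0 H0 Y e"
  define t where "t = hadj H0 H0 Y' \<Omega>0"
  have qt: "q \<in> hc H0" "t \<in> hc H0"
   using bopD(1)[OF hadj_props(1)[OF h0(1,1) Yb] e(1)] bopD(1)[OF hadj_props(1)[OF h0(1,1) Yb'] h0(3)] by (simp_all add: q_def t_def)
  let ?I = "K - set w" and ?v = "\<lambda>k. fv (k # w) (e # xs)"
  define P where "P k = act k (pp k q) ?z" for k
  define R where "R k = ract k t (?v k)" for k
  \<comment> \<open>A common bound for the norms of all \<open>P k\<close> and \<open>R k\<close>,
    as Bessel's inequality needs. It is independent of \<open>k\<close> because the triples are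
    identical.\<close>
  define B where "B = hnorm H0 (pp \<mu> q) * hnorm F ?z + hnorm H0 t * (N * hnorm F ?z)"
  \<comment> \<open>Because the triples are identical, \<open>e\<close>, the first letter of
    \<open>w\<close>, and the vectors \<open>q\<close> and \<open>t\<close> make sense at every
    fresh letter \<open>k\<close>.\<close>
  have fr: "k \<in> K" "e \<in> cplus k" "pp k q \<in> cplus k" "q \<in> hc (H k)" "t \<in> hc (H k)" "pp k q = pp \<mu> q"
   "fv w xs \<in> hc (G k)" "k # w \<in> W" "e # xs \<in> args (k # w)" "\<not> ends k (k # w)" "P k = fv (k # w) (pp k q # xs)"
   "pp k q # xs \<in> args (k # w)" "?v k = act k e ?z" if kI: "k \<in> ?I" for k
  proof -
   show k: "k \<in> K" and e': "e \<in> cplus k" and q: "q \<in> hc (H k)" "t \<in> hc (H k)" "pp k q = pp \<mu> q"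
    using kI hom e qt m by (auto simp: pp_def vc_def)
   have kw: "k \<notin> set w" using kI by simp
   show p: "pp k q \<in> cplus k" by (rule pp_in[OF k q(1)])
   note f = fresh_letter[OF k kw w e'] and g = fresh_letter[OF k kw w p]
   show "fv w xs \<in> hc (G k)" "k # w \<in> W" "e # xs \<in> args (k # w)" "\<not> ends k (k # w)" "?v k = act k e ?z"
    using f by auto
   show "P k = fv (k # w) (pp k q # xs)" "pp k q # xs \<in> args (k # w)" using g by (auto simp: P_def)
  qed
  have nv: "hnorm F (?v k) = N * hnorm F ?z" if "k \<in> ?I" for k
   using hnorm_act[OF fr(1)[OF that] _ fr(7)[OF that], of e] fr(2)[OF that] hom[OF fr(1)[OF that]]
   by (simp add: fr(13)[OF that] N_def)
  have B0: "0 \<le> hnorm H0 (pp \<mu> q)" "0 \<le> hnorm H0 t" "0 \<le> hnorm F ?z"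
   using pp_in[OF m, of q] hom[OF m] qt z by auto
  have fP: "finite {k \<in> ?I. \<epsilon>1 \<le> cmod (hinner F (P k) ?x)}" if "\<epsilon>1 > 0" for \<epsilon>1
  proof (rule F.finite_large_coefficients[where B = B, OF _ _ _ xv that])
   fix k assume k: "k \<in> ?I"
   note f = fr[OF k]
   show "P k \<in> hc F" unfolding f(11) by (rule fv_closed[OF f(8,12)])
   have "hnorm F (P k) = hnorm H0 (pp \<mu> q) * hnorm F ?z"
    unfolding P_def using hnorm_act[OF f(1) _ f(7), of "pp k q"] f(3,6) hom[OF f(1)] by simp
   then show "hnorm F (P k) \<le> B" using B0 N0 by (simp add: B_def)
   show "hinner F (P k) (P k') = 0" if k': "k' \<in> ?I" and ne: "k \<noteq> k'" for k'
    unfolding f(11) fr(11)[OF k'] using inner_fv[OF f(8,12) fr(8,12)[OF k']] ne by simp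
  qed
  have fR: "finite {k \<in> ?I. \<epsilon>1 \<le> cmod (hinner F (R k) ?x)}" if "\<epsilon>1 > 0" for \<epsilon>1
  proof (rule F.finite_large_coefficients[where B = B, OF _ _ _ xv that])
   fix k assume k: "k \<in> ?I"
   note f = fr[OF k]
   have g: "fv (rev (k # w)) (rev (e # xs)) \<in> hc (G k)"
    using idx_off_Cons(6)[OF f(1) off_rev[OF f(8,9,10)]] .
   have Jv: "J (?v k) = fv (rev (k # w)) (rev (e # xs))" by (rule J_fv[OF f(8,9)])
   have a: "act k t (J (?v k)) \<in> hc F" unfolding Jv by (rule act_closed[OF f(1,5) g])
   show "R k \<in> hc F" unfolding R_def ract_def using a by simp
   have "hnorm F (R k) = hnorm F (act k t (J (?v k)))"
    unfolding R_def ract_def by (rule unitary_opD(4)[OF J_unitary a])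
   also have "\<dots> = hnorm H0 t * hnorm F (J (?v k))"
    unfolding Jv hnorm_act[OF f(1,5) g] using hom[OF f(1)] by simp
   also have "\<dots> = hnorm H0 t * (N * hnorm F ?z)"
    unfolding unitary_opD(4)[OF J_unitary fv_closed[OF f(8,9)]] nv[OF k] ..
   finally show "hnorm F (R k) \<le> B" using B0 by (simp add: B_def)
   \<comment> \<open>Every word occurring in \<open>R k\<close> starts with \<open>k\<close>, so for
     different letters the vectors live on different words.\<close>
   show "hinner F (R k) (R k') = 0" if k': "k' \<in> ?I" and ne: "k \<noteq> k'" for k'
   proof -
    note f' = fr[OF k']
    note r = ract_fv(1-3)[OF f(1,8,9,10,5)] and r' = ract_fv(1-3)[OF f'(1,8,9,10,5)]
    note c = fv_closed[OF f(8,9)] fv_closed[OF r(1,2)] fv_closed[OF f'(8,9)] fv_closed[OF r'(1,2)]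
    show ?thesis unfolding R_def r(3) r'(3) using c ne
     by (simp add: F.scale_closed F.add_closed F.inner_add_right F.inner_scale_right inner_fv[OF f(8,9) f'(8,9)]
      inner_fv[OF f(8,9) r'(1,2)] inner_fv[OF r(1,2) f'(8,9)] inner_fv[OF r(1,2) r'(1,2)] del: append_Cons)
   qed
  qed
  \<comment> \<open>Only finitely many fresh letters have a coefficient of size at least
    \<open>\<epsilon>1\<close>, so some letter of the infinite set is left. \<open>Y\<close> and
    \<open>Y'\<close> do not depend on the letter, so \<open>\<epsilon>1\<close> can tend to 0 with
    both fixed.\<close>
  have est: "cmod (hinner H0 e (Y \<Omega>0)) * c \<le> 2 * C * N * hnorm F ?z * \<epsilon> + 2 * \<epsilon>1" if d: "\<epsilon>1 > 0" for \<epsilon>1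
  proof -
   have "infinite (?I - ({k \<in> ?I. \<epsilon>1 \<le> cmod (hinner F (P k) ?x)} \<union> {k \<in> ?I. \<epsilon>1 \<le> cmod (hinner F (R k) ?x)}))"
    by (intro Diff_infinite_finite finite_UnI fP[OF d] fR[OF d] K finite_set)
   from infinite_imp_nonempty[OF this] obtain k where k: "k \<in> ?I"
    "cmod (hinner F (P k) ?x) < \<epsilon>1" "cmod (hinner F (R k) ?x) < \<epsilon>1"
    unfolding not_le[symmetric] by blast
   note f = fr[OF k(1)]
   have kw: "k \<notin> set w" using k(1) by simp
   have hk: "H k = H0" "M k = M0" "T k = T0" "\<Omega> k = \<Omega>0" using hom[OF f(1)] by auto
   let ?D = "hdiff F (lam k Y ?x) (rho k Y' ?x)"
   have yb: "Y \<in> bops (H k)" "Y' \<in> bops (H k)" using Yb Yb' hk by auto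
   have "hnorm F ?D \<le> C * hnorm H0 (hdiff H0 (Y \<Omega>0) (Y' \<Omega>0))"
    using relative_commutant_near[OF x f(1), of S Y' C] S(1) Y'(1) C(2) unfolding hk Y_def by blast
   also have "\<dots> \<le> C * (2 * \<epsilon>)" using YY C(1) by (intro mult_left_mono) auto
   finally have D: "hnorm F ?D \<le> C * (2 * \<epsilon>)" .
   have Dc: "?D \<in> hc F"
    using bopD(1)[OF lam_bop[OF f(1) yb(1)] xv] bopD(1)[OF rho_bop[OF f(1) yb(2)] xv] by (simp add: F.add_closed F.scale_closed)
   have vc: "?v k \<in> hc F" by (rule fv_closed[OF f(8,9)])
   have "cmod (hinner F (?v k) ?D) \<le> hnorm F (?v k) * hnorm F ?D" by (rule F.cauchy_schwarz[OF vc Dc])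
   also have "\<dots> \<le> (N * hnorm F ?z) * (C * (2 * \<epsilon>))"
    unfolding nv[OF k(1)] using D B0 N0 by (intro mult_left_mono) auto
   finally have b1: "cmod (hinner F (?v k) ?D) \<le> 2 * C * N * hnorm F ?z * \<epsilon>" by (simp add: mult_ac)
   have "hinner H0 e (Y \<Omega>0) * hinner F ?z ?x = hinner F (?v k) ?D - hinner F (P k) ?x + hinner F (R k) ?x"
    using fresh_letter_identity[OF f(1) kw w f(2) yb xv] unfolding hk P_def R_def q_def t_def .
   then have "cmod (hinner H0 e (Y \<Omega>0)) * c = cmod (hinner F (?v k) ?D - hinner F (P k) ?x + hinner F (R k) ?x)"
    by (simp only: c_def norm_mult[symmetric])
   also have "\<dots> \<le> cmod (hinner F (?v k) ?D) + cmod (hinner F (P k) ?x) + cmod (hinner F (R k) ?x)"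
    using norm_triangle_ineq[of "hinner F (?v k) ?D - hinner F (P k) ?x" "hinner F (R k) ?x"]
     norm_triangle_ineq4[of "hinner F (?v k) ?D" "hinner F (P k) ?x"] by linarith
   finally show ?thesis using b1 k(2,3) by linarith
  qed
  have "cmod (hinner H0 e (Y \<Omega>0)) * c \<le> 2 * C * N * hnorm F ?z * \<epsilon>"
  proof (rule field_le_epsilon)
   fix d :: real assume "d > 0"
   then show "cmod (hinner H0 e (Y \<Omega>0)) * c \<le> 2 * C * N * hnorm F ?z * \<epsilon> + d" using est[of "d / 2"] by simp
  qed
  moreover have "(N\<^sup>2 - N * \<epsilon>) * c \<le> cmod (hinner H0 e (Y \<Omega>0)) * c" by (rule mult_right_mono[OF eY]) (simp add: c_def)
  ultimately show ?thesis by (simp add: algebra_simps)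
 qed
 have "N\<^sup>2 * c \<le> 0"
 proof (rule field_le_epsilon)
  fix d :: real assume d: "d > 0"
  define b where "b = 2 * C * N * hnorm F ?z + N * c"
  have b0: "b \<ge> 0" using C(1) N0 z by (simp add: b_def c_def)
  have "N\<^sup>2 * c \<le> d / (b + 1) * b" using key[of "d / (b + 1)"] d b0 by (simp add: b_def)
  also have "\<dots> \<le> d" using d b0 by (simp add: field_simps)
  finally show "N\<^sup>2 * c \<le> 0 + d" by simp
 qed
 then have "N = 0 \<or> c = 0" using N0 by (auto simp: c_def mult_le_0_iff)
 then show ?thesis
 proof
  \<comment> \<open>A zero letter makes the whole elementary tensor zero.\<close>
  assume "N = 0"
  then have "e = hzero (H \<mu>)" using H0.hnorm_eq_zero[OF e(1)] hom[OF m] by (simp add: N_def)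
  then have "?z = hzero F" using fv_Cons_zero[of \<mu> w' xs'] w(1) xs' w' by simp
  then show ?thesis using xv by simp
 qed (simp add: c_def)
qed

text \<open>Orthogonality to all nonempty words makes \<open>x vac\<close> a multiple
  \<open>c\<close> of the vacuum. Then \<open>x - c\<close> lies in the free product algebra and
  kills the vacuum, which is separating.\<close>

lemma relative_commutant:
 assumes K: "infinite K" and hom: "\<And>k. k \<in> K ==> H k = H0 \<and> M k = M0 \<and> T k = T0 \<and> \<Omega> k = \<Omega>0"
  and a: "a \<in> right_wedge"
 shows "commutant F (Ad F (TT a) ` MM) \<inter> MM = range (scalar_op F)"
proof
 have Mb: "MM \<subseteq> bops F" unfolding MM_eq by (rule commutant_bops)
 have Ab: "Ad F (TT a) ` MM \<subseteq> bops F" using Ad_MM[OF a] Mb by blast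
 have "scalar_op F c \<in> commutant F (Ad F (TT a) ` MM)" "scalar_op F c \<in> MM" for c
  unfolding MM_eq by (rule commutant_scalar[OF hilbert_F Ab[unfolded MM_eq]], rule commutant_scalar[OF hilbert_F commutant_bops])
 then show "range (scalar_op F) \<subseteq> commutant F (Ad F (TT a) ` MM) \<inter> MM" by blast
 show "commutant F (Ad F (TT a) ` MM) \<inter> MM \<subseteq> range (scalar_op F)"
 proof
  fix x assume "x \<in> commutant F (Ad F (TT a) ` MM) \<inter> MM"
  then have x: "x \<in> MM" "x \<in> commutant F (Ad F (TT a) ` MM)" by auto
  have xb: "x \<in> bops F" using x Mb by blast
  have xv: "x vac \<in> hc F" by (rule bopD(1)[OF xb vac_closed])
  define c where "c = hinner F vac (x vac)"
  have xc: "x vac = hscale F c vac"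
  proof (rule F.total_eqI[OF fv_total fv_sub xv F.scale_closed[OF vac_closed]])
   fix v assume "v \<in> (\<lambda>(w, xs). fv w xs) ` idx"
   then obtain w xs where w: "v = fv w xs" "w \<in> W" "xs \<in> args w" by (auto simp: idx_def)
   show "hinner F v (x vac) = hinner F v (hscale F c vac)"
   proof (cases "w = []")
    case True
    then have "v = vac" using w by (simp add: vac_eq)
    then show ?thesis by (simp add: F.inner_scale_right c_def)
   next
    case False
    have "hinner F v vac = 0" using inner_fv[OF w(2,3), of "[]" "[]"] False by (simp add: w(1) vac_eq)
    then show ?thesis using relative_commutant_orthogonal[OF K hom x w(2,3) False] w by (simp add: F.inner_scale_right)
   qed
  qed
  let ?y = "\<lambda>\<xi>\<in>hc F. hadd F (x \<xi>) (scalar_op F (- c) \<xi>)"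
  have gc: "commutant F gens \<subseteq> bops F" by (rule commutant_bops)
  have "?y \<in> MM" unfolding MM_eq
   by (rule commutant_add[OF hilbert_F gc _ commutant_scalar[OF hilbert_F gc]]) (use x in \<open>simp add: MM_eq\<close>)
  moreover have "?y vac = hzero F"
   by (rule F.eqI) (use xc in \<open>simp_all add: F.inner_add_right F.inner_scale_right F.scale_closed F.add_closed F.zero_closed\<close>)
  ultimately have y0: "?y = scalar_op F 0" using MM_separating unfolding separating_vector_def by blast
  have "x = scalar_op F c"
  proof (rule bop_eqI[OF xb scalar_op_bop[OF F.pre]])
   fix \<xi> assume z: "\<xi> \<in> hc F"
   have zc: "x \<xi> \<in> hc F" by (rule bopD(1)[OF xb z])
   have "hadd F (x \<xi>) (hscale F (- c) \<xi>) = hscale F 0 \<xi>" using fun_cong[OF y0, of \<xi>] z by simp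
   then have "hinner F \<zeta> (x \<xi>) = hinner F \<zeta> (hscale F c \<xi>)" if "\<zeta> \<in> hc F" for \<zeta>
    using that z zc F.inner_add_right[OF that zc F.scale_closed[OF z, of "- c"]] F.inner_scale_right[OF that z]
    by (simp add: F.scale_zero)
   then show "x \<xi> = scalar_op F c \<xi>" using z zc by (intro F.eqI) (auto simp: F.scale_closed)
  qed
  then show "x \<in> range (scalar_op F)" by blast
 qed
qed

end

theorem proposition5p1:
  fixes K :: "'k set"
    and H :: "'k \<Rightarrow> 'a hilb"
    and M :: "'k \<Rightarrow> ('a \<Rightarrow> 'a) set"
    and T :: "'k \<Rightarrow> real \<times> real \<Rightarrow> 'a \<Rightarrow> 'a"
    and \<Omega> :: "'k \<Rightarrow> 'a"
  defines "HH \<equiv> free_hilb K H \<Omega>"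
    and "MM \<equiv> free_vN K H \<Omega> M"
    and "TT \<equiv> \<lambda>a. free_unitary K H \<Omega> (\<lambda>\<kappa>. T \<kappa> a)"
  assumes "\<And>\<kappa>. \<kappa> \<in> K \<Longrightarrow> borchers_triple (H \<kappa>) (M \<kappa>) (T \<kappa>) (\<Omega> \<kappa>)"
  shows "borchers_triple HH MM TT (free_vacuum K H \<Omega>)
    \<and> (infinite K
        \<and> (\<exists>H0 M0 T0 \<Omega>0. \<forall>\<kappa>\<in>K. H \<kappa> = H0 \<and> M \<kappa> = M0 \<and> T \<kappa> = T0 \<and> \<Omega> \<kappa> = \<Omega>0)
        \<longrightarrow> (\<forall>a\<in>right_wedge. commutant HH (Ad HH (TT a) ` MM) \<inter> MM = range (scalar_op HH)))"
proof -
 have bt: "borchers_triple (H \<kappa>) (M \<kappa>) (T \<kappa>) (\<Omega> \<kappa>)" if "\<kappa> \<in> K" for \<kappa> by (rule assms(4)[OF that])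
 have b: "hilbert_space (H \<kappa>)" "von_neumann_algebra (H \<kappa>) (M \<kappa>)" "unitary_rep (H \<kappa>) (T \<kappa>)"
   "spectrum_condition (H \<kappa>) (T \<kappa>)" "\<Omega> \<kappa> \<in> hcarrier (H \<kappa>)" "hnorm (H \<kappa>) (\<Omega> \<kappa>) = 1"
   "\<And>\<xi>. \<xi> \<in> hcarrier (H \<kappa>) \<Longrightarrow> (\<forall>a. T \<kappa> a \<xi> = \<xi>) \<longleftrightarrow> (\<exists>c. \<xi> = hscale (H \<kappa>) c (\<Omega> \<kappa>))"
   "\<And>a. a \<in> right_wedge \<Longrightarrow> Ad (H \<kappa>) (T \<kappa> a) ` M \<kappa> \<subseteq> M \<kappa>"
   "cyclic_vector (H \<kappa>) (M \<kappa>) (\<Omega> \<kappa>)" "separating_vector (H \<kappa>) (M \<kappa>) (\<Omega> \<kappa>)" if "\<kappa> \<in> K" for \<kappa>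
  using bt[OF that] unfolding borchers_triple_def by simp_all
 have "\<forall>\<kappa>\<in>K. \<exists>E. joint_spectral_measure (H \<kappa>) (T \<kappa>) E \<and> pvm_support (H \<kappa>) E \<subseteq> closed_forward_cone"
  using b(4) unfolding spectrum_condition_def by simp
 \<comment> \<open>The spectrum condition only asserts that a spectral measure exists, so one is
   chosen for each letter.\<close>
 then obtain E where E: "\<And>\<kappa>. \<kappa> \<in> K \<Longrightarrow> joint_spectral_measure (H \<kappa>) (T \<kappa>) (E \<kappa>)"
  "\<And>\<kappa>. \<kappa> \<in> K \<Longrightarrow> pvm_support (H \<kappa>) (E \<kappa>) \<subseteq> closed_forward_cone"
  using bchoice[of K "\<lambda>\<kappa> E. joint_spectral_measure (H \<kappa>) (T \<kappa>) E \<and> pvm_support (H \<kappa>) E \<subseteq> closed_forward_cone"] by blast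
 \<comment> \<open>The vacuum vector is a multiple of itself, with factor 1, hence invariant by the
   characterization of invariant vectors.\<close>
 have T_fix: "T \<kappa> a (\<Omega> \<kappa>) = \<Omega> \<kappa>" if k: "\<kappa> \<in> K" for \<kappa> a
 proof -
  have "\<Omega> \<kappa> = hscale (H \<kappa>) 1 (\<Omega> \<kappa>)"
   by (rule pre_hilbert_space.scale_one[OF hilbert_pre[OF b(1)[OF k]] b(5)[OF k], symmetric])
  then show ?thesis using b(7)[OF k b(5)[OF k]] by blast
 qed
 interpret B: free_borchers K H \<Omega> M T
  by (intro free_borchers.intro free_product_vN.intro free_rep.intro free_product.intro free_product_vN_axioms.intro
   free_rep_axioms.intro free_borchers_axioms.intro) (fact b T_fix)+
 interpret S: free_spectral K H \<Omega> T E
 proof (intro free_spectral.intro B.free_rep_axioms free_spectral_axioms.intro)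
  fix \<kappa> assume k: "\<kappa> \<in> K"
  show "spectral_rep (H \<kappa>) (E \<kappa>) (T \<kappa>)"
   using E(1)[OF k] B.U.U_unitary[OF k] unfolding joint_spectral_measure_def phase_def[symmetric]
   by (intro spectral_rep.intro pvm_space.intro B.hilb[OF k] spectral_rep_axioms.intro pvm_space_axioms.intro) blast+
  show "pvm_support (H \<kappa>) (E \<kappa>) \<subseteq> closed_forward_cone" by (rule E(2)[OF k])
  show "\<exists>c. \<xi> = hscale (H \<kappa>) c (\<Omega> \<kappa>)" if "\<xi> \<in> hcarrier (H \<kappa>)" "\<And>a. T \<kappa> a \<xi> = \<xi>" for \<xi>
   using b(7)[OF k that(1)] that(2) by simp
 qed
 show ?thesis unfolding HH_def MM_def TT_def
 proof (intro conjI impI ballI)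
  show "borchers_triple B.F B.MM B.TT B.vac"
   unfolding borchers_triple_def
   using B.MM_vN S.TT_rep S.spectrum_condition_F B.vac_norm_F S.invariant_vac B.Ad_MM B.MM_cyclic B.MM_separating by simp
  fix a assume "infinite K \<and> (\<exists>H0 M0 T0 \<Omega>0. \<forall>\<kappa>\<in>K. H \<kappa> = H0 \<and> M \<kappa> = M0 \<and> T \<kappa> = T0 \<and> \<Omega> \<kappa> = \<Omega>0)" "a \<in> right_wedge"
  then show "commutant B.F (Ad B.F (B.TT a) ` B.MM) \<inter> B.MM = range (scalar_op B.F)"
   using B.relative_commutant[of _ _ _ _ a] by blast
 qed
qed

end
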